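(* Let $M$ be an irreducible differential module over $K=\mathbb{C}(z)$ which has at least one (regular or irregular) singular point that is unramified. Then the strong Riemann--Hilbert problem has a solution for $M$: there exists a connection $(\mathcal{V},\nabla)$ on $\mathbb{P}^1_{\mathbb{C}}$ with generic fibre $M$ such that the vector bundle $\mathcal{V}$ is free (a direct sum of copies of $\mathcal{O}_{\mathbb{P}^1}$) and $$\nabla:\mathcal{V}\to\Omega\Big(\sum_p (r^+(p)+1)[p]\Big)\otimes\mathcal{V},$$ where the sum is over the singular points $p$ of $M$, and $r^+(p)$ is the smallest integer $\ge r(p)$, with $r(p)$ the Katz invariant of $M$ at $p$.
   Context: A differential module over $K=\mathbb{C}(z)$ is a finite-dimensional $K$-vector space $M$ with $\nabla:M\to\Omega_{K/\mathbb{C}}\otimes M$ additive satisfying the Leibniz rule. For $p\in\mathbb{P}^1$ let $t=t_p$ be the local parameter ($z-p$, or $z^{-1}$ for $p=\infty$), $\widehat K_p=\mathbb{C}((t))$, and consider $\widehat K_p\otimes M$ with the operator $\delta=\nabla_{t\,d/dt}$. The point $p$ is non-singular if $\widehat K_p\otimes M$ has a basis of elements killed by $\delta$; otherwise it is singular (regular singular or irregular singular). By the Hukuhara--Turrittin classification, the formal solution space of $\widehat K_p\otimes M$ decomposes as $V=\bigoplus_q V_q$ over $q\in\bigcup_{n\ge1}t^{-1/n}\mathbb{C}[t^{-1/n}]$, where $V_q$ consists of the solutions of the form $\exp(\int q\frac{dt}{t})$ times expressions in complex powers of $t$, $\log t$ and formal Laurent series. The $q$ with $V_q\neq0$ are called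 the eigenvalues at $p$. The Katz invariant $r(p)\in\mathbb{Q}_{\ge0}$ is the maximum of the degrees in $t^{-1}$ of the eigenvalues at $p$ (it is $0$ iff $p$ is regular singular or non-singular). The singular point $p$ is unramified if all eigenvalues at $p$ lie in $t^{-1}\mathbb{C}[t^{-1}]$ (no fractional powers; in particular every regular singular point is unramified). A connection with singularities on $\mathbb{P}^1$ is a vector bundle $\mathcal{V}$ with $\nabla:\mathcal{V}\to\Omega(D)\otimes\mathcal{V}$ for an effective divisor $D$; its generic fibre is a differential module over $K$. $M$ is irreducible if it has no proper non-zero differential submodule. *)

theory Defs
  imports
    "HOL-Computational_Algebra.Computational_Algebra"
    "HOL-Computational_Algebra.Field_as_Ring"
    "HOL-Library.Function_Algebras"
    "HOL-Library.Poly_Mapping"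
begin

section \<open>The field of rational functions and the projective line\<close>

type_synonym ratfun = "complex poly fract"

definition rat_deriv :: "ratfun \<Rightarrow> ratfun" where
  "rat_deriv f = (case quot_of_fract f of (a, b) \<Rightarrow>
     Fract (pderiv a * b - a * pderiv b) (b ^ 2))"

datatype P1 = Finite complex | Infinity

fun local_param :: "P1 \<Rightarrow> ratfun" where
  "local_param (Finite p) = Fract [:- p, 1:] 1"
| "local_param Infinity = Fract 1 [:0, 1:]"

text \<open>The coordinate \<open>z\<close> as a Laurent series in the local parameter \<open>t\<close>:
  \<open>z = p + t\<close>, respectively \<open>z = 1 / t\<close>.\<close>

fun coord_at :: "P1 \<Rightarrow> complex fls" where
  "coord_at (Finite p) = fls_const p + fls_X"
| "coord_at Infinity = fls_X_inv"

text \<open>The embedding of the rational functions into \<open>\<complex>((t))\<close> at a point.\<close>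

definition expand :: "P1 \<Rightarrow> ratfun \<Rightarrow> complex fls" where
  "expand p f = (case quot_of_fract f of (a, b) \<Rightarrow>
     poly (map_poly fls_const a) (coord_at p) / poly (map_poly fls_const b) (coord_at p))"

text \<open>Only non-empty Zariski open sets are considered; as \<open>\<P>\<^sup>1\<close> is irreducible, they
  determine the subsheaves of constant sheaves used below.\<close>

definition zariski_open :: "P1 set \<Rightarrow> bool" where
  "zariski_open U \<longleftrightarrow> U \<noteq> {} \<and> finite (- U)"

definition struct_sheaf :: "P1 set \<Rightarrow> ratfun set" where
  "struct_sheaf U = {f. \<forall>p\<in>U. fls_subdegree (expand p f) \<ge> 0}"

definition effective_divisor :: "(P1 \<Rightarrow> int) \<Rightarrow> bool" where
  "effective_divisor d \<longleftrightarrow> finite {p. d p \<noteq> 0} \<and> (\<forall>p. d p \<ge> 0)"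

text \<open>The union of the sections of a subsheaf of a constant sheaf over all non-empty open sets,
  that is, its stalk at the generic point.\<close>

definition generic_fibre :: "(P1 set \<Rightarrow> 'm set) \<Rightarrow> 'm set" where
  "generic_fibre \<V> = (\<Union>U\<in>Collect zariski_open. \<V> U)"

text \<open>The sections \<open>g dz\<close> of \<open>\<Omega>(d)\<close>, represented by \<open>g\<close>. Locally \<open>g dz = g (dz/dt) dt\<close>,
  so that \<open>dz\<close> has a double pole at infinity.\<close>

definition Omega :: "(P1 \<Rightarrow> int) \<Rightarrow> P1 set \<Rightarrow> ratfun set" where
  "Omega d U = {g. g = 0 \<or>
     (\<forall>p\<in>U. fls_subdegree (expand p g * fls_deriv (coord_at p)) \<ge> - d p)}"


section \<open>Generalized series for formal solutions\<close>

text \<open>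
  A function \<open>y\<close> represents \<open>\<Sum> y a k \<cdot> t\<^sup>a (log t)\<^sup>k\<close>. The functions satisfying
  \<open>log_series\<close> represent the differential ring generated over \<open>\<complex>((t))\<close> by the symbols
  \<open>t\<^sup>a\<close> with \<open>a\<close> complex and by \<open>log t\<close>. It contains \<open>\<complex>((t\<^bsup>1/n\<^esup>))\<close> for every \<open>n\<close>.
\<close>

type_synonym log_ser = "complex \<Rightarrow> nat \<Rightarrow> complex"

definition log_series :: "log_ser \<Rightarrow> bool" where
  "log_series y \<longleftrightarrow> (\<exists>A N. finite A \<and>
     (\<forall>a k. y a k \<noteq> 0 \<longrightarrow> k \<le> N \<and> (\<exists>a\<^sub>0\<in>A. \<exists>j::nat. a = a\<^sub>0 + of_nat j)))"

text \<open>The derivation \<open>t d/dt\<close>.\<close>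

definition log_ser_delta :: "log_ser \<Rightarrow> log_ser" where
  "log_ser_delta y = (\<lambda>a k. a * y a k + of_nat (Suc k) * y a (Suc k))"

definition fls_times_log_ser :: "complex fls \<Rightarrow> log_ser \<Rightarrow> log_ser" where
  "fls_times_log_ser f y = (\<lambda>a k.
     \<Sum>j | fls_nth f j \<noteq> 0 \<and> y (a - of_int j) k \<noteq> 0. fls_nth f j * y (a - of_int j) k)"

text \<open>
  An exponential part \<open>q = \<Sum> c\<^sub>r t\<^bsup>-r\<^esup>\<close>, with \<open>r\<close> ranging over finitely many positive
  rationals, is represented by its coefficients \<open>c\<^sub>r\<close>; so these are the elements of
  the union of the \<open>t\<^bsup>-1/n\<^esup> \<complex>[t\<^bsup>-1/n\<^esup>]\<close>.
\<close>

definition exponential_parts :: "(rat \<Rightarrow>\<^sub>0 complex) set" where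
  "exponential_parts = {q. Poly_Mapping.keys q \<subseteq> {0<..}}"

definition exp_part_times_log_ser :: "(rat \<Rightarrow>\<^sub>0 complex) \<Rightarrow> log_ser \<Rightarrow> log_ser" where
  "exp_part_times_log_ser q y = (\<lambda>a k. \<Sum>r\<in>Poly_Mapping.keys q. Poly_Mapping.lookup q r * y (a + of_rat r) k)"

text \<open>The degree in \<open>t\<^bsup>-1\<^esup>\<close>.\<close>

definition exp_part_degree :: "(rat \<Rightarrow>\<^sub>0 complex) \<Rightarrow> rat" where
  "exp_part_degree q = (if q = 0 then 0 else Max (Poly_Mapping.keys q))"


section \<open>Differential modules\<close>

global_interpretation coords: vector_space
  "\<lambda>(f :: complex fls) (Y :: 'm \<Rightarrow> complex fls) b. f * Y b"
  by unfold_locales (auto simp: fun_eq_iff algebra_simps)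

text \<open>
  \<open>nabla\<close> is the component of the connection along \<open>dz\<close>, that is, the connection maps \<open>m\<close>
  to \<open>dz \<otimes> nabla m\<close>. The field \<open>Basis\<close> of the library locale supplies coordinates for scalar
  extensions: an element \<open>\<Sum> Y b \<otimes> b\<close> of a scalar extension of \<open>M\<close> is represented by its family
  of coordinates \<open>Y\<close>, extended by zero outside \<open>Basis\<close>. None of the notions below depends on
  the choice of the basis.
\<close>

locale differential_module = finite_dimensional_vector_space scale Basis
  for scale :: "ratfun \<Rightarrow> 'm::ab_group_add \<Rightarrow> 'm" (infixr "*s" 75) and Basis :: "'m set" +
  fixes nabla :: "'m \<Rightarrow> 'm"
  assumes nabla_add: "nabla (x + y) = nabla x + nabla y"
    and nabla_Leibniz: "nabla (f *s x) = rat_deriv f *s x + f *s nabla x"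
begin

definition irreducible_module :: bool where
  "irreducible_module \<longleftrightarrow>
     (\<forall>N. subspace N \<and> nabla ` N \<subseteq> N \<longrightarrow> N = {0} \<or> N = UNIV)"

subsection \<open>Local theory\<close>

text \<open>The operator \<open>\<nabla>\<close> along \<open>t d/dt = (t / (dt/dz)) d/dz\<close>.\<close>

definition delta :: "P1 \<Rightarrow> 'm \<Rightarrow> 'm" where
  "delta p m = (local_param p / rat_deriv (local_param p)) *s nabla m"

definition delta_matrix :: "P1 \<Rightarrow> 'm \<Rightarrow> 'm \<Rightarrow> complex fls" where
  "delta_matrix p c b = expand p (representation Basis (delta p b) c)"

definition completion :: "('m \<Rightarrow> complex fls) set" where
  "completion = {Y. \<forall>b. b \<notin> Basis \<longrightarrow> Y b = 0}"

definition completion_delta :: "P1 \<Rightarrow> ('m \<Rightarrow> complex fls) \<Rightarrow> 'm \<Rightarrow> complex fls" where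
  "completion_delta p Y = (\<lambda>c. if c \<in> Basis
     then fls_X * fls_deriv (Y c) + (\<Sum>b\<in>Basis. delta_matrix p c b * Y b) else 0)"

definition nonsingular_point :: "P1 \<Rightarrow> bool" where
  "nonsingular_point p \<longleftrightarrow>
     (\<exists>S. coords.independent S \<and> coords.span S = completion \<and>
          (\<forall>Y\<in>S. completion_delta p Y = 0))"

definition singular_point :: "P1 \<Rightarrow> bool" where
  "singular_point p \<longleftrightarrow> \<not> nonsingular_point p"

text \<open>
  The space \<open>V\<^sub>q\<close> of solutions \<open>exp(\<integral> q dt/t) \<cdot> Y\<close>, where the coordinates of \<open>Y\<close> are
  generalized series. As \<open>t d/dt\<close> multiplies the exponential factor by \<open>q\<close>, the equation
  \<open>\<delta> (exp(\<integral> q dt/t) \<cdot> Y) = 0\<close> amounts to \<open>\<delta> Y + q Y = 0\<close>.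
\<close>

definition formal_solutions ::
  "P1 \<Rightarrow> (rat \<Rightarrow>\<^sub>0 complex) \<Rightarrow> ('m \<Rightarrow> log_ser) set" where
  "formal_solutions p q = {Y.
     (\<forall>b. b \<notin> Basis \<longrightarrow> Y b = 0) \<and> (\<forall>b\<in>Basis. log_series (Y b)) \<and>
     (\<forall>c\<in>Basis. log_ser_delta (Y c) + (\<Sum>b\<in>Basis. fls_times_log_ser (delta_matrix p c b) (Y b))
        + exp_part_times_log_ser q (Y c) = 0)}"

definition eigenvalues :: "P1 \<Rightarrow> (rat \<Rightarrow>\<^sub>0 complex) set" where
  "eigenvalues p = {q \<in> exponential_parts. formal_solutions p q \<noteq> {0}}"

definition Katz_invariant :: "P1 \<Rightarrow> rat" where
  "Katz_invariant p = Max (exp_part_degree ` eigenvalues p)"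

definition unramified_point :: "P1 \<Rightarrow> bool" where
  "unramified_point p \<longleftrightarrow> (\<forall>q\<in>eigenvalues p. Poly_Mapping.keys q \<subseteq> \<int>)"

text \<open>The divisor \<open>\<Sum> (r\<^sup>+(p) + 1) [p]\<close> over the singular points.\<close>

definition Katz_divisor :: "P1 \<Rightarrow> int" where
  "Katz_divisor p = (if singular_point p then \<lceil>Katz_invariant p\<rceil> + 1 else 0)"

subsection \<open>Vector bundles with generic fibre \<open>M\<close>\<close>

text \<open>
  Sections of a vector bundle on \<open>\<P>\<^sup>1\<close> are determined by their image in the generic fibre, so
  a vector bundle with generic fibre \<open>M\<close> is a locally free sheaf of submodules of the constant
  sheaf \<open>M\<close> whose sections over all open sets exhaust \<open>M\<close>.
\<close>

text \<open>The restriction of \<open>\<V>\<close> to \<open>W\<close> is free with basis the sections \<open>B\<close>.\<close>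

definition free_on :: "(P1 set \<Rightarrow> 'm set) \<Rightarrow> P1 set \<Rightarrow> 'm set \<Rightarrow> bool" where
  "free_on \<V> W B \<longleftrightarrow> finite B \<and> independent B \<and>
     (\<forall>U. zariski_open U \<and> U \<subseteq> W \<longrightarrow>
        \<V> U = {\<Sum>b\<in>B. f b *s b | f. \<forall>b\<in>B. f b \<in> struct_sheaf U})"

definition vector_bundle :: "(P1 set \<Rightarrow> 'm set) \<Rightarrow> bool" where
  "vector_bundle \<V> \<longleftrightarrow>
     (\<forall>U. zariski_open U \<longrightarrow> 0 \<in> \<V> U \<and> (\<forall>x\<in>\<V> U. \<forall>y\<in>\<V> U. x + y \<in> \<V> U) \<and>
        (\<forall>f\<in>struct_sheaf U. \<forall>x\<in>\<V> U. f *s x \<in> \<V> U)) \<and>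
     (\<forall>U U'. zariski_open U \<and> zariski_open U' \<and> U' \<subseteq> U \<longrightarrow> \<V> U \<subseteq> \<V> U') \<and>
     (\<forall>\<U>. \<U> \<noteq> {} \<and> (\<forall>U\<in>\<U>. zariski_open U) \<longrightarrow> (\<Inter>U\<in>\<U>. \<V> U) \<subseteq> \<V> (\<Union>\<U>)) \<and>
     (\<forall>p. \<exists>W B. zariski_open W \<and> p \<in> W \<and> free_on \<V> W B)"

definition free_bundle :: "(P1 set \<Rightarrow> 'm set) \<Rightarrow> bool" where
  "free_bundle \<V> \<longleftrightarrow> (\<exists>B. free_on \<V> UNIV B)"

text \<open>
  The sheaf \<open>\<Omega>(d) \<otimes> \<V>\<close> as a subsheaf of the constant sheaf \<open>K dz \<otimes> M\<close>, where \<open>dz \<otimes> m\<close> is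
  represented by \<open>m\<close>: its sections are locally finite sums of tensors \<open>g dz \<otimes> v\<close>.
\<close>

definition Omega_tensor :: "(P1 \<Rightarrow> int) \<Rightarrow> (P1 set \<Rightarrow> 'm set) \<Rightarrow> P1 set \<Rightarrow> 'm set" where
  "Omega_tensor d \<V> U = {m. \<forall>p\<in>U. \<exists>U'. zariski_open U' \<and> p \<in> U' \<and> U' \<subseteq> U \<and>
     (\<exists>(n::nat) g v. (\<forall>i<n. g i \<in> Omega d U' \<and> v i \<in> \<V> U') \<and> m = (\<Sum>i<n. g i *s v i))}"

text \<open>The connection on \<open>\<V>\<close> is the restriction of the one on \<open>M\<close>.\<close>

definition connection_with_singularities :: "(P1 set \<Rightarrow> 'm set) \<Rightarrow> (P1 \<Rightarrow> int) \<Rightarrow> bool" where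
  "connection_with_singularities \<V> d \<longleftrightarrow> vector_bundle \<V> \<and> effective_divisor d \<and>
     (\<forall>U. zariski_open U \<longrightarrow> nabla ` \<V> U \<subseteq> Omega_tensor d \<V> U)"

end

end

theory Submission
  imports Defs "Jordan_Normal_Form.Determinant"
begin

text \<open>
  In terms of a frame of \<open>M\<close>, the connection is a matrix, and one has to find a frame whose matrix
  has the prescribed pole order everywhere; the bundle is then spanned by this frame.

  Locally, Hensel's lemma for skew polynomials shows that a system has an eigenvector over some
  \<open>\<complex>((t\<^bsup>1/m\<^esup>))\<close>, so that it becomes triangular there. The polar parts of the diagonal entries give
  the eigenvalues. Conjugation by diagonal matrices of widely spaced powers of \<open>t\<close> makes the
  off-diagonal entries as small as desired; this yields a lattice with the pole order given by the
  Katz invariant, which descends to \<open>\<complex>((t))\<close>. At an unramified point \<open>p\<^sub>0\<close> the triangular form exists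
  over \<open>\<complex>((t))\<close> itself.

  Globally, one chooses good lattices outside \<open>p\<^sub>0\<close>, and at \<open>p\<^sub>0\<close> the triangular frame conjugated by
  very widely spaced powers of \<open>t\<close>. The resulting bundle is a sum of line bundles, and
  irreducibility bounds the differences of their degrees independently of the spacing (Bolibrukh).
  Elementary modifications at \<open>p\<^sub>0\<close> make the degrees equal; they change the exponents of \<open>t\<close> in the
  local frame by bounded amounts only, so that the pole order is not affected.
\<close>

section \<open>Hensel's lemma for skew polynomials\<close>

text \<open>The obstacle is the passage from local to global: lattices with the right pole order
  exist at every point, but the bundle that they define need not be trivial. Correcting its degrees
  means multiplying basis vectors of one lattice by t, which in general raises the pole order there.
  It is harmless if the local matrix is triangular with off-diagonal entries so small that they
  absorb any bounded change of the exponents. This takes a triangular frame over C((t)) itself and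
  not merely a lattice that descends from a ramified extension; hence the unramified point. How
  small the entries must be has to be known in advance. An entry (i, j) of the global matrix is a
  rational function whose poles outside the chosen point are bounded by the divisor, while its order
  at that point grows with the difference of the degrees j and i; once the difference exceeds the
  degree of the divisor, the entry vanishes. A large gap between the degrees would thus produce a
  zero block and a proper submodule. So the bound depends only on the rank and on the
  divisor.\<close>

lemma causal_fixpoint:
  fixes \<Phi> :: "(nat \<Rightarrow> 'x) \<Rightarrow> nat \<Rightarrow> 'x"
  assumes "\<And>f g k. (\<And>i. i < k \<Longrightarrow> f i = g i) \<Longrightarrow> \<Phi> f k = \<Phi> g k"
  obtains f where "\<Phi> f = f"
proof -
  define F where "F = (\<lambda>k. (\<Phi> ^^ Suc k) undefined)"
  \<comment> \<open>Entry i of the iterates is final after i + 1 applications of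
    \<open>\<Phi>\<close>, so the diagonal of the iterates is a fixpoint.\<close>
  have st: "i < m \<Longrightarrow> (\<Phi> ^^ m) undefined i = F i i" for m i
  proof (induction i arbitrary: m rule: less_induct)
    case (less i)
    from less.prems obtain m' where m: "m = Suc m'" "i \<le> m'" by (cases m) auto
    have "\<Phi> ((\<Phi> ^^ m') undefined) i = \<Phi> ((\<Phi> ^^ i) undefined) i"
      by (rule assms) (use less.IH m in auto)
    then show ?case by (simp add: F_def m)
  qed
  have "\<Phi> (\<lambda>k. F k k) = (\<lambda>k. F k k)"
  proof
    fix k
    have "\<Phi> (\<lambda>k. F k k) k = \<Phi> ((\<Phi> ^^ k) undefined) k"
      by (rule assms) (use st in auto)
    then show "\<Phi> (\<lambda>k. F k k) k = F k k" by (simp add: F_def)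
  qed
  then show ?thesis using that by blast
qed

hide_const (open) Module.smult

text \<open>An operator with power series coefficients, read as a power series in t with polynomial
  coefficients: this is its coefficient of t^k. Hensel's lemma is a recursion on k.\<close>

definition slice :: "nat \<Rightarrow> complex fps poly \<Rightarrow> complex poly" where
  "slice k a = map_poly (\<lambda>c. fps_nth c k) a"

lemma coeff_slice [simp]: "coeff (slice k a) l = fps_nth (coeff a l) k"
  by (simp add: slice_def coeff_map_poly)

lemma degree_slice_le: "degree (slice k a) \<le> degree a"
  by (rule degree_le) (simp add: coeff_eq_0)

lemma slice_sum: "slice k (\<Sum>x\<in>S. f x) = (\<Sum>x\<in>S. slice k (f x))"
  by (rule poly_eqI) (simp add: coeff_sum fps_sum_nth)

lemma slice_smult: "slice k (smult c b) = (\<Sum>i\<le>k. smult (fps_nth c i) (slice (k - i) b))"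
  by (rule poly_eqI) (simp add: coeff_sum fps_mult_nth atLeast0AtMost)

lemma slice_eqI: "(\<And>k. slice k a = slice k b) \<Longrightarrow> a = b"
  by (rule poly_eqI, rule fps_ext) (metis coeff_slice)

text \<open>Composition of the operators \<open>\<Sum> a\<^sub>l N\<^sup>l\<close>, where \<open>N f = t\<^sup>s \<cdot> t df/dt + f N\<close>; the function
  \<open>dop s\<close> is composition with \<open>N\<close> from the left.\<close>

definition dop :: "nat \<Rightarrow> complex fps poly \<Rightarrow> complex fps poly" where
  "dop s b = pCons 0 b + map_poly (\<lambda>c. fps_X ^ s * (fps_X * fps_deriv c)) b"

lemma coeff_dop: "coeff (dop s b) l =
   (case l of 0 \<Rightarrow> 0 | Suc l' \<Rightarrow> coeff b l') + fps_X ^ s * (fps_X * fps_deriv (coeff b l))"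
  by (simp add: dop_def coeff_map_poly coeff_pCons)

lemma slice_dop: "slice k (dop s b) =
   pCons 0 (slice k b) + (if s \<le> k then smult (of_nat (k - s)) (slice (k - s) b) else 0)"
  by (rule poly_eqI) (auto simp: coeff_dop coeff_pCons fps_X_power_mult_nth
      fps_mult_fps_X_deriv_shift split: nat.splits)

text \<open>The l-th power of N has to pass \<open>b\<close> before the coefficient of
  \<open>a\<close> multiplies it, hence the iterates of \<open>dop s\<close>.\<close>

definition star :: "nat \<Rightarrow> complex fps poly \<Rightarrow> complex fps poly \<Rightarrow> complex fps poly" where
  "star s a b = (\<Sum>l\<le>degree a. smult (coeff a l) ((dop s ^^ l) b))"

lemma star_upto:
  assumes "degree a \<le> n"
  shows "star s a b = (\<Sum>l\<le>n. smult (coeff a l) ((dop s ^^ l) b))"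
  unfolding star_def
  by (rule sum.mono_neutral_left) (use assms in \<open>auto simp: coeff_eq_0\<close>)

lemma slice_star:
  assumes "degree a \<le> n"
  shows "slice k (star s a b) =
    (\<Sum>l\<le>n. \<Sum>i\<le>k. smult (coeff (slice i a) l) (slice (k - i) ((dop s ^^ l) b)))"
  by (simp add: star_upto[OF assms] slice_sum slice_smult)

text \<open>If the coefficients of \<open>b\<close> below \<open>t\<^sup>k\<close> are fixed, composition with \<open>N\<close> multiplies a change of
  the coefficient of \<open>t\<^sup>k\<close> by this polynomial.\<close>

definition shift_poly :: "nat \<Rightarrow> nat \<Rightarrow> complex poly" where
  "shift_poly s k = [:if s = 0 then of_nat k else 0, 1:]"

lemma sum_coeff_pcompose:
  assumes "degree p \<le> n"
  shows "(\<Sum>l\<le>n. smult (coeff p l) (q ^ l)) = pcompose p q"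
proof -
  have "pcompose p q = (\<Sum>l\<le>degree p. smult (coeff p l) (q ^ l))"
    by (simp add: pcompose_altdef poly_altdef coeff_map_poly degree_map_poly)
  also have "\<dots> = (\<Sum>l\<le>n. smult (coeff p l) (q ^ l))"
    by (rule sum.mono_neutral_left) (use assms in \<open>auto simp: coeff_eq_0\<close>)
  finally show ?thesis by simp
qed

text \<open>On a term of order t^k the derivation t d/dt is multiplication by k. For s = 0 this
  shifts the variable by k; for s > 0 the factor t^s moves the derivative of the change beyond order
  k.\<close>

lemma slice_dop_power:
  assumes "\<And>i. i < k \<Longrightarrow> slice i b = slice i b'" "1 \<le> k"
  shows "\<And>i. i < k \<Longrightarrow> slice i ((dop s ^^ l) b) = slice i ((dop s ^^ l) b')"
    and "slice k ((dop s ^^ l) b) - slice k ((dop s ^^ l) b') =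
         shift_poly s k ^ l * (slice k b - slice k b')"
proof (induction l)
  case 0
  { case 1 then show ?case using assms by simp }
  { case 2 then show ?case by simp }
next
  case (Suc l)
  { case 1 then show ?case using Suc.IH(1) by (simp add: slice_dop) }
  { case 2
    let ?c = "(dop s ^^ l) b" and ?c' = "(dop s ^^ l) b'"
    have "slice k (dop s ?c) - slice k (dop s ?c') = shift_poly s k * (slice k ?c - slice k ?c')"
    proof (cases "s = 0")
      case True
      then show ?thesis
        by (simp add: slice_dop shift_poly_def smult_diff_right)
           (metis diff_pCons minus_diff_eq diff_zero add_diff_eq)?
    next
      case False
      have "s \<le> k \<Longrightarrow> slice (k - s) ?c = slice (k - s) ?c'" using Suc.IH(1)[of "k - s"] False assms(2) by simp
      then show ?thesis using False by (simp add: slice_dop shift_poly_def)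
    qed
    then show ?case using Suc.IH(2) by (simp add: mult.assoc) }
qed

lemma slice_0_dop_power: "slice 0 ((dop s ^^ l) b) = [:0, 1:] ^ l * slice 0 b"
  by (induction l) (simp_all add: slice_dop mult.assoc)

lemma slice_0_star: "slice 0 (star s a b) = slice 0 a * slice 0 b"
proof -
  have "slice 0 (star s a b) = (\<Sum>l\<le>degree a. smult (coeff (slice 0 a) l) ([:0, 1:] ^ l)) * slice 0 b"
    by (simp add: slice_star[OF order_refl] slice_0_dop_power sum_distrib_right)
  also have "(\<Sum>l\<le>degree a. smult (coeff (slice 0 a) l) ([:0, 1:] ^ l)) = slice 0 a"
    by (subst sum_coeff_pcompose) (auto simp: pcompose_idR degree_slice_le)
  finally show ?thesis .
qed

text \<open>In the coefficient of t^k of a product, the changes of either factor meet only the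
  coefficient of order 0 of the other; all remaining terms involve coefficients below k, which
  agree. This is the linear equation that Hensel's lemma solves in each order.\<close>

lemma slice_star_diff:
  assumes a: "\<And>i. i < k \<Longrightarrow> slice i a = slice i a'"
    and b: "\<And>i. i < k \<Longrightarrow> slice i b = slice i b'" and k: "1 \<le> k"
  shows "slice k (star s a b) - slice k (star s a' b') =
     (slice k a - slice k a') * slice 0 b
      + pcompose (slice 0 a) (shift_poly s k) * (slice k b - slice k b')"
proof -
  define n where "n = max (degree a) (degree a')"
  have na: "degree a \<le> n" "degree a' \<le> n" by (auto simp: n_def)
  have ns: "degree (slice i a) \<le> n" "degree (slice i a') \<le> n" for i
    using na degree_slice_le by (meson le_trans)+
  let ?S = "shift_poly s k"
  note D = slice_dop_power[where s = s, OF b k]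
  have tm: "(\<Sum>i\<le>k. smult (coeff (slice i a) l) (slice (k - i) ((dop s ^^ l) b)))
      - (\<Sum>i\<le>k. smult (coeff (slice i a') l) (slice (k - i) ((dop s ^^ l) b')))
      = smult (coeff (slice 0 a) l) (?S ^ l) * (slice k b - slice k b')
        + smult (coeff (slice k a - slice k a') l) ([:0,1:] ^ l) * slice 0 b" (is "?lhs = ?rhs") for l
  proof -
    have "?lhs = (\<Sum>i\<le>k. smult (coeff (slice i a) l) (slice (k - i) ((dop s ^^ l) b))
                  - smult (coeff (slice i a') l) (slice (k - i) ((dop s ^^ l) b')))" (is "_ = sum ?f _")
      by (simp add: sum_subtractf)
    also have "\<dots> = sum ?f {0, k}"
    proof (rule sum.mono_neutral_right)
      show "\<forall>i\<in>{..k} - {0, k}. ?f i = 0"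
      proof
        fix i assume i: "i \<in> {..k} - {0, k}"
        then have "slice i a = slice i a'" using a by auto
        moreover have "slice (k - i) ((dop s ^^ l) b) = slice (k - i) ((dop s ^^ l) b')"
          using D(1)[of "k - i" l] i by auto
        ultimately show "?f i = 0" by simp
      qed
    qed auto
    also have "\<dots> = ?f 0 + ?f k" using k by simp
    also have "?f 0 = smult (coeff (slice 0 a) l) (?S ^ l) * (slice k b - slice k b')"
      using a[of 0] k D(2)[of l] by (simp flip: smult_diff_right)
    also have "?f k = smult (coeff (slice k a - slice k a') l) ([:0,1:] ^ l) * slice 0 b"
      using b[of 0] k by (simp add: slice_0_dop_power smult_diff_left left_diff_distrib)
    finally show ?thesis .
  qed
  have "slice k (star s a b) - slice k (star s a' b') =
    (\<Sum>l\<le>n. smult (coeff (slice 0 a) l) (?S ^ l) * (slice k b - slice k b')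
        + smult (coeff (slice k a - slice k a') l) ([:0,1:] ^ l) * slice 0 b)"
    by (subst tm[symmetric]) (simp add: slice_star[OF na(1)] slice_star[OF na(2)] sum_subtractf)
  also have "\<dots> = (\<Sum>l\<le>n. smult (coeff (slice 0 a) l) (?S ^ l)) * (slice k b - slice k b')
     + (\<Sum>l\<le>n. smult (coeff (slice k a - slice k a') l) ([:0,1:] ^ l)) * slice 0 b"
    by (simp only: sum.distrib sum_distrib_right)
  also have "(\<Sum>l\<le>n. smult (coeff (slice 0 a) l) (?S ^ l)) = pcompose (slice 0 a) ?S"
    by (rule sum_coeff_pcompose[OF ns(1)])
  also have "(\<Sum>l\<le>n. smult (coeff (slice k a - slice k a') l) ([:0,1:] ^ l)) = slice k a - slice k a'"
    by (subst sum_coeff_pcompose) (use ns in \<open>auto simp: pcompose_idR intro: degree_diff_le\<close>)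
  finally show ?thesis by (simp add: algebra_simps)
qed

text \<open>A Bezout relation multiplied by F, with A reduced modulo P; comparing degrees then
  bounds B. The case \<open>B = 0\<close> is listed separately because R may be constant.\<close>

lemma bezout_degree:
  fixes P R F :: "complex poly"
  assumes "coprime P R" "P \<noteq> 0" "degree P > 0" "degree F < degree P + degree R"
  obtains A B where "F = A * R + P * B" "degree A < degree P" "B = 0 \<or> degree B < degree R"
proof -
  obtain u v where uv: "u * P + v * R = 1"
    using bezout_coefficients[of P R] assms(1) by (metis coprime_imp_gcd_eq_1 surj_pair)
  define A where "A = (F * v) mod P"
  define B where "B = F * u + ((F * v) div P) * R"
  have "A * R + P * B = (P * ((F * v) div P) + A) * R + P * F * u" by (simp add: B_def algebra_simps)
  also have "P * ((F * v) div P) + A = F * v" by (simp add: A_def)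
  also have "F * v * R + P * F * u = F * (u * P + v * R)" by (simp add: algebra_simps)
  finally have eq: "F = A * R + P * B" by (simp add: uv)
  have dA: "degree A < degree P"
    using degree_mod_less[OF assms(2), of "F * v"] assms(3) by (auto simp: A_def)
  have "B = 0 \<or> degree B < degree R"
  proof (rule disjCI)
    assume B0: "\<not> degree B < degree R"
    show "B = 0"
    proof (rule ccontr)
      assume "B \<noteq> 0"
      then have d: "degree (P * B) = degree P + degree B" using assms(2) by (simp add: degree_mult_eq)
      have "degree (A * R) \<le> degree A + degree R" by (rule degree_mult_le)
      then have "degree (F - A * R) < degree P + degree R"
        using assms(4) dA by (intro le_less_trans[OF degree_diff_le_max]) auto
      moreover have "F - A * R = P * B" using eq by (simp add: algebra_simps)
      ultimately show False using d B0 by simp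
    qed
  qed
  then show ?thesis using that eq dA by blast
qed

text \<open>Inverse to \<open>slice\<close> on operators of degree at most n.\<close>

definition asm :: "nat \<Rightarrow> (nat \<Rightarrow> complex poly) \<Rightarrow> complex fps poly" where
  "asm n f = (\<Sum>l\<le>n. monom (Abs_fps (\<lambda>k. coeff (f k) l)) l)"

lemma coeff_asm: "coeff (asm n f) l = (if l \<le> n then Abs_fps (\<lambda>k. coeff (f k) l) else 0)"
  by (simp add: asm_def coeff_sum if_distrib cong: if_cong)

lemma slice_asm: "degree (f k) \<le> n \<Longrightarrow> slice k (asm n f) = f k"
  by (rule poly_eqI) (auto simp: coeff_asm coeff_eq_0)

lemma degree_asm_le: "degree (asm n f) \<le> n"
  by (rule degree_le) (simp add: coeff_asm)

lemma coeff_asm_top: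
  assumes "coeff (f 0) n = 1" "\<And>k. k > 0 \<Longrightarrow> coeff (f k) n = 0"
  shows "coeff (asm n f) n = 1"
  by (rule fps_ext) (use assms in \<open>auto simp: coeff_asm fps_one_nth\<close>)

lemma dop_power_top:
  assumes "degree b \<le> r"
  shows "degree ((dop s ^^ l) b) \<le> r + l \<and> coeff ((dop s ^^ l) b) (r + l) = coeff b r"
proof (induction l)
  case (Suc l)
  let ?c = "(dop s ^^ l) b"
  have "coeff ?c j = 0" if "j > r + l" for j using Suc that by (simp add: coeff_eq_0)
  then have "coeff (dop s ?c) j = 0" if "j > r + Suc l" for j
    using that by (auto simp: coeff_dop split: nat.splits)
  then show ?case using Suc by (auto simp: coeff_dop coeff_eq_0 intro: degree_le)
qed (use assms in auto)

lemma star_top: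
  assumes "degree a \<le> p" "degree b \<le> r"
  shows "degree (star s a b) \<le> p + r" "coeff (star s a b) (p + r) = coeff a p * coeff b r"
proof -
  note T = dop_power_top[where s = s, OF assms(2)]
  show "degree (star s a b) \<le> p + r"
    unfolding star_upto[OF assms(1)]
  proof (rule degree_sum_le)
    fix l assume "l \<in> {..p}"
    then show "degree (smult (coeff a l) ((dop s ^^ l) b)) \<le> p + r"
      using T[of l] by (intro order_trans[OF degree_smult_le]) auto
  qed simp
  have z: "coeff ((dop s ^^ l) b) (p + r) = 0" if "l < p" for l
    using T[of l] that by (intro coeff_eq_0) linarith
  have "coeff (star s a b) (p + r) = (\<Sum>l\<le>p. coeff a l * coeff ((dop s ^^ l) b) (p + r))"
    by (simp add: star_upto[OF assms(1)] coeff_sum)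
  also have "\<dots> = (\<Sum>l\<in>{p}. coeff a l * coeff ((dop s ^^ l) b) (p + r))"
    by (rule sum.mono_neutral_right) (auto simp: z)
  finally show "coeff (star s a b) (p + r) = coeff a p * coeff b r"
    using T[of p] by (simp add: add.commute)
qed

text \<open>The coefficients of order t^k of the two factors solve a Bezout equation for R and for P
  with its variable replaced by \<open>shift_poly s k\<close>. This shift is the only trace of
  non-commutativity. It is the reason why coprimality is required for the shifts with k >= 1; for s
  = 0 a common root of P and R is allowed.\<close>

lemma skew_hensel:
  assumes L: "lead_coeff L = 1" and L0: "slice 0 L = P * R"
    and P: "lead_coeff P = 1" and R: "lead_coeff R = 1" and dP: "degree P > 0"
    and cop: "\<And>k. k \<ge> 1 \<Longrightarrow> coprime (pcompose P (shift_poly s k)) R"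
  obtains a b where "star s a b = L" "slice 0 a = P" "degree a = degree P" "lead_coeff a = 1"
    "degree b = degree R" "lead_coeff b = 1"
proof -
  define p where "p = degree P"
  define r where "r = degree R"
  have nz: "P \<noteq> 0" "R \<noteq> 0" using P R by auto
  have degL: "degree L = p + r"
  proof -
    have "coeff (slice 0 L) (degree L) = 1" using L by simp
    then have "degree L \<le> degree (P * R)" by (metis L0 le_degree one_neq_zero)
    moreover have "degree (slice 0 L) \<le> degree L" by (rule degree_slice_le)
    ultimately show ?thesis using nz by (simp add: L0 degree_mult_eq p_def r_def)
  qed
  define PK where "PK k = pcompose P (shift_poly s k)" for k
  have PK: "degree (PK k) = p" for k by (simp add: PK_def p_def shift_poly_def degree_pcompose)
  \<comment> \<open>Cut off at k, so that \<open>rest f k\<close> depends only on earlier entries,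
    as \<open>causal_fixpoint\<close> demands.\<close>
  define tr where "tr f k i = (if i < k then f i else 0)" for f :: "nat \<Rightarrow> complex poly" and k i :: nat
  define rest where "rest f k = slice k L - slice k (star s (asm p (tr (fst \<circ> f) k)) (asm r (tr (snd \<circ> f) k)))"
    for f :: "nat \<Rightarrow> complex poly \<times> complex poly" and k
  define good where "good k F AB \<longleftrightarrow> F = fst AB * R + PK k * snd AB \<and> degree (fst AB) < p \<and>
     (snd AB = 0 \<or> degree (snd AB) < r)" for k F AB
  define \<Phi> where "\<Phi> f k = (if k = 0 then (P, R) else SOME AB. good k (rest f k) AB)" for f k
  have "\<Phi> f k = \<Phi> g k" if "\<And>i. i < k \<Longrightarrow> f i = g i" for f g k
  proof -
    have "tr (fst \<circ> f) k = tr (fst \<circ> g) k" "tr (snd \<circ> f) k = tr (snd \<circ> g) k"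
      using that by (auto simp: tr_def)
    then show ?thesis by (simp add: \<Phi>_def rest_def)
  qed
  then obtain f where f: "\<Phi> f = f" by (rule causal_fixpoint)
  have f0: "f 0 = (P, R)" by (subst f[symmetric]) (simp add: \<Phi>_def)
  have fk: "good k (rest f k) (f k)" if "k \<ge> 1" for k
    using that
  proof (induction k rule: less_induct)
    case (less k)
    have deg: "coeff (fst (f i)) p = 0 \<and> degree (fst (f i)) \<le> p \<and> coeff (snd (f i)) r = 0 \<and> degree (snd (f i)) \<le> r"
      if "i < k" "i > 0" for i
    proof -
      have "good i (rest f i) (f i)" using less.IH[of i] that by simp
      then show ?thesis by (auto simp: good_def coeff_eq_0)
    qed
    let ?a = "asm p (tr (fst \<circ> f) k)" and ?b = "asm r (tr (snd \<circ> f) k)"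
    have "coeff ?a p = 1"
      by (rule coeff_asm_top) (use less.prems P deg in \<open>auto simp: tr_def f0 p_def\<close>)
    moreover have "coeff ?b r = 1"
      by (rule coeff_asm_top) (use less.prems R deg in \<open>auto simp: tr_def f0 r_def\<close>)
    ultimately have st: "degree (star s ?a ?b) \<le> p + r" "coeff (star s ?a ?b) (p + r) = 1"
      using star_top[OF degree_asm_le degree_asm_le, of s p "tr (fst \<circ> f) k" r "tr (snd \<circ> f) k"] by simp_all
    \<comment> \<open>L and the product of the approximations are both monic of degree p + r, so
      their difference is small enough for \<open>bezout_degree\<close>.\<close>
    have "coeff (rest f k) j = 0" if "j \<ge> p + r" for j
    proof (cases "j = p + r")
      case True
      then show ?thesis using st L degL less.prems by (simp add: rest_def)
    next
      case False
      then show ?thesis using st degL that by (simp add: rest_def coeff_eq_0)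
    qed
    then have "degree (rest f k) < p + r"
      using dP p_def by (metis coeff_eq_0 degree_0 leI leading_coeff_0_iff add_gr_0)
    then obtain A B where "rest f k = A * R + PK k * B" "degree A < p" "B = 0 \<or> degree B < r"
      using bezout_degree[OF cop[OF less.prems, folded PK_def], of "rest f k"] dP
      unfolding PK p_def[symmetric] r_def[symmetric]
      by (metis PK degree_0 less_irrefl)
    then have "\<exists>AB. good k (rest f k) AB" by (auto simp: good_def)
    then have "good k (rest f k) (SOME AB. good k (rest f k) AB)" by (rule someI_ex)
    moreover have "f k = (SOME AB. good k (rest f k) AB)"
      by (subst f[symmetric]) (use less.prems in \<open>simp add: \<Phi>_def\<close>)
    ultimately show ?case by simp
  qed
  define a where "a = asm p (fst \<circ> f)"
  define b where "b = asm r (snd \<circ> f)"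
  have df: "degree (fst (f i)) \<le> p" "degree (snd (f i)) \<le> r" for i
    using fk[of i] f0 by (cases "i = 0"; auto simp: good_def p_def r_def)+
  have sa: "slice i a = fst (f i)" "slice i b = snd (f i)" for i
    using df by (simp_all add: a_def b_def slice_asm)
  have star: "star s a b = L"
  proof (rule slice_eqI)
    fix k show "slice k (star s a b) = slice k L"
    proof (cases "k = 0")
      case True
      then show ?thesis by (simp add: slice_0_star sa f0 L0)
    next
      case False
      let ?a = "asm p (tr (fst \<circ> f) k)" and ?b = "asm r (tr (snd \<circ> f) k)"
      have dt: "degree (tr (fst \<circ> f) k i) \<le> p" "degree (tr (snd \<circ> f) k i) \<le> r" for i
        using df by (simp_all add: tr_def)
      have tra: "slice i ?a = tr (fst \<circ> f) k i" "slice i ?b = tr (snd \<circ> f) k i" for i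
        using dt by (simp_all add: slice_asm)
      have "slice k (star s a b) - slice k (star s ?a ?b) =
         (slice k a - slice k ?a) * slice 0 b + pcompose (slice 0 a) (shift_poly s k) * (slice k b - slice k ?b)"
        by (rule slice_star_diff) (use False in \<open>auto simp: sa tra tr_def\<close>)
      also have "\<dots> = fst (f k) * R + PK k * snd (f k)"
        by (simp add: sa tra tr_def f0 PK_def)
      also have "\<dots> = rest f k" using fk[of k] False by (simp add: good_def)
      finally show ?thesis by (simp add: rest_def)
    qed
  qed
  have ca: "coeff a p = 1" unfolding a_def
    by (rule coeff_asm_top) (use P fk in \<open>auto simp: f0 p_def good_def coeff_eq_0 Suc_leI\<close>)
  have cb: "coeff b r = 1" unfolding b_def
    by (rule coeff_asm_top)
       (use R fk in \<open>auto simp: f0 r_def good_def coeff_eq_0 Suc_leI, (metis One_nat_def Suc_leI coeff_0 coeff_eq_0)?\<close>)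
  have "degree a = p" using ca degree_asm_le[of p "fst \<circ> f"] unfolding a_def[symmetric]
    by (metis le_antisym le_degree one_neq_zero)
  moreover have "degree b = r" using cb degree_asm_le[of r "snd \<circ> f"] unfolding b_def[symmetric]
    by (metis le_antisym le_degree one_neq_zero)
  ultimately show ?thesis using that star ca cb sa(1)[of 0] f0 by (simp add: p_def r_def)
qed

section \<open>Laurent series\<close>

text \<open>The valuation of x is at least N, where the valuation of 0 is infinite; the convention
  \<open>fls_subdegree 0 = 0\<close> would spoil the rules for sums and products.\<close>

definition vge :: "int \<Rightarrow> complex fls \<Rightarrow> bool" where
  "vge N x \<longleftrightarrow> (\<forall>k<N. fls_nth x k = 0)"

lemma vge_iff: "vge N x \<longleftrightarrow> x = 0 \<or> N \<le> fls_subdegree x"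
  unfolding vge_def by (auto intro: fls_subdegree_geI)

lemma vge_0_iff: "vge 0 x \<longleftrightarrow> fls_subdegree x \<ge> 0"
  by (auto simp: vge_iff)

lemma vge_zero [simp]: "vge N 0" by (simp add: vge_def)

lemma vge_one [simp]: "vge 0 1" by (simp add: vge_def)

lemma vge_const [simp]: "vge 0 (fls_const c)" by (simp add: vge_def)

lemma vge_mono: "vge N x \<Longrightarrow> M \<le> N \<Longrightarrow> vge M x" by (simp add: vge_def)

lemma vge_add: "vge N x \<Longrightarrow> vge N y \<Longrightarrow> vge N (x + y)" by (simp add: vge_def)

lemma vge_diff: "vge N x \<Longrightarrow> vge N y \<Longrightarrow> vge N (x - y)" by (simp add: vge_def)

lemma vge_uminus: "vge N x \<Longrightarrow> vge N (- x)" by (simp add: vge_def)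

lemma vge_sum: "(\<And>i. i \<in> S \<Longrightarrow> vge N (f i)) \<Longrightarrow> vge N (\<Sum>i\<in>S. f i)"
  by (induction S rule: infinite_finite_induct) (auto intro: vge_add)

lemma vge_mult: "vge M x \<Longrightarrow> vge N y \<Longrightarrow> vge (M + N) (x * y)"
  by (cases "x = 0"; cases "y = 0") (auto simp: vge_iff)

lemma vge_mult0: "vge 0 x \<Longrightarrow> vge N y \<Longrightarrow> vge N (x * y)"
  using vge_mult[of 0 x N y] by simp

lemma vge_power: "vge 0 x \<Longrightarrow> vge 0 (x ^ n)"
  by (induction n) (auto intro: vge_mult0)

lemma vge_of_nat [simp]: "vge 0 (of_nat n)" and vge_of_int [simp]: "vge 0 (of_int i)"
  by (simp_all add: fls_of_nat fls_of_int)

lemma vge_nth_mult: "vge 0 x \<Longrightarrow> vge 0 y \<Longrightarrow> fls_nth (x * y) 0 = fls_nth x 0 * fls_nth y 0"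
proof -
  assume x: "vge 0 x" and y: "vge 0 y"
  define f g where "f = fls_regpart x" and "g = fls_regpart y"
  have "x = fps_to_fls f" "y = fps_to_fls g"
    using x y by (auto simp: f_def g_def vge_def fls_eq_iff)
  then show ?thesis by (simp flip: fls_times_fps_to_fls)
qed

lemma fps_of_vge: "vge 0 x \<Longrightarrow> fps_to_fls (fls_regpart x) = x"
  by (auto simp: vge_def fls_eq_iff)

definition tp :: "int \<Rightarrow> complex fls" where "tp k = fls_X_intpow k"

lemma nth_tp_mult [simp]: "fls_nth (tp a * f) k = fls_nth f (k - a)"
  by (simp add: tp_def fls_X_intpow_times_conv_shift)

lemma nth_tp_mult2 [simp]: "fls_nth (f * tp a) k = fls_nth f (k - a)"
  by (simp add: mult.commute[of f])

lemma nth_tp: "fls_nth (tp a) k = (if k = a then 1 else 0)"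
  using nth_tp_mult[of a 1 k] by simp

lemma tp_0 [simp]: "tp 0 = 1" by (simp add: tp_def)

lemma tp_add: "tp (a + b) = tp a * tp b"
  by (simp add: tp_def fls_X_intpow_times_fls_X_intpow)

lemma tp_nz [simp]: "tp a \<noteq> 0" by (simp add: tp_def)

lemma tp_pow: "tp a ^ n = tp (int n * a)"
  by (induction n) (auto simp: tp_add[symmetric] algebra_simps)

lemma tp_inv: "tp a * tp (- a) = 1" "tp (- a) * tp a = 1"
  by (simp_all add: tp_add[symmetric])

lemma tp_1: "tp 1 = fls_X" by (simp add: tp_def fls_X_conv_shift_1)

lemma vge_tp_mult: "vge N (tp a * f) \<longleftrightarrow> vge (N - a) f"
  unfolding vge_def nth_tp_mult
proof (intro iffI allI impI)
  fix k assume "\<forall>k<N. fls_nth f (k - a) = 0" "k < N - a"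
  then have "fls_nth f (k + a - a) = 0" by (metis less_diff_eq)
  then show "fls_nth f k = 0" by simp
qed auto

lemma vge_tp [simp]: "vge a (tp a)" by (simp add: vge_def nth_tp)

lemma vge_ex: "\<exists>N. vge N x"
  using fls_eq0_below_subdegree unfolding vge_def by blast

section \<open>The derivation t d/dt and ramified extensions\<close>

definition theta :: "complex fls \<Rightarrow> complex fls" where "theta f = fls_X * fls_deriv f"

lemma nth_theta [simp]: "fls_nth (theta f) k = of_int k * fls_nth f k"
  by (simp add: theta_def fls_X_times_conv_shift(1))

lemma theta_add: "theta (f + g) = theta f + theta g" by (simp add: fls_eq_iff algebra_simps)

lemma theta_0 [simp]: "theta 0 = 0" by (simp add: theta_def)

lemma theta_1 [simp]: "theta 1 = 0" by (simp add: theta_def)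

lemma theta_mult: "theta (f * g) = theta f * g + f * theta g"
  by (simp add: theta_def algebra_simps)

lemma theta_sum: "theta (\<Sum>i\<in>S. f i) = (\<Sum>i\<in>S. theta (f i))"
  by (simp add: fls_eq_iff fls_nth_sum sum_distrib_left)

lemma theta_diff: "theta (f - g) = theta f - theta g" by (simp add: fls_eq_iff algebra_simps)

lemma vge_theta: "vge N f \<Longrightarrow> vge N (theta f)" by (simp add: vge_def)

lemma vge_theta_1: "vge 0 f \<Longrightarrow> vge 1 (theta f)"
  unfolding vge_def nth_theta
proof (intro allI impI)
  fix k :: int assume f: "\<forall>k<0. fls_nth f k = 0" and k: "k < 1"
  show "of_int k * fls_nth f k = 0"
    using f k by (cases "k = 0") auto
qed

lemma theta_tp: "theta (tp k) = of_int k * tp k" by (auto simp: fls_eq_iff nth_tp fls_of_int)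

lemma theta_fps: "theta (fps_to_fls f) = fps_to_fls (fps_X * fps_deriv f)"
  by (simp add: theta_def fls_deriv_fps_to_fls fls_times_fps_to_fls)

text \<open>The embedding of C((t)) into C((t^(1/m))), expressed in the parameter of the larger
  field.\<close>

definition ram :: "nat \<Rightarrow> complex fls \<Rightarrow> complex fls" where "ram m f = fls_compose_power f m"

lemma nth_ram: "m > 0 \<Longrightarrow> fls_nth (ram m f) k = (if int m dvd k then fls_nth f (k div int m) else 0)"
  by (simp add: ram_def fls_nth_compose_power)

lemma ram_add: "ram m (f + g) = ram m f + ram m g" by (simp add: ram_def)

lemma ram_diff: "ram m (f - g) = ram m f - ram m g" by (simp add: ram_def)

lemma ram_0 [simp]: "ram m 0 = 0" by (simp add: ram_def)

lemma ram_mult: "m > 0 \<Longrightarrow> ram m (f * g) = ram m f * ram m g" by (simp add: ram_def)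

lemma ram_sum: "ram m (\<Sum>i\<in>S. f i) = (\<Sum>i\<in>S. ram m (f i))"
  by (induction S rule: infinite_finite_induct) (auto simp: ram_add)

lemma ram_1 [simp]: "m > 0 \<Longrightarrow> ram m 1 = 1" by (simp add: ram_def)

lemma ram_const [simp]: "m > 0 \<Longrightarrow> ram m (fls_const c) = fls_const c" by (simp add: ram_def)

lemma ram_of_nat [simp]: "m > 0 \<Longrightarrow> ram m (of_nat c) = of_nat c" by (simp add: fls_of_nat)

lemma ram_tp: "m > 0 \<Longrightarrow> ram m (tp k) = tp (int m * k)" by (simp add: ram_def tp_def)

lemma ram_eq_0_iff [simp]: "m > 0 \<Longrightarrow> ram m f = 0 \<longleftrightarrow> f = 0"
proof
  assume m: "m > 0" and f: "ram m f = 0"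
  show "f = 0"
  proof (rule fls_zero_eqI)
    fix n show "fls_nth f n = 0" using nth_ram[OF m, of f "int m * n"] f m by simp
  qed
qed simp

lemma theta_ram: "m > 0 \<Longrightarrow> theta (ram m f) = of_nat m * ram m (theta f)"
  by (rule fls_eqI) (auto simp: nth_ram elim!: dvdE)

lemma ram_ram: "m > 0 \<Longrightarrow> m' > 0 \<Longrightarrow> ram m' (ram m f) = ram (m * m') f"
proof (rule fls_eqI)
  fix k assume m: "m > 0" "m' > 0"
  show "fls_nth (ram m' (ram m f)) k = fls_nth (ram (m * m') f) k"
  proof (cases "int m' dvd k")
    case True
    then obtain j where j: "k = int m' * j" by (elim dvdE)
    have "int (m * m') dvd k \<longleftrightarrow> int m dvd j" using m by (simp add: j mult.commute)
    moreover have "k div int (m * m') = j div int m" using m by (simp add: j mult.commute)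
    ultimately show ?thesis using m by (simp add: nth_ram j)
  next
    case False
    then have "\<not> int (m * m') dvd k" by (metis dvd_mult_right of_nat_mult)
    then show ?thesis using m False by (simp add: nth_ram)
  qed
qed

lemma ram_by_1 [simp]: "ram 1 f = f" by (simp add: fls_eq_iff nth_ram)

lemma vge_ram: "m > 0 \<Longrightarrow> vge (int m * N) (ram m f) \<longleftrightarrow> vge N f"
proof -
  assume m: "m > 0"
  show ?thesis
  proof
    assume L: "vge (int m * N) (ram m f)"
    show "vge N f" unfolding vge_def
    proof (intro allI impI)
      fix k assume "k < N"
      then show "fls_nth f k = 0"
        using L[unfolded vge_def, rule_format, of "int m * k"] m by (simp add: nth_ram)
    qed
  next
    assume "vge N f" then show "vge (int m * N) (ram m f)"
      using m by (auto simp: vge_def nth_ram elim!: dvdE)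
  qed
qed

section \<open>Operators on vectors of Laurent series\<close>

type_synonym fvec = "nat \<Rightarrow> complex fls"

text \<open>N is a connection along the vector field h t d/dt. The factor h makes it possible to
  rescale the operator until its relations have power series coefficients.\<close>

locale skew_op =
  fixes h :: "complex fls" and N :: "fvec \<Rightarrow> fvec"
  assumes N_add: "N (\<lambda>b. y b + z b) = (\<lambda>b. N y b + N z b)"
    and N_scale: "N (\<lambda>b. f * y b) = (\<lambda>b. h * theta f * y b + f * N y b)"
begin

lemma N_zero: "N (\<lambda>b. 0) = (\<lambda>b. 0)"
  using N_scale[of 0 "\<lambda>b. 0"] by simp

lemma N_lincomb: "N (\<lambda>b. \<Sum>j\<in>S. f j * Y j b) = (\<lambda>b. \<Sum>j\<in>S. h * theta (f j) * Y j b + f j * N (Y j) b)"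
proof (induction S rule: infinite_finite_induct)
  case (insert x S)
  then show ?case
    using N_add[of "\<lambda>b. f x * Y x b" "\<lambda>b. \<Sum>j\<in>S. f j * Y j b"] by (simp add: N_scale)
qed (simp_all add: N_zero)

text \<open>Coefficient of \<open>N ^^ j\<close> in the i-th power of the operator k N + g, see
  \<open>change_operator\<close>.\<close>

primrec cf :: "complex fls \<Rightarrow> complex fls \<Rightarrow> nat \<Rightarrow> nat \<Rightarrow> complex fls" where
  "cf k g 0 j = (if j = 0 then 1 else 0)"
| "cf k g (Suc i) j = k * (h * theta (cf k g i j)) + g * cf k g i j + k * (case j of 0 \<Rightarrow> 0 | Suc j' \<Rightarrow> cf k g i j')"

lemma cf_above: "j > i \<Longrightarrow> cf k g i j = 0"
  by (induction i arbitrary: j) (auto split: nat.splits)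

lemma cf_diag: "cf k g i i = k ^ i"
  by (induction i) (auto simp: cf_above)

lemma cf_subdiag: "cf 1 g (Suc i) i = of_nat (Suc i) * g"
  by (induction i) (auto simp: cf_diag cf_above algebra_simps)

lemma change_operator:
  assumes "\<And>y. N' y = (\<lambda>b. k * N y b + g * y b)"
  shows "(N' ^^ i) y = (\<lambda>b. \<Sum>j\<le>i. cf k g i j * (N ^^ j) y b)"
proof (induction i)
  case (Suc i)
  have "(N' ^^ Suc i) y = N' (\<lambda>b. \<Sum>j\<le>i. cf k g i j * (N ^^ j) y b)"
    using Suc.IH by simp
  also have "\<dots> = (\<lambda>b. \<Sum>j\<le>Suc i. cf k g (Suc i) j * (N ^^ j) y b)"
  proof
    fix b
    have "N' (\<lambda>b. \<Sum>j\<le>i. cf k g i j * (N ^^ j) y b) b =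
        (\<Sum>j\<le>i. (k * (h * theta (cf k g i j)) + g * cf k g i j) * (N ^^ j) y b)
          + (\<Sum>j\<le>i. k * cf k g i j * (N ^^ Suc j) y b)"
      unfolding assms N_lincomb
      by (simp add: sum_distrib_left sum.distrib distrib_right distrib_left mult.assoc)
    also have "(\<Sum>j\<le>i. (k * (h * theta (cf k g i j)) + g * cf k g i j) * (N ^^ j) y b) =
       (\<Sum>j\<le>Suc i. (k * (h * theta (cf k g i j)) + g * cf k g i j) * (N ^^ j) y b)"
      by (simp add: cf_above)
    also have "(\<Sum>j\<le>i. k * cf k g i j * (N ^^ Suc j) y b) =
       (\<Sum>j\<le>Suc i. (k * (case j of 0 \<Rightarrow> 0 | Suc j' \<Rightarrow> cf k g i j')) * (N ^^ j) y b)"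
      by (subst sum.atMost_Suc_shift) simp
    finally show "N' (\<lambda>b. \<Sum>j\<le>i. cf k g i j * (N ^^ j) y b) b = (\<Sum>j\<le>Suc i. cf k g (Suc i) j * (N ^^ j) y b)"
      by (simp add: sum.distrib[symmetric] distrib_right del: sum.atMost_Suc)
  qed
  finally show ?case .
qed simp

definition op_act :: "complex fps poly \<Rightarrow> fvec \<Rightarrow> fvec" where
  "op_act L y = (\<lambda>b. \<Sum>j\<le>degree L. fps_to_fls (coeff L j) * (N ^^ j) y b)"

lemma op_act_upto: "degree L \<le> n \<Longrightarrow> op_act L y = (\<lambda>b. \<Sum>j\<le>n. fps_to_fls (coeff L j) * (N ^^ j) y b)"
  unfolding op_act_def by (rule ext, rule sum.mono_neutral_left) (auto simp: coeff_eq_0)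

lemma op_act_add: "op_act (L + M) y = (\<lambda>b. op_act L y b + op_act M y b)"
  using op_act_upto[of L "max (degree L) (degree M)" y] op_act_upto[of M "max (degree L) (degree M)" y]
    op_act_upto[of "L + M" "max (degree L) (degree M)" y]
  by (simp add: degree_add_le_max sum.distrib algebra_simps)

lemma op_act_smult: "op_act (smult c L) y = (\<lambda>b. fps_to_fls c * op_act L y b)"
  unfolding op_act_upto[OF degree_smult_le] op_act_def
  by (simp add: fls_times_fps_to_fls sum_distrib_left mult.assoc)

lemma op_act_0: "op_act 0 y = (\<lambda>b. 0)" by (simp add: op_act_def)

lemma op_act_sum: "op_act (\<Sum>x\<in>S. f x) y = (\<lambda>b. \<Sum>x\<in>S. op_act (f x) y b)"
  by (induction S rule: infinite_finite_induct) (auto simp: op_act_0 op_act_add)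

lemma op_act_dop:
  assumes "h = fls_X ^ s"
  shows "op_act (dop s L) y = N (op_act L y)"
proof -
  let ?n = "degree L"
  have d: "degree (dop s L) \<le> Suc ?n"
    by (rule degree_le) (auto simp: coeff_dop coeff_eq_0 split: nat.splits)
  have c: "fps_to_fls (coeff (dop s L) j) = (case j of 0 \<Rightarrow> 0 | Suc j' \<Rightarrow> fps_to_fls (coeff L j'))
      + h * theta (fps_to_fls (coeff L j))" for j
    by (cases j) (simp_all add: coeff_dop assms theta_fps fls_times_fps_to_fls fps_to_fls_power)
  have "op_act (dop s L) y = (\<lambda>b. (\<Sum>j\<le>Suc ?n. (case j of 0 \<Rightarrow> 0 | Suc j' \<Rightarrow> fps_to_fls (coeff L j')) * (N ^^ j) y b)
      + (\<Sum>j\<le>Suc ?n. h * theta (fps_to_fls (coeff L j)) * (N ^^ j) y b))"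
    unfolding op_act_upto[OF d] c by (simp only: distrib_right sum.distrib)
  also have "\<dots> = (\<lambda>b. (\<Sum>j\<le>?n. fps_to_fls (coeff L j) * (N ^^ Suc j) y b)
      + (\<Sum>j\<le>?n. h * theta (fps_to_fls (coeff L j)) * (N ^^ j) y b))"
    by (subst sum.atMost_Suc_shift) (simp add: coeff_eq_0)
  also have "\<dots> = N (op_act L y)"
    by (simp add: op_act_def N_lincomb sum.distrib algebra_simps)
  finally show ?thesis .
qed

lemma op_act_star:
  assumes "h = fls_X ^ s"
  shows "op_act (star s a b) y = op_act a (op_act b y)"
proof -
  have "op_act ((dop s ^^ l) b) y = (N ^^ l) (op_act b y)" for l
    by (induction l) (simp_all add: op_act_dop[OF assms])
  then show ?thesis
    by (simp add: star_def op_act_sum op_act_smult) (simp add: op_act_def)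
qed

end

text \<open>A monic operator of order d annihilates y. The induction that finds eigenvectors runs
  over d.\<close>

definition krel :: "(fvec \<Rightarrow> fvec) \<Rightarrow> nat \<Rightarrow> fvec \<Rightarrow> bool" where
  "krel N d y \<longleftrightarrow> (\<exists>a. (N ^^ d) y = (\<lambda>b. \<Sum>j<d. a j * (N ^^ j) y b))"

text \<open>The passage from powers of N' to powers of N is triangular with powers of k on the
  diagonal, so a monic relation of order d becomes one with leading coefficient k^d, which can be
  divided out.\<close>

lemma (in skew_op) relation_change:
  assumes N': "\<And>y. N' y = (\<lambda>b. k * N y b + g * y b)" and k: "k \<noteq> 0"
    and a: "(N' ^^ d) y = (\<lambda>b. \<Sum>j<d. a j * (N' ^^ j) y b)"
  shows "(N ^^ d) y = (\<lambda>b. \<Sum>j<d. (((\<Sum>i<d. a i * cf k g i j) - cf k g d j) / k ^ d) * (N ^^ j) y b)"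
proof -
  note E = change_operator[OF N', of _ y]
  define c where "c j = (\<Sum>i<d. a i * cf k g i j) - cf k g d j" for j
  have "(N ^^ d) y b = (\<Sum>j<d. (c j / k ^ d) * (N ^^ j) y b)" for b
  proof -
    have "(\<Sum>j<d. cf k g d j * (N ^^ j) y b) + k ^ d * (N ^^ d) y b = (N' ^^ d) y b"
      by (simp add: E cf_diag lessThan_Suc_atMost[symmetric])
    also have "\<dots> = (\<Sum>i<d. a i * (\<Sum>j\<le>i. cf k g i j * (N ^^ j) y b))"
      by (simp add: a) (simp add: E)
    also have "\<dots> = (\<Sum>i<d. a i * (\<Sum>j<d. cf k g i j * (N ^^ j) y b))"
    proof (rule sum.cong[OF refl])
      fix i assume "i \<in> {..<d}"
      then have "(\<Sum>j\<le>i. cf k g i j * (N ^^ j) y b) = (\<Sum>j<d. cf k g i j * (N ^^ j) y b)"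
        by (intro sum.mono_neutral_left) (auto simp: cf_above)
      then show "a i * (\<Sum>j\<le>i. cf k g i j * (N ^^ j) y b) = a i * (\<Sum>j<d. cf k g i j * (N ^^ j) y b)"
        by simp
    qed
    also have "\<dots> = (\<Sum>j<d. (\<Sum>i<d. a i * cf k g i j) * (N ^^ j) y b)"
      by (simp add: sum_distrib_left sum_distrib_right mult.assoc) (rule sum.swap)
    finally have "(\<Sum>j<d. cf k g d j * (N ^^ j) y b) + k ^ d * (N ^^ d) y b
      = (\<Sum>j<d. (\<Sum>i<d. a i * cf k g i j) * (N ^^ j) y b)" .
    moreover have "(\<Sum>j<d. c j * (N ^^ j) y b) = (\<Sum>j<d. (\<Sum>i<d. a i * cf k g i j) * (N ^^ j) y b)
      - (\<Sum>j<d. cf k g d j * (N ^^ j) y b)"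
      by (simp only: c_def left_diff_distrib sum_subtractf)
    moreover have "u = v" if "x + u = w" "v = w - x" for u v w x :: "complex fls"
      using that by auto
    ultimately have "k ^ d * (N ^^ d) y b = (\<Sum>j<d. c j * (N ^^ j) y b)"
      by blast
    moreover have "(\<Sum>j<d. (c j / k ^ d) * (N ^^ j) y b) = (\<Sum>j<d. c j * (N ^^ j) y b) / k ^ d"
      by (simp add: sum_divide_distrib)
    moreover have "(N ^^ d) y b = (k ^ d * (N ^^ d) y b) / k ^ d" using k by simp
    ultimately show ?thesis by (simp only:)
  qed
  then show ?thesis by (simp add: c_def fun_eq_iff)
qed

lemma (in skew_op) krel_change:
  assumes "\<And>y. N' y = (\<lambda>b. k * N y b + g * y b)" "k \<noteq> 0" "krel N' d y"
  shows "krel N d y"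
proof -
  from assms(3) obtain a where a: "(N' ^^ d) y = (\<lambda>b. \<Sum>j<d. a j * (N' ^^ j) y b)"
    by (auto simp: krel_def)
  show ?thesis unfolding krel_def by (rule exI, rule relation_change[OF assms(1,2) a])
qed

lemma (in skew_op) krel_of_op_act:
  assumes "op_act L y = (\<lambda>b. 0)" "lead_coeff L = 1"
  shows "krel N (degree L) y"
  unfolding krel_def
proof (intro exI ext)
  fix b
  have "op_act L y b = 0" using assms by simp
  then have "(\<Sum>j<degree L. fps_to_fls (coeff L j) * (N ^^ j) y b) + (N ^^ degree L) y b = 0"
    using assms(2) by (simp add: op_act_def lessThan_Suc_atMost[symmetric])
  then show "(N ^^ degree L) y b = (\<Sum>j<degree L. (- fps_to_fls (coeff L j)) * (N ^^ j) y b)"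
    by (simp add: sum_negf eq_neg_iff_add_eq_0 add.commute)
qed

text \<open>The scalar \<open>c\<close> keeps the family closed under twisting by a rank one module.\<close>

definition nab :: "nat \<Rightarrow> complex fls \<Rightarrow> (nat \<Rightarrow> nat \<Rightarrow> complex fls) \<Rightarrow> fvec \<Rightarrow> fvec" where
  "nab n c A y = (\<lambda>i. theta (y i) + c * y i + (if i < n then \<Sum>j<n. A i j * y j else 0))"

lemma skew_op_scaled_nab: "skew_op h (\<lambda>y b. h * nab n c A y b)"
proof
  show "(\<lambda>b. h * nab n c A (\<lambda>b. y b + z b) b) = (\<lambda>b. h * nab n c A y b + h * nab n c A z b)" for y z
    by (rule ext) (simp add: nab_def theta_add distrib_left sum.distrib add_ac)
  show "(\<lambda>b. h * nab n c A (\<lambda>b. f * y b) b) = (\<lambda>b. h * theta f * y b + f * (h * nab n c A y b))" for f y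
    by (rule ext) (simp add: nab_def theta_mult distrib_left sum_distrib_left mult_ac add_ac)
qed

lemma skew_op_nab: "skew_op 1 (nab n c A)"
  using skew_op_scaled_nab[of 1 n c A] by simp

text \<open>The factor \<open>m\<close> is due to \<open>\<tau> d/d\<tau> = m t d/dt\<close> for \<open>t = \<tau>\<^sup>m\<close>.\<close>

definition rams :: "nat \<Rightarrow> complex fls \<Rightarrow> complex fls" where
  "rams m c = of_nat m * ram m c"

lemma nab_ram:
  assumes "m > 0"
  shows "nab n (rams m c) (\<lambda>i j. rams m (A i j)) (\<lambda>i. ram m (y i)) = (\<lambda>i. rams m (nab n c A y i))"
  using assms by (intro ext) (simp add: nab_def rams_def theta_ram ram_add ram_mult ram_sum distrib_left
      sum_distrib_left mult.assoc)

lemma nab_ram_power: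
  assumes "m > 0"
  shows "(nab n (rams m c) (\<lambda>i j. rams m (A i j)) ^^ k) (\<lambda>i. ram m (y i)) = (\<lambda>i. of_nat m ^ k * ram m ((nab n c A ^^ k) y i))"
proof (induction k)
  case (Suc k)
  interpret skew_op 1 "nab n (rams m c) (\<lambda>i j. rams m (A i j))" by (rule skew_op_nab)
  have t: "theta (of_nat m ^ k) = 0"
    by (simp add: theta_def flip: of_nat_power)
  let ?N = "nab n (rams m c) (\<lambda>i j. rams m (A i j))" and ?z = "(nab n c A ^^ k) y"
  have "(?N ^^ Suc k) (\<lambda>i. ram m (y i)) = ?N (\<lambda>i. of_nat m ^ k * ram m (?z i))"
    using Suc by simp
  also have "\<dots> = (\<lambda>i. of_nat m ^ k * ?N (\<lambda>i. ram m (?z i)) i)"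
    by (simp only: N_scale t) simp
  also have "\<dots> = (\<lambda>i. of_nat m ^ Suc k * ram m (nab n c A ?z i))"
    by (simp only: nab_ram[OF assms]) (simp only: rams_def power_Suc2 mult.assoc)
  finally show ?case by simp
qed simp

lemma rams_rams: "m > 0 \<Longrightarrow> m' > 0 \<Longrightarrow> rams m' (rams m f) = rams (m * m') f"
  by (simp add: rams_def ram_mult ram_ram algebra_simps)

lemma nab_supp: "(\<And>i. i \<ge> n \<Longrightarrow> y i = 0) \<Longrightarrow> i \<ge> n \<Longrightarrow> (((\<lambda>y b. h * nab n c A y b) ^^ k) y) i = 0"
  by (induction k arbitrary: i) (auto simp: nab_def)

section \<open>Eigenvectors over ramified extensions\<close>

text \<open>The Newton polygon for coefficients of valuations \<open>v j\<close>: s is the least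
  natural number that makes the rescaled coefficients integral. The factor d! anticipates a
  ramification of that degree; as it is divisible by every d - j, a positive least s makes some
  rescaled coefficient a unit.\<close>

lemma slope_exists:
  fixes v :: "nat \<Rightarrow> int"
  assumes "J \<subseteq> {..<d}"
  obtains s :: nat where "\<And>j. j \<in> J \<Longrightarrow> fact d * v j + int ((d - j) * s) \<ge> 0"
    "s > 0 \<Longrightarrow> \<exists>j\<in>J. fact d * v j + int ((d - j) * s) = 0"
proof -
  let ?P = "\<lambda>s. \<forall>j\<in>J. fact d * v j + int ((d - j) * s) \<ge> 0"
  have fin: "finite J" using assms finite_subset by blast
  have "?P (\<Sum>j\<in>J. nat \<bar>fact d * v j\<bar>)"
  proof
    fix j assume j: "j \<in> J"
    have "nat \<bar>fact d * v j\<bar> \<le> (\<Sum>j\<in>J. nat \<bar>fact d * v j\<bar>)" (is "_ \<le> ?s") using fin j by (intro member_le_sum) auto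
    also have "\<dots> \<le> (d - j) * ?s" using j assms by (cases "d - j") auto
    finally show "0 \<le> fact d * v j + int ((d - j) * ?s)" by linarith
  qed
  then have ex: "\<exists>s. ?P s" by blast
  define s where "s = (LEAST s. ?P s)"
  have s: "?P s" unfolding s_def using ex by (rule LeastI_ex)
  have "\<exists>j\<in>J. fact d * v j + int ((d - j) * s) = 0" if "s > 0"
  proof -
    have "\<not> ?P (s - 1)" using that not_less_Least[of "s - 1" ?P] by (simp add: s_def)
    then obtain j where j: "j \<in> J" "fact d * v j + int ((d - j) * (s - 1)) < 0" by force
    have "d - j > 0" "d - j \<le> d" using j assms by auto
    then have "(d - j) dvd fact d" by (intro dvd_fact) auto
    then obtain q where q: "fact d = (d - j) * q" by (auto elim: dvdE)
    then have fq: "fact d = int (d - j) * int q" by (metis of_nat_fact of_nat_mult)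
    have "int (d - j) * (int q * v j + int (s - 1)) < 0"
      using j(2) by (simp only: fq of_nat_mult distrib_left mult.assoc)
    then have "int q * v j + int (s - 1) < 0" using \<open>d - j > 0\<close> by (simp add: mult_less_0_iff)
    then have "int q * v j + int s \<le> 0" using that by simp
    moreover have "int (d - j) * (int q * v j + int s) \<ge> 0"
      using bspec[OF s j(1)] by (simp only: fq of_nat_mult distrib_left mult.assoc)
    then have "int q * v j + int s \<ge> 0" using \<open>d - j > 0\<close> by (simp add: zero_le_mult_iff)
    ultimately have "int (d - j) * (int q * v j + int s) = 0" by simp
    then have "fact d * v j + int ((d - j) * s) = 0"
      by (simp only: fq of_nat_mult distrib_left mult.assoc)
    then show ?thesis using j(1) by blast
  qed
  then show ?thesis using that s by blast
qed

text \<open>Rescaling N by t^s multiplies the coefficient \<open>a j\<close> by t^((d - j) s), up to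
  commutators with powers of t. For s > 0 the commutators have positive order, so the constant terms
  are those of the rescaled coefficients.\<close>

lemma integral_relation:
  assumes sk: "skew_op (fls_X ^ s) N'" and N: "\<And>y. N' y = (\<lambda>b. fls_X ^ s * N y b)"
    and rel: "(N ^^ d) y = (\<lambda>b. \<Sum>j<d. a j * (N ^^ j) y b)"
    and int: "\<And>j. j < d \<Longrightarrow> vge 0 (a j * tp (int ((d - j) * s)))"
  obtains L where "skew_op.op_act N' L y = (\<lambda>b. 0)" "lead_coeff L = 1" "degree L = d"
    "s > 0 \<longrightarrow> (\<forall>j<d. coeff (slice 0 L) j = - fls_nth (a j * tp (int ((d - j) * s))) 0)"
proof -
  interpret skew_op "fls_X ^ s" N' by (rule sk)
  have X: "fls_X ^ s = tp (int s)" using tp_pow[of 1 s] by (simp add: tp_1)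
  have Xinv: "tp (- int s) * fls_X ^ s = 1" by (simp add: X tp_inv)
  define e where "e = cf (tp (- int s)) 0"
  have N2: "N y = (\<lambda>b. tp (- int s) * N' y b + 0 * y b)" for y
    by (simp add: N X mult.assoc[symmetric] tp_inv)
  note E = change_operator[OF N2, of _ y, folded e_def]
  have e_top: "e i i = tp (- int (i * s))" for i
    by (simp add: e_def cf_diag tp_pow)
  have e_int: "vge (- int (j * s)) (e i j)" for i j
  proof (induction i arbitrary: j)
    case 0 then show ?case by (auto simp: e_def intro: vge_mono[OF vge_one])
  next
    case (Suc i)
    have "e (Suc i) j = theta (e i j) + tp (- int s) * (case j of 0 \<Rightarrow> 0 | Suc j' \<Rightarrow> e i j')"
      by (cases j) (simp_all add: e_def Xinv mult.assoc[symmetric])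
    moreover have "vge (- int (j * s)) (tp (- int s) * (case j of 0 \<Rightarrow> 0 | Suc j' \<Rightarrow> e i j'))"
      using Suc.IH by (auto simp: vge_tp_mult algebra_simps split: nat.split)
    ultimately show ?case using Suc.IH by (auto intro: vge_add vge_theta)
  qed
  define al where "al i = (if i = d then 1 else - a i)" for i
  have al_int: "vge 0 (al i * tp (int ((d - i) * s)))" if "i \<le> d" for i
    using int[of i] that by (auto simp: al_def intro: vge_uminus)
  \<comment> \<open>The coefficients with respect to powers of N', multiplied by t^(d s) to make the
    relation monic again.\<close>
  define B where "B j = (\<Sum>i\<le>d. al i * tp (int (d * s)) * e i j)" for j
  have term_eq: "al i * tp (int (d * s)) * e i j = (al i * tp (int ((d - i) * s))) * (tp (int (i * s)) * e i j)"
    if "i \<le> d" for i j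
    using that by (simp add: mult.assoc tp_add[symmetric] left_diff_distrib flip: of_nat_add)
  have term_int: "vge (int ((i - j) * s)) (al i * tp (int (d * s)) * e i j)" if "i \<le> d" for i j
  proof (cases "i < j")
    case True
    then show ?thesis by (simp add: e_def cf_above)
  next
    case False
    then have "int ((i - j) * s) - int (i * s) = - int (j * s)"
      by (simp add: not_less of_nat_diff left_diff_distrib)
    then have "vge (int ((i - j) * s)) (tp (int (i * s)) * e i j)"
      using e_int[of j i] by (simp only: vge_tp_mult)
    then show ?thesis unfolding term_eq[OF that] using al_int[OF that] by (rule vge_mult0[rotated])
  qed
  have B_int: "vge 0 (B j)" for j
    unfolding B_def by (rule vge_sum, rule vge_mono[OF term_int]) auto
  have B_d: "B d = 1"
  proof -
    have "B d = (\<Sum>i\<in>{d}. al i * tp (int (d * s)) * e i d)"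
      unfolding B_def by (rule sum.mono_neutral_right) (auto simp: e_def cf_above)
    then show ?thesis by (simp add: al_def e_top tp_inv)
  qed
  have rel0: "(\<Sum>j\<le>d. B j * (N' ^^ j) y b) = 0" for b
  proof -
    have "(\<Sum>i<d. al i * (N ^^ i) y b) + (N ^^ d) y b = 0"
      by (simp add: rel al_def sum_negf)
    then have "0 = (\<Sum>i\<le>d. al i * (N ^^ i) y b)"
      by (simp add: lessThan_Suc_atMost[symmetric] al_def)
    then have "0 = tp (int (d * s)) * (\<Sum>i\<le>d. al i * (N ^^ i) y b)" by simp
    also have "\<dots> = (\<Sum>i\<le>d. \<Sum>j\<le>d. al i * tp (int (d * s)) * e i j * (N' ^^ j) y b)"
    proof -
      have "tp (int (d * s)) * (al i * (N ^^ i) y b) = (\<Sum>j\<le>d. al i * tp (int (d * s)) * e i j * (N' ^^ j) y b)"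
        if "i \<le> d" for i
      proof -
        have "(N ^^ i) y b = (\<Sum>j\<le>d. e i j * (N' ^^ j) y b)"
          unfolding E by (rule sum.mono_neutral_left) (use that in \<open>auto simp: e_def cf_above\<close>)
        then show ?thesis by (simp add: sum_distrib_left mult_ac)
      qed
      then show ?thesis by (simp add: sum_distrib_left)
    qed
    also have "\<dots> = (\<Sum>j\<le>d. \<Sum>i\<le>d. al i * tp (int (d * s)) * e i j * (N' ^^ j) y b)"
      by (rule sum.swap)
    also have "\<dots> = (\<Sum>j\<le>d. B j * (N' ^^ j) y b)"
      by (simp only: B_def sum_distrib_right)
    finally show ?thesis by simp
  qed
  define L where "L = (\<Sum>j\<le>d. monom (fls_regpart (B j)) j)"
  have cL: "coeff L j = (if j \<le> d then fls_regpart (B j) else 0)" for j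
    by (simp add: L_def coeff_sum if_distrib cong: if_cong)
  have dL: "degree L = d"
    by (rule antisym, rule degree_le, simp add: cL, rule le_degree, simp add: cL B_d)
  have "op_act L y = (\<lambda>b. 0)"
    by (simp add: op_act_def dL cL rel0 fps_of_vge[OF B_int])
  moreover have "coeff (slice 0 L) j = - fls_nth (a j * tp (int ((d - j) * s))) 0" if "s > 0" "j < d" for j
  proof -
    have "coeff (slice 0 L) j = fls_nth (B j) 0" using that by (simp add: cL)
    also have "\<dots> = (\<Sum>i\<in>{..d}. fls_nth (al i * tp (int (d * s)) * e i j) 0)"
      by (simp add: B_def fls_nth_sum)
    also have "\<dots> = (\<Sum>i\<in>{j}. fls_nth (al i * tp (int (d * s)) * e i j) 0)"
    proof (rule sum.mono_neutral_right)
      show "\<forall>i\<in>{..d} - {j}. fls_nth (al i * tp (int (d * s)) * e i j) 0 = 0"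
      proof
        fix i assume "i \<in> {..d} - {j}"
        then consider "i < j" | "j < i" "i \<le> d" by force
        then show "fls_nth (al i * tp (int (d * s)) * e i j) 0 = 0"
        proof cases
          case 1 then show ?thesis by (simp add: e_def cf_above)
        next
          case 2
          then have "0 < int ((i - j) * s)" using that by simp
          then show ?thesis using term_int[of i j] 2 unfolding vge_def by blast
        qed
      qed
    qed (use that in auto)
    also have "\<dots> = fls_nth (al j * tp (int ((d - j) * s))) 0"
    proof -
      have t: "al j * tp (int (d * s)) * e j j = al j * tp (int ((d - j) * s))"
        unfolding term_eq[OF less_imp_le[OF that(2)]] by (simp only: e_top tp_inv mult_1_right)
      show ?thesis by (simp only: t sum.insert[OF finite.emptyI] empty_iff not_False_eq_True sum.empty add_0_right)
    qed
    finally show ?thesis using that by (simp add: al_def)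
  qed
  ultimately show ?thesis using that dL by (simp add: cL B_d)
qed

lemma coprime_linear_power:
  fixes R :: "complex poly"
  assumes "poly R a \<noteq> 0"
  shows "coprime ([:- a, 1:] ^ e) R"
proof -
  have "coprime [:- a, 1:] R"
    by (rule prime_elem_imp_coprime) (use assms in \<open>auto simp: prime_elem_linear_field_poly poly_eq_0_iff_dvd\<close>)
  then show ?thesis by simp
qed

text \<open>Roots that differ by positive integers are resonant. Below a root of least real part
  there is none, which is the coprimality that \<open>skew_hensel\<close> needs for s = 0.\<close>

lemma min_Re_root:
  assumes "degree (F :: complex poly) > 0"
  obtains c where "poly F c = 0" "\<And>k. k \<ge> 1 \<Longrightarrow> poly F (c - of_nat k) \<noteq> 0"
proof -
  let ?S = "{z. poly F z = 0}"
  have "F \<noteq> 0" using assms by auto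
  then have fin: "finite ?S" by (rule poly_roots_finite)
  have ne: "?S \<noteq> {}" using assms fundamental_theorem_of_algebra[of F] constant_degree[of F] by auto
  define c where "c = arg_min_on Re ?S"
  have c: "c \<in> ?S" "\<not> (\<exists>x\<in>?S. Re x < Re c)"
    using arg_min_if_finite[OF fin ne, of Re] by (simp_all add: c_def)
  show ?thesis
  proof (rule that)
    show "poly F c = 0" using c by simp
    fix k :: nat assume k: "k \<ge> 1"
    show "poly F (c - of_nat k) \<noteq> 0"
    proof
      assume "poly F (c - of_nat k) = 0"
      then have "\<not> Re (c - of_nat k) < Re c" using c(2) by blast
      then show False using k by simp
    qed
  qed
qed


text \<open>Factor L as u v. If v annihilates y, then y satisfies a shorter relation; otherwise v y
  is non-zero and annihilated by u. At slope 0 the factor u is linear, so the second case is an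
  eigenvector; at positive slope both factors have lower order. The conclusion Q is abstract and
  stands for the goal of the induction that calls this step.\<close>

lemma split_by_slope:
  fixes Q :: bool
  defines "N' \<equiv> \<lambda>s n c A y b. fls_X ^ s * nab n c A y b"
  assumes L: "skew_op.op_act (N' s n c A) L y = (\<lambda>b. 0)" "lead_coeff L = 1" "degree L = d" and d: "d > 0"
    and y: "y \<noteq> (\<lambda>i. 0)" "\<And>i. i \<ge> n \<Longrightarrow> y i = 0"
    and slope: "s > 0 \<Longrightarrow> coeff (slice 0 L) (d - 1) = 0 \<and> (\<exists>j<d. coeff (slice 0 L) j \<noteq> 0)"
    and IH: "\<And>e z. krel (nab n c A) e z \<Longrightarrow> z \<noteq> (\<lambda>i. 0) \<Longrightarrow> (\<And>i. i \<ge> n \<Longrightarrow> z i = 0) \<Longrightarrow> e < d \<Longrightarrow> Q"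
    and eigen: "\<And>z lam. z \<noteq> (\<lambda>i. 0) \<Longrightarrow> (\<And>i. i \<ge> n \<Longrightarrow> z i = 0) \<Longrightarrow> nab n c A z = (\<lambda>b. lam * z b) \<Longrightarrow> Q"
  shows Q
proof -
  let ?N = "nab n c A"
  interpret N': skew_op "fls_X ^ s" "N' s n c A" unfolding N'_def by (rule skew_op_scaled_nab)
  interpret N2: skew_op 1 ?N by (rule skew_op_nab)
  define F where "F = slice 0 L"
  have Fd: "coeff F d = 1" using L by (simp add: F_def)
  have degF: "degree F = d"
    using degree_slice_le[of 0 L] Fd L(3) by (intro antisym le_degree) (auto simp: F_def)
  have krel_N2: "krel ?N e z" if "krel (N' s n c A) e z" for e z
    by (rule N2.krel_change[where k = "fls_X ^ s" and g = 0, OF _ _ that]) (auto simp: N'_def)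
  have supp: "N'.op_act M z i = 0" if "\<And>i. i \<ge> n \<Longrightarrow> z i = 0" "i \<ge> n" for M z i
  proof -
    have "(N' s n c A ^^ k) z i = 0" for k
      unfolding N'_def by (rule nab_supp) (use that in auto)
    then show ?thesis by (simp add: N'.op_act_def)
  qed
  show Q
  proof (cases "s = 0")
    case True
    obtain r where r: "poly F r = 0" "\<And>k. k \<ge> 1 \<Longrightarrow> poly F (r - of_nat k) \<noteq> 0"
      using min_Re_root[of F] degF d by auto
    then obtain R where R: "F = [:- r, 1:] * R" by (auto simp: poly_eq_0_iff_dvd elim: dvdE)
    have "lead_coeff F = 1" by (simp add: degF Fd)
    moreover have "lead_coeff F = lead_coeff [:- r, 1:] * lead_coeff R" by (simp only: R lead_coeff_mult)
    ultimately have lR: "lead_coeff R = 1" by simp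
    have cop: "coprime (pcompose [:- r, 1:] (shift_poly s k)) R" if "k \<ge> 1" for k
    proof -
      have "pcompose [:- r, 1:] (shift_poly s k) = [:- (r - of_nat k), 1:]"
        by (simp add: True shift_poly_def pcompose_pCons)
      moreover have "poly R (r - of_nat k) \<noteq> 0" using r(2)[OF that] by (auto simp: R)
      ultimately show ?thesis using coprime_linear_power[of R "r - of_nat k" 1] by simp
    qed
    have P1: "lead_coeff [:- r, 1:] = 1" "degree [:- r, 1:] > 0" by simp_all
    obtain u v where uv: "star s u v = L" "degree u = degree [:- r, 1:]" "lead_coeff u = 1"
        "degree v = degree R" "lead_coeff v = 1"
      by (rule skew_hensel[OF L(2) R[unfolded F_def] P1(1) lR P1(2) cop])
    define z where "z = N'.op_act v y"
    have z: "N'.op_act u z = (\<lambda>b. 0)"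
      using L(1) by (simp add: z_def N'.op_act_star[OF refl, symmetric] uv)
    have zs: "\<And>i. i \<ge> n \<Longrightarrow> z i = 0" unfolding z_def by (rule supp[OF y(2)])
    show Q
    proof (cases "z = (\<lambda>b. 0)")
      case z0: True
      have "R \<noteq> 0" using lR by auto
      then have "degree R < d" using degree_mult_eq[of "[:- r, 1:]" R] by (simp only: degF[symmetric] R) simp
      then show Q using IH[OF krel_N2[OF N'.krel_of_op_act[OF z0[unfolded z_def] uv(5)]]] y uv(4) by simp
    next
      case False
      have "fps_to_fls (coeff u 0) * z b + N' s n c A z b = 0" for b
        using fun_cong[OF z, of b] uv(2,3) by (simp add: N'.op_act_def)
      then have "?N z = (\<lambda>b. (- fps_to_fls (coeff u 0)) * z b)"
        by (auto simp: N'_def True fun_eq_iff eq_neg_iff_add_eq_0 add.commute)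
      then show Q using eigen False zs by blast
      qed
  next
    case False
    then obtain j where j: "j < d" "coeff F j \<noteq> 0" and F1: "coeff F (d - 1) = 0"
      using slope by (auto simp: F_def)
    have "F \<noteq> 0" using Fd by auto
    obtain r where r: "poly F r = 0" using min_Re_root[of F] degF d by auto
    obtain R where R: "F = [:- r, 1:] ^ order r F * R" "\<not> [:- r, 1:] dvd R"
      using order_decomp[OF \<open>F \<noteq> 0\<close>] by blast
    define e where "e = order r F"
    have e: "e > 0" using r \<open>F \<noteq> 0\<close> by (simp add: e_def order_gt_0_iff)
    have lF: "lead_coeff F = 1" by (simp add: degF Fd)
    have Re: "F = [:- r, 1:] ^ e * R" using R(1) by (simp only: e_def)
    have "lead_coeff F = lead_coeff ([:- r, 1:] ^ e) * lead_coeff R"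
      unfolding Re by (rule lead_coeff_mult)
    then have lR: "lead_coeff R = 1" using lF by (simp add: lead_coeff_power)
    then have "R \<noteq> 0" by auto
    have "degree F = degree ([:- r, 1:] ^ e) + degree R"
      unfolding Re by (rule degree_mult_eq) (use \<open>R \<noteq> 0\<close> in auto)
    then have dR: "e + degree R = d" using degF by (simp add: degree_power_eq)
    \<comment> \<open>Otherwise F is the d-th power of X - r. Its coefficient at d - 1 vanishes, so
      r = 0 and F is X^d, although some lower coefficient is non-zero.\<close>
    have "degree R > 0"
    proof (rule ccontr)
      assume "\<not> degree R > 0"
      then have "R = 1" using lR by (metis degree_0_id gr0I one_pCons of_nat_0 degree_eq_zeroE lead_coeff_pCons(2) pCons_0_0 coeff_pCons_0)
      then have FF: "F = [:- r, 1:] ^ d" using R dR by (simp add: e_def)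
      have "of_nat (d choose (d - 1)) * (- r) = 0"
        using F1 d by (simp add: FF coeff_linear_poly_power)
      then have "r = 0" using d by (auto simp: binomial_eq_0_iff)
      then have "coeff F j = 0" using j(1) by (simp add: FF coeff_linear_poly_power)
      then show False using j(2) by simp
    qed
    have cop: "coprime (pcompose ([:- r, 1:] ^ e) (shift_poly s k)) R" for k
      using coprime_linear_power[of R r e] R(2) False
      by (simp add: shift_poly_def pcompose_idR poly_eq_0_iff_dvd)
    have P1: "lead_coeff ([:- r, 1:] ^ e) = 1" "degree ([:- r, 1:] ^ e) > 0"
      using e by (simp_all only: lead_coeff_power degree_power_eq) (simp_all add: degree_power_eq)
    obtain u v where uv: "star s u v = L" "degree u = degree ([:- r, 1:] ^ e)" "lead_coeff u = 1"
        "degree v = degree R" "lead_coeff v = 1"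
      by (rule skew_hensel[OF L(2) R(1)[folded e_def, unfolded F_def] P1(1) lR P1(2) cop])
    have de: "degree u = e" using uv(2) by (simp add: degree_power_eq)
    define z where "z = N'.op_act v y"
    have z: "N'.op_act u z = (\<lambda>b. 0)"
      using L(1) by (simp add: z_def N'.op_act_star[OF refl, symmetric] uv)
    have zs: "\<And>i. i \<ge> n \<Longrightarrow> z i = 0" unfolding z_def by (rule supp[OF y(2)])
    show Q
    proof (cases "z = (\<lambda>b. 0)")
      case z0: True
      show Q using IH[OF krel_N2[OF N'.krel_of_op_act[OF z0[unfolded z_def] uv(5)]]] y uv(4) dR e by simp
    next
      case False
      show Q using IH[OF krel_N2[OF N'.krel_of_op_act[OF z uv(3)]] False zs] de dR \<open>degree R > 0\<close> by simp
    qed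
  qed
qed

text \<open>The relation is normalized before it is factored. A twist by the scalar g removes the
  coefficient of order d - 1, so that at a positive slope the leading polynomial has two different
  roots, and ramification of degree d! makes the slope integral. The scalar c of \<open>nab\<close>
  records the twists made in the induction.\<close>

lemma eigenvector_of_krel:
  assumes "krel (nab n c A) d y" "y \<noteq> (\<lambda>i. 0)" "\<And>i. i \<ge> n \<Longrightarrow> y i = 0"
  shows "\<exists>m lam w. m > 0 \<and> w \<noteq> (\<lambda>i. 0) \<and> (\<forall>i\<ge>n. w i = 0) \<and>
           nab n (rams m c) (\<lambda>i j. rams m (A i j)) w = (\<lambda>i. lam * w i)"
  using assms
proof (induction d arbitrary: c A y rule: less_induct)
  case (less d)
  from less.prems(1) obtain a where a: "(nab n c A ^^ d) y = (\<lambda>b. \<Sum>j<d. a j * (nab n c A ^^ j) y b)"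
    by (auto simp: krel_def)
  have d: "d > 0" using a less.prems(2) by (cases d) auto
  define g where "g = a (d - 1) / of_nat d"
  interpret N1: skew_op 1 "nab n (c - g) A" by (rule skew_op_nab)
  have N_N1: "nab n c A y = (\<lambda>b. 1 * nab n (c - g) A y b + g * y b)" for y
    by (simp add: nab_def algebra_simps fun_eq_iff)
  define a1 where "a1 j = (\<Sum>i<d. a i * N1.cf 1 g i j) - N1.cf 1 g d j" for j
  have rel1: "(nab n (c - g) A ^^ d) y = (\<lambda>b. \<Sum>j<d. a1 j * (nab n (c - g) A ^^ j) y b)"
    using N1.relation_change[OF N_N1 _ a] by (simp add: a1_def)
  have a1_0: "a1 (d - 1) = 0"
  proof -
    have "(\<Sum>i<d. a i * N1.cf 1 g i (d - 1)) = (\<Sum>i\<in>{d - 1}. a i * N1.cf 1 g i (d - 1))"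
      using d by (intro sum.mono_neutral_right) (auto simp: N1.cf_above)
    moreover have "N1.cf 1 g d (d - 1) = of_nat d * g" using N1.cf_subdiag[of g "d - 1"] d by simp
    ultimately show ?thesis using d by (simp add: a1_def N1.cf_diag g_def)
  qed
  define m0 :: nat where "m0 = fact d"
  have m0: "m0 > 0" by (simp add: m0_def)
  define c2 where "c2 = rams m0 (c - g)"
  define A2 where "A2 = (\<lambda>i j. rams m0 (A i j))"
  define y2 where "y2 = (\<lambda>i. ram m0 (y i))"
  define N2 where "N2 = nab n c2 A2"
  define a2 where "a2 j = of_nat m0 ^ (d - j) * ram m0 (a1 j)" for j
  have y2: "y2 \<noteq> (\<lambda>i. 0)" "\<And>i. i \<ge> n \<Longrightarrow> y2 i = 0"
    using less.prems(2,3) m0 by (auto simp: y2_def fun_eq_iff)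
  have pow2: "(N2 ^^ k) y2 = (\<lambda>i. of_nat m0 ^ k * ram m0 ((nab n (c - g) A ^^ k) y i))" for k
    using nab_ram_power[OF m0] by (simp add: N2_def c2_def A2_def y2_def)
  have rel2: "(N2 ^^ d) y2 = (\<lambda>b. \<Sum>j<d. a2 j * (N2 ^^ j) y2 b)"
  proof
    fix b
    have "a2 j * (N2 ^^ j) y2 b = of_nat m0 ^ d * (ram m0 (a1 j) * ram m0 ((nab n (c - g) A ^^ j) y b))"
      if "j < d" for j
      using that by (simp add: a2_def pow2 mult_ac flip: power_add)
    then have "(\<Sum>j<d. a2 j * (N2 ^^ j) y2 b) =
        of_nat m0 ^ d * (\<Sum>j<d. ram m0 (a1 j) * ram m0 ((nab n (c - g) A ^^ j) y b))"
      by (simp add: sum_distrib_left)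
    then show "(N2 ^^ d) y2 b = (\<Sum>j<d. a2 j * (N2 ^^ j) y2 b)"
      using m0 by (simp add: pow2 rel1 ram_sum ram_mult)
  qed
  define Q where "Q \<longleftrightarrow> (\<exists>m lam w. m > 0 \<and> w \<noteq> (\<lambda>i. 0) \<and> (\<forall>i\<ge>n. w i = 0) \<and>
           nab n (rams m c2) (\<lambda>i j. rams m (A2 i j)) w = (\<lambda>i. lam * w i))"
  have IH: Q if "krel N2 e z" "z \<noteq> (\<lambda>i. 0)" "\<And>i. i \<ge> n \<Longrightarrow> z i = 0" "e < d" for e z
    unfolding Q_def using less.IH[OF that(4) that(1)[unfolded N2_def] that(2,3)] .
  have Q
  proof -
    define J where "J = {j. j < d \<and> a1 j \<noteq> 0}"
    have "J \<subseteq> {..<d}" by (auto simp: J_def)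
    then obtain s where s: "\<And>j. j \<in> J \<Longrightarrow> fact d * fls_subdegree (a1 j) + int ((d - j) * s) \<ge> 0"
      "s > 0 \<Longrightarrow> \<exists>j\<in>J. fact d * fls_subdegree (a1 j) + int ((d - j) * s) = 0"
      using slope_exists[of J d "\<lambda>j. fls_subdegree (a1 j)"] by metis
    have m0f: "int m0 = fact d" by (simp add: m0_def)
    have a2_int: "vge 0 (a2 j * tp (int ((d - j) * s)))" if "j < d" for j
    proof (cases "j \<in> J")
      case True
      have "vge (int m0 * fls_subdegree (a1 j)) (ram m0 (a1 j))"
        using m0 by (simp add: vge_ram) (simp add: vge_iff)
      then have "vge (0 + int m0 * fls_subdegree (a1 j)) (a2 j)"
        unfolding a2_def by (intro vge_mult vge_power) auto
      then have "vge (int m0 * fls_subdegree (a1 j) + int ((d - j) * s)) (a2 j * tp (int ((d - j) * s)))"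
        by (intro vge_mult) auto
      then show ?thesis using s(1)[OF True] by (auto simp: m0f intro: vge_mono)
    next
      case False
      then show ?thesis using that by (simp add: J_def a2_def)
    qed
    define N' where "N' = (\<lambda>y b. fls_X ^ s * N2 y b)"
    have sk: "skew_op (fls_X ^ s) N'" unfolding N'_def N2_def by (rule skew_op_scaled_nab)
    interpret N': skew_op "fls_X ^ s" N' by (rule sk)
    have N'_N2: "N' y = (\<lambda>b. fls_X ^ s * N2 y b)" for y by (simp add: N'_def)
    obtain L where L: "N'.op_act L y2 = (\<lambda>b. 0)" "lead_coeff L = 1" "degree L = d"
      and L0: "s > 0 \<longrightarrow> (\<forall>j<d. coeff (slice 0 L) j = - fls_nth (a2 j * tp (int ((d - j) * s))) 0)"
      by (rule integral_relation[OF sk N'_N2 rel2 a2_int])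
    have slope: "coeff (slice 0 L) (d - 1) = 0 \<and> (\<exists>j<d. coeff (slice 0 L) j \<noteq> 0)" if spos: "s > 0"
    proof
      show "coeff (slice 0 L) (d - 1) = 0"
        using L0 spos d by (simp add: a2_def a1_0[unfolded One_nat_def])
      obtain j where j: "j \<in> J" "fact d * fls_subdegree (a1 j) + int ((d - j) * s) = 0"
        using s(2)[OF spos] by auto
      have sj: "- int ((d - j) * s) = int m0 * fls_subdegree (a1 j)" using j(2) m0f by (metis eq_neg_iff_add_eq_0)
      have "coeff (slice 0 L) j = - fls_nth (a2 j) (int m0 * fls_subdegree (a1 j))"
        using L0 spos j(1) by (simp add: J_def sj[symmetric])
      also have "\<dots> = - (of_nat m0 ^ (d - j) * fls_nth (a1 j) (fls_subdegree (a1 j)))"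
        using m0 by (simp add: a2_def nth_ram flip: of_nat_power)
      finally show "\<exists>j<d. coeff (slice 0 L) j \<noteq> 0" using j(1) m0 by (auto simp: J_def)
    qed
    have act: "skew_op.op_act (\<lambda>y b. fls_X ^ s * nab n c2 A2 y b) L y2 = (\<lambda>b. 0)"
      using L(1) by (simp only: N'_def N2_def)
    show Q
    proof (rule split_by_slope[OF act L(2,3) d y2 slope])
      fix e z assume "krel (nab n c2 A2) e z" "z \<noteq> (\<lambda>i. 0)" "\<And>i. i \<ge> n \<Longrightarrow> z i = 0" "e < d"
      then show Q by (rule IH[unfolded N2_def])
    next
      fix z lam assume "z \<noteq> (\<lambda>i. 0)" "\<And>i. i \<ge> n \<Longrightarrow> z i = 0" "nab n c2 A2 z = (\<lambda>b. lam * z b)"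
      then show Q unfolding Q_def
        by (intro exI[of _ 1] exI[of _ lam] exI[of _ z]) (auto simp: rams_def ram_by_1[unfolded One_nat_def])
    qed
  qed
  then obtain m lam w where w: "m > 0" "w \<noteq> (\<lambda>i. 0)" "\<forall>i\<ge>n. w i = 0"
    "nab n (rams m c2) (\<lambda>i j. rams m (A2 i j)) w = (\<lambda>i. lam * w i)" unfolding Q_def by blast
  \<comment> \<open>Undoing the twist by g only shifts the eigenvalue.\<close>
  have "nab n (rams (m0 * m) c) (\<lambda>i j. rams (m0 * m) (A i j)) w = (\<lambda>i. (lam + rams (m0 * m) g) * w i)"
  proof
    fix i
    have "rams (m0 * m) c = rams (m0 * m) (c - g) + rams (m0 * m) g"
      by (simp add: rams_def ram_diff algebra_simps)
    then show "nab n (rams (m0 * m) c) (\<lambda>i j. rams (m0 * m) (A i j)) w i = (lam + rams (m0 * m) g) * w i"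
      using fun_cong[OF w(4), of i] m0 w(1)
      by (simp add: c2_def A2_def rams_rams nab_def algebra_simps)
  qed
  then show ?case using w m0 by (intro exI[of _ "m0 * m"] exI[of _ "lam + rams (m0 * m) g"] exI[of _ w]) auto
qed

text \<open>The square matrix of size n + 1 with columns y, ..., N^n y has a zero last row and is
  singular; d is the last index with a non-zero coefficient in a dependence of the columns.\<close>

lemma krel_exists:
  assumes supp: "\<And>k i. i \<ge> n \<Longrightarrow> (N ^^ k) y i = 0"
  shows "\<exists>d. krel N d y"
proof -
  define M where "M = mat (Suc n) (Suc n) (\<lambda>(i, j). (N ^^ j) y i)"
  have M: "M \<in> carrier_mat (Suc n) (Suc n)" by (simp add: M_def)
  have "transpose_mat M *\<^sub>v unit_vec (Suc n) n = 0\<^sub>v (Suc n)"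
    by (rule eq_vecI) (auto simp: M_def supp)
  moreover have "unit_vec (Suc n) n \<noteq> (0\<^sub>v (Suc n) :: complex fls vec)"
    by (metis index_unit_vec(2) index_zero_vec(1) lessI zero_neq_one)
  ultimately have "det (transpose_mat M) = 0"
    using det_0_iff_vec_prod_zero_field[of "transpose_mat M" "Suc n"] M
    by (metis transpose_carrier_mat unit_vec_carrier)
  then have "det M = 0" using det_transpose[OF M] by simp
  then obtain v where v: "v \<in> carrier_vec (Suc n)" "v \<noteq> 0\<^sub>v (Suc n)" "M *\<^sub>v v = 0\<^sub>v (Suc n)"
    using det_0_iff_vec_prod_zero_field[OF M] by blast
  define J where "J = {j. j \<le> n \<and> vec_index v j \<noteq> 0}"
  have "J \<noteq> {}"
  proof
    assume "J = {}"
    then have "v = 0\<^sub>v (Suc n)" using v(1) by (intro eq_vecI) (auto simp: J_def less_Suc_eq_le)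
    then show False using v(2) by simp
  qed
  moreover have fJ: "finite J" by (auto simp: J_def)
  ultimately have dJ: "Max J \<in> J" by (rule Max_in[rotated])
  define d where "d = Max J"
  have vd: "vec_index v d \<noteq> 0" "d \<le> n" using dJ by (auto simp: J_def d_def)
  have above: "vec_index v j = 0" if "d < j" "j \<le> n" for j
  proof -
    have "j \<notin> J" using Max_ge[OF fJ, of j] that by (auto simp: d_def)
    then show ?thesis using that by (simp add: J_def)
  qed
  have "(\<Sum>j\<le>d. vec_index v j * (N ^^ j) y i) = 0" for i
  proof (cases "i \<le> n")
    case True
    have "0 = vec_index (M *\<^sub>v v) i" using v True by simp
    also have "\<dots> = (\<Sum>j\<le>n. (N ^^ j) y i * vec_index v j)"
      using True v(1) by (simp add: M_def scalar_prod_def lessThan_Suc_atMost atLeast0LessThan del: sum.lessThan_Suc sum.op_ivl_Suc)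
    also have "\<dots> = (\<Sum>j\<le>d. (N ^^ j) y i * vec_index v j)"
      by (rule sum.mono_neutral_right) (use above vd in auto)
    finally show ?thesis by (simp add: mult.commute)
  next
    case False
    then show ?thesis by (simp add: supp)
  qed
  then have "vec_index v d * (N ^^ d) y i = - (\<Sum>j<d. vec_index v j * (N ^^ j) y i)" for i
    by (simp add: lessThan_Suc_atMost[symmetric] eq_neg_iff_add_eq_0 add.commute)
  moreover have "(\<Sum>j<d. (- vec_index v j / vec_index v d) * (N ^^ j) y i)
      = - (\<Sum>j<d. vec_index v j * (N ^^ j) y i) / vec_index v d" for i
    by (simp add: sum_negf sum_divide_distrib)
  moreover have "(N ^^ d) y i = (vec_index v d * (N ^^ d) y i) / vec_index v d" for i
    using vd(1) by simp
  ultimately have "(N ^^ d) y i = (\<Sum>j<d. (- vec_index v j / vec_index v d) * (N ^^ j) y i)" for i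
    by (simp only:)
  then show ?thesis unfolding krel_def by (intro exI[of _ d] exI[of _ "\<lambda>j. - vec_index v j / vec_index v d"]) auto
qed

text \<open>w spans a line stable under the connection theta + A. Rescaling w by a series f changes
  lam by the logarithmic derivative of f, so only the polar part of lam is intrinsic.\<close>

definition eigv :: "nat \<Rightarrow> complex fls mat \<Rightarrow> complex fls \<Rightarrow> fvec \<Rightarrow> bool" where
  "eigv n A lam w \<longleftrightarrow> (\<exists>i<n. w i \<noteq> 0) \<and>
     (\<forall>i<n. theta (w i) + (\<Sum>j<n. A $$ (i, j) * w j) = lam * w i)"

abbreviation ramm :: "nat \<Rightarrow> complex fls mat \<Rightarrow> complex fls mat" where
  "ramm m A \<equiv> map_mat (rams m) A"

lemma eigenvector_exists:
  assumes A: "A \<in> carrier_mat n n" and n: "n > 0"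
  shows "\<exists>m lam w. m > 0 \<and> eigv n (ramm m A) lam w"
proof -
  let ?A = "\<lambda>i j. A $$ (i, j)"
  define y :: fvec where "y i = (if i = 0 then 1 else 0)" for i
  have supp: "(nab n 0 ?A ^^ k) y i = 0" if "i \<ge> n" for k i
    using nab_supp[where h = 1 and y = y and k = k and n = n and c = 0 and A = ?A and i = i] that n
    by (simp add: y_def)
  obtain d where "krel (nab n 0 ?A) d y" using krel_exists[OF supp] by blast
  moreover have "y \<noteq> (\<lambda>i. 0)" by (auto simp: y_def fun_eq_iff)
  moreover have "\<And>i. i \<ge> n \<Longrightarrow> y i = 0" using n by (auto simp: y_def)
  ultimately obtain m lam w where w: "m > 0" "w \<noteq> (\<lambda>i. 0)" "\<forall>i\<ge>n. w i = 0"
    "nab n (rams m 0) (\<lambda>i j. rams m (?A i j)) w = (\<lambda>i. lam * w i)"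
    using eigenvector_of_krel[of n 0 ?A d y] by metis
  have "\<exists>i<n. w i \<noteq> 0" using w(2,3) by (metis ext not_less)
  moreover have "theta (w i) + (\<Sum>j<n. ramm m A $$ (i, j) * w j) = lam * w i" if "i < n" for i
    using fun_cong[OF w(4), of i] that A by (simp add: nab_def rams_def)
  ultimately show ?thesis using w(1) unfolding eigv_def by blast
qed

section \<open>Changes of frame\<close>

definition inv_pair :: "nat \<Rightarrow> 'a::field mat \<Rightarrow> 'a mat \<Rightarrow> bool" where
  "inv_pair n T S \<longleftrightarrow> T \<in> carrier_mat n n \<and> S \<in> carrier_mat n n \<and> T * S = 1\<^sub>m n \<and> S * T = 1\<^sub>m n"

definition derivation :: "('a::field \<Rightarrow> 'a) \<Rightarrow> bool" where
  "derivation D \<longleftrightarrow> (\<forall>x y. D (x + y) = D x + D y) \<and> (\<forall>x y. D (x * y) = D x * y + x * D y)"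

text \<open>In the frame given by the columns of T the connection D + A has the matrix B; the
  equation is written without the inverse of T.\<close>

definition gauges :: "('a::field \<Rightarrow> 'a) \<Rightarrow> nat \<Rightarrow> 'a mat \<Rightarrow> 'a mat \<Rightarrow> 'a mat \<Rightarrow> bool" where
  "gauges D n A T B \<longleftrightarrow> A \<in> carrier_mat n n \<and> T \<in> carrier_mat n n \<and> B \<in> carrier_mat n n \<and>
     A * T + map_mat D T = T * B"

lemma inv_pair_sym: "inv_pair n T S \<Longrightarrow> inv_pair n S T"
  by (auto simp: inv_pair_def)

lemma inv_pair_cancel:
  assumes "inv_pair n T S" "X \<in> carrier_mat n m"
  shows "T * (S * X) = X"
proof -
  have "T * (S * X) = (T * S) * X"
    by (rule assoc_mult_mat[symmetric]) (use assms in \<open>auto simp: inv_pair_def\<close>)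
  then show ?thesis using assms by (simp add: inv_pair_def)
qed

lemma inv_pair_one: "inv_pair n (1\<^sub>m n) (1\<^sub>m n)" by (simp add: inv_pair_def)

lemma inv_pair_mult:
  assumes "inv_pair n T S" "inv_pair n T' S'"
  shows "inv_pair n (T * T') (S' * S)"
proof -
  have c: "T \<in> carrier_mat n n" "S \<in> carrier_mat n n" "T' \<in> carrier_mat n n" "S' \<in> carrier_mat n n"
    using assms by (auto simp: inv_pair_def)
  have "(T * T') * (S' * S) = T * (T' * (S' * S))" "(S' * S) * (T * T') = S' * (S * (T * T'))"
    using c by (auto intro!: assoc_mult_mat)
  then show ?thesis using assms c
    by (simp add: inv_pair_def inv_pair_cancel[OF assms(2)] inv_pair_cancel[OF inv_pair_sym[OF assms(1)]])
qed

lemma inv_pair_of_det: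
  assumes "T \<in> carrier_mat n n" "det T \<noteq> (0 :: 'a::field)"
  obtains S where "inv_pair n T S"
proof -
  have "T \<in> Units (ring_mat TYPE('a) n ())" by (rule det_non_zero_imp_unit[OF assms])
  then show ?thesis using that assms(1) by (auto simp: Units_def ring_mat_def inv_pair_def)
qed

lemma inv_pair_det: "inv_pair n T S \<Longrightarrow> det T * det S = 1"
  unfolding inv_pair_def by (metis det_mult det_one)

lemma derivation_0: "derivation D \<Longrightarrow> D 0 = 0"
  unfolding derivation_def by (metis add_cancel_right_right)

lemma derivation_1: "derivation D \<Longrightarrow> D 1 = 0"
  unfolding derivation_def by (metis add_cancel_right_right mult.right_neutral mult.left_neutral)

lemma derivation_sum: "derivation D \<Longrightarrow> D (\<Sum>i\<in>S. f i) = (\<Sum>i\<in>S. D (f i))"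
  by (induction S rule: infinite_finite_induct) (auto simp: derivation_0 derivation_def)

lemma derivation_theta: "derivation theta"
  by (simp add: derivation_def theta_add theta_mult)

lemma map_mat_derivation_mult:
  assumes "derivation D" "A \<in> carrier_mat n n" "B \<in> carrier_mat n n"
  shows "map_mat D (A * B) = map_mat D A * B + A * map_mat D B"
  by (rule eq_matI) (use assms in \<open>auto simp: scalar_prod_def derivation_sum sum.distrib
      simp del: sum.op_ivl_Suc, auto simp: derivation_def sum.distrib\<close>)

lemma map_mat_derivation_one: "derivation D \<Longrightarrow> map_mat D (1\<^sub>m n) = 0\<^sub>m n n"
  by (rule eq_matI) (auto simp: derivation_0 derivation_1 one_mat_def)

lemma gauges_trans:
  assumes D: "derivation D" and 1: "gauges D n A T B" and 2: "gauges D n B S C"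
  shows "gauges D n A (T * S) C"
proof -
  have c: "A \<in> carrier_mat n n" "T \<in> carrier_mat n n" "B \<in> carrier_mat n n" "S \<in> carrier_mat n n" "C \<in> carrier_mat n n"
    "map_mat D T \<in> carrier_mat n n" "map_mat D S \<in> carrier_mat n n"
    using 1 2 by (auto simp: gauges_def)
  have "A * (T * S) + map_mat D (T * S) = (A * T) * S + (map_mat D T * S + T * map_mat D S)"
    using c by (simp add: map_mat_derivation_mult[OF D c(2,4)] assoc_mult_mat[of _ n n _ n _ n])
  also have "\<dots> = (A * T + map_mat D T) * S + T * map_mat D S"
    using c by (simp add: add_mult_distrib_mat[of _ n n] assoc_add_mat[of _ n n])
  also have "A * T + map_mat D T = T * B" using 1 by (simp add: gauges_def)
  also have "T * B * S + T * map_mat D S = T * (B * S + map_mat D S)"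
    using c by (simp add: mult_add_distrib_mat[of _ n n _ n] assoc_mult_mat[of _ n n _ n _ n])
  also have "B * S + map_mat D S = S * C" using 2 by (simp add: gauges_def)
  finally show ?thesis using c by (simp add: gauges_def assoc_mult_mat[of _ n n _ n _ n])
qed

lemma gauges_exists:
  assumes "inv_pair n T S" "A \<in> carrier_mat n n"
  shows "gauges D n A T (S * (A * T + map_mat D T))"
proof -
  have "T * (S * (A * T + map_mat D T)) = A * T + map_mat D T"
    by (rule inv_pair_cancel[OF assms(1)]) (use assms in \<open>auto simp: inv_pair_def\<close>)
  then show ?thesis using assms by (auto simp: gauges_def inv_pair_def)
qed

lemma gauges_eq:
  assumes "inv_pair n T S" "gauges D n A T B"
  shows "B = S * (A * T + map_mat D T)"
proof -
  have "S * (A * T + map_mat D T) = S * (T * B)" using assms by (simp add: gauges_def)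
  also have "\<dots> = B"
    by (rule inv_pair_cancel[OF inv_pair_sym[OF assms(1)]]) (use assms in \<open>auto simp: gauges_def\<close>)
  finally show ?thesis by simp
qed

lemma gauges_inverse:
  assumes D: "derivation D" and i: "inv_pair n T S" and g: "gauges D n A T B"
  shows "gauges D n B S A"
proof -
  have c: "T \<in> carrier_mat n n" "S \<in> carrier_mat n n" "B \<in> carrier_mat n n" "A \<in> carrier_mat n n"
    using i g by (auto simp: inv_pair_def gauges_def)
  let ?C = "T * (B * S + map_mat D S)"
  have "gauges D n B S ?C" by (rule gauges_exists[OF inv_pair_sym[OF i] c(3)])
  from gauges_trans[OF D g this] have "gauges D n A (1\<^sub>m n) ?C" using i by (simp add: inv_pair_def)
  then have "A = ?C" using c by (simp add: gauges_def map_mat_derivation_one[OF D])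
  then show ?thesis using \<open>gauges D n B S ?C\<close> by simp
qed

definition mapp :: "nat \<Rightarrow> 'a::comm_ring_1 mat \<Rightarrow> (nat \<Rightarrow> 'a) \<Rightarrow> nat \<Rightarrow> 'a" where
  "mapp n T z i = (\<Sum>j<n. T $$ (i, j) * z j)"

lemma mapp_cong: "(\<And>j. j < n \<Longrightarrow> z j = z' j) \<Longrightarrow> mapp n T z i = mapp n T z' i"
  by (simp add: mapp_def)

lemma mapp_mult:
  assumes "T \<in> carrier_mat n n" "S \<in> carrier_mat n n" "i < n"
  shows "mapp n T (mapp n S z) i = mapp n (T * S) z i"
proof -
  have "mapp n T (mapp n S z) i = (\<Sum>l<n. (\<Sum>j<n. T $$ (i, j) * S $$ (j, l)) * z l)"
    unfolding mapp_def sum_distrib_left sum_distrib_right mult.assoc by (rule sum.swap)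
  also have "\<dots> = mapp n (T * S) z i"
    unfolding mapp_def using assms by (intro sum.cong) (simp_all add: scalar_prod_def atLeast0LessThan)
  finally show ?thesis .
qed

lemma mapp_add_mat:
  "A \<in> carrier_mat n n \<Longrightarrow> B \<in> carrier_mat n n \<Longrightarrow> i < n \<Longrightarrow> mapp n (A + B) z i = mapp n A z i + mapp n B z i"
  by (simp add: mapp_def distrib_right sum.distrib)

lemma inv_pair_apply: "inv_pair n T S \<Longrightarrow> i < n \<Longrightarrow> mapp n T (mapp n S x) i = x i"
  by (simp add: inv_pair_def mapp_mult) (simp add: mapp_def one_mat_def if_distrib[of "\<lambda>x. x * _"] sum.delta' cong: if_cong)

lemma gauges_action:
  assumes g: "gauges theta n A T B" and i: "i < n"
  shows "theta (mapp n T z i) + mapp n A (mapp n T z) i = mapp n T (\<lambda>l. theta (z l) + mapp n B z l) i"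
proof -
  have c: "T \<in> carrier_mat n n" "B \<in> carrier_mat n n" "A \<in> carrier_mat n n" using g by (auto simp: gauges_def)
  have "theta (mapp n T z i) = mapp n (map_mat theta T) z i + mapp n T (\<lambda>l. theta (z l)) i"
    using c i by (simp add: mapp_def theta_sum theta_mult sum.distrib)
  then have "theta (mapp n T z i) + mapp n A (mapp n T z) i
      = mapp n (A * T + map_mat theta T) z i + mapp n T (\<lambda>l. theta (z l)) i"
    using c i by (simp add: mapp_mult mapp_add_mat)
  also have "A * T + map_mat theta T = T * B" using g by (simp add: gauges_def)
  also have "mapp n (T * B) z i = mapp n T (mapp n B z) i" using c i by (simp add: mapp_mult)
  finally show ?thesis by (simp add: mapp_def distrib_left sum.distrib)
qed

lemma eigv_mapp: "eigv n A lam w \<longleftrightarrow> (\<exists>i<n. w i \<noteq> 0) \<and> (\<forall>i<n. theta (w i) + mapp n A w i = lam * w i)"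
  by (simp add: eigv_def mapp_def)

lemma eigv_gauge:
  assumes g: "gauges theta n A T B" and i: "inv_pair n T S" and w: "eigv n B lam w"
  shows "eigv n A lam (mapp n T w)"
  unfolding eigv_mapp
proof (intro conjI allI impI)
  obtain i0 where i0: "i0 < n" "w i0 \<noteq> 0" using w by (auto simp: eigv_mapp)
  show "\<exists>i<n. mapp n T w i \<noteq> 0"
  proof (rule ccontr)
    assume "\<not> (\<exists>i<n. mapp n T w i \<noteq> 0)"
    then have "mapp n S (mapp n T w) i0 = 0" by (simp add: mapp_def[of n S])
    then show False using inv_pair_apply[OF inv_pair_sym[OF i] i0(1)] i0(2) by simp
  qed
  fix l assume l: "l < n"
  have "theta (mapp n T w l) + mapp n A (mapp n T w) l = mapp n T (\<lambda>l. lam * w l) l"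
    unfolding gauges_action[OF g l] by (rule mapp_cong) (use w in \<open>simp add: eigv_mapp\<close>)
  then show "theta (mapp n T w l) + mapp n A (mapp n T w) l = lam * mapp n T w l"
    by (simp add: mapp_def sum_distrib_left mult.left_commute)
qed

lemma map_mat_hom_mult:
  assumes "\<And>x y. f (x + y) = f x + f y" "\<And>x y. f (x * y) = f x * f y" "f 0 = 0"
    "A \<in> carrier_mat n m" "B \<in> carrier_mat m k"
  shows "map_mat f (A * B :: 'a::semiring_0 mat) = map_mat f A * (map_mat f B :: 'b::semiring_0 mat)"
proof -
  have "f (\<Sum>i\<in>S. g i) = (\<Sum>i\<in>S. f (g i))" for g and S :: "nat set"
    by (induction S rule: infinite_finite_induct) (auto simp: assms)
  then show ?thesis by (intro eq_matI) (use assms in \<open>auto simp: scalar_prod_def\<close>)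
qed

lemma map_mat_ram_mult:
  "m > 0 \<Longrightarrow> A \<in> carrier_mat n n \<Longrightarrow> B \<in> carrier_mat n n \<Longrightarrow>
    map_mat (ram m) (A * B) = map_mat (ram m) A * map_mat (ram m) B"
  by (rule map_mat_hom_mult) (auto simp: ram_add ram_mult)

lemma inv_pair_hom:
  assumes "\<And>x y. f (x + y) = f x + f y" "\<And>x y. f (x * y) = f x * f y" "f 0 = 0" "f 1 = 1" and i: "inv_pair n T S"
  shows "inv_pair n (map_mat f T) (map_mat f S)"
proof -
  have "map_mat f (1\<^sub>m n) = 1\<^sub>m n" by (rule eq_matI) (auto simp: assms(3,4))
  moreover have "map_mat f (T * S) = map_mat f T * map_mat f S" "map_mat f (S * T) = map_mat f S * map_mat f T"
    using i unfolding inv_pair_def by (blast intro: map_mat_hom_mult[OF assms(1-3), of _ n n _ n])+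
  ultimately show ?thesis using i by (auto simp: inv_pair_def)
qed

lemma inv_pair_ram: "m > 0 \<Longrightarrow> inv_pair n T S \<Longrightarrow> inv_pair n (map_mat (ram m) T) (map_mat (ram m) S)"
  by (rule inv_pair_hom) (auto simp: ram_add ram_mult)

lemma ramm_eq: "ramm m A = of_nat m \<cdot>\<^sub>m map_mat (ram m) A"
  by (rule eq_matI) (auto simp: rams_def)

lemma gauges_ram:
  assumes m: "m > 0" and g: "gauges theta n A T B"
  shows "gauges theta n (ramm m A) (map_mat (ram m) T) (ramm m B)"
proof -
  have c: "T \<in> carrier_mat n n" "B \<in> carrier_mat n n" "A \<in> carrier_mat n n" using g by (auto simp: gauges_def)
  have th: "map_mat theta (map_mat (ram m) T) = of_nat m \<cdot>\<^sub>m map_mat (ram m) (map_mat theta T)"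
    by (rule eq_matI) (auto simp: theta_ram m)
  have "ramm m A * map_mat (ram m) T + map_mat theta (map_mat (ram m) T)
     = of_nat m \<cdot>\<^sub>m (map_mat (ram m) (A * T) + map_mat (ram m) (map_mat theta T))"
    using c by (simp add: ramm_eq th map_mat_ram_mult[OF m c(3,1)] mult_smult_assoc_mat[of _ n n _ n] add_smult_distrib_left_mat[of _ n n])
  also have "map_mat (ram m) (A * T) + map_mat (ram m) (map_mat theta T) = map_mat (ram m) (A * T + map_mat theta T)"
    using c by (intro eq_matI) (auto simp: ram_add)
  also have "A * T + map_mat theta T = T * B" using g by (simp add: gauges_def)
  also have "of_nat m \<cdot>\<^sub>m map_mat (ram m) (T * B) = map_mat (ram m) T * ramm m B"
    using c by (simp add: ramm_eq map_mat_ram_mult[OF m] mult_smult_distrib[of _ n n _ n])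
  finally show ?thesis using c by (simp add: gauges_def)
qed

lemma eigv_ram:
  assumes m: "m > 0" and A: "A \<in> carrier_mat n n" and w: "eigv n A lam w"
  shows "eigv n (ramm m A) (rams m lam) (\<lambda>i. ram m (w i))"
proof -
  have "theta (ram m (w i)) + (\<Sum>j<n. ramm m A $$ (i, j) * ram m (w j)) = rams m lam * ram m (w i)" if "i < n" for i
  proof -
    have "rams m lam * ram m (w i) = of_nat m * ram m (theta (w i) + (\<Sum>j<n. A $$ (i, j) * w j))"
      using w that m by (simp add: eigv_def rams_def ram_mult)
    also have "\<dots> = theta (ram m (w i)) + (\<Sum>j<n. ramm m A $$ (i, j) * ram m (w j))"
      using m A that by (simp add: ram_add ram_sum ram_mult theta_ram distrib_left sum_distrib_left rams_def mult.assoc)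
    finally show ?thesis by simp
  qed
  then show ?thesis using w m by (auto simp: eigv_def)
qed

section \<open>Triangularization\<close>

lemma inv_pair_first_column:
  fixes w :: "nat \<Rightarrow> 'a::field"
  assumes "\<exists>i<n. w i \<noteq> 0"
  obtains T S where "inv_pair n T S" "\<And>i. i < n \<Longrightarrow> T $$ (i, 0) = w i"
proof -
  obtain l where l: "l < n" "w l \<noteq> 0" using assms by blast
  \<comment> \<open>The unit vector at l is exchanged for w: for l > 0 column l receives the unit
    vector at 0, whose own column is taken by w.\<close>
  define c where "c j = (if j = l then 0 else j)" for j :: nat
  define T where "T = mat n n (\<lambda>(i, j). if j = 0 then w i else if i = c j then 1 else 0)"
  have T: "T \<in> carrier_mat n n" by (simp add: T_def)
  have "det T \<noteq> 0"
  proof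
    assume "det T = 0"
    then obtain v where v: "v \<in> carrier_vec n" "v \<noteq> 0\<^sub>v n" "T *\<^sub>v v = 0\<^sub>v n"
      using det_0_iff_vec_prod_zero_field[OF T] by blast
    have row: "w i * vec_index v 0 + (\<Sum>j=1..<n. (if i = c j then 1 else 0) * vec_index v j) = 0" if "i < n" for i
    proof -
      have "vec_index (T *\<^sub>v v) i = (\<Sum>j=0..<n. (if j = 0 then w i else if i = c j then 1 else 0) * vec_index v j)"
        using that v(1) by (simp add: T_def scalar_prod_def)
      also have "\<dots> = w i * vec_index v 0 + (\<Sum>j=1..<n. (if j = 0 then w i else if i = c j then 1 else 0) * vec_index v j)"
        using l(1) by (subst sum.atLeast_Suc_lessThan) auto
      also have "(\<Sum>j=1..<n. (if j = 0 then w i else if i = c j then 1 else 0) * vec_index v j)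
         = (\<Sum>j=1..<n. (if i = c j then 1 else 0) * vec_index v j)"
        by (intro sum.cong) auto
      finally show ?thesis using v(3) that by simp
    qed
    have "(\<Sum>j=1..<n. (if l = c j then 1 else 0) * vec_index v j) = 0"
      by (rule sum.neutral) (auto simp: c_def)
    then have v0: "vec_index v 0 = 0" using row[OF l(1)] l(2) by simp
    have "vec_index v j = 0" if "0 < j" "j < n" for j
    proof -
      have cj: "c j < n" using that l by (simp add: c_def)
      have "(\<Sum>j'=1..<n. (if c j = c j' then 1 else 0) * vec_index v j') = (\<Sum>j'\<in>{j}. (if c j = c j' then 1 else 0) * vec_index v j')"
        by (rule sum.mono_neutral_right) (use that in \<open>auto simp: c_def split: if_splits\<close>)
      then show ?thesis using row[OF cj] v0 by simp
    qed
    then have "v = 0\<^sub>v n" using v0 v(1) by (intro eq_vecI) (auto, metis gr0I)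
    then show False using v(2) by simp
  qed
  then obtain S where "inv_pair n T S" using inv_pair_of_det[OF T] by blast
  moreover have "T $$ (i, 0) = w i" if "i < n" for i using that l(1) by (simp add: T_def)
  ultimately show ?thesis using that by blast
qed

abbreviation corner :: "'a::zero \<Rightarrow> 'a mat \<Rightarrow> nat \<Rightarrow> 'a mat \<Rightarrow> 'a mat" where
  "corner x r k A \<equiv> four_block_mat (mat 1 1 (\<lambda>_. x)) r (0\<^sub>m k 1) A"

lemma triang_step:
  assumes A: "A \<in> carrier_mat (Suc k) (Suc k)" and w: "eigv (Suc k) A lam w"
  obtains T S r A' where "inv_pair (Suc k) T S" "gauges theta (Suc k) A T (corner lam r k A')"
    "r \<in> carrier_mat 1 k" "A' \<in> carrier_mat k k"
proof -
  obtain T S where T: "inv_pair (Suc k) T S" "\<And>i. i < Suc k \<Longrightarrow> T $$ (i, 0) = w i"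
    using inv_pair_first_column[of "Suc k" w] w by (auto simp: eigv_def)
  have c: "T \<in> carrier_mat (Suc k) (Suc k)" "S \<in> carrier_mat (Suc k) (Suc k)" using T by (auto simp: inv_pair_def)
  define B where "B = S * (A * T + map_mat theta T)"
  have g: "gauges theta (Suc k) A T B" unfolding B_def by (rule gauges_exists[OF T(1) A])
  have Bc: "B \<in> carrier_mat (Suc k) (Suc k)" using g by (simp add: gauges_def)
  have col: "(A * T + map_mat theta T) $$ (i, 0) = lam * T $$ (i, 0)" if "i < Suc k" for i
    using w that c A by (simp add: eigv_def scalar_prod_def T(2) atLeast0LessThan add.commute
        del: sum.lessThan_Suc sum.op_ivl_Suc)
  have B0: "B $$ (i, 0) = (if i = 0 then lam else 0)" if "i < Suc k" for i
  proof -
    have "B $$ (i, 0) = (\<Sum>j<Suc k. S $$ (i, j) * (A * T + map_mat theta T) $$ (j, 0))"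
      using that c A by (simp add: B_def scalar_prod_def atLeast0LessThan del: sum.lessThan_Suc sum.op_ivl_Suc index_add_mat(1))
    also have "\<dots> = lam * (\<Sum>j<Suc k. S $$ (i, j) * T $$ (j, 0))"
      unfolding sum_distrib_left by (intro sum.cong refl) (use col in auto)
    also have "(\<Sum>j<Suc k. S $$ (i, j) * T $$ (j, 0)) = (S * T) $$ (i, 0)"
      using that c by (simp add: scalar_prod_def atLeast0LessThan del: sum.lessThan_Suc sum.op_ivl_Suc)
    finally show ?thesis using T(1) that by (simp add: inv_pair_def)
  qed
  define r where "r = mat 1 k (\<lambda>(i, j). B $$ (0, Suc j))"
  define A' where "A' = mat k k (\<lambda>(i, j). B $$ (Suc i, Suc j))"
  have Beq: "B = corner lam r k A'"
    by (rule eq_matI) (use Bc B0 in \<open>auto simp: r_def A'_def\<close>)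
  have "gauges theta (Suc k) A T (corner lam r k A')"
    by (subst Beq[symmetric]) (rule g)
  moreover have "r \<in> carrier_mat 1 k" "A' \<in> carrier_mat k k" by (simp_all add: r_def A'_def)
  ultimately show ?thesis using that T(1) by blast
qed

lemma triang_combine:
  assumes r: "r \<in> carrier_mat 1 k" and g: "gauges theta k A T B" and i: "inv_pair k T S"
  shows "gauges theta (Suc k) (corner lam r k A) (corner 1 (0\<^sub>m 1 k) k T) (corner lam (r * T) k B)"
    and "inv_pair (Suc k) (corner 1 (0\<^sub>m 1 k) k T) (corner 1 (0\<^sub>m 1 k) k S)"
proof -
  have c: "A \<in> carrier_mat k k" "T \<in> carrier_mat k k" "B \<in> carrier_mat k k" "S \<in> carrier_mat k k"
    using g i by (auto simp: gauges_def inv_pair_def)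
  have m1: "mat 1 1 (\<lambda>_. x) * mat 1 1 (\<lambda>_. y) = mat 1 1 (\<lambda>_. x * y)" for x y :: "complex fls"
    by (rule eq_matI) (auto simp: scalar_prod_def)
  have m11: "mat 1 1 (\<lambda>_. x) + 0\<^sub>m 1 1 = mat 1 1 (\<lambda>_. x)" for x :: "complex fls"
    by (rule eq_matI) auto
  have one: "mat 1 1 (\<lambda>_. 1) = (1\<^sub>m 1 :: complex fls mat)" by (rule eq_matI) auto
  have th: "map_mat theta (corner 1 (0\<^sub>m 1 k) k T) = corner 0 (0\<^sub>m 1 k) k (map_mat theta T)"
    by (rule eq_matI) (use c in auto)
  have z: "mat 1 1 (\<lambda>_. 0) = (0\<^sub>m 1 1 :: complex fls mat)" by (rule eq_matI) auto
  have "corner lam r k A * corner 1 (0\<^sub>m 1 k) k T = corner lam (r * T) k (A * T)"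
    by (subst mult_four_block_mat[of _ 1 1 _ k _ k _ _ 1 _ k]) (use c r in \<open>auto simp: one[unfolded One_nat_def] z[unfolded One_nat_def] m1[unfolded One_nat_def] m11[unfolded One_nat_def]\<close>)
  moreover have "corner lam (r * T) k (A * T) + corner 0 (0\<^sub>m 1 k) k (map_mat theta T)
      = corner lam (r * T) k (A * T + map_mat theta T)"
    by (rule eq_matI) (use c r in auto)
  moreover have "corner 1 (0\<^sub>m 1 k) k T * corner lam (r * T) k B = corner lam (r * T) k (T * B)"
    by (subst mult_four_block_mat[of _ 1 1 _ k _ k _ _ 1 _ k]) (use c r in \<open>auto simp: one[unfolded One_nat_def] z[unfolded One_nat_def] m1[unfolded One_nat_def] m11[unfolded One_nat_def]\<close>)
  ultimately show "gauges theta (Suc k) (corner lam r k A) (corner 1 (0\<^sub>m 1 k) k T) (corner lam (r * T) k B)"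
    using g c by (simp add: gauges_def th[unfolded One_nat_def] four_block_carrier_mat[of _ 1 1 _ k k, simplified])
  have "corner 1 (0\<^sub>m 1 k) k X * corner 1 (0\<^sub>m 1 k) k Y = 1\<^sub>m (Suc k)"
    if "X \<in> carrier_mat k k" "Y \<in> carrier_mat k k" "X * Y = 1\<^sub>m k" for X Y :: "complex fls mat"
    by (subst mult_four_block_mat[of _ 1 1 _ k _ k _ _ 1 _ k])
       (use that four_block_one_mat[of 1 k] in \<open>auto simp: one[unfolded One_nat_def] z[unfolded One_nat_def] m1[unfolded One_nat_def] m11[unfolded One_nat_def]\<close>)
  then show "inv_pair (Suc k) (corner 1 (0\<^sub>m 1 k) k T) (corner 1 (0\<^sub>m 1 k) k S)"
    using i c by (simp add: inv_pair_def four_block_carrier_mat[of _ 1 1 _ k k, simplified])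
qed

lemma upper_triangular_corner:
  assumes "upper_triangular B" "B \<in> carrier_mat k k" "r \<in> carrier_mat 1 k"
  shows "upper_triangular (corner lam r k B)"
proof (rule upper_triangularI)
  fix i j assume "j < i" "i < dim_row (corner lam r k B)"
  then show "corner lam r k B $$ (i, j) = 0"
    using assms by (cases j) (auto simp: upper_triangular_def)
qed

text \<open>Induction on the rank through the quotient by an eigenvector. Each step may need a
  further ramification, so the orders multiply.\<close>

lemma ramified_triangularization:
  assumes "A \<in> carrier_mat n n"
  obtains m T S B where "m > 0" "inv_pair n T S" "gauges theta n (ramm m A) T B" "upper_triangular B"
  using assms
proof (induction n arbitrary: A thesis)
  case 0
  have "gauges theta 0 (ramm 1 A) (1\<^sub>m 0) (1\<^sub>m 0)" using 0 by (auto simp: gauges_def)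
  then show ?case using 0(1)[of 1 "1\<^sub>m 0" "1\<^sub>m 0" "1\<^sub>m 0"] inv_pair_one[of 0] by auto
next
  case (Suc k)
  obtain m1 lam w where w: "m1 > 0" "eigv (Suc k) (ramm m1 A) lam w"
    using eigenvector_exists[OF Suc.prems(2)] by auto
  have c1: "ramm m1 A \<in> carrier_mat (Suc k) (Suc k)" using Suc.prems(2) by simp
  obtain T1 S1 r A' where 1: "inv_pair (Suc k) T1 S1" "gauges theta (Suc k) (ramm m1 A) T1 (corner lam r k A')"
    "r \<in> carrier_mat 1 k" "A' \<in> carrier_mat k k" by (rule triang_step[OF c1 w(2)])
  obtain m2 T2 S2 B2 where 2: "m2 > 0" "inv_pair k T2 S2" "gauges theta k (ramm m2 A') T2 B2" "upper_triangular B2"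
    using Suc.IH[OF _ 1(4)] by metis
  have rr: "ramm m2 (ramm m1 A) = ramm (m1 * m2) A"
    by (rule eq_matI) (auto simp: rams_rams w 2)
  have rc: "ramm m2 (corner lam r k A') = corner (rams m2 lam) (ramm m2 r) k (ramm m2 A')"
    by (rule eq_matI) (use 1 in \<open>auto simp: rams_def\<close>)
  have r2: "ramm m2 r \<in> carrier_mat 1 k" using 1(3) by simp
  note comb = triang_combine(1)[OF r2 2(3,2), of "rams m2 lam"] triang_combine(2)[OF r2 2(3,2)]
  have "gauges theta (Suc k) (ramm (m1 * m2) A) (map_mat (ram m2) T1) (corner (rams m2 lam) (ramm m2 r) k (ramm m2 A'))"
    using gauges_ram[OF 2(1) 1(2)] by (simp only: rr rc)
  from gauges_trans[OF derivation_theta this comb(1)]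
  have G: "gauges theta (Suc k) (ramm (m1 * m2) A) (map_mat (ram m2) T1 * corner 1 (0\<^sub>m 1 k) k T2)
      (corner (rams m2 lam) (ramm m2 r * T2) k B2)" .
  have "upper_triangular (corner (rams m2 lam) (ramm m2 r * T2) k B2)"
    using 2 r2 by (intro upper_triangular_corner) (auto simp: gauges_def)
  then show ?case
    using Suc.prems(1)[OF _ inv_pair_mult[OF inv_pair_ram[OF 2(1) 1(1)] comb(2)] G] w(1) 2(1) by simp
qed

section \<open>Triangular systems\<close>

text \<open>The contraction principle for the t-adic topology. The fixpoint equation determines each
  coefficient from the earlier ones, which reduces it to \<open>causal_fixpoint\<close>.\<close>

lemma fls_fixpoint:
  fixes \<Phi> :: "('b \<Rightarrow> complex fls) \<Rightarrow> 'b \<Rightarrow> complex fls"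
  assumes base: "\<And>x b. (\<And>b. vge M (x b)) \<Longrightarrow> vge M (\<Phi> x b)"
    and contr: "\<And>x y k b. M \<le> k \<Longrightarrow> (\<And>b. vge M (x b)) \<Longrightarrow> (\<And>b. vge M (y b)) \<Longrightarrow>
      (\<And>b. vge k (x b - y b)) \<Longrightarrow> vge (k + 1) (\<Phi> x b - \<Phi> y b)"
  obtains x where "\<And>b. vge M (x b)" "\<Phi> x = x"
proof -
  define E where "E f b = tp M * fps_to_fls (Abs_fps (\<lambda>k. f k b))" for f :: "nat \<Rightarrow> 'b \<Rightarrow> complex" and b
  have nth_E: "fls_nth (E f b) k = (if k < M then 0 else f (nat (k - M)) b)" for f b k
    by (simp add: E_def)
  have E: "vge M (E f b)" for f b by (simp add: vge_def nth_E)
  define \<Psi> where "\<Psi> f k = (\<lambda>b. fls_nth (\<Phi> (E f) b) (M + int k))" for f k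
  have "\<Psi> f k = \<Psi> g k" if "\<And>i. i < k \<Longrightarrow> f i = g i" for f g k
  proof
    fix b
    have d: "vge (M + int k) (E f b - E g b)" for b
      using that by (auto simp: vge_def nth_E)
    have "vge (M + int k + 1) (\<Phi> (E f) b - \<Phi> (E g) b)"
      by (rule contr[OF _ E E d]) simp
    then have "fls_nth (\<Phi> (E f) b - \<Phi> (E g) b) (M + int k) = 0" by (simp add: vge_def)
    then show "\<Psi> f k b = \<Psi> g k b" by (simp add: \<Psi>_def)
  qed
  then obtain f where f: "\<Psi> f = f" by (rule causal_fixpoint)
  have "\<Phi> (E f) b = E f b" for b
  proof (rule fls_eqI)
    fix k
    show "fls_nth (\<Phi> (E f) b) k = fls_nth (E f b) k"
    proof (cases "k < M")
      case True
      then show ?thesis using base[of "E f" b, OF E] by (simp add: nth_E vge_def)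
    next
      case False
      have "f (nat (k - M)) b = fls_nth (\<Phi> (E f) b) (M + int (nat (k - M)))"
        by (subst f[symmetric]) (simp add: \<Psi>_def)
      then show ?thesis using False by (simp add: nth_E)
    qed
  qed
  then have "\<Phi> (E f) = E f" by auto
  then show ?thesis by (rule that[OF E])
qed

lemma vge_divide: "vge M x \<Longrightarrow> g \<noteq> 0 \<Longrightarrow> vge (M - fls_subdegree g) (x / g)"
  by (cases "x = 0") (auto simp: vge_iff fls_divide_subdegree)

text \<open>As g has a pole, division by g raises the order, and x = (f - theta x) / g is a
  contraction.\<close>

lemma solve_first_order:
  assumes "\<not> vge 0 g"
  obtains x where "theta x + g * x = f"
proof -
  have g: "g \<noteq> 0" "fls_subdegree g < 0" using assms by (auto simp: vge_iff)
  obtain M where M: "vge M (f / g)" using vge_ex by blast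
  define \<Phi> where "\<Phi> = (\<lambda>x (b :: unit). (f - theta (x b)) / g)"
  have step: "vge (k + 1) (y / g)" if "vge k y" for y k
    using vge_divide[OF that g(1)] g(2) by (auto elim: vge_mono)
  obtain x where x: "\<Phi> x = x"
  proof (rule fls_fixpoint[of M \<Phi>])
    fix x :: "unit \<Rightarrow> complex fls" and b
    assume "\<And>b. vge M (x b)"
    then have "vge (M + 1) (theta (x b) / g)" by (intro step vge_theta)
    then have "vge M (theta (x b) / g)" by (rule vge_mono) simp
    then show "vge M (\<Phi> x b)" using M by (simp add: \<Phi>_def diff_divide_distrib vge_diff)
  next
    fix x y :: "unit \<Rightarrow> complex fls" and k b
    assume "\<And>b. vge k (x b - y b)"
    then have "vge (k + 1) (theta (x b - y b) / g)" by (intro step vge_theta)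
    moreover have "\<Phi> x b - \<Phi> y b = - (theta (x b - y b) / g)"
      by (simp add: \<Phi>_def theta_diff diff_divide_distrib)
    ultimately show "vge (k + 1) (\<Phi> x b - \<Phi> y b)" by (simp add: vge_uminus)
  qed auto
  have "x () = (f - theta (x ())) / g" using fun_cong[OF x, of "()"] by (simp add: \<Phi>_def)
  then have "g * x () = f - theta (x ())" using g by (metis nonzero_mult_div_cancel_left times_divide_eq_right)
  then show ?thesis using that[of "x ()"] by simp
qed

text \<open>Termwise antiderivative for theta, normalized to have no constant term.\<close>

definition integrate :: "complex fls \<Rightarrow> complex fls" where
  "integrate f = Abs_fls (\<lambda>k. if k = 0 then 0 else fls_nth f k / of_int k)"

lemma nth_integrate: "fls_nth (integrate f) k = (if k = 0 then 0 else fls_nth f k / of_int k)"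
proof -
  obtain M where "vge M f" using vge_ex by blast
  then have "\<exists>M. \<forall>k<M. (if k = 0 then 0 else fls_nth f k / of_int k) = 0"
    by (intro exI[of _ M]) (simp add: vge_def)
  then show ?thesis unfolding integrate_def by (rule nth_Abs_fls_ex_lower_bound)
qed

lemma theta_integrate: "vge 1 f \<Longrightarrow> theta (integrate f) = f"
  by (rule fls_eqI) (auto simp: nth_integrate vge_def)

lemma vge_integrate: "vge N f \<Longrightarrow> vge N (integrate f)"
  by (simp add: vge_def nth_integrate)

text \<open>Integration from the initial value c; there is no resonance because the matrix vanishes
  at t = 0.\<close>

lemma formal_system_solution:
  fixes A :: "nat \<Rightarrow> nat \<Rightarrow> complex fls"
  assumes A: "\<And>i j. vge 1 (A i j)"
  obtains x where "\<And>i. vge 0 (x i)" "\<And>i. theta (x i) + (\<Sum>j<n. A i j * x j) = 0" "\<And>i. fls_nth (x i) 0 = c i"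
proof -
  define \<Phi> where "\<Phi> = (\<lambda>x i. fls_const (c i) - integrate (\<Sum>j<n. A i j * x j))"
  have step: "vge (k + 1) (\<Sum>j<n. A i j * x j)" if "\<And>j. vge k (x j)" for k i x
    using vge_mult[OF A that] by (intro vge_sum) (simp add: add.commute)
  obtain x where x: "\<And>b. vge 0 (x b)" "\<Phi> x = x"
  proof (rule fls_fixpoint[of 0 \<Phi>])
    fix x :: fvec and b
    assume "\<And>b. vge 0 (x b)"
    then have "vge 0 (\<Sum>j<n. A b j * x j)" using vge_mono[OF step[of 0 x b], of 0] by simp
    then show "vge 0 (\<Phi> x b)" by (simp add: \<Phi>_def vge_diff vge_integrate)
  next
    fix x y :: fvec and k b
    assume "\<And>b. vge k (x b - y b)"
    then have "vge (k + 1) (integrate (\<Sum>j<n. A b j * (x j - y j)))" by (intro vge_integrate step)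
    moreover have "\<Phi> x b - \<Phi> y b = - integrate (\<Sum>j<n. A b j * (x j - y j))"
      by (rule fls_eqI) (simp add: \<Phi>_def nth_integrate fls_nth_sum right_diff_distrib sum_subtractf diff_divide_distrib)
    ultimately show "vge (k + 1) (\<Phi> x b - \<Phi> y b)" by (simp add: vge_uminus)
  qed auto
  have xi: "x i = fls_const (c i) - integrate (\<Sum>j<n. A i j * x j)" for i
    using fun_cong[OF x(2), of i] by (simp add: \<Phi>_def)
  have s: "vge 1 (\<Sum>j<n. A i j * x j)" for i using step[OF x(1)] by simp
  have "theta (x i) + (\<Sum>j<n. A i j * x j) = 0" for i
  proof -
    have "theta (x i) = - theta (integrate (\<Sum>j<n. A i j * x j))"
      by (subst xi) (simp add: theta_diff, simp add: theta_def)
    then show ?thesis by (simp add: theta_integrate[OF s])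
  qed
  moreover have "fls_nth (x i) 0 = c i" for i by (subst xi) (simp add: nth_integrate)
  ultimately show ?thesis using that x(1) by blast
qed

text \<open>\<open>l\<close> is the first diagonal position with the polar part of position i.
  Starting with 1 at l, the components of smaller index are found one by one from first order
  equations; their coefficients are differences of diagonal entries, which have a pole by the choice
  of l.\<close>

lemma triangular_eigenvector:
  assumes B: "B \<in> carrier_mat n n" "upper_triangular B" and i: "i < n"
  obtains lam w where "eigv n B lam w" "vge 0 (lam - B $$ (i, i))"
proof -
  define l where "l = (LEAST l. vge 0 (B $$ (l, l) - B $$ (i, i)))"
  have l: "vge 0 (B $$ (l, l) - B $$ (i, i))" unfolding l_def by (rule LeastI[of _ i]) simp
  have ln: "l < n" using Least_le[of "\<lambda>l. vge 0 (B $$ (l, l) - B $$ (i, i))" i] i by (simp add: l_def)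
  have ne: "\<not> vge 0 (B $$ (j, j) - B $$ (l, l))" if "j < l" for j
  proof
    assume "vge 0 (B $$ (j, j) - B $$ (l, l))"
    then have "vge 0 (B $$ (j, j) - B $$ (i, i))" using vge_add[OF _ l] by force
    then show False using not_less_Least[of j "\<lambda>l. vge 0 (B $$ (l, l) - B $$ (i, i))"] that by (simp add: l_def)
  qed
  let ?eq = "\<lambda>w j. theta (w j) + (\<Sum>k<n. B $$ (j, k) * w k) = B $$ (l, l) * w j"
  have low: "B $$ (j, k) = 0" if "k < j" "j < n" for j k
    using B that by (auto simp: upper_triangular_def)
  have "\<exists>w. w l = 1 \<and> (\<forall>j>l. w j = 0) \<and> (\<forall>j<n. l - s \<le> j \<longrightarrow> ?eq w j)" if "s \<le> l" for s
    using that
  proof (induction s)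
    case 0
    let ?w = "\<lambda>j. if j = l then 1 else 0 :: complex fls"
    have "?eq ?w j" if "j < n" "l \<le> j" for j
    proof -
      have "(\<Sum>k<n. B $$ (j, k) * ?w k) = (\<Sum>k<n. if k = l then B $$ (j, k) else 0)"
        by (intro sum.cong) auto
      also have "\<dots> = B $$ (j, l)" using ln by (simp add: sum.delta)
      finally show ?thesis using low[of l j] that by (cases "j = l") auto
    qed
    then show ?case by (intro exI[of _ ?w]) auto
  next
    case (Suc s)
    then obtain w where w: "w l = 1" "\<forall>j>l. w j = 0" "\<forall>j<n. l - s \<le> j \<longrightarrow> ?eq w j" by auto
    define j0 where "j0 = l - Suc s"
    have j0: "j0 < l" "l - s = Suc j0" using Suc.prems by (auto simp: j0_def)
    then have j0n: "j0 < n" using ln by simp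
    obtain x where x: "theta x + (B $$ (j0, j0) - B $$ (l, l)) * x = - (\<Sum>k\<in>{..<n} - {j0}. B $$ (j0, k) * w k)"
      using solve_first_order[OF ne[OF j0(1)]] by blast
    let ?w = "w(j0 := x)"
    have "?eq ?w j" if j: "j < n" "l - Suc s \<le> j" for j
    proof (cases "j = j0")
      case True
      have "(\<Sum>k<n. B $$ (j0, k) * ?w k) = B $$ (j0, j0) * x + (\<Sum>k\<in>{..<n} - {j0}. B $$ (j0, k) * w k)"
        using j0n by (subst sum.remove[of _ j0]) auto
      then show ?thesis using x True by (simp add: algebra_simps)
    next
      case False
      then have jj: "j0 < j" using j by (simp add: j0_def)
      have "(\<Sum>k<n. B $$ (j, k) * ?w k) = (\<Sum>k<n. B $$ (j, k) * w k)"
        by (intro sum.cong refl) (use low[OF jj j(1)] in auto)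
      then show ?thesis using w(3) j jj j0(2) False by simp
    qed
    then show ?case using w j0 by (intro exI[of _ ?w]) auto
  qed
  from this[of l] obtain w where w: "w l = 1" "\<forall>j<n. ?eq w j" by auto
  have "eigv n B (B $$ (l, l)) w" unfolding eigv_def using w ln by (metis zero_neq_one)
  then show ?thesis using that l by blast
qed

lemma vge_logarithmic_derivative: "x \<noteq> 0 \<Longrightarrow> vge 0 (theta x / x)"
  using vge_divide[OF vge_theta, of "fls_subdegree x" x x] by (simp add: vge_iff)

text \<open>In the last non-zero component the equation involves only a diagonal entry, and the
  logarithmic derivative of that component has no pole.\<close>

lemma triangular_eigenvalue:
  assumes B: "B \<in> carrier_mat n n" "upper_triangular B" and w: "eigv n B lam w"
  obtains i where "i < n" "vge 0 (lam - B $$ (i, i))"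
proof -
  define J where "J = {i. i < n \<and> w i \<noteq> 0}"
  have fJ: "finite J" "J \<noteq> {}" using w by (auto simp: J_def eigv_def)
  define i where "i = Max J"
  have i: "i < n" "w i \<noteq> 0" using Max_in[OF fJ] by (auto simp: J_def i_def)
  have above: "w k = 0" if "i < k" "k < n" for k
  proof -
    have "k \<notin> J" using Max_ge[OF fJ(1), of k] that by (auto simp: i_def)
    then show ?thesis using that by (simp add: J_def)
  qed
  have "(\<Sum>k<n. B $$ (i, k) * w k) = (\<Sum>k\<in>{i}. B $$ (i, k) * w k)"
  proof (rule sum.mono_neutral_right)
    show "\<forall>k\<in>{..<n} - {i}. B $$ (i, k) * w k = 0"
    proof
      fix k assume "k \<in> {..<n} - {i}"
      then show "B $$ (i, k) * w k = 0"
        using above[of k] B i by (cases "k < i") (auto simp: upper_triangular_def)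
    qed
  qed (use i in auto)
  moreover have "theta (w i) + (\<Sum>k<n. B $$ (i, k) * w k) = lam * w i" using w i(1) unfolding eigv_def by blast
  ultimately have "theta (w i) + B $$ (i, i) * w i = lam * w i" by simp
  then have "theta (w i) = (lam - B $$ (i, i)) * w i" by (simp add: algebra_simps)
  then have "lam - B $$ (i, i) = theta (w i) / w i" using i by simp
  then show ?thesis using that[OF i(1)] vge_logarithmic_derivative[OF i(2)] by simp
qed

section \<open>Unramified systems\<close>

definition cut :: "complex fls \<Rightarrow> complex fls" where
  "cut f = f - fps_to_fls (Abs_fps (\<lambda>k. if k = 0 then 0 else fls_nth f (int k)))"

lemma nth_cut: "fls_nth (cut f) k = (if k \<le> 0 then fls_nth f k else 0)"
  by (simp add: cut_def)

text \<open>If p has positive order, theta u = - p u has a solution with constant term 1;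
  multiplication by u removes p from the eigenvalue.\<close>

lemma eigv_cut:
  assumes w: "eigv n A lam w"
  obtains w' where "eigv n A (cut lam) w'"
proof -
  define p where "p = lam - cut lam"
  have p: "vge 1 p" by (simp add: p_def vge_def nth_cut)
  obtain x :: fvec where x: "\<And>i. vge 0 (x i)" "\<And>i. theta (x i) + (\<Sum>j<1. p * x j) = 0" "\<And>i. fls_nth (x i) 0 = 1"
    by (rule formal_system_solution[of "\<lambda>_ _. p" 1 "\<lambda>_. 1"]) (use p in auto)
  define u where "u = x (0 :: nat)"
  have u: "theta u = - p * u" using x(2)[of 0] by (simp add: u_def eq_neg_iff_add_eq_0)
  have "u \<noteq> 0" using x(3)[of 0] by (auto simp: u_def)
  have "theta (u * w i) + (\<Sum>j<n. A $$ (i, j) * (u * w j)) = cut lam * (u * w i)" if "i < n" for i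
  proof -
    have "theta (u * w i) + (\<Sum>j<n. A $$ (i, j) * (u * w j)) = - p * u * w i + u * (theta (w i) + (\<Sum>j<n. A $$ (i, j) * w j))"
    proof -
      have "(\<Sum>j<n. A $$ (i, j) * (u * w j)) = u * (\<Sum>j<n. A $$ (i, j) * w j)"
        by (simp add: sum_distrib_left mult.left_commute)
      then show ?thesis by (simp only: theta_mult u distrib_left add.assoc)
    qed
    also have "\<dots> = - p * u * w i + u * (lam * w i)" using w that by (simp add: eigv_def)
    also have "\<dots> = cut lam * (u * w i)" by (simp add: p_def algebra_simps)
    finally show ?thesis .
  qed
  then have "eigv n A (cut lam) (\<lambda>i. u * w i)" using w \<open>u \<noteq> 0\<close> by (simp add: eigv_def)
  then show ?thesis by (rule that)
qed

text \<open>Component j in the decomposition of C((t^(1/m))) into the spaces t^(j/m) C((t)) with j <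
  m, see \<open>comp_decomposition\<close>.\<close>

definition comp :: "nat \<Rightarrow> nat \<Rightarrow> complex fls \<Rightarrow> complex fls" where
  "comp m j f = Abs_fls (\<lambda>k. fls_nth f (int m * k + int j))"

lemma nth_comp:
  assumes "m > 0"
  shows "fls_nth (comp m j f) k = fls_nth f (int m * k + int j)"
proof -
  obtain M where M: "vge M f" using vge_ex by blast
  have "\<forall>k < - (\<bar>M\<bar> + int j). fls_nth f (int m * k + int j) = 0"
  proof (intro allI impI)
    fix k assume k: "k < - (\<bar>M\<bar> + int j)"
    have "int m * k \<le> 1 * k" using assms k by (intro mult_right_mono_neg) auto
    then show "fls_nth f (int m * k + int j) = 0" using M k by (simp add: vge_def)
  qed
  then show ?thesis unfolding comp_def by (intro nth_Abs_fls_ex_lower_bound) blast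
qed

lemma comp_add: "m > 0 \<Longrightarrow> comp m j (f + g) = comp m j f + comp m j g"
  by (rule fls_eqI) (simp add: nth_comp)

lemma comp_sum: "m > 0 \<Longrightarrow> comp m j (\<Sum>i\<in>S. f i) = (\<Sum>i\<in>S. comp m j (f i))"
  by (rule fls_eqI) (simp add: nth_comp fls_nth_sum)

lemma comp_theta: "m > 0 \<Longrightarrow> comp m j (theta f) = of_nat m * theta (comp m j f) + of_nat j * comp m j f"
  by (rule fls_eqI) (simp add: nth_comp algebra_simps)

lemma dvd_diff_iff_mod: "l < m \<Longrightarrow> int m dvd k - int l \<longleftrightarrow> k mod int m = int l"
  by (metis mod_eq_dvd_iff mod_pos_pos_trivial of_nat_0_le_iff of_nat_less_iff)

lemma comp_sum_tp_ram:
  assumes "m > 0" "j < m"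
  shows "comp m j (\<Sum>l<m. tp (int l) * ram m (c l)) = c j"
proof (rule fls_eqI)
  fix k
  have "fls_nth (comp m j (\<Sum>l<m. tp (int l) * ram m (c l))) k =
      (\<Sum>l<m. if int m dvd int m * k + int j - int l then fls_nth (c l) ((int m * k + int j - int l) div int m) else 0)"
    using assms(1) by (simp add: nth_comp fls_nth_sum nth_ram)
  also have "\<dots> = (\<Sum>l<m. if l = j then fls_nth (c l) k else 0)"
    by (intro sum.cong refl) (use assms in \<open>auto simp: dvd_diff_iff_mod\<close>)
  also have "\<dots> = fls_nth (c j) k" using assms by (simp add: sum.delta)
  finally show "fls_nth (comp m j (\<Sum>l<m. tp (int l) * ram m (c l))) k = fls_nth (c j) k" .
qed

lemma comp_decomposition:
  assumes "m > 0"
  shows "f = (\<Sum>l<m. tp (int l) * ram m (comp m l f))"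
proof (rule fls_eqI)
  fix k
  define r where "r = nat (k mod int m)"
  have r: "int r = k mod int m" "r < m" using assms by (auto simp: r_def nat_less_iff)
  have "fls_nth (\<Sum>l<m. tp (int l) * ram m (comp m l f)) k =
      (\<Sum>l<m. if int m dvd k - int l then fls_nth f (int m * ((k - int l) div int m) + int l) else 0)"
    using assms by (simp add: fls_nth_sum nth_ram nth_comp cong: if_cong)
  also have "\<dots> = (\<Sum>l<m. if l = r then fls_nth f k else 0)"
    by (intro sum.cong refl) (use r in \<open>auto simp: dvd_diff_iff_mod dvd_mult_div_cancel\<close>)
  also have "\<dots> = fls_nth f k" using r by (simp add: sum.delta)
  finally show "fls_nth f k = fls_nth (\<Sum>l<m. tp (int l) * ram m (comp m l f)) k" by simp
qed

lemma comp_ram_mult: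
  assumes "m > 0" "j < m"
  shows "comp m j (ram m a * f) = a * comp m j f"
proof -
  have "ram m a * f = (\<Sum>l<m. tp (int l) * ram m (a * comp m l f))"
    by (subst (1) comp_decomposition[OF assms(1), of f])
       (simp add: sum_distrib_left ram_mult assms mult.left_commute)
  then show ?thesis using comp_sum_tp_ram[OF assms, of "\<lambda>l. a * comp m l f"] by simp
qed

lemma rams_eq_ram: "m > 0 \<Longrightarrow> rams m a = ram m (of_nat m * a)"
  by (simp add: rams_def ram_mult)

text \<open>The components of an eigenvector along the powers of the ramified parameter are eigenvectors
  over the original field, as soon as the eigenvalue lies in that field.\<close>

lemma eigenvector_descent:
  assumes m: "m > 0" and A: "A \<in> carrier_mat n n" and w: "eigv n (ramm m A) lam w"
    and lam: "\<And>k. k > 0 \<Longrightarrow> fls_nth lam k = 0" "\<And>k. k < 0 \<Longrightarrow> fls_nth lam k \<noteq> 0 \<Longrightarrow> int m dvd k"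
  obtains lam' w' where "eigv n A lam' w'"
proof -
  define lam1 where "lam1 = comp m 0 lam"
  have lam1: "lam = ram m lam1"
  proof (rule fls_eqI)
    fix k show "fls_nth lam k = fls_nth (ram m lam1) k"
      using lam(1)[of k] lam(2)[of k] m by (cases k "0 :: int" rule: linorder_cases) (auto simp: nth_ram lam1_def nth_comp)
  qed
  obtain i0 where i0: "i0 < n" "w i0 \<noteq> 0" using w by (auto simp: eigv_def)
  then obtain k0 where k0: "fls_nth (w i0) k0 \<noteq> 0" using fls_nonzero_nth by blast
  \<comment> \<open>This residue class of exponents occurs in w, so that its component is not
    zero.\<close>
  define j where "j = nat (k0 mod int m)"
  have j: "int j = k0 mod int m" "j < m" using m by (auto simp: j_def nat_less_iff)
  define w' where "w' i = comp m j (w i)" for i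
  have "fls_nth (w' i0) (k0 div int m) = fls_nth (w i0) k0"
    using m by (simp add: w'_def nth_comp j(1))
  then have "w' i0 \<noteq> 0" using k0 by auto
  \<comment> \<open>The derivation of the ramified parameter multiplies t^(j/m) by j, which shifts
    the eigenvalue by j before the division by m.\<close>
  moreover have "theta (w' i) + (\<Sum>l<n. A $$ (i, l) * w' l) = ((lam1 - of_nat j) / of_nat m) * w' i" if "i < n" for i
  proof -
    have "lam1 * w' i = comp m j (theta (w i) + (\<Sum>l<n. ramm m A $$ (i, l) * w l))"
      using w that m j by (simp add: eigv_def w'_def lam1 comp_ram_mult)
    also have "\<dots> = of_nat m * theta (w' i) + of_nat j * w' i + (\<Sum>l<n. of_nat m * A $$ (i, l) * w' l)"
    proof -
      have "comp m j (\<Sum>l<n. ramm m A $$ (i, l) * w l) = (\<Sum>l<n. of_nat m * A $$ (i, l) * w' l)"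
        unfolding comp_sum[OF m]
        by (intro sum.cong refl) (use A that in \<open>simp add: rams_eq_ram[OF m] comp_ram_mult[OF m j(2)] w'_def\<close>)
      then show ?thesis by (simp add: comp_add comp_theta m w'_def)
    qed
    finally have "of_nat m * (theta (w' i) + (\<Sum>l<n. A $$ (i, l) * w' l)) = (lam1 - of_nat j) * w' i"
      by (simp add: algebra_simps sum_distrib_left)
    then show ?thesis using m by (simp add: nonzero_eq_divide_eq mult.commute)
  qed
  ultimately have "eigv n A ((lam1 - of_nat j) / of_nat m) w'" using i0 by (auto simp: eigv_def)
  then show ?thesis by (rule that)
qed

text \<open>The polar parts of the eigenvalues over all ramified extensions come from C((t)). In
  this form the condition passes to the quotients met in the triangularization.\<close>

definition unram :: "nat \<Rightarrow> complex fls mat \<Rightarrow> bool" where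
  "unram n A \<longleftrightarrow> (\<forall>m lam w k. m > 0 \<longrightarrow> eigv n (ramm m A) lam w \<longrightarrow> k < 0 \<longrightarrow> fls_nth lam k \<noteq> 0 \<longrightarrow> int m dvd k)"

lemma unram_eigenvector:
  assumes "A \<in> carrier_mat n n" "unram n A" "n > 0"
  obtains lam w where "eigv n A lam w"
proof -
  obtain m lam w where 1: "m > 0" "eigv n (ramm m A) lam w" using eigenvector_exists[OF assms(1,3)] by auto
  obtain w' where 2: "eigv n (ramm m A) (cut lam) w'" using eigv_cut[OF 1(2)] by blast
  show ?thesis
    by (rule eigenvector_descent[OF 1(1) assms(1) 2 _ _ that])
       (use assms(2) 1 in \<open>auto simp: nth_cut unram_def\<close>)
qed

text \<open>An eigenvector of the quotient lifts by solving one first order equation, unless its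
  eigenvalue has the polar part of the eigenvalue of the line. In that case the exponents are
  divisible by m because lam lies in C((t)).\<close>

lemma unram_quotient:
  assumes u: "unram (Suc k) A" and i: "inv_pair (Suc k) T S" and g: "gauges theta (Suc k) A T (corner lam r k A')"
    and r: "r \<in> carrier_mat 1 k" "A' \<in> carrier_mat k k"
  shows "unram k A'"
  unfolding unram_def
proof (intro allI impI)
  fix m mu w l assume m: "m > 0" and w: "eigv k (ramm m A') mu w" and l: "l < 0" "fls_nth mu l \<noteq> 0"
  show "int m dvd l"
  proof (cases "vge 0 (mu - rams m lam)")
    case True
    then have "fls_nth (rams m lam) l = fls_nth mu l" using l(1) by (simp add: vge_def)
    then show ?thesis using l(2) m by (auto simp: rams_def nth_ram split: if_splits)
  next
    case False
    then have "\<not> vge 0 (rams m lam - mu)" using vge_uminus[of 0 "rams m lam - mu"] by auto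
    then obtain x where x: "theta x + (rams m lam - mu) * x = - (\<Sum>j<k. ramm m r $$ (0, j) * w j)"
      using solve_first_order by blast
    define W where "W i = (case i of 0 \<Rightarrow> x | Suc i' \<Rightarrow> w i')" for i
    have "eigv (Suc k) (ramm m (corner lam r k A')) mu W"
      unfolding eigv_def
    proof (intro conjI allI impI)
      obtain i where "i < k" "w i \<noteq> 0" using w by (auto simp: eigv_def)
      then show "\<exists>i<Suc k. W i \<noteq> 0" by (intro exI[of _ "Suc i"]) (simp add: W_def)
      fix i assume i: "i < Suc k"
      show "theta (W i) + (\<Sum>j<Suc k. ramm m (corner lam r k A') $$ (i, j) * W j) = mu * W i"
      proof (cases i)
        case 0
        have "(\<Sum>j<Suc k. ramm m (corner lam r k A') $$ (i, j) * W j) = rams m lam * x + (\<Sum>j<k. ramm m r $$ (0, j) * w j)"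
          unfolding sum.lessThan_Suc_shift using r 0 by (simp add: W_def)
        then show ?thesis using x 0 by (simp add: W_def algebra_simps)
      next
        case (Suc i')
        have "(\<Sum>j<Suc k. ramm m (corner lam r k A') $$ (i, j) * W j) = (\<Sum>j<k. ramm m A' $$ (i', j) * w j)"
          unfolding sum.lessThan_Suc_shift using r i Suc by (simp add: W_def rams_def)
        then show ?thesis using w i Suc by (simp add: W_def eigv_def)
      qed
    qed
    from eigv_gauge[OF gauges_ram[OF m g] inv_pair_ram[OF m i] this]
    show ?thesis using u m l unfolding unram_def by blast
  qed
qed

lemma unramified_triangularization:
  assumes "A \<in> carrier_mat n n" "unram n A"
  obtains T S B where "inv_pair n T S" "gauges theta n A T B" "upper_triangular B"
  using assms
proof (induction n arbitrary: A thesis)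
  case 0
  have "gauges theta 0 A (1\<^sub>m 0) (1\<^sub>m 0)" using 0 by (auto simp: gauges_def)
  then show ?case using 0(1)[of "1\<^sub>m 0" "1\<^sub>m 0" "1\<^sub>m 0"] inv_pair_one[of 0] by auto
next
  case (Suc k)
  obtain lam w where w: "eigv (Suc k) A lam w" using unram_eigenvector[OF Suc.prems(2,3)] by auto
  obtain T1 S1 r A' where 1: "inv_pair (Suc k) T1 S1" "gauges theta (Suc k) A T1 (corner lam r k A')"
    "r \<in> carrier_mat 1 k" "A' \<in> carrier_mat k k" by (rule triang_step[OF Suc.prems(2) w])
  obtain T2 S2 B2 where 2: "inv_pair k T2 S2" "gauges theta k A' T2 B2" "upper_triangular B2"
    using Suc.IH[OF _ 1(4) unram_quotient[OF Suc.prems(3) 1]] by metis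
  have "upper_triangular (corner lam (r * T2) k B2)"
    using 2 1 by (intro upper_triangular_corner) (auto simp: gauges_def)
  then show ?case
    using Suc.prems(1)[OF inv_pair_mult[OF 1(1) triang_combine(2)[OF 1(3) 2(2,1)]]
        gauges_trans[OF derivation_theta 1(2) triang_combine(1)[OF 1(3) 2(2,1)]]] by simp
qed

section \<open>Diagonal matrices of powers of t\<close>

definition dg :: "nat \<Rightarrow> (nat \<Rightarrow> int) \<Rightarrow> complex fls mat" where
  "dg n l = mat n n (\<lambda>(i, j). if i = j then tp (l i) else 0)"

lemma dg_carrier [simp]: "dg n l \<in> carrier_mat n n" by (simp add: dg_def)

lemma dg_mult_left: "A \<in> carrier_mat n n \<Longrightarrow> dg n l * A = mat n n (\<lambda>(i, j). tp (l i) * A $$ (i, j))"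
  by (rule eq_matI) (auto simp: dg_def scalar_prod_def if_distrib[of "\<lambda>x. x * _"] sum.delta cong: if_cong)

lemma dg_mult_right: "A \<in> carrier_mat n n \<Longrightarrow> A * dg n l = mat n n (\<lambda>(i, j). A $$ (i, j) * tp (l j))"
  by (rule eq_matI) (auto simp: dg_def scalar_prod_def if_distrib[of "\<lambda>x. _ * x"] sum.delta' cong: if_cong)

lemma inv_pair_dg: "inv_pair n (dg n l) (dg n (\<lambda>i. - l i))"
proof -
  have "dg n l * dg n (\<lambda>i. - l i) = 1\<^sub>m n" for l
    unfolding dg_mult_left[OF dg_carrier] by (rule eq_matI) (auto simp: dg_def tp_inv)
  from this[of l] this[of "\<lambda>i. - l i"] show ?thesis by (simp add: inv_pair_def)
qed

lemma gauges_dg: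
  assumes "B \<in> carrier_mat n n"
  shows "gauges theta n B (dg n l)
    (mat n n (\<lambda>(i, j). tp (l j - l i) * B $$ (i, j) + (if i = j then of_int (l i) else 0)))"
proof -
  have "B * dg n l + map_mat theta (dg n l) = dg n l *
      mat n n (\<lambda>(i, j). tp (l j - l i) * B $$ (i, j) + (if i = j then of_int (l i) else 0))"
    unfolding dg_mult_right[OF assms]
    by (subst dg_mult_left)
       (auto intro!: eq_matI simp: dg_def theta_tp distrib_left mult.assoc[symmetric] tp_add[symmetric] mult.commute)
  then show ?thesis using assms by (simp add: gauges_def)
qed

section \<open>Rational functions on the projective line\<close>

definition ev :: "P1 \<Rightarrow> complex poly \<Rightarrow> complex fls" where
  "ev p a = poly (map_poly fls_const a) (coord_at p)"

lemma ev_0 [simp]: "ev p 0 = 0" by (simp add: ev_def)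

lemma ev_pCons: "ev p (pCons c a) = fls_const c + coord_at p * ev p a"
  by (simp add: ev_def map_poly_pCons)

lemma ev_add: "ev p (a + b) = ev p a + ev p b"
  by (induction a b rule: poly_induct2) (simp_all add: ev_pCons distrib_left fls_plus_const[symmetric])

lemma ev_smult: "ev p (smult c a) = fls_const c * ev p a"
  by (induction a) (simp_all add: ev_pCons distrib_left mult.left_commute)

lemma ev_mult: "ev p (a * b) = ev p a * ev p b"
  by (induction a) (simp_all add: ev_pCons ev_add ev_smult distrib_right mult.assoc)

lemma ev_1 [simp]: "ev p 1 = 1" by (simp add: one_pCons ev_pCons)

lemma ev_linear: "ev p [:- c, 1:] = coord_at p - fls_const c"
  by (simp add: ev_pCons)

definition lin_ord :: "P1 \<Rightarrow> complex \<Rightarrow> int" where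
  "lin_ord p c = (case p of Infinity \<Rightarrow> - 1 | Finite q \<Rightarrow> if q = c then 1 else 0)"

lemma subdegree_linear: "ev p [:- c, 1:] \<noteq> 0" "fls_subdegree (ev p [:- c, 1:]) = lin_ord p c"
proof -
  have "fls_nth (ev p [:- c, 1:]) (lin_ord p c) \<noteq> 0 \<and> (\<forall>k<lin_ord p c. fls_nth (ev p [:- c, 1:]) k = 0)"
    by (cases p) (auto simp: ev_linear lin_ord_def)
  then show "ev p [:- c, 1:] \<noteq> 0" "fls_subdegree (ev p [:- c, 1:]) = lin_ord p c"
    by (auto intro: fls_subdegree_eqI)
qed

text \<open>\<open>R\<close> is the multiset of roots; the divisor of a polynomial consists of its
  roots and a pole of order \<open>size R\<close> at infinity.\<close>

lemma ev_divisor: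
  assumes "a \<noteq> 0"
  obtains R where "\<And>p. ev p a \<noteq> 0"
    "\<And>c. fls_subdegree (ev (Finite c) a) = int (count R c)"
    "fls_subdegree (ev Infinity a) = - int (size R)"
  using assms
proof (induction "degree a" arbitrary: a thesis)
  case 0
  then obtain c where "a = [:c:]" by (metis degree_0_id)
  then show ?case using 0(2)[of "{#}"] 0(3) by (simp add: ev_pCons)
next
  case (Suc d)
  then obtain r where "poly a r = 0"
    using fundamental_theorem_of_algebra[of a] constant_degree[of a] by auto
  then obtain b where b: "a = [:- r, 1:] * b" by (auto simp: poly_eq_0_iff_dvd elim: dvdE)
  have "b \<noteq> 0" using b Suc.prems by auto
  moreover have "degree a = degree [:- r, 1:] + degree b" unfolding b by (rule degree_mult_eq) (use \<open>b \<noteq> 0\<close> in auto)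
  then have "d = degree b" using Suc.hyps by simp
  ultimately obtain R where R: "\<And>p. ev p b \<noteq> 0"
    "\<And>c. fls_subdegree (ev (Finite c) b) = int (count R c)"
    "fls_subdegree (ev Infinity b) = - int (size R)"
    using Suc.hyps(1) by blast
  have "ev p a = ev p [:- r, 1:] * ev p b" for p unfolding b by (rule ev_mult)
  then show ?case
    using R subdegree_linear by (intro Suc.prems(1)[of "add_mset r R"]) (auto simp: lin_ord_def)
qed

lemma ev_nonzero [simp]: "ev p a = 0 \<longleftrightarrow> a = 0"
  using ev_divisor[of a] by (metis ev_0)

lemma quot_of_fract_cases:
  obtains a b where "quot_of_fract f = (a, b)" "b \<noteq> 0" "f = Fract a b"
proof -
  obtain a b where "quot_of_fract f = (a, b)" by (cases "quot_of_fract f")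
  moreover have "b \<noteq> 0" using snd_quot_of_fract_nonzero[of f] calculation by simp
  moreover have "f = Fract a b"
    using Fract_quot_of_fract[of f] calculation by simp
  ultimately show ?thesis using that by blast
qed

lemma expand_Fract:
  assumes "b \<noteq> 0"
  shows "expand p (Fract a b) = ev p a / ev p b"
proof -
  obtain a' b' where q: "quot_of_fract (Fract a b) = (a', b')" "b' \<noteq> 0" "Fract a b = Fract a' b'"
    by (rule quot_of_fract_cases)
  then have "a * b' = a' * b" using assms by (simp add: eq_fract)
  then have "ev p a * ev p b' = ev p a' * ev p b" by (simp flip: ev_mult)
  moreover have "expand p (Fract a b) = ev p a' / ev p b'" by (simp add: expand_def q(1) ev_def)
  ultimately show ?thesis using assms q(2) by (simp add: frac_eq_eq)
qed

lemma expand_add: "expand p (f + g) = expand p f + expand p g"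
  by (cases f; cases g) (simp add: expand_Fract ev_add ev_mult add_frac_eq mult.commute)

lemma expand_mult: "expand p (f * g) = expand p f * expand p g"
  by (cases f; cases g) (simp add: expand_Fract ev_mult)

lemma expand_0 [simp]: "expand p 0 = 0" by (simp add: Zero_fract_def expand_Fract)

lemma expand_1 [simp]: "expand p 1 = 1" by (simp add: One_fract_def expand_Fract)

lemma expand_eq_0_iff [simp]: "expand p f = 0 \<longleftrightarrow> f = 0"
  by (cases f) (simp add: expand_Fract Zero_fract_def eq_fract)

lemma expand_uminus: "expand p (- f) = - expand p f"
  using expand_add[of p f "- f"] by (simp add: eq_neg_iff_add_eq_0 add.commute)

lemma expand_diff: "expand p (f - g) = expand p f - expand p g"
  using expand_add[of p f "- g"] by (simp add: expand_uminus)

lemma expand_inj: "expand p f = expand p g \<Longrightarrow> f = g"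
  using expand_diff[of p f g] by simp

lemma expand_sum: "expand p (\<Sum>i\<in>S. f i) = (\<Sum>i\<in>S. expand p (f i))"
  by (induction S rule: infinite_finite_induct) (auto simp: expand_add)

lemma expand_prod: "expand p (\<Prod>i\<in>S. f i) = (\<Prod>i\<in>S. expand p (f i))"
  by (induction S rule: infinite_finite_induct) (auto simp: expand_mult)

lemma expand_power: "expand p (f ^ n) = expand p f ^ n"
  by (induction n) (auto simp: expand_mult)

lemma expand_divide: "expand p (f / g) = expand p f / expand p g"
proof (cases "g = 0")
  case False
  then have "expand p (f / g) * expand p g = expand p f" by (simp flip: expand_mult)
  then show ?thesis using False by (simp add: eq_divide_eq)
qed simp

lemma expand_power_int: "expand p (f powi k) = expand p f powi k"
  by (simp add: power_int_def expand_power inverse_eq_divide expand_divide)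

definition cst :: "complex \<Rightarrow> ratfun" where "cst c = Fract [:c:] 1"

lemma expand_cst [simp]: "expand p (cst c) = fls_const c"
  by (simp add: cst_def expand_Fract ev_pCons)

lemma ev_deriv: "fls_deriv (ev p a) = ev p (pderiv a) * fls_deriv (coord_at p)"
  by (induction a) (simp_all add: ev_pCons pderiv_pCons ev_add algebra_simps)

lemma expand_deriv: "fls_deriv (expand p f) = expand p (rat_deriv f) * fls_deriv (coord_at p)"
proof -
  obtain a b where q: "quot_of_fract f = (a, b)" "b \<noteq> 0" "f = Fract a b" by (rule quot_of_fract_cases)
  define F where "F = expand p f"
  have B: "ev p b \<noteq> 0" using q by simp
  have FB: "F * ev p b = ev p a" using q B by (simp add: F_def expand_Fract)
  then have "fls_deriv (F * ev p b) = fls_deriv (ev p a)" by simp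
  then have s: "fls_deriv F * ev p b = (ev p (pderiv a) - F * ev p (pderiv b)) * fls_deriv (coord_at p)"
    by (simp add: ev_deriv algebra_simps)
  have "fls_deriv F * ev p b * ev p b = (ev p (pderiv a) * ev p b - (F * ev p b) * ev p (pderiv b)) * fls_deriv (coord_at p)"
    unfolding s by (simp add: algebra_simps)
  then have 1: "fls_deriv F * ev p (b ^ 2) = ev p (pderiv a * b + smult (-1) (a * pderiv b)) * fls_deriv (coord_at p)"
    unfolding FB by (simp only: ev_add ev_mult ev_smult power2_eq_square mult.assoc) simp
  have r: "expand p (rat_deriv f) = ev p (pderiv a * b + smult (-1) (a * pderiv b)) / ev p (b ^ 2)"
    using q by (simp add: rat_deriv_def expand_Fract)
  have "fls_deriv F = ev p (pderiv a * b + smult (-1) (a * pderiv b)) * fls_deriv (coord_at p) / ev p (b ^ 2)"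
    using q(2) by (subst 1[symmetric]) simp
  then show ?thesis unfolding F_def[symmetric] r by simp
qed

lemma derivation_rat_deriv: "derivation rat_deriv"
proof -
  have e: "expand (Finite 0) (rat_deriv f) = fls_deriv (expand (Finite 0) f)" for f
    using expand_deriv[of "Finite 0" f] by simp
  show ?thesis unfolding derivation_def
    by (intro conjI allI; rule expand_inj[of "Finite 0"]) (simp_all add: e expand_add expand_mult)
qed

text \<open>The derivation \<open>t d/dt\<close> is \<open>t (dz/dt) d/dz\<close>.\<close>

definition tdz :: "P1 \<Rightarrow> complex fls" where
  "tdz p = fls_X * fls_deriv (coord_at p)"

lemma theta_expand: "theta (expand p f) = tdz p * expand p (rat_deriv f)"
  by (simp add: theta_def tdz_def expand_deriv mult_ac)

lemma tdz_Finite: "tdz (Finite c) = tp 1" by (simp add: tdz_def tp_1)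

lemma tdz_Infinity: "tdz Infinity = - tp (- 1)"
  by (rule fls_eqI) (simp add: tdz_def nth_tp fls_X_times_conv_shift power2_eq_square fls_X_inv_times_conv_shift)

text \<open>The scalar in \<open>delta\<close> is t dz/dt: apply \<open>theta_expand\<close> to the
  local parameter, which theta fixes.\<close>

lemma expand_delta_factor:
  "expand p (local_param p / rat_deriv (local_param p)) = tdz p"
proof -
  have lp: "expand p (local_param p) = fls_X"
    by (cases p) (simp_all add: expand_Fract ev_pCons fls_inverse_X_inv[unfolded inverse_eq_divide] fls_X_conv_shift_1)
  have "theta fls_X = tdz p * expand p (rat_deriv (local_param p))"
    using theta_expand[of p "local_param p"] lp by simp
  moreover have "theta fls_X = fls_X" by (simp add: theta_def)
  ultimately have e: "fls_X = tdz p * expand p (rat_deriv (local_param p))" by simp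
  then have "expand p (rat_deriv (local_param p)) \<noteq> 0" by (metis fls_X_nonzero mult_zero_right)
  then show ?thesis unfolding expand_divide lp using e by (metis nonzero_mult_div_cancel_right)
qed

text \<open>On the projective line any two points are linearly equivalent: u has the divisor [p] -
  [p0].\<close>

lemma uniformizer_exists:
  assumes "p \<noteq> p0"
  obtains u where "u \<noteq> 0" "fls_subdegree (expand p u) = 1" "fls_subdegree (expand p0 u) = - 1"
    "\<And>q. q \<noteq> p \<Longrightarrow> q \<noteq> p0 \<Longrightarrow> fls_subdegree (expand q u) = 0"
proof -
  define l where "l c = Fract [:- c, 1:] 1" for c :: complex
  have l: "fls_subdegree (expand q (l c)) = lin_ord q c" "l c \<noteq> 0" for q c
  proof -
    have "expand q (l c) = ev q [:- c, 1:]" by (simp add: l_def expand_Fract)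
    then show "fls_subdegree (expand q (l c)) = lin_ord q c" using subdegree_linear by simp
    have "expand q (l c) \<noteq> 0" using \<open>expand q (l c) = _\<close> subdegree_linear by simp
    then show "l c \<noteq> 0" by auto
  qed
  consider a where "p0 = Infinity" "p = Finite a" | a b where "p0 = Finite b" "p = Finite a" "a \<noteq> b"
    | b where "p0 = Finite b" "p = Infinity"
    using assms by (cases p; cases p0) auto
  then show ?thesis
  proof cases
    case 1
    show ?thesis by (rule that[of "l a"]) (use 1 l in \<open>auto simp: lin_ord_def split: P1.splits\<close>)
  next
    case 2
    have s: "fls_subdegree (expand q (l a / l b)) = lin_ord q a - lin_ord q b" for q
      using l by (simp add: expand_divide fls_divide_subdegree)
    show ?thesis by (rule that[of "l a / l b"]) (use 2 l in \<open>auto simp: s lin_ord_def split: P1.splits\<close>)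
  next
    case 3
    have s: "fls_subdegree (expand q (1 / l b)) = - lin_ord q b" for q
      using l by (simp add: expand_divide fls_divide_subdegree)
    show ?thesis by (rule that[of "1 / l b"]) (use 3 l in \<open>auto simp: s lin_ord_def split: P1.splits\<close>)
  qed
qed

text \<open>The divisor of a non-zero f has degree 0. If it is nowhere negative, it is 0, and f has
  no zero.\<close>

lemma no_nonconstant_regular:
  assumes reg: "\<And>p. vge 0 (expand p f)" and zero: "vge 1 (expand p0 f)"
  shows "f = 0"
proof (rule ccontr)
  assume f: "f \<noteq> 0"
  obtain a b where q: "b \<noteq> 0" "f = Fract a b" by (rule quot_of_fract_cases)
  have "a \<noteq> 0" using f q by (auto simp: Zero_fract_def eq_fract)
  obtain R where R: "\<And>p. ev p a \<noteq> 0" "\<And>c. fls_subdegree (ev (Finite c) a) = int (count R c)"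
    "fls_subdegree (ev Infinity a) = - int (size R)" using ev_divisor[OF \<open>a \<noteq> 0\<close>] by blast
  obtain R' where R': "\<And>p. ev p b \<noteq> 0" "\<And>c. fls_subdegree (ev (Finite c) b) = int (count R' c)"
    "fls_subdegree (ev Infinity b) = - int (size R')" using ev_divisor[OF q(1)] by blast
  have s: "fls_subdegree (expand p f) = fls_subdegree (ev p a) - fls_subdegree (ev p b)" for p
    using q R(1) R'(1) by (simp add: expand_Fract fls_divide_subdegree)
  have nn: "fls_subdegree (ev p a) \<ge> fls_subdegree (ev p b)" for p
    using reg[of p] s[of p] by (simp add: vge_0_iff)
  have "R' \<subseteq># R" by (rule mset_subset_eqI) (use nn[of "Finite _"] R R' in simp)
  moreover have "size R \<le> size R'" using nn[of Infinity] R R' by simp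
  ultimately have "R = R'" by (metis mset_subset_size not_le subset_mset.le_neq_trans)
  then have "fls_subdegree (expand p0 f) = 0" using s R R' by (cases p0) simp_all
  then show False using zero f by (simp add: vge_iff)
qed

lemma finite_poles: "finite {p. \<not> vge 0 (expand p f)}"
proof -
  obtain a b where q: "b \<noteq> 0" "f = Fract a b" by (rule quot_of_fract_cases)
  obtain R' where R': "\<And>p. ev p b \<noteq> 0" "\<And>c. fls_subdegree (ev (Finite c) b) = int (count R' c)"
    "fls_subdegree (ev Infinity b) = - int (size R')" using ev_divisor[OF q(1)] by blast
  have "vge 0 (expand (Finite c) f)" if "c \<notin># R'" for c
  proof (cases "a = 0")
    case True then show ?thesis using q by (simp add: expand_Fract)
  next
    case False
    obtain R where "\<And>p. ev p a \<noteq> 0" "\<And>c. fls_subdegree (ev (Finite c) a) = int (count R c)"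
      using ev_divisor[OF False] by metis
    then show ?thesis using q R' that by (simp add: vge_0_iff expand_Fract fls_divide_subdegree not_in_iff)
  qed
  then have "{p. \<not> vge 0 (expand p f)} \<subseteq> insert Infinity (Finite ` set_mset R')"
    by (auto simp: image_iff) (metis P1.exhaust)
  then show ?thesis by (rule finite_subset) simp
qed

text \<open>Leading terms of x are removed one after the other by multiples of the functions
  \<open>h k\<close>. P stands for the conditions at the other points that the approximating
  function has to keep.\<close>

lemma approximation:
  assumes h: "\<And>k. k < N \<Longrightarrow> h k \<noteq> 0 \<and> fls_subdegree (expand p (h k)) = k"
    and P: "P 0" "\<And>f g. P f \<Longrightarrow> P g \<Longrightarrow> P (f + g)" "\<And>k c. k < N \<Longrightarrow> P (cst c * h k)"
  obtains f where "P f" "vge N (x - expand p f)"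
proof -
  have "\<exists>f. P f \<and> vge N (x - expand p f)" if "vge M x" for M x
    using that
  proof (induction "nat (N - M)" arbitrary: M x)
    case 0
    then show ?case using P(1) by (intro exI[of _ 0]) (auto intro: vge_mono)
  next
    case (Suc d)
    then have M: "M < N" by simp
    define c where "c = fls_nth x M / fls_nth (expand p (h M)) M"
    have hM: "fls_nth (expand p (h M)) M \<noteq> 0" "\<And>k. k < M \<Longrightarrow> fls_nth (expand p (h M)) k = 0"
      using h[OF M] by (metis expand_eq_0_iff nth_fls_subdegree_nonzero, metis fls_eq0_below_subdegree)
    have "vge (M + 1) (x - expand p (cst c * h M))"
      unfolding vge_def
    proof (intro allI impI)
      fix k assume "k < M + 1"
      then consider "k < M" | "k = M" by linarith
      then show "fls_nth (x - expand p (cst c * h M)) k = 0"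
        using hM Suc.prems by cases (auto simp: expand_mult c_def vge_def)
    qed
    moreover have "d = nat (N - (M + 1))" using Suc.hyps(2) by simp
    ultimately obtain f where "P f" "vge N (x - expand p (cst c * h M) - expand p f)"
      using Suc.hyps(1) by blast
    then show ?case using P(2)[OF P(3)[OF M, of c]] by (intro exI[of _ "cst c * h M + f"]) (simp add: expand_add diff_diff_eq)
  qed
  then show ?thesis using that vge_ex by blast
qed

section \<open>Lattices\<close>

definition mvge :: "int \<Rightarrow> nat \<Rightarrow> complex fls mat \<Rightarrow> bool" where
  "mvge N n A \<longleftrightarrow> (\<forall>i<n. \<forall>j<n. vge N (A $$ (i, j)))"

lemma mvge_add: "A \<in> carrier_mat n n \<Longrightarrow> B \<in> carrier_mat n n \<Longrightarrow> mvge N n A \<Longrightarrow> mvge N n B \<Longrightarrow> mvge N n (A + B)"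
  by (auto simp: mvge_def intro: vge_add)

lemma mvge_mult:
  assumes "A \<in> carrier_mat n n" "B \<in> carrier_mat n n" "mvge M n A" "mvge N n B"
  shows "mvge (M + N) n (A * B)"
  using assms by (auto simp: mvge_def scalar_prod_def intro!: vge_sum vge_mult)

lemma mvge_mult0:
  assumes "A \<in> carrier_mat n n" "B \<in> carrier_mat n n" "mvge 0 n A" "mvge N n B"
  shows "mvge N n (A * B)"
  using mvge_mult[OF assms] by simp

lemma mvge_ex:
  obtains N where "N \<ge> 0" "mvge (- N) n A"
proof -
  have "\<forall>i j. \<exists>v. vge v (A $$ (i, j))" using vge_ex by blast
  then obtain v where v: "\<And>i j. vge (v i j) (A $$ (i, j))" by metis
  define N where "N = (\<Sum>i<n. \<Sum>j<n. \<bar>v i j\<bar>)"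
  have "- N \<le> v i j" if "i < n" "j < n" for i j
  proof -
    have "\<bar>v i j\<bar> \<le> (\<Sum>j<n. \<bar>v i j\<bar>)" using that by (intro member_le_sum) auto
    also have "\<dots> \<le> N" unfolding N_def using that
      by (intro member_le_sum[of i "{..<n}" "\<lambda>i. \<Sum>j<n. \<bar>v i j\<bar>"]) (auto intro: sum_nonneg)
    finally show ?thesis by linarith
  qed
  then have "mvge (- N) n A" by (auto simp: mvge_def intro!: vge_mono[OF v])
  moreover have "N \<ge> 0" by (auto simp: N_def intro!: sum_nonneg)
  ultimately show ?thesis by (rule that[rotated])
qed

lemma vge_prod: "(\<And>i. i \<in> S \<Longrightarrow> vge 0 (f i)) \<Longrightarrow> vge 0 (\<Prod>i\<in>S. f i)"
  by (induction S rule: infinite_finite_induct) (auto intro: vge_mult0)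

lemma vge_det:
  assumes "A \<in> carrier_mat n n" "mvge 0 n A"
  shows "vge 0 (det A)"
proof -
  have "vge 0 (signof p)" for p :: "nat \<Rightarrow> nat" by (simp add: sign_def vge_uminus)
  moreover have "vge 0 (\<Prod>i = 0..<n. A $$ (i, p i))" if "p permutes {0..<n}" for p
    using assms(2) permutes_in_image[OF that] by (intro vge_prod) (auto simp: mvge_def)
  ultimately show ?thesis using assms(1)
    by (auto simp: det_def intro!: vge_sum vge_mult0)
qed

text \<open>P lies in GL_n(C[[t]]) with inverse Q, so it changes one basis of a lattice into
  another.\<close>

definition int_pair :: "nat \<Rightarrow> complex fls mat \<Rightarrow> complex fls mat \<Rightarrow> bool" where
  "int_pair n P Q \<longleftrightarrow> inv_pair n P Q \<and> mvge 0 n P \<and> mvge 0 n Q"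

lemma int_pair_mult: "int_pair n P Q \<Longrightarrow> int_pair n P' Q' \<Longrightarrow> int_pair n (P * P') (Q' * Q)"
  unfolding int_pair_def using inv_pair_mult[of n P Q P' Q'] by (auto simp: inv_pair_def intro: mvge_mult0)

lemma int_pair_det:
  assumes "int_pair n P Q"
  shows "det P \<noteq> 0" "fls_subdegree (det P) = 0"
proof -
  have d: "det P * det Q = 1" using assms by (auto simp: int_pair_def inv_pair_det)
  then show nz: "det P \<noteq> 0" by auto
  have "det Q \<noteq> 0" using d by auto
  have "fls_subdegree (det P) + fls_subdegree (det Q) = 0"
    using d nz \<open>det Q \<noteq> 0\<close> by (metis fls_one_subdegree fls_subdegree_mult)
  moreover have "fls_subdegree (det P) \<ge> 0" "fls_subdegree (det Q) \<ge> 0"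
    using assms vge_det[of P n] vge_det[of Q n] by (auto simp: int_pair_def inv_pair_def vge_0_iff)
  ultimately show "fls_subdegree (det P) = 0" by simp
qed

text \<open>Cramer's rule: the adjugate has integral entries and the determinant is a unit.\<close>

lemma int_pair_of_det:
  assumes P: "P \<in> carrier_mat n n" "mvge 0 n P" "inv_pair n P Q" and d: "fls_subdegree (det P) = 0"
  shows "int_pair n P Q"
proof -
  have Qc: "Q \<in> carrier_mat n n" using P by (simp add: inv_pair_def)
  have d0: "det P \<noteq> 0" using inv_pair_det[OF P(3)] by auto
  have ac: "adj_mat P \<in> carrier_mat n n" using adj_mat(1)[OF P(1)] .
  have "adj_mat P = Q * (P * adj_mat P)"
    using inv_pair_cancel[OF inv_pair_sym[OF P(3)] ac] by simp
  also have "P * adj_mat P = det P \<cdot>\<^sub>m 1\<^sub>m n" using adj_mat(2)[OF P(1)] .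
  also have "Q * (det P \<cdot>\<^sub>m 1\<^sub>m n) = det P \<cdot>\<^sub>m Q" using Qc by (simp add: mult_smult_distrib[of _ n n _ n])
  finally have aQ: "adj_mat P = det P \<cdot>\<^sub>m Q" .
  have "vge 0 (Q $$ (i, j))" if ij: "i < n" "j < n" for i j
  proof -
    have "vge 0 (det (mat_delete P j i))"
    proof (rule vge_det)
      show "mat_delete P j i \<in> carrier_mat (n - 1) (n - 1)" using P(1) by (rule mat_delete_carrier)
      show "mvge 0 (n - 1) (mat_delete P j i)"
        using P(1,2) by (auto simp: mvge_def mat_delete_def)
    qed
    then have "vge 0 (cofactor P j i)"
      unfolding cofactor_def by (intro vge_mult0 vge_power vge_uminus) auto
    then have "vge 0 (det P * Q $$ (i, j))"
      using arg_cong[OF aQ, of "\<lambda>M. M $$ (i, j)"] ij P(1) Qc by (simp add: adj_mat_def)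
    then show ?thesis using d d0 by (cases "Q $$ (i, j) = 0") (auto simp: vge_iff)
  qed
  then show ?thesis using P by (auto simp: int_pair_def mvge_def)
qed

text \<open>The term theta P has order at least 1 because theta kills constants. This explains the
  bound N <= 1, which still covers points where the connection has no pole.\<close>

lemma gauge_int_pair:
  assumes P: "int_pair n P Q" and g: "gauges theta n B P C" and B: "mvge N n B" "N \<le> 1"
  shows "mvge N n C"
proof -
  have c: "P \<in> carrier_mat n n" "Q \<in> carrier_mat n n" "B \<in> carrier_mat n n"
    using P g by (auto simp: int_pair_def inv_pair_def gauges_def)
  have "mvge (N + 0) n (B * P)" using P B c by (intro mvge_mult) (auto simp: int_pair_def)
  moreover have "mvge N n (map_mat theta P)"
    using P c B(2) by (auto simp: int_pair_def mvge_def intro: vge_mono[OF vge_theta_1])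
  ultimately have "mvge N n (B * P + map_mat theta P)" using c by (intro mvge_add) auto
  then have "mvge N n (Q * (B * P + map_mat theta P))" using P c by (intro mvge_mult0) (auto simp: int_pair_def)
  then show ?thesis using gauges_eq[OF _ g] P by (auto simp: int_pair_def)
qed

text \<open>A C[[t]]-module between two multiples of the standard one. Only the first n coordinates
  influence membership.\<close>

definition lattice :: "nat \<Rightarrow> fvec set \<Rightarrow> bool" where
  "lattice n \<Lambda> \<longleftrightarrow> (\<forall>x\<in>\<Lambda>. \<forall>y\<in>\<Lambda>. (\<lambda>i. x i + y i) \<in> \<Lambda>) \<and> (\<forall>f. \<forall>x\<in>\<Lambda>. vge 0 f \<longrightarrow> (\<lambda>i. f * x i) \<in> \<Lambda>) \<and>
     (\<exists>N. (\<forall>x. (\<forall>i<n. vge N (x i)) \<longrightarrow> x \<in> \<Lambda>) \<and> (\<forall>x\<in>\<Lambda>. \<forall>i<n. vge (- N) (x i)))"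

lemma lattice_add: "lattice n \<Lambda> \<Longrightarrow> x \<in> \<Lambda> \<Longrightarrow> y \<in> \<Lambda> \<Longrightarrow> (\<lambda>i. x i + y i) \<in> \<Lambda>"
  and lattice_smult: "lattice n \<Lambda> \<Longrightarrow> vge 0 f \<Longrightarrow> x \<in> \<Lambda> \<Longrightarrow> (\<lambda>i. f * x i) \<in> \<Lambda>"
  by (auto simp: lattice_def)

definition off_regular :: "P1 set \<Rightarrow> ratfun \<Rightarrow> bool" where
  "off_regular S f \<longleftrightarrow> (\<forall>q. q \<notin> S \<longrightarrow> vge 0 (expand q f))"

lemma off_regular_add: "off_regular S f \<Longrightarrow> off_regular S g \<Longrightarrow> off_regular S (f + g)"
  by (auto simp: off_regular_def expand_add intro: vge_add)

lemma off_regular_mult: "off_regular S f \<Longrightarrow> off_regular S g \<Longrightarrow> off_regular S (f * g)"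
  by (auto simp: off_regular_def expand_mult intro: vge_mult0)

lemma off_regular_0 [simp]: "off_regular S 0" and off_regular_1 [simp]: "off_regular S 1"
  and off_regular_cst [simp]: "off_regular S (cst c)"
  by (auto simp: off_regular_def)

text \<open>The order of the j-th coordinate is bounded below on the lattice, so a minimum is
  attained. It is a pivot of the Hermite normal form.\<close>

lemma lattice_pivot:
  assumes L: "lattice n \<Lambda>" and j: "j < n"
  obtains x k where "x \<in> \<Lambda>" "\<And>i. j < i \<Longrightarrow> i < n \<Longrightarrow> x i = 0" "x j \<noteq> 0" "fls_subdegree (x j) = k"
    "\<And>y. y \<in> \<Lambda> \<Longrightarrow> (\<And>i. j < i \<Longrightarrow> i < n \<Longrightarrow> y i = 0) \<Longrightarrow> vge k (y j)"
proof -
  from L obtain N where "\<forall>x. (\<forall>i<n. vge N (x i)) \<longrightarrow> x \<in> \<Lambda>" "\<forall>x\<in>\<Lambda>. \<forall>i<n. vge (- N) (x i)"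
    unfolding lattice_def by blast
  then have N: "\<And>x. (\<forall>i<n. vge N (x i)) \<Longrightarrow> x \<in> \<Lambda>" "\<And>x i. x \<in> \<Lambda> \<Longrightarrow> i < n \<Longrightarrow> vge (- N) (x i)"
    by blast+
  define S where "S = {x \<in> \<Lambda>. (\<forall>i. j < i \<longrightarrow> i < n \<longrightarrow> x i = 0) \<and> x j \<noteq> 0}"
  have "(\<lambda>i. if i = j then tp N else 0) \<in> S" unfolding S_def by (auto intro!: N(1))
  then have "\<exists>s x. x \<in> S \<and> nat (fls_subdegree (x j) + N) = s" by blast
  then obtain s where s: "\<exists>x. x \<in> S \<and> nat (fls_subdegree (x j) + N) = s"
    "\<And>s'. s' < s \<Longrightarrow> \<not> (\<exists>x. x \<in> S \<and> nat (fls_subdegree (x j) + N) = s')"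
    using exists_least_iff[of "\<lambda>s. \<exists>x. x \<in> S \<and> nat (fls_subdegree (x j) + N) = s"] by blast
  then obtain x where x: "x \<in> S" "nat (fls_subdegree (x j) + N) = s" by blast
  have lb: "fls_subdegree (y j) + N \<ge> 0" if "y \<in> S" for y
    using N(2)[of y j] that j by (auto simp: S_def vge_iff)
  show ?thesis
  proof (rule that[of x "fls_subdegree (x j)"])
    fix y assume y: "y \<in> \<Lambda>" "\<And>i. j < i \<Longrightarrow> i < n \<Longrightarrow> y i = 0"
    show "vge (fls_subdegree (x j)) (y j)"
    proof (cases "y j = 0")
      case False
      then have yS: "y \<in> S" using y by (simp add: S_def)
      then have "\<not> nat (fls_subdegree (y j) + N) < s" using s(2) by blast
      then show ?thesis using lb[OF yS] lb[OF x(1)] x(2) by (auto simp: vge_iff)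
    qed simp
  qed (use x in \<open>auto simp: S_def\<close>)
qed

lemma expand_hom_det:
  assumes "A \<in> carrier_mat n n"
  shows "expand p (det A) = det (map_mat (expand p) A)"
proof -
  have "expand p (signof s * (\<Prod>i = 0..<n. A $$ (i, s i))) = signof s * (\<Prod>i = 0..<n. map_mat (expand p) A $$ (i, s i))"
    if "s permutes {0..<n}" for s
  proof -
    have "expand p (signof s) = signof s" by (simp add: sign_def expand_uminus)
    moreover have "(\<Prod>i = 0..<n. map_mat (expand p) A $$ (i, s i)) = (\<Prod>i = 0..<n. expand p (A $$ (i, s i)))"
      using assms permutes_in_image[OF that] by (intro prod.cong) auto
    ultimately show ?thesis by (simp add: expand_mult expand_prod)
  qed
  then show ?thesis using assms by (simp add: det_def expand_sum)
qed

lemma inv_pair_expand: "inv_pair n T S \<Longrightarrow> inv_pair n (map_mat (expand p) T) (map_mat (expand p) S)"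
  by (rule inv_pair_hom) (auto simp: expand_add expand_mult)

lemma map_mat_expand_mult:
  "A \<in> carrier_mat n n \<Longrightarrow> B \<in> carrier_mat n n \<Longrightarrow> map_mat (expand p) (A * B) = map_mat (expand p) A * map_mat (expand p) B"
  by (rule map_mat_hom_mult) (auto simp: expand_add expand_mult)

text \<open>Triangular bases of a lattice can be truncated without leaving the lattice, so that they are
  defined over the rational functions; their determinant is a power of the uniformizer.\<close>

lemma lattice_basis:
  assumes L: "lattice n \<Lambda>" and p: "p \<noteq> p0"
  obtains H HI where "inv_pair n H HI"
    "\<And>q. q \<noteq> p \<Longrightarrow> q \<noteq> p0 \<Longrightarrow> int_pair n (map_mat (expand q) H) (map_mat (expand q) HI)"
    "\<And>j. j < n \<Longrightarrow> (\<lambda>i. if i < n then expand p (H $$ (i, j)) else 0) \<in> \<Lambda>"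
    "\<And>x i. x \<in> \<Lambda> \<Longrightarrow> i < n \<Longrightarrow> vge 0 (\<Sum>j<n. expand p (HI $$ (i, j)) * x j)"
proof -
  obtain u where u: "u \<noteq> 0" "fls_subdegree (expand p u) = 1" "fls_subdegree (expand p0 u) = - 1"
    "\<And>q. q \<noteq> p \<Longrightarrow> q \<noteq> p0 \<Longrightarrow> fls_subdegree (expand q u) = 0" using uniformizer_exists[OF p] by metis
  have upow: "u powi k \<noteq> 0" "fls_subdegree (expand q (u powi k)) = k * fls_subdegree (expand q u)" for q k
    using u(1) by (auto simp: expand_power_int)
  from L obtain N where "\<forall>x. (\<forall>i<n. vge N (x i)) \<longrightarrow> x \<in> \<Lambda>" "\<forall>x\<in>\<Lambda>. \<forall>i<n. vge (- N) (x i)"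
    unfolding lattice_def by blast
  then have N: "\<And>x. (\<forall>i<n. vge N (x i)) \<Longrightarrow> x \<in> \<Lambda>" "\<And>x i. x \<in> \<Lambda> \<Longrightarrow> i < n \<Longrightarrow> vge (- N) (x i)"
    by blast+
  have upow_reg: "off_regular {p, p0} (u powi k)" for k
    using u(4) by (auto simp: off_regular_def vge_0_iff upow)
  define Q where "Q j c k \<longleftrightarrow> (\<forall>i<n. off_regular {p, p0} (c i)) \<and> (\<forall>i. j < i \<longrightarrow> c i = 0) \<and> c j = u powi k \<and>
      (\<lambda>i. if i < n then expand p (c i) else 0) \<in> \<Lambda> \<and>
      (\<forall>y. y \<in> \<Lambda> \<longrightarrow> (\<forall>i. j < i \<longrightarrow> i < n \<longrightarrow> y i = 0) \<longrightarrow> vge k (y j))" for j c k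
  have "\<exists>c k. Q j c k" if j: "j < n" for j
  proof -
    obtain x k where x: "x \<in> \<Lambda>" "\<And>i. j < i \<Longrightarrow> i < n \<Longrightarrow> x i = 0" "x j \<noteq> 0" "fls_subdegree (x j) = k"
      "\<And>y. y \<in> \<Lambda> \<Longrightarrow> (\<And>i. j < i \<Longrightarrow> i < n \<Longrightarrow> y i = 0) \<Longrightarrow> vge k (y j)"
      using lattice_pivot[OF L j] by metis
    \<comment> \<open>This factor turns the pivot into a power of the global function u; it is
      integral because both have order k.\<close>
    define g where "g = expand p (u powi k) / x j"
    have "vge 0 g" using vge_divide[of k "expand p (u powi k)" "x j"] x(3,4) upow u(2) by (simp add: g_def vge_iff)
    then have gx: "(\<lambda>i. g * x i) \<in> \<Lambda>" using lattice_smult[OF L] x(1) by blast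
    \<comment> \<open>Changes of order N stay in the lattice, so the entries with index below j may
      be replaced by rational functions.\<close>
    have "\<exists>f. off_regular {p, p0} f \<and> vge N (g * x i - expand p f)" for i
      using approximation[of N "\<lambda>k. u powi k" p "off_regular {p, p0}" "g * x i"]
        upow u(2) upow_reg off_regular_add off_regular_mult by (metis mult.right_neutral off_regular_0 off_regular_cst)
    then obtain f where f: "\<And>i. off_regular {p, p0} (f i)" "\<And>i. vge N (g * x i - expand p (f i))" by metis
    define c where "c i = (if i < j then f i else if i = j then u powi k else 0)" for i
    have gxj: "g * x j = expand p (u powi k)" using x(3) by (simp add: g_def)
    have "(\<lambda>i. (if i < n then expand p (c i) else 0) - g * x i) \<in> \<Lambda>"
    proof (rule N(1), intro allI impI)
      fix i assume "i < n"
      then show "vge N ((if i < n then expand p (c i) else 0) - g * x i)"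
        using f(2)[of i] vge_uminus[OF f(2)[of i]] gxj x(2)[of i] by (cases i j rule: linorder_cases) (auto simp: c_def)
    qed
    from lattice_add[OF L this gx] have "(\<lambda>i. if i < n then expand p (c i) else 0) \<in> \<Lambda>" by simp
    then show ?thesis unfolding Q_def using f(1) upow_reg x(5) by (intro exI[of _ c] exI[of _ k]) (auto simp: c_def)
  qed
  then obtain c k where "\<And>j. j < n \<Longrightarrow> Q j (c j) (k j)" by metis
  then have c: "\<And>i j. j < n \<Longrightarrow> i < n \<Longrightarrow> off_regular {p, p0} (c j i)" "\<And>i j. j < n \<Longrightarrow> j < i \<Longrightarrow> c j i = 0"
    "\<And>j. j < n \<Longrightarrow> c j j = u powi (k j)"
    "\<And>j. j < n \<Longrightarrow> (\<lambda>i. if i < n then expand p (c j i) else 0) \<in> \<Lambda>"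
    "\<And>y j. j < n \<Longrightarrow> y \<in> \<Lambda> \<Longrightarrow> (\<forall>i. j < i \<longrightarrow> i < n \<longrightarrow> y i = 0) \<Longrightarrow> vge (k j) (y j)"
    unfolding Q_def by blast+
  define H where "H = mat n n (\<lambda>(i, j). c j i)"
  have Hc: "H \<in> carrier_mat n n" by (simp add: H_def)
  have ut: "upper_triangular H" by (auto simp: H_def upper_triangular_def c(2))
  have det: "det H = (\<Prod>i<n. u powi (k i))"
    using det_upper_triangular[OF ut Hc] by (simp add: prod_list_diag_prod H_def atLeast0LessThan c(3))
  have "det H \<noteq> 0" using upow by (simp add: det)
  then obtain HI where HI: "inv_pair n H HI" using inv_pair_of_det[OF Hc] by blast
  have off: "int_pair n (map_mat (expand q) H) (map_mat (expand q) HI)" if q: "q \<noteq> p" "q \<noteq> p0" for q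
  proof (rule int_pair_of_det[OF _ _ inv_pair_expand[OF HI]])
    show "mvge 0 n (map_mat (expand q) H)" using c(1) q by (auto simp: mvge_def H_def off_regular_def)
    have "fls_subdegree (\<Prod>i<n. expand q (u powi (k i))) = (\<Sum>i<n. fls_subdegree (expand q (u powi (k i))))"
      by (rule fls_subdegree_prod) (use upow in auto)
    then show "fls_subdegree (det (map_mat (expand q) H)) = 0"
      using u(4)[OF q] by (simp add: expand_hom_det[OF Hc, symmetric] det expand_prod upow)
  qed (use Hc in auto)
  \<comment> \<open>Elimination from the last coordinate downwards; s bounds the coordinates that
    may still be non-zero.\<close>
  have span: "\<exists>z. (\<forall>j<n. vge 0 (z j)) \<and> (\<forall>i<n. x i = (\<Sum>j<n. expand p (c j i) * z j))"
    if "x \<in> \<Lambda>" "\<forall>i. s \<le> i \<longrightarrow> i < n \<longrightarrow> x i = 0" "s \<le> n" for s x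
    using that
  proof (induction s arbitrary: x)
    case 0
    then show ?case by (intro exI[of _ "\<lambda>_. 0"]) auto
  next
    case (Suc s)
    then have s: "s < n" by simp
    have ck: "fls_subdegree (expand p (c s s)) = k s" "expand p (c s s) \<noteq> 0"
      using c(3)[OF s] upow u(2) by auto
    define zs where "zs = x s / expand p (c s s)"
    have "vge (k s) (x s)" using c(5)[OF s Suc.prems(1)] Suc.prems(2) by (simp add: Suc_le_eq)
    then have zs: "vge 0 zs" using vge_divide[of "k s" "x s" "expand p (c s s)"] ck by (simp add: zs_def)
    define y where "y i = x i + (- zs) * (if i < n then expand p (c s i) else 0)" for i
    have "y \<in> \<Lambda>" unfolding y_def
      by (rule lattice_add[OF L Suc.prems(1) lattice_smult[OF L vge_uminus[OF zs] c(4)[OF s]]])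
    moreover have "y i = 0" if "s \<le> i" "i < n" for i
      using that Suc.prems(2) ck c(2)[OF s, of i] by (cases "i = s") (auto simp: y_def zs_def)
    ultimately obtain z where z: "\<forall>j<n. vge 0 (z j)" "\<forall>i<n. y i = (\<Sum>j<n. expand p (c j i) * z j)"
      using Suc.IH[of y] s by auto
    have "x i = (\<Sum>j<n. expand p (c j i) * (z(s := z s + zs)) j)" if "i < n" for i
    proof -
      have "(\<Sum>j<n. expand p (c j i) * (z(s := z s + zs)) j) = (\<Sum>j<n. expand p (c j i) * z j + (if j = s then expand p (c s i) * zs else 0))"
        by (intro sum.cong) (auto simp: distrib_left)
      also have "\<dots> = y i + expand p (c s i) * zs" using z(2) that s by (simp add: sum.distrib sum.delta)
      finally show ?thesis using that by (simp add: y_def)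
    qed
    then show ?case using z(1) zs by (intro exI[of _ "z(s := z s + zs)"]) (auto intro: vge_add)
  qed
  show ?thesis
  proof (rule that[OF HI off])
    show "(\<lambda>i. if i < n then expand p (H $$ (i, j)) else 0) \<in> \<Lambda>" if "j < n" for j
    proof -
      have "(\<lambda>i. if i < n then expand p (H $$ (i, j)) else 0) = (\<lambda>i. if i < n then expand p (c j i) else 0)"
        using that by (auto simp: H_def)
      then show ?thesis using c(4)[OF that] by simp
    qed
    have HIc: "HI \<in> carrier_mat n n" using HI by (simp add: inv_pair_def)
    fix x i assume x: "x \<in> \<Lambda>" and i: "i < n"
    obtain z where z: "\<forall>j<n. vge 0 (z j)" "\<forall>i<n. x i = (\<Sum>j<n. expand p (c j i) * z j)"
      using span[OF x, of n] by auto
    have "(\<Sum>j<n. expand p (HI $$ (i, j)) * x j) = (\<Sum>j<n. \<Sum>l<n. expand p (HI $$ (i, j)) * expand p (c l j) * z l)"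
      using z(2) by (simp add: sum_distrib_left mult.assoc)
    also have "\<dots> = (\<Sum>l<n. (\<Sum>j<n. expand p (HI $$ (i, j)) * expand p (c l j)) * z l)"
      unfolding sum_distrib_right by (rule sum.swap)
    also have "\<dots> = (\<Sum>l<n. if i = l then z l else 0)"
    proof (rule sum.cong[OF refl])
      fix l assume l: "l \<in> {..<n}"
      have "(\<Sum>j<n. expand p (HI $$ (i, j)) * expand p (c l j)) = expand p ((HI * H) $$ (i, l))"
        using HIc l i by (simp add: H_def scalar_prod_def atLeast0LessThan expand_sum expand_mult)
      then show "(\<Sum>j<n. expand p (HI $$ (i, j)) * expand p (c l j)) * z l = (if i = l then z l else 0)"
        using HI l i by (simp add: inv_pair_def)
    qed
    also have "\<dots> = z i" using i by (simp add: sum.delta')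
    finally show "vge 0 (\<Sum>j<n. expand p (HI $$ (i, j)) * x j)" using z(1) i by simp
  qed
qed

section \<open>Local frames\<close>

text \<open>Descent of a lattice: the vectors over C((t)) that lie in the ramified lattice spanned
  by T form a lattice, which the connection maps into its multiple by t^(-e). Its rational basis H
  is then the required frame. The frame T itself has no counterpart over C((t)).\<close>

lemma local_frame:
  assumes A: "A \<in> carrier_mat n n" and m: "m > 0" and g: "gauges theta n (ramm m A) T B" and i: "inv_pair n T S"
    and B: "\<And>z i. (\<And>j. j < n \<Longrightarrow> vge 0 (z j)) \<Longrightarrow> i < n \<Longrightarrow> vge (- (int m * e)) (theta (z i) + mapp n B z i)"
    and p: "p \<noteq> p0"
  obtains H HI C where "inv_pair n H HI"
    "\<And>q. q \<noteq> p \<Longrightarrow> q \<noteq> p0 \<Longrightarrow> int_pair n (map_mat (expand q) H) (map_mat (expand q) HI)"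
    "gauges theta n A (map_mat (expand p) H) C" "mvge (- e) n C"
proof -
  have c: "T \<in> carrier_mat n n" "S \<in> carrier_mat n n" "B \<in> carrier_mat n n"
    using i g by (auto simp: inv_pair_def gauges_def)
  define L where "L = {y :: fvec. \<forall>i<n. vge 0 (mapp n S (\<lambda>j. ram m (y j)) i)}"
  obtain M where M: "M \<ge> 0" "mvge (- M) n S" by (rule mvge_ex)
  obtain M' where M': "M' \<ge> 0" "mvge (- M') n T" by (rule mvge_ex)
  define N where "N = max M M'"
  have N: "N \<ge> 0" "N \<ge> M" "N \<ge> M'" using M M' by (auto simp: N_def)
  have mN: "int m * N \<ge> N" using m N(1) mult_right_mono[of 1 "int m" N] by simp
  have lat: "lattice n L"
    unfolding lattice_def
  proof (intro conjI ballI allI impI exI[of _ N])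
    fix x y assume "x \<in> L" "y \<in> L"
    then show "(\<lambda>i. x i + y i) \<in> L"
      by (auto simp: L_def mapp_def ram_add distrib_left sum.distrib intro: vge_add)
  next
    fix f x assume "x \<in> L" "vge 0 f"
    moreover have "mapp n S (\<lambda>j. ram m (f * x j)) i = ram m f * mapp n S (\<lambda>j. ram m (x j)) i" for i
      using m by (simp add: mapp_def ram_mult sum_distrib_left mult.left_commute)
    moreover have "vge 0 (ram m f)" using vge_ram[OF m, of 0 f] \<open>vge 0 f\<close> by simp
    ultimately show "(\<lambda>i. f * x i) \<in> L" by (auto simp: L_def intro: vge_mult0)
  next
    fix x :: fvec assume x: "\<forall>i<n. vge N (x i)"
    have "vge (- M + int m * N) (mapp n S (\<lambda>j. ram m (x j)) i)" if "i < n" for i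
      unfolding mapp_def using M(2) x that m by (intro vge_sum vge_mult) (auto simp: mvge_def vge_ram)
    moreover have "0 \<le> - M + int m * N" using mN N by linarith
    ultimately have "vge 0 (mapp n S (\<lambda>j. ram m (x j)) i)" if "i < n" for i
      using that vge_mono by blast
    then show "x \<in> L" by (simp add: L_def)
  next
    fix x l assume x: "x \<in> L" and l: "l < n"
    have "ram m (x l) = mapp n T (mapp n S (\<lambda>j. ram m (x j))) l" using inv_pair_apply[OF i l] by simp
    moreover have "vge (- M' + 0) (mapp n T (mapp n S (\<lambda>j. ram m (x j))) l)"
      unfolding mapp_def[of n T] using M'(2) x l by (intro vge_sum vge_mult) (auto simp: mvge_def L_def)
    ultimately have "vge (int m * - N) (ram m (x l))" using mN N by (auto intro: vge_mono)
    then show "vge (- N) (x l)" using vge_ram[OF m] by blast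
  qed
  have stable: "(\<lambda>i. tp e * (theta (y i) + mapp n A y i)) \<in> L" if y: "y \<in> L" for y
  proof -
    define z where "z = mapp n S (\<lambda>j. ram m (y j))"
    define w where "w i = theta (y i) + mapp n A y i" for i
    have Tz: "mapp n T z i = ram m (y i)" if "i < n" for i
      using inv_pair_apply[OF i that] by (simp add: z_def)
    have rw: "rams m (w i) = mapp n T (\<lambda>l. theta (z l) + mapp n B z l) i" if "i < n" for i
    proof -
      have "rams m (w i) = theta (ram m (y i)) + mapp n (ramm m A) (\<lambda>j. ram m (y j)) i"
        using m A that by (simp add: w_def rams_def ram_add theta_ram mapp_def ram_sum ram_mult distrib_left
            sum_distrib_left mult.assoc)
      also have "\<dots> = theta (mapp n T z i) + mapp n (ramm m A) (mapp n T z) i"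
        using Tz that by (simp add: mapp_def[of n "ramm m A"])
      finally show ?thesis using gauges_action[OF g that] by simp
    qed
    have "vge 0 (mapp n S (\<lambda>j. ram m (tp e * w j)) i)" if l: "i < n" for i
    proof -
      have "of_nat m * mapp n S (\<lambda>j. ram m (tp e * w j)) i = tp (int m * e) * mapp n S (\<lambda>j. rams m (w j)) i"
        using m by (simp add: mapp_def rams_def ram_mult ram_tp sum_distrib_left mult_ac)
      also have "mapp n S (\<lambda>j. rams m (w j)) i = mapp n S (mapp n T (\<lambda>l. theta (z l) + mapp n B z l)) i"
        by (rule mapp_cong) (rule rw)
      also have "\<dots> = theta (z i) + mapp n B z i"
        by (rule inv_pair_apply[OF inv_pair_sym[OF assms(4)] l])
      finally have "of_nat m * mapp n S (\<lambda>j. ram m (tp e * w j)) i = tp (int m * e) * (theta (z i) + mapp n B z i)" .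
      moreover have "vge (- (int m * e)) (theta (z i) + mapp n B z i)"
        by (rule B[OF _ l]) (use y in \<open>simp add: L_def z_def\<close>)
      ultimately have "vge 0 (of_nat m * mapp n S (\<lambda>j. ram m (tp e * w j)) i)" by (simp add: vge_tp_mult)
      then show ?thesis using m by (simp add: vge_def)
    qed
    then show ?thesis by (simp add: L_def w_def)
  qed
  obtain H HI where H: "inv_pair n H HI"
    "\<And>q. q \<noteq> p \<Longrightarrow> q \<noteq> p0 \<Longrightarrow> int_pair n (map_mat (expand q) H) (map_mat (expand q) HI)"
    "\<And>j. j < n \<Longrightarrow> (\<lambda>i. if i < n then expand p (H $$ (i, j)) else 0) \<in> L"
    "\<And>x i. x \<in> L \<Longrightarrow> i < n \<Longrightarrow> vge 0 (\<Sum>j<n. expand p (HI $$ (i, j)) * x j)"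
    by (rule lattice_basis[OF lat p]) (rule that; blast)
  let ?H = "map_mat (expand p) H" and ?HI = "map_mat (expand p) HI"
  define C where "C = ?HI * (A * ?H + map_mat theta ?H)"
  have Hc: "H \<in> carrier_mat n n" "HI \<in> carrier_mat n n" using H(1) by (auto simp: inv_pair_def)
  have "gauges theta n A ?H C" unfolding C_def by (rule gauges_exists[OF inv_pair_expand[OF H(1)] A])
  moreover have "mvge (- e) n C"
    unfolding mvge_def
  proof (intro allI impI)
    fix i j assume ij: "i < n" "j < n"
    define y where "y = (\<lambda>i. if i < n then expand p (H $$ (i, j)) else 0)"
    have col: "(A * ?H + map_mat theta ?H) $$ (l, j) = theta (y l) + mapp n A y l" if "l < n" for l
      using that A Hc ij by (simp add: scalar_prod_def atLeast0LessThan mapp_def y_def add.commute)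
    have "C $$ (i, j) = (\<Sum>l<n. expand p (HI $$ (i, l)) * (A * ?H + map_mat theta ?H) $$ (l, j))"
      using ij A Hc by (simp add: C_def scalar_prod_def atLeast0LessThan del: index_add_mat(1))
    also have "\<dots> = (\<Sum>l<n. expand p (HI $$ (i, l)) * (theta (y l) + mapp n A y l))"
      by (intro sum.cong refl) (use col in auto)
    finally have Cij: "tp e * C $$ (i, j) = (\<Sum>l<n. expand p (HI $$ (i, l)) * (tp e * (theta (y l) + mapp n A y l)))"
      by (simp add: sum_distrib_left mult.left_commute)
    have "vge 0 (tp e * C $$ (i, j))"
      unfolding Cij by (rule H(4)[OF stable ij(1)]) (use H(3)[OF ij(2)] in \<open>simp add: y_def\<close>)
    then show "vge (- e) (C $$ (i, j))" by (simp add: vge_tp_mult)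
  qed
  ultimately show ?thesis using that H by blast
qed


text \<open>After ramification, some lattice is mapped by \<open>\<delta>\<close> into its multiple by \<open>t\<^bsup>-e\<^esup>\<close>. At non-singular
  points this holds for \<open>e = -1\<close>.\<close>

definition locgood :: "nat \<Rightarrow> int \<Rightarrow> complex fls mat \<Rightarrow> bool" where
  "locgood n e A \<longleftrightarrow> (\<exists>m T S B. m > 0 \<and> gauges theta n (ramm m A) T B \<and> inv_pair n T S \<and>
     (\<forall>z i. (\<forall>j<n. vge 0 (z j)) \<longrightarrow> i < n \<longrightarrow> vge (- (int m * e)) (theta (z i) + mapp n B z i)))"

lemma locgood_gauge:
  assumes "locgood n e A" and g: "gauges theta n A X A'" and i: "inv_pair n X Y"
  shows "locgood n e A'"
proof -
  obtain m T S B where m: "m > 0" and T: "gauges theta n (ramm m A) T B" "inv_pair n T S"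
    "\<forall>z i. (\<forall>j<n. vge 0 (z j)) \<longrightarrow> i < n \<longrightarrow> vge (- (int m * e)) (theta (z i) + mapp n B z i)"
    using assms(1) unfolding locgood_def by blast
  have "gauges theta n (ramm m A') (map_mat (ram m) Y) (ramm m A)"
    by (rule gauges_ram[OF m gauges_inverse[OF derivation_theta i g]])
  from gauges_trans[OF derivation_theta this T(1)]
  have "gauges theta n (ramm m A') (map_mat (ram m) Y * T) B" .
  moreover have "inv_pair n (map_mat (ram m) Y * T) (S * map_mat (ram m) X)"
    by (rule inv_pair_mult[OF inv_pair_ram[OF m inv_pair_sym[OF i]] T(2)])
  ultimately show ?thesis unfolding locgood_def using m T(3) by blast
qed

text \<open>The matrix of \<open>t d/dt\<close> at \<open>p\<close>, for the connection with matrix \<open>G\<close> along \<open>d/dz\<close>.\<close>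

definition locm :: "P1 \<Rightarrow> ratfun mat \<Rightarrow> complex fls mat" where
  "locm p G = map_mat (\<lambda>g. tdz p * expand p g) G"

lemma locm_carrier [simp]: "locm p G \<in> carrier_mat n k \<longleftrightarrow> G \<in> carrier_mat n k"
  by (simp add: locm_def)

lemma locm_gauge:
  assumes g: "gauges rat_deriv n G T G'"
  shows "gauges theta n (locm p G) (map_mat (expand p) T) (locm p G')"
proof -
  have c: "G \<in> carrier_mat n n" "T \<in> carrier_mat n n" "G' \<in> carrier_mat n n" using g by (auto simp: gauges_def)
  have l: "locm p X = tdz p \<cdot>\<^sub>m map_mat (expand p) X" for X by (rule eq_matI) (auto simp: locm_def)
  have th: "map_mat theta (map_mat (expand p) T) = tdz p \<cdot>\<^sub>m map_mat (expand p) (map_mat rat_deriv T)"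
    by (rule eq_matI) (auto simp: theta_expand)
  have "locm p G * map_mat (expand p) T + map_mat theta (map_mat (expand p) T)
      = tdz p \<cdot>\<^sub>m (map_mat (expand p) (G * T) + map_mat (expand p) (map_mat rat_deriv T))"
    using c by (simp add: l th map_mat_expand_mult[OF c(1,2)] mult_smult_assoc_mat[of _ n n _ n] add_smult_distrib_left_mat[of _ n n])
  also have "map_mat (expand p) (G * T) + map_mat (expand p) (map_mat rat_deriv T) = map_mat (expand p) (G * T + map_mat rat_deriv T)"
    using c by (intro eq_matI) (auto simp: expand_add)
  also have "G * T + map_mat rat_deriv T = T * G'" using g by (simp add: gauges_def)
  also have "tdz p \<cdot>\<^sub>m map_mat (expand p) (T * G') = map_mat (expand p) T * locm p G'"
    using c by (simp add: l map_mat_expand_mult mult_smult_distrib[of _ n n _ n])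
  finally show ?thesis using c by (simp add: gauges_def)
qed

text \<open>The matrix along d/dt has a pole of order at most \<open>d p\<close>; along t d/dt this
  is one less.\<close>

definition goodm :: "nat \<Rightarrow> (P1 \<Rightarrow> int) \<Rightarrow> P1 \<Rightarrow> ratfun mat \<Rightarrow> bool" where
  "goodm n d p G \<longleftrightarrow> mvge (1 - d p) n (locm p G)"

lemma goodm_gauge:
  assumes "goodm n d p G" "gauges rat_deriv n G U G'" "int_pair n (map_mat (expand p) U) V" "d p \<ge> 0"
  shows "goodm n d p G'"
  using gauge_int_pair[OF assms(3) locm_gauge[OF assms(2)]] assms(1,4) by (auto simp: goodm_def)

lemma gauges_unique:
  assumes "inv_pair n T S" "gauges D n A T B" "gauges D n A T C"
  shows "B = C"
  using gauges_eq[OF assms(1,2)] gauges_eq[OF assms(1,3)] by simp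

text \<open>The points are treated one at a time. The base change at p is invertible over the local
  rings at all points other than p and p0, so it does not disturb the points already treated; p0
  absorbs the zeros and poles that the global functions must have elsewhere.\<close>

lemma good_away:
  assumes "finite S" "p0 \<notin> S" "\<And>p. d p \<ge> 0" "G \<in> carrier_mat n n"
    "\<And>p. p \<in> S \<Longrightarrow> locgood n (d p - 1) (locm p G)"
  shows "\<exists>T TI G'. inv_pair n T TI \<and> gauges rat_deriv n G T G' \<and> (\<forall>p\<in>S. goodm n d p G') \<and>
     (\<forall>q. q \<notin> S \<longrightarrow> q \<noteq> p0 \<longrightarrow> int_pair n (map_mat (expand q) T) (map_mat (expand q) TI))"
  using assms
proof (induction S rule: finite_induct)
  case empty
  have "gauges rat_deriv n G (1\<^sub>m n) G"
    using empty by (simp add: gauges_def map_mat_derivation_one[OF derivation_rat_deriv])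
  moreover have "int_pair n (map_mat (expand q) (1\<^sub>m n)) (map_mat (expand q) (1\<^sub>m n))" for q
    using inv_pair_expand[OF inv_pair_one] by (auto simp: int_pair_def mvge_def one_mat_def)
  ultimately show ?case using inv_pair_one by blast
next
  case (insert p S)
  then obtain T TI G' where T: "inv_pair n T TI" "gauges rat_deriv n G T G'" "\<forall>p\<in>S. goodm n d p G'"
     "\<forall>q. q \<notin> S \<longrightarrow> q \<noteq> p0 \<longrightarrow> int_pair n (map_mat (expand q) T) (map_mat (expand q) TI)"
    by (metis insertCI)
  have pp0: "p \<noteq> p0" using insert by auto
  have Gc: "G' \<in> carrier_mat n n" using T by (simp add: gauges_def)
  have "locgood n (d p - 1) (locm p G')"
    using locgood_gauge[OF _ locm_gauge[OF T(2)] inv_pair_expand[OF T(1)]] insert.prems by blast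
  then obtain m X Y B where X: "m > 0" "gauges theta n (ramm m (locm p G')) X B" "inv_pair n X Y"
    "\<forall>z i. (\<forall>j<n. vge 0 (z j)) \<longrightarrow> i < n \<longrightarrow> vge (- (int m * (d p - 1))) (theta (z i) + mapp n B z i)"
    unfolding locgood_def by blast
  obtain H HI C where H: "inv_pair n H HI"
    "\<And>q. q \<noteq> p \<Longrightarrow> q \<noteq> p0 \<Longrightarrow> int_pair n (map_mat (expand q) H) (map_mat (expand q) HI)"
    "gauges theta n (locm p G') (map_mat (expand p) H) C" "mvge (- (d p - 1)) n C"
    by (rule local_frame[OF _ X(1-3), of "d p - 1" p p0]) (use X(4) Gc pp0 in auto)
  define G2 where "G2 = HI * (G' * H + map_mat rat_deriv H)"
  have G2: "gauges rat_deriv n G' H G2" unfolding G2_def by (rule gauges_exists[OF H(1) Gc])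
  have "locm p G2 = C" by (rule gauges_unique[OF inv_pair_expand[OF H(1)] locm_gauge[OF G2] H(3)])
  then have gp: "goodm n d p G2" using H(4) by (simp add: goodm_def)
  have gS: "goodm n d q G2" if "q \<in> S" for q
    by (rule goodm_gauge[OF _ G2 H(2)]) (use that T insert in auto)
  have TH: "inv_pair n (T * H) (HI * TI)" by (rule inv_pair_mult[OF T(1) H(1)])
  have c: "T \<in> carrier_mat n n" "H \<in> carrier_mat n n" "TI \<in> carrier_mat n n" "HI \<in> carrier_mat n n"
    using T(1) H(1) by (auto simp: inv_pair_def)
  have "int_pair n (map_mat (expand q) (T * H)) (map_mat (expand q) (HI * TI))" if "q \<notin> insert p S" "q \<noteq> p0" for q
    using int_pair_mult[of n "map_mat (expand q) T" "map_mat (expand q) TI" "map_mat (expand q) H" "map_mat (expand q) HI"]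
      T(4) H(2)[of q] that by (simp add: map_mat_expand_mult[OF c(1,2)] map_mat_expand_mult[OF c(4,3)])
  then show ?case
    using TH gauges_trans[OF derivation_rat_deriv T(2) G2] gp gS by blast
qed

lemma finite_bad_points:
  assumes "G \<in> carrier_mat n n" "\<And>p. d p \<ge> 0"
  shows "finite {p. \<not> goodm n d p G}"
proof -
  have "{p. \<not> goodm n d p G} \<subseteq> insert Infinity (\<Union>i<n. \<Union>j<n. {p. \<not> vge 0 (expand p (G $$ (i, j)))})"
  proof
    fix p assume p: "p \<in> {p. \<not> goodm n d p G}"
    then obtain i j where ij: "i < n" "j < n" "\<not> vge (1 - d p) (tdz p * expand p (G $$ (i, j)))"
      using assms(1) by (auto simp: goodm_def mvge_def locm_def)
    show "p \<in> insert Infinity (\<Union>i<n. \<Union>j<n. {p. \<not> vge 0 (expand p (G $$ (i, j)))})"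
    proof (cases p)
      case (Finite c)
      then have "\<not> vge (- d p) (expand p (G $$ (i, j)))" using ij by (simp add: tdz_Finite vge_tp_mult)
      then have "\<not> vge 0 (expand p (G $$ (i, j)))" using assms(2)[of p] by (auto intro: vge_mono)
      then show ?thesis using ij by auto
    qed simp
  qed
  then show ?thesis by (rule finite_subset) (auto intro: finite_poles)
qed

text \<open>The sum of the orders of a rational function vanishes; this bounds the order at \<open>p0\<close>.\<close>

lemma few_poles_imp_zero:
  assumes d: "\<And>p. d p \<ge> 0" "finite {p. d p \<noteq> 0}" and s: "s > (\<Sum>p\<in>{p. d p \<noteq> 0}. d p)"
    and g: "\<And>p. p \<noteq> p0 \<Longrightarrow> vge (1 - d p) (tdz p * expand p g)"
    and g0: "vge (1 - d p0 + s) (tdz p0 * expand p0 g)"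
  shows "g = 0"
proof -
  \<comment> \<open>t dz/dt has order 1 at finite points and order -1 at infinity, so dividing by it
    lowers the order by at most 1.\<close>
  have red: "vge (k - 1) (expand p g)" if "vge k (tdz p * expand p g)" for k p
    using that vge_uminus[of k "- (tp (-1) * expand p g)"]
    by (cases p) (auto simp: tdz_Finite tdz_Infinity vge_tp_mult elim: vge_mono)
  have g': "vge (- d p) (expand p g)" if "p \<noteq> p0" for p using red[OF g[OF that]] by simp
  have g0': "vge (- d p0 + s) (expand p0 g)" using red[OF g0] by simp
  define S where "S = {p. d p \<noteq> 0} - {p0}"
  have fS: "finite S" using d(2) by (simp add: S_def)
  have "\<exists>u. p \<noteq> p0 \<longrightarrow> u \<noteq> 0 \<and> fls_subdegree (expand p u) = 1 \<and> fls_subdegree (expand p0 u) = - 1 \<and>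
    (\<forall>q. q \<noteq> p \<longrightarrow> q \<noteq> p0 \<longrightarrow> fls_subdegree (expand q u) = 0)" for p
    using uniformizer_exists[of p p0] by metis
  then obtain u where u: "\<And>p. p \<noteq> p0 \<Longrightarrow> u p \<noteq> 0 \<and> fls_subdegree (expand p (u p)) = 1 \<and> fls_subdegree (expand p0 (u p)) = - 1 \<and>
    (\<forall>q. q \<noteq> p \<longrightarrow> q \<noteq> p0 \<longrightarrow> fls_subdegree (expand q (u p)) = 0)" by metis
  \<comment> \<open>The zeros of h cancel the poles of g outside p0, at the price of a pole at p0 of
    the total order.\<close>
  define h where "h = (\<Prod>p\<in>S. u p powi d p)"
  have sh: "fls_subdegree (expand q h) = (\<Sum>p\<in>S. d p * fls_subdegree (expand q (u p)))" for q
  proof -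
    have "fls_subdegree (\<Prod>p\<in>S. expand q (u p) powi d p) = (\<Sum>p\<in>S. fls_subdegree (expand q (u p) powi d p))"
      by (rule fls_subdegree_prod) (use u in \<open>auto simp: S_def\<close>)
    then show ?thesis by (simp add: h_def expand_prod expand_power_int)
  qed
  have hnz: "h \<noteq> 0" using u fS by (auto simp: h_def S_def)
  have hv: "vge (fls_subdegree (expand q h)) (expand q h)" for q by (simp add: vge_iff)
  have "vge 0 (expand q (g * h)) \<and> (q = p0 \<longrightarrow> vge 1 (expand q (g * h)))" for q
  proof (cases "q = p0")
    case True
    have "fls_subdegree (expand p0 h) = - (\<Sum>p\<in>S. d p)"
      unfolding sh sum_negf[symmetric] by (intro sum.cong) (use u in \<open>auto simp: S_def\<close>)
    moreover have "(\<Sum>p\<in>{p. d p \<noteq> 0}. d p) = d p0 + (\<Sum>p\<in>S. d p)"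
    proof (cases "d p0 = 0")
      case True then show ?thesis by (simp add: S_def)
    next
      case False then show ?thesis using d(2) by (simp add: S_def sum.remove[of _ p0])
    qed
    ultimately have "1 \<le> (- d p0 + s) + fls_subdegree (expand p0 h)" using s by linarith
    then have "vge 1 (expand p0 (g * h))" unfolding expand_mult by (rule vge_mono[OF vge_mult[OF g0' hv]])
    then show ?thesis using True by (auto intro: vge_mono)
  next
    case False
    have "fls_subdegree (expand q h) = (\<Sum>p\<in>S. if p = q then d p else 0)"
      unfolding sh by (intro sum.cong) (use u False in \<open>auto simp: S_def\<close>)
    also have "\<dots> = d q" using False fS by (auto simp: sum.delta S_def)
    finally have "0 \<le> - d q + fls_subdegree (expand q h)" by simp
    then show ?thesis using False unfolding expand_mult by (auto intro: vge_mono[OF vge_mult[OF g'[OF False] hv]])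
  qed
  then have "g * h = 0" using no_nonconstant_regular[of "g * h" p0] by blast
  then show ?thesis using hnz by simp
qed

section \<open>Birkhoff factorization\<close>

lemma dg_mult_dg: "dg n l * dg n l' = dg n (\<lambda>i. l i + l' i)"
  unfolding dg_mult_left[OF dg_carrier] by (rule eq_matI) (auto simp: dg_def tp_add)

lemma dg_0: "dg n (\<lambda>_. 0) = 1\<^sub>m n"
  by (rule eq_matI) (auto simp: dg_def)

lemma det_dg: "det (dg n l) = tp (\<Sum>i<n. l i)"
proof -
  have "upper_triangular (dg n l)" by (auto simp: upper_triangular_def dg_def)
  then have "det (dg n l) = (\<Prod>i<n. tp (l i))"
    using det_upper_triangular[of "dg n l" n] by (simp add: prod_list_diag_prod dg_def atLeast0LessThan)
  also have "\<dots> = tp (\<Sum>i<n. l i)" by (induction n) (auto simp: tp_add)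
  finally show ?thesis .
qed

lemma fls_subdegree_tp [simp]: "fls_subdegree (tp k) = k"
  by (rule fls_subdegree_eqI) (auto simp: nth_tp)

lemma nth_prod_integral:
  "(\<And>i. i \<in> S \<Longrightarrow> vge 0 (f i)) \<Longrightarrow> fls_nth (\<Prod>i\<in>S. f i) 0 = (\<Prod>i\<in>S. fls_nth (f i) 0)"
  by (induction S rule: infinite_finite_induct) (auto simp: vge_nth_mult vge_prod)

text \<open>Taking the constant term is a ring homomorphism on integral series.\<close>

lemma nth_det:
  assumes "P \<in> carrier_mat n n" "mvge 0 n P"
  shows "fls_nth (det P) 0 = det (map_mat (\<lambda>x. fls_nth x 0) P)"
proof -
  have "fls_nth (signof s * (\<Prod>i = 0..<n. P $$ (i, s i))) 0
      = signof s * (\<Prod>i = 0..<n. map_mat (\<lambda>x. fls_nth x 0) P $$ (i, s i))" if "s permutes {0..<n}" for s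
  proof -
    have v: "vge 0 (P $$ (i, s i))" if "i \<in> {0..<n}" for i
      using assms(2) permutes_in_image[OF \<open>s permutes _\<close>, of i] that by (auto simp: mvge_def)
    have "(\<Prod>i = 0..<n. map_mat (\<lambda>x. fls_nth x 0) P $$ (i, s i)) = (\<Prod>i = 0..<n. fls_nth (P $$ (i, s i)) 0)"
      using assms(1) permutes_in_image[OF that] by (intro prod.cong) auto
    moreover have "fls_nth (\<Prod>i = 0..<n. P $$ (i, s i)) 0 = (\<Prod>i = 0..<n. fls_nth (P $$ (i, s i)) 0)"
      by (rule nth_prod_integral) (rule v)
    ultimately show ?thesis by (simp add: sign_def)
  qed
  then show ?thesis using assms(1) by (simp add: det_def fls_nth_sum)
qed

text \<open>Multiplication by \<open>colm\<close> from the right adds multiples of the other columns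
  to column i; \<open>rowm\<close> adds multiples of column i to the other columns.\<close>

definition colm :: "nat \<Rightarrow> nat \<Rightarrow> (nat \<Rightarrow> 'a::field) \<Rightarrow> 'a mat" where
  "colm n i v = mat n n (\<lambda>(a, b). if b = i then (if a = i then 1 else v a) else if a = b then 1 else 0)"

definition rowm :: "nat \<Rightarrow> nat \<Rightarrow> (nat \<Rightarrow> 'a::field) \<Rightarrow> 'a mat" where
  "rowm n i v = mat n n (\<lambda>(a, b). if a = i then (if b = i then 1 else v b) else if a = b then 1 else 0)"

lemma transpose_colm: "transpose_mat (colm n i v) = rowm n i v"
  by (rule eq_matI) (auto simp: colm_def rowm_def)

lemma colm_mult:
  assumes "i < n"
  shows "colm n i v * colm n i (\<lambda>a. - v a) = 1\<^sub>m n"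
proof (rule eq_matI)
  fix a b assume ab: "a < dim_row (1\<^sub>m n :: 'a mat)" "b < dim_col (1\<^sub>m n :: 'a mat)"
  let ?C = "colm n i v" and ?D = "colm n i (\<lambda>a. - v a)"
  have "(?C * ?D) $$ (a, b) = (\<Sum>k<n. ?C $$ (a, k) * ?D $$ (k, b))"
    using ab by (simp add: scalar_prod_def colm_def atLeast0LessThan)
  also have "\<dots> = (\<Sum>k<n. (if k = i then (if a = i then 1 else v a) * ?D $$ (i, b) else 0)
      + (if k = a then (if a = i then 0 else ?D $$ (a, b)) else 0))"
    using ab assms by (intro sum.cong) (auto simp: colm_def)
  also have "\<dots> = (if a = i then 1 else v a) * ?D $$ (i, b) + (if a = i then 0 else ?D $$ (a, b))"
    using ab assms by (simp add: sum.distrib sum.delta)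
  finally show "(?C * ?D) $$ (a, b) = 1\<^sub>m n $$ (a, b)" using ab assms by (auto simp: colm_def)
qed (auto simp: colm_def)

lemma inv_pair_colm:
  assumes "i < n"
  shows "inv_pair n (colm n i v) (colm n i (\<lambda>a. - v a))"
  using colm_mult[OF assms, of v] colm_mult[OF assms, of "\<lambda>a. - v a"]
  by (simp add: inv_pair_def) (simp add: colm_def)

lemma inv_pair_rowm:
  assumes "i < n"
  shows "inv_pair n (rowm n i v) (rowm n i (\<lambda>a. - v a))"
proof -
  have "rowm n i v * rowm n i (\<lambda>a. - v a) = 1\<^sub>m n" for v :: "nat \<Rightarrow> 'a"
  proof -
    have "transpose_mat (colm n i (\<lambda>a. - v a) * colm n i (\<lambda>a. - (- v a)))
       = transpose_mat (colm n i (\<lambda>a. - (- v a))) * transpose_mat (colm n i (\<lambda>a. - v a))"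
      by (rule transpose_mult) (auto simp: colm_def)
    then show ?thesis using colm_mult[OF assms, of "\<lambda>a. - v a"] by (simp add: transpose_colm)
  qed
  from this[of v] this[of "\<lambda>a. - v a"] show ?thesis by (simp add: inv_pair_def) (simp add: rowm_def)
qed

lemma int_pair_colm: "i < n \<Longrightarrow> (\<And>a. a < n \<Longrightarrow> vge 0 (v a)) \<Longrightarrow> int_pair n (colm n i v) (colm n i (\<lambda>a. - v a))"
  by (simp add: int_pair_def inv_pair_colm) (auto simp: mvge_def colm_def vge_uminus)

lemma int_pair_rowm: "i < n \<Longrightarrow> (\<And>a. a < n \<Longrightarrow> vge 0 (v a)) \<Longrightarrow> int_pair n (rowm n i v) (rowm n i (\<lambda>a. - v a))"
  by (simp add: int_pair_def inv_pair_rowm) (auto simp: mvge_def rowm_def vge_uminus)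

lemma expand_colm: "map_mat (expand p) (colm n i v) = colm n i (\<lambda>a. expand p (v a))"
  by (rule eq_matI) (auto simp: colm_def)

lemma expand_rowm: "map_mat (expand p) (rowm n i v) = rowm n i (\<lambda>a. expand p (v a))"
  by (rule eq_matI) (auto simp: rowm_def)

lemma dg_colm: "dg n l * colm n i v = colm n i (\<lambda>a. tp (l a - l i) * v a) * dg n l"
  by (subst dg_mult_left, simp add: colm_def, subst dg_mult_right, simp add: colm_def)
     (rule eq_matI, auto simp: colm_def mult_ac tp_add[symmetric] mult.assoc[symmetric])

lemma dg_rowm: "dg n l * rowm n i v = rowm n i (\<lambda>a. tp (l i - l a) * v a) * dg n l"
  by (subst dg_mult_left, simp add: rowm_def, subst dg_mult_right, simp add: rowm_def)
     (rule eq_matI, auto simp: rowm_def mult_ac tp_add[symmetric] mult.assoc[symmetric])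

text \<open>A power of the function with divisor [p] - [p0] realizes any leading coefficient at p0.
  For e < 0 a function regular outside p0 would vanish at p0, hence be 0; this sign condition
  governs the choice of i in \<open>birkhoff_step\<close> and \<open>shift_step\<close>.\<close>

lemma global_coefficient:
  assumes "e \<ge> 0"
  obtains v where "off_regular {p0} v" "vge 1 (tp e * expand p0 v - fls_const c)"
proof -
  define p where "p = (if p0 = Infinity then Finite 0 else Infinity)"
  have "p \<noteq> p0" by (cases p0) (auto simp: p_def)
  then obtain u where u: "u \<noteq> 0" "fls_subdegree (expand p u) = 1" "fls_subdegree (expand p0 u) = - 1"
    "\<And>q. q \<noteq> p \<Longrightarrow> q \<noteq> p0 \<Longrightarrow> fls_subdegree (expand q u) = 0" using uniformizer_exists[of p p0] by metis
  define w where "w = tp e * expand p0 (u ^ nat e)"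
  have w: "w \<noteq> 0" "fls_subdegree w = 0"
    using u assms by (auto simp: w_def expand_power fls_subdegree_pow)
  have w0: "fls_nth w 0 \<noteq> 0" using w nth_fls_subdegree_nonzero[of w] by simp
  define v where "v = cst (c / fls_nth w 0) * u ^ nat e"
  have "off_regular {p0} (u ^ nat e)"
    unfolding off_regular_def
  proof (intro allI impI)
    fix q assume "q \<notin> {p0}"
    then have "vge 0 (expand q u)" using u by (cases "q = p") (auto simp: vge_0_iff)
    then show "vge 0 (expand q (u ^ nat e))" by (simp add: expand_power vge_power)
  qed
  then have "off_regular {p0} v" by (simp add: v_def off_regular_mult)
  moreover have "vge 1 (tp e * expand p0 v - fls_const c)"
  proof -
    have e: "tp e * expand p0 v = fls_const (c / fls_nth w 0) * w"
      by (simp add: v_def w_def expand_mult mult_ac)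
    have "fls_nth (tp e * expand p0 v - fls_const c) k = 0" if "k < 1" for k
      using w w0 that unfolding e by (cases "k = 0") auto
    then show ?thesis by (simp add: vge_def)
  qed
  ultimately show ?thesis by (rule that)
qed

text \<open>V is invertible over the ring of functions regular outside p0, so it preserves the
  standard lattices at all other points.\<close>

definition unit_off :: "nat \<Rightarrow> P1 \<Rightarrow> ratfun mat \<Rightarrow> ratfun mat \<Rightarrow> bool" where
  "unit_off n p0 V VI \<longleftrightarrow> inv_pair n V VI \<and> (\<forall>q. q \<noteq> p0 \<longrightarrow> int_pair n (map_mat (expand q) V) (map_mat (expand q) VI))"

lemma unit_off_mult:
  assumes "unit_off n p0 V VI" "unit_off n p0 W WI"
  shows "unit_off n p0 (V * W) (WI * VI)"
  unfolding unit_off_def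
proof (intro conjI allI impI)
  show "inv_pair n (V * W) (WI * VI)" using assms by (auto simp: unit_off_def intro: inv_pair_mult)
  fix q assume "q \<noteq> p0"
  have c: "V \<in> carrier_mat n n" "W \<in> carrier_mat n n" "VI \<in> carrier_mat n n" "WI \<in> carrier_mat n n"
    using assms by (auto simp: unit_off_def inv_pair_def)
  show "int_pair n (map_mat (expand q) (V * W)) (map_mat (expand q) (WI * VI))"
    using assms \<open>q \<noteq> p0\<close> unfolding map_mat_expand_mult[OF c(1,2)] map_mat_expand_mult[OF c(4,3)]
    by (intro int_pair_mult) (auto simp: unit_off_def)
qed

lemma unit_off_one: "unit_off n p0 (1\<^sub>m n) (1\<^sub>m n)"
proof -
  have "map_mat (expand q) (1\<^sub>m n) = 1\<^sub>m n" for q by (rule eq_matI) auto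
  then show ?thesis by (simp add: unit_off_def int_pair_def inv_pair_one) (simp add: mvge_def one_mat_def)
qed

lemma unit_off_colm:
  assumes "i < n" "\<And>a. a < n \<Longrightarrow> off_regular {p0} (v a)"
  shows "unit_off n p0 (colm n i v) (colm n i (\<lambda>a. - v a))"
  using assms int_pair_colm[of i n "\<lambda>a. expand q (v a)" for q]
  by (auto simp: unit_off_def inv_pair_colm expand_colm expand_uminus off_regular_def)

lemma unit_off_rowm:
  assumes "i < n" "\<And>a. a < n \<Longrightarrow> off_regular {p0} (v a)"
  shows "unit_off n p0 (rowm n i v) (rowm n i (\<lambda>a. - v a))"
  using assms int_pair_rowm[of i n "\<lambda>a. expand q (v a)" for q]
  by (auto simp: unit_off_def inv_pair_rowm expand_rowm expand_uminus off_regular_def)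

text \<open>If det P vanishes at t = 0, the columns of P(0) are dependent. A column operation makes
  column i divisible by t; dividing t out lowers the order of the determinant by one, and the factor
  is moved to the exponent of i.\<close>

lemma birkhoff_step:
  assumes P: "P \<in> carrier_mat n n" "mvge 0 n P" "inv_pair n P Q" and d: "fls_subdegree (det P) > 0"
  obtains W WI P' Q' i where "i < n" "unit_off n p0 W WI" "P' \<in> carrier_mat n n" "mvge 0 n P'" "inv_pair n P' Q'"
    "P * (dg n o' * map_mat (expand p0) W) = P' * dg n (\<lambda>a. o' a + (if a = i then 1 else 0))"
    "fls_subdegree (det P') = fls_subdegree (det P) - 1"
proof -
  have detP: "det P \<noteq> 0" using inv_pair_det[OF P(3)] by auto
  let ?P0 = "map_mat (\<lambda>x. fls_nth x 0) P"
  have "fls_nth (det P) 0 = 0" using d by simp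
  then have "det ?P0 = 0" using nth_det[OF P(1,2)] by simp
  then obtain c where c: "c \<in> carrier_vec n" "c \<noteq> 0\<^sub>v n" "?P0 *\<^sub>v c = 0\<^sub>v n"
    using det_0_iff_vec_prod_zero_field[of ?P0 n] P(1) by auto
  define J where "J = {a. a < n \<and> vec_index c a \<noteq> 0}"
  have "J \<noteq> {}"
  proof
    assume "J = {}"
    then have "c = 0\<^sub>v n" using c(1) by (intro eq_vecI) (auto simp: J_def)
    then show False using c(2) by simp
  qed
  moreover have "finite J" by (simp add: J_def)
  \<comment> \<open>Among the columns in the dependence, i has the least exponent. So the
    coefficients of the operation, moved past the powers of t, are of the kind that
    \<open>global_coefficient\<close> provides.\<close>
  ultimately obtain i where i: "i \<in> J" "\<And>a. a \<in> J \<Longrightarrow> o' i \<le> o' a"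
    using ex_min_if_finite[of "o' ` J"] by (metis (no_types, lifting) finite_imageI image_iff image_is_empty linorder_not_less)
  have iN: "i < n" "vec_index c i \<noteq> 0" using i(1) by (auto simp: J_def)
  have "\<exists>v. off_regular {p0} v \<and> (vec_index c a = 0 \<longrightarrow> v = 0) \<and>
      (a \<in> J \<longrightarrow> vge 1 (tp (o' a - o' i) * expand p0 v - fls_const (vec_index c a / vec_index c i)))" for a
  proof (cases "a \<in> J")
    case True
    obtain v where "off_regular {p0} v" "vge 1 (tp (o' a - o' i) * expand p0 v - fls_const (vec_index c a / vec_index c i))"
      by (rule global_coefficient[of "o' a - o' i"]) (use i(2)[OF True] in auto)
    then show ?thesis using True by (auto simp: J_def)
  next
    case False
    then show ?thesis by (intro exI[of _ 0]) auto
  qed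
  then obtain v where v: "\<And>a. off_regular {p0} (v a)" "\<And>a. vec_index c a = 0 \<Longrightarrow> v a = 0"
    "\<And>a. a \<in> J \<Longrightarrow> vge 1 (tp (o' a - o' i) * expand p0 (v a) - fls_const (vec_index c a / vec_index c i))" by metis
  define w where "w a = tp (o' a - o' i) * expand p0 (v a)" for a
  have w: "vge 0 (w a)" "fls_nth (w a) 0 = vec_index c a / vec_index c i" if "a < n" for a
  proof -
    have "vge 0 (w a) \<and> fls_nth (w a) 0 = vec_index c a / vec_index c i"
    proof (cases "a \<in> J")
      case True
      define e where "e = w a - fls_const (vec_index c a / vec_index c i)"
      have "vge 1 e" using v(3)[OF True] by (simp add: e_def w_def)
      moreover have "w a = e + fls_const (vec_index c a / vec_index c i)" by (simp add: e_def)
      ultimately show ?thesis by (auto simp: vge_def)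
    next
      case False
      then show ?thesis using v(2)[of a] that by (simp add: w_def J_def)
    qed
    then show "vge 0 (w a)" "fls_nth (w a) 0 = vec_index c a / vec_index c i" by auto
  qed
  let ?W = "colm n i v" and ?W' = "colm n i w" and ?e = "\<lambda>a. if a = i then 1 else 0 :: int"
  have W': "int_pair n ?W' (colm n i (\<lambda>a. - w a))" by (rule int_pair_colm[OF iN(1) w(1)])
  have W'c: "?W' \<in> carrier_mat n n" by (simp add: colm_def)
  define R where "R = P * ?W'"
  have Rc: "R \<in> carrier_mat n n" using P(1) W'c by (simp add: R_def)
  have Rint: "mvge 0 n R" unfolding R_def using P(1,2) W'c W' by (intro mvge_mult0) (auto simp: int_pair_def)
  have Rcol: "vge 1 (R $$ (a, i))" if a: "a < n" for a
  proof -
    have "R $$ (a, i) = (\<Sum>b<n. P $$ (a, b) * ?W' $$ (b, i))"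
      using P(1) a iN by (simp add: R_def scalar_prod_def atLeast0LessThan colm_def)
    then have "fls_nth (R $$ (a, i)) 0 = (\<Sum>b<n. fls_nth (P $$ (a, b) * ?W' $$ (b, i)) 0)" by (simp add: fls_nth_sum)
    also have "\<dots> = (\<Sum>b<n. fls_nth (P $$ (a, b)) 0 * (vec_index c b / vec_index c i))"
      using P(2) W' a iN w by (intro sum.cong refl, subst vge_nth_mult) (auto simp: mvge_def int_pair_def colm_def)
    also have "\<dots> = vec_index (?P0 *\<^sub>v c) a / vec_index c i"
      using P(1) c(1) a by (simp add: scalar_prod_def atLeast0LessThan sum_divide_distrib)
    also have "\<dots> = 0" using c(3) a by simp
    finally have z: "fls_nth (R $$ (a, i)) 0 = 0" .
    have "fls_nth (R $$ (a, i)) k = 0" if "k < 1" for k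
      using z Rint a iN that by (cases "k = 0") (auto simp: mvge_def vge_def)
    then show ?thesis by (simp add: vge_def)
  qed
  define P' where "P' = R * dg n (\<lambda>a. - ?e a)"
  have P'c: "P' \<in> carrier_mat n n" using Rc by (simp add: P'_def)
  show ?thesis
  proof (rule that[OF iN(1) unit_off_colm[OF iN(1) v(1)] P'c])
    show "mvge 0 n P'"
      unfolding P'_def dg_mult_right[OF Rc] using Rint Rcol
      by (auto simp: mvge_def mult.commute[of _ "tp _"] vge_tp_mult)
    show "inv_pair n P' (dg n (\<lambda>a. - (- ?e a)) * (colm n i (\<lambda>a. - w a) * Q))"
      unfolding P'_def R_def using W' by (intro inv_pair_mult P(3) inv_pair_dg) (auto simp: int_pair_def)
    have "P * (dg n o' * map_mat (expand p0) ?W) = R * dg n o'"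
      using P(1) W'c by (simp add: expand_colm dg_colm w_def[symmetric] R_def assoc_mult_mat[of _ n n _ n _ n])
    also have "R * dg n o' = R * (dg n (\<lambda>a. - ?e a) * dg n (\<lambda>a. o' a + ?e a))" by (simp add: dg_mult_dg)
    also have "R * (dg n (\<lambda>a. - ?e a) * dg n (\<lambda>a. o' a + ?e a)) = P' * dg n (\<lambda>a. o' a + ?e a)"
      using Rc by (simp add: P'_def assoc_mult_mat[of _ n n _ n _ n])
    finally show "P * (dg n o' * map_mat (expand p0) ?W) = P' * dg n (\<lambda>a. o' a + ?e a)" .
    have "det P' = det P * det ?W' * tp (\<Sum>a<n. - ?e a)"
      using P(1) W'c Rc by (simp add: P'_def R_def det_mult[of _ n] det_dg)
    moreover have "(\<Sum>a<n. - ?e a) = - 1" using iN(1) by (simp add: sum_negf sum.delta)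
    ultimately show "fls_subdegree (det P') = fls_subdegree (det P) - 1"
      using detP int_pair_det[OF W'] by simp
  qed
qed

text \<open>The bundle with the lattice spanned by X at p0 and standard lattices elsewhere is a sum
  of line bundles; \<open>o' j\<close> is the degree of the j-th one. The recursion runs over the
  order of det P.\<close>

lemma birkhoff:
  assumes X: "inv_pair n X Y"
  obtains V VI P Q o' where "unit_off n p0 V VI" "int_pair n P Q" "map_mat (expand p0) V = X * P * dg n o'"
proof -
  have Xc: "X \<in> carrier_mat n n" "Y \<in> carrier_mat n n" using X by (auto simp: inv_pair_def)
  have red: "\<exists>V VI P Q o'. unit_off n p0 V VI \<and> int_pair n P Q \<and> map_mat (expand p0) V = X * P * dg n o'"
    if "unit_off n p0 V VI" "P \<in> carrier_mat n n" "mvge 0 n P" "inv_pair n P Q"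
      "map_mat (expand p0) V = X * P * dg n o'" for V VI P Q o'
    using that
  proof (induction "nat (fls_subdegree (det P))" arbitrary: V VI P Q o' rule: less_induct)
    case less
    have Vc: "V \<in> carrier_mat n n" using less.prems(1) by (auto simp: unit_off_def inv_pair_def)
    have "fls_subdegree (det P) \<ge> 0" using vge_det[OF less.prems(2,3)] by (simp add: vge_0_iff)
    then consider "fls_subdegree (det P) = 0" | "fls_subdegree (det P) > 0" by linarith
    then show ?case
    proof cases
      case 1
      have "int_pair n P Q" by (rule int_pair_of_det[OF less.prems(2-4) 1])
      then show ?thesis using less.prems by blast
    next
      case 2
      obtain W WI P' Q' i where W: "unit_off n p0 W WI" "P' \<in> carrier_mat n n" "mvge 0 n P'" "inv_pair n P' Q'"
        "P * (dg n o' * map_mat (expand p0) W) = P' * dg n (\<lambda>a. o' a + (if a = i then 1 else 0))"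
        "fls_subdegree (det P') = fls_subdegree (det P) - 1"
        by (rule birkhoff_step[OF less.prems(2-4) 2])
      have Wc: "W \<in> carrier_mat n n" using W(1) by (auto simp: unit_off_def inv_pair_def)
      have "map_mat (expand p0) (V * W) = X * (P * (dg n o' * map_mat (expand p0) W))"
        using Vc Wc Xc less.prems(2) by (simp add: map_mat_expand_mult less.prems(5) assoc_mult_mat[of _ n n _ n _ n])
      also have "\<dots> = X * P' * dg n (\<lambda>a. o' a + (if a = i then 1 else 0))"
        using Xc W(2) by (simp add: W(5) assoc_mult_mat[of _ n n _ n _ n])
      finally show ?thesis
        using less.hyps[OF _ unit_off_mult[OF less.prems(1) W(1)] W(2-4)] W(6) 2 by simp
    qed
  qed
  obtain N where N: "N \<ge> 0" "mvge (- N) n Y" by (rule mvge_ex)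
  \<comment> \<open>The start: V is the identity, and N is large enough to make \<open>?P\<close>
    integral.\<close>
  let ?P = "Y * dg n (\<lambda>_. N)"
  have one: "map_mat (expand p0) (1\<^sub>m n) = 1\<^sub>m n" by (rule eq_matI) auto
  have "X * ?P * dg n (\<lambda>_. - N) = X * (Y * (dg n (\<lambda>_. N) * dg n (\<lambda>_. - N)))"
    using Xc by (simp add: assoc_mult_mat[of _ n n _ n _ n])
  also have "\<dots> = 1\<^sub>m n" using X Xc by (simp add: dg_mult_dg dg_0 inv_pair_def)
  finally have "map_mat (expand p0) (1\<^sub>m n) = X * ?P * dg n (\<lambda>_. - N)" by (simp add: one)
  moreover have "mvge 0 n ?P" unfolding dg_mult_right[OF Xc(2)] using N
    by (auto simp: mvge_def mult.commute[of _ "tp _"] vge_tp_mult)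
  moreover have "inv_pair n ?P (dg n (\<lambda>_. - N) * X)" by (rule inv_pair_mult[OF inv_pair_sym[OF X] inv_pair_dg])
  ultimately show ?thesis
    using red[OF unit_off_one, of ?P "dg n (\<lambda>_. - N) * X" "\<lambda>_. - N"] Xc that by (metis dg_carrier mult_carrier_mat)
qed

section \<open>Frames of the trivial bundle\<close>

lemma dg_cong: "(\<And>i. i < n \<Longrightarrow> l i = l' i) \<Longrightarrow> dg n l = dg n l'"
  by (rule eq_matI) (auto simp: dg_def)

text \<open>Bolibrukh's elementary step: multiplying one vector of the lattice basis by \<open>t\<close> lowers a
  maximal exponent of the splitting type by one.\<close>

lemma shift_step:
  assumes P: "int_pair n P Q" and i: "i < n" "\<And>a. a < n \<Longrightarrow> o' a \<le> o' i"
  obtains W WI P' Q' j where "j < n" "unit_off n p0 W WI" "int_pair n P' Q'"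
    "P * (dg n o' * map_mat (expand p0) W) =
      dg n (\<lambda>a. if a = j then 1 else 0) * P' * dg n (\<lambda>a. o' a - (if a = i then 1 else 0))"
proof -
  have Pc: "P \<in> carrier_mat n n" "Q \<in> carrier_mat n n" "mvge 0 n P" "mvge 0 n Q" "Q * P = 1\<^sub>m n"
    using P by (auto simp: int_pair_def inv_pair_def)
  \<comment> \<open>P(0) is invertible, so its column i is not zero.\<close>
  have "\<exists>j<n. fls_nth (P $$ (j, i)) 0 \<noteq> 0"
  proof (rule ccontr)
    assume "\<not> (\<exists>j<n. fls_nth (P $$ (j, i)) 0 \<noteq> 0)"
    then have "fls_nth (\<Sum>j<n. Q $$ (i, j) * P $$ (j, i)) 0 = 0"
      using Pc i(1) by (auto simp: fls_nth_sum mvge_def vge_nth_mult intro!: sum.neutral)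
    moreover have "(\<Sum>j<n. Q $$ (i, j) * P $$ (j, i)) = (Q * P) $$ (i, i)"
      using Pc(1,2) i(1) by (simp add: scalar_prod_def atLeast0LessThan)
    ultimately show False using Pc(5) i(1) by simp
  qed
  then obtain j where j: "j < n" "fls_nth (P $$ (j, i)) 0 \<noteq> 0" by blast
  \<comment> \<open>Adding these multiples of column i clears row j modulo t outside column i. As o'
    i is maximal, the exponents o' i - o' k allow the use of
    \<open>global_coefficient\<close>.\<close>
  define x where "x k = - fls_nth (P $$ (j, k)) 0 / fls_nth (P $$ (j, i)) 0" for k
  have "\<exists>v. off_regular {p0} v \<and> (k < n \<longrightarrow> vge 1 (tp (o' i - o' k) * expand p0 v - fls_const (x k)))" for k
  proof (cases "k < n")
    case True
    then show ?thesis using global_coefficient[of "o' i - o' k" p0 "x k"] i(2)[OF True]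
      by (metis diff_ge_0_iff_ge)
  qed (auto intro!: exI[of _ 0])
  then obtain v where v: "\<And>k. off_regular {p0} (v k)"
    "\<And>k. k < n \<Longrightarrow> vge 1 (tp (o' i - o' k) * expand p0 (v k) - fls_const (x k))" by metis
  define w where "w k = tp (o' i - o' k) * expand p0 (v k)" for k
  have w: "vge 0 (w k)" "fls_nth (w k) 0 = x k" if "k < n" for k
  proof -
    define e where "e = w k - fls_const (x k)"
    have "vge 1 e" using v(2)[OF that] by (simp add: e_def w_def)
    moreover have "w k = e + fls_const (x k)" by (simp add: e_def)
    ultimately show "vge 0 (w k)" "fls_nth (w k) 0 = x k" by (auto simp: vge_def)
  qed
  let ?W = "rowm n i v" and ?W' = "rowm n i w" and ?WI = "rowm n i (\<lambda>a. - w a)"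
    and ?e = "\<lambda>j a. if a = j then 1 else 0 :: int"
  have W': "int_pair n ?W' ?WI" by (rule int_pair_rowm[OF i(1) w(1)])
  have W'c: "?W' \<in> carrier_mat n n" by (simp add: rowm_def)
  define R where "R = P * ?W'"
  have Rc: "R \<in> carrier_mat n n" using Pc(1) W'c by (simp add: R_def)
  have Rp: "int_pair n R (?WI * Q)" unfolding R_def by (rule int_pair_mult[OF P W'])
  have Rrow: "vge 1 (R $$ (j, k))" if k: "k < n" "k \<noteq> i" for k
  proof -
    have "R $$ (j, k) = (\<Sum>b<n. P $$ (j, b) * ?W' $$ (b, k))"
      using Pc(1) k j by (simp add: R_def scalar_prod_def atLeast0LessThan rowm_def)
    also have "\<dots> = (\<Sum>b<n. (if b = i then P $$ (j, i) * w k else 0) + (if b = k then P $$ (j, k) else 0))"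
      using k i(1) by (intro sum.cong) (auto simp: rowm_def)
    also have "\<dots> = P $$ (j, i) * w k + P $$ (j, k)" using k i(1) by (simp add: sum.distrib sum.delta)
    finally have "fls_nth (R $$ (j, k)) 0 = fls_nth (P $$ (j, i)) 0 * x k + fls_nth (P $$ (j, k)) 0"
      using Pc(3) i(1) j(1) w k by (simp add: vge_nth_mult mvge_def)
    then have z: "fls_nth (R $$ (j, k)) 0 = 0" using j(2) by (simp add: x_def)
    have "fls_nth (R $$ (j, k)) l = 0" if "l < 1" for l
      using z Rp j(1) k that by (cases "l = 0") (auto simp: mvge_def vge_def int_pair_def)
    then show ?thesis by (simp add: vge_def)
  qed
  \<comment> \<open>Row j is divided by t and column i is multiplied by t. By \<open>Rrow\<close>
    the result is integral, and the order of the determinant has not changed.\<close>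
  define P' where "P' = dg n (\<lambda>a. - ?e j a) * (R * dg n (?e i))"
  have P'c: "P' \<in> carrier_mat n n" unfolding P'_def by (intro mult_carrier_mat[of _ n n] dg_carrier Rc)
  have "inv_pair n P' ((dg n (\<lambda>a. - ?e i a) * (?WI * Q)) * dg n (\<lambda>a. - (- ?e j a)))"
    unfolding P'_def by (intro inv_pair_mult inv_pair_dg) (use Rp in \<open>simp add: int_pair_def\<close>)
  then obtain Q' where Q': "inv_pair n P' Q'" by blast
  have P'int: "mvge 0 n P'"
    unfolding mvge_def
  proof (intro allI impI)
    fix a b assume ab: "a < n" "b < n"
    have e: "P' $$ (a, b) = tp (- ?e j a + ?e i b) * R $$ (a, b)"
      unfolding P'_def using ab Rc by (subst dg_mult_left, simp, subst dg_mult_right, simp) (auto simp: tp_add tp_inv mult_ac)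
    have "vge 0 (R $$ (a, b))" using Rp ab by (auto simp: int_pair_def mvge_def)
    moreover have "a = j \<Longrightarrow> b \<noteq> i \<Longrightarrow> vge 1 (R $$ (a, b))" using Rrow ab by auto
    ultimately show "vge 0 (P' $$ (a, b))" unfolding e vge_tp_mult by (auto intro: vge_mono)
  qed
  have "det P' = tp (\<Sum>a<n. - ?e j a) * (det R * tp (\<Sum>a<n. ?e i a))"
    unfolding P'_def using Rc by (simp add: det_mult[of _ n] det_dg)
  also have "(\<Sum>a<n. - ?e j a) = - 1" using j(1) by (simp add: sum_negf sum.delta)
  also have "(\<Sum>a<n. ?e i a) = 1" using i(1) by (simp add: sum.delta)
  finally have "fls_subdegree (det P') = 0" using int_pair_det[OF Rp] by simp
  then have "int_pair n P' Q'" by (rule int_pair_of_det[OF P'c P'int Q'])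
  moreover have "P * (dg n o' * map_mat (expand p0) ?W) = dg n (?e j) * P' * dg n (\<lambda>a. o' a - ?e i a)"
  proof -
    have "dg n (?e j) * P' * dg n (\<lambda>a. o' a - ?e i a)
        = (dg n (?e j) * dg n (\<lambda>a. - ?e j a)) * (R * (dg n (?e i) * dg n (\<lambda>a. o' a - ?e i a)))"
      using Rc by (simp add: P'_def assoc_mult_mat[of _ n n _ n _ n] mult_carrier_mat[of _ n n _ n])
    also have "\<dots> = R * dg n o'" using Rc by (simp add: dg_mult_dg dg_0)
    also have "\<dots> = P * (dg n o' * map_mat (expand p0) ?W)"
      using Pc(1) W'c by (simp add: expand_rowm dg_rowm w_def[symmetric] R_def assoc_mult_mat[of _ n n _ n _ n] mult_carrier_mat[of _ n n _ n])
    finally show ?thesis by simp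
  qed
  moreover have "unit_off n p0 ?W (rowm n i (\<lambda>a. - v a))" by (rule unit_off_rowm[OF i(1)]) (rule v(1))
  ultimately show ?thesis using that[OF j(1)] by blast
qed

text \<open>Each \<open>shift_step\<close> lowers the sum of the o' a - c by one and raises a single
  exponent of l by one. So the number of steps, which is that sum, bounds the change of l.\<close>

lemma equalize:
  assumes "unit_off n p0 V VI" "int_pair n P Q" "X \<in> carrier_mat n n"
    "map_mat (expand p0) V = X * dg n l * P * dg n o'" "\<And>a. a < n \<Longrightarrow> c \<le> o' a"
  shows "\<exists>V VI P Q l'. unit_off n p0 V VI \<and> int_pair n P Q \<and>
    map_mat (expand p0) V = X * dg n l' * P * dg n (\<lambda>_. c) \<and>
    (\<forall>a<n. l a \<le> l' a \<and> l' a \<le> l a + (\<Sum>a<n. o' a - c))"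
  using assms
proof (induction "nat (\<Sum>a<n. o' a - c)" arbitrary: V VI P Q l o' rule: less_induct)
  case less
  have nn: "0 \<le> o' a - c" if "a < n" for a using less.prems(5)[OF that] by simp
  show ?case
  proof (cases "\<forall>a<n. o' a = c")
    case True
    have "dg n o' = dg n (\<lambda>_. c)" by (rule dg_cong) (use True in simp)
    then have "map_mat (expand p0) V = X * dg n l * P * dg n (\<lambda>_. c)" using less.prems(4) by simp
    moreover have "(\<Sum>a<n. o' a - c) = 0" using True by simp
    ultimately show ?thesis using less.prems(1,2) by (intro exI[of _ V] exI[of _ VI] exI[of _ P] exI[of _ Q] exI[of _ l]) auto
  next
    case False
    have ne: "{..<n} \<noteq> {}" using False by auto
    obtain i where i: "i < n" "\<And>a. a < n \<Longrightarrow> o' a \<le> o' i"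
    proof -
      have "Max (o' ` {..<n}) \<in> o' ` {..<n}" using ne by (intro Max_in) auto
      then obtain i where "i < n" "o' i = Max (o' ` {..<n})" by force
      then show ?thesis using that[of i] by (metis Max_ge finite_imageI finite_lessThan imageI lessThan_iff)
    qed
    have oi: "o' i > c" using False i less.prems(5) by (metis order_le_less order_less_le_trans)
    obtain W WI P' Q' j where W: "j < n" "unit_off n p0 W WI" "int_pair n P' Q'"
      "P * (dg n o' * map_mat (expand p0) W) =
        dg n (\<lambda>a. if a = j then 1 else 0) * P' * dg n (\<lambda>a. o' a - (if a = i then 1 else 0))"
      by (rule shift_step[where o' = o' and i = i, OF less.prems(2) i])
    let ?o = "\<lambda>a. o' a - (if a = i then 1 else 0)" and ?l = "\<lambda>a. l a + (if a = j then 1 else 0)"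
    have c: "V \<in> carrier_mat n n" "W \<in> carrier_mat n n" "P \<in> carrier_mat n n" "P' \<in> carrier_mat n n"
      using less.prems(1,2) W by (auto simp: unit_off_def int_pair_def inv_pair_def)
    have "map_mat (expand p0) (V * W) = X * dg n l * (P * (dg n o' * map_mat (expand p0) W))"
      using c less.prems(3) by (simp add: map_mat_expand_mult[OF c(1,2)] less.prems(4) assoc_mult_mat[of _ n n _ n _ n] mult_carrier_mat[of _ n n _ n])
    also have "\<dots> = X * (dg n l * dg n (\<lambda>a. if a = j then 1 else 0)) * P' * dg n ?o"
      unfolding W(4) using c less.prems(3) by (simp add: assoc_mult_mat[of _ n n _ n _ n] mult_carrier_mat[of _ n n _ n])
    finally have eq: "map_mat (expand p0) (V * W) = X * dg n ?l * P' * dg n ?o" by (simp add: dg_mult_dg)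
    have sum: "(\<Sum>a<n. ?o a - c) = (\<Sum>a<n. o' a - c) - 1"
    proof -
      have "(\<Sum>a<n. ?o a - c) = (\<Sum>a<n. (o' a - c) - (if a = i then 1 else 0))" by (intro sum.cong) auto
      then show ?thesis using i(1) by (simp only: sum_subtractf) (simp add: sum.delta)
    qed
    have "o' i - c \<le> (\<Sum>a<n. o' a - c)" using i(1) nn by (intro member_le_sum) auto
    then have pos: "(\<Sum>a<n. o' a - c) > 0" using oi by linarith
    have "\<And>a. a < n \<Longrightarrow> c \<le> ?o a" using less.prems(5) oi by auto
    from less.hyps[OF _ unit_off_mult[OF less.prems(1) W(2)] W(3) less.prems(3) eq this] sum pos
    obtain V2 VI2 P2 Q2 l2 where 2: "unit_off n p0 V2 VI2" "int_pair n P2 Q2"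
      "map_mat (expand p0) V2 = X * dg n l2 * P2 * dg n (\<lambda>_. c)"
      "\<forall>a<n. ?l a \<le> l2 a \<and> l2 a \<le> ?l a + ((\<Sum>a<n. o' a - c) - 1)" by auto
    have "l a \<le> l2 a \<and> l2 a \<le> l a + (\<Sum>a<n. o' a - c)" if "a < n" for a
      using 2(4)[rule_format, OF that] by (auto split: if_splits)
    then show ?thesis using 2(1-3) by blast
  qed
qed

text \<open>The sets of indices with exponent at most o' i0 + t N grow with t: unless such a set is
  everything, the hypothesis for its complement yields a new member of the next one. After n steps
  all indices are reached.\<close>

lemma spread_bound:
  fixes o' :: "nat \<Rightarrow> int"
  assumes N: "N \<ge> 0" and gap: "\<And>J. J \<subseteq> {..<n} \<Longrightarrow> J \<noteq> {} \<Longrightarrow> J \<noteq> {..<n} \<Longrightarrow> \<exists>i<n. i \<notin> J \<and> (\<exists>j\<in>J. o' j - o' i \<le> N)"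
    and ij: "i0 < n" "j0 < n"
  shows "o' j0 - o' i0 \<le> int n * N"
proof -
  define K where "K t = {i. i < n \<and> o' i \<le> o' i0 + int t * N}" for t
  have fin: "finite (K t)" for t by (simp add: K_def)
  have "min n (Suc t) \<le> card (K t)" for t
  proof (induction t)
    case 0
    have "i0 \<in> K 0" using ij by (simp add: K_def)
    then have "card (K 0) \<ge> 1" using fin by (metis One_nat_def Suc_leI card_gt_0_iff empty_iff)
    then show ?case by simp
  next
    case (Suc t)
    have sub: "K t \<subseteq> K (Suc t)" using N by (auto simp: K_def distrib_right)
    show ?case
    proof (cases "K t = {..<n}")
      case True
      then have "K (Suc t) = {..<n}" using sub by (auto simp: K_def)
      then show ?thesis by simp
    next
      case False
      let ?J = "{..<n} - K t"
      have "i0 \<in> K t" using ij N by (simp add: K_def)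
      then have "?J \<noteq> {..<n}" using ij by blast
      moreover have "?J \<noteq> {}" using False by (auto simp: K_def)
      ultimately obtain i j where i: "i < n" "i \<notin> ?J" and j: "j \<in> ?J" "o' j - o' i \<le> N"
        using gap[of ?J] by auto
      have "o' i \<le> o' i0 + int t * N" using i by (auto simp: K_def)
      then have "j \<in> K (Suc t)" using j by (auto simp: K_def distrib_right)
      then have "K t \<subset> K (Suc t)" using sub j by blast
      then have "card (K t) < card (K (Suc t))" by (rule psubset_card_mono[OF fin])
      then show ?thesis using Suc.IH by simp
    qed
  qed
  from this[of n] have "card {..<n} \<le> card (K n)" by simp
  moreover have "K n \<subseteq> {..<n}" by (auto simp: K_def)
  ultimately have "K n = {..<n}" by (metis card_seteq finite_lessThan)
  then have "j0 \<in> K n" using ij by auto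
  then show ?thesis by (simp add: K_def)
qed

text \<open>In no frame does a proper non-empty subset of the frame vectors span a
  submodule.\<close>

definition irreducible_matrix :: "nat \<Rightarrow> ratfun mat \<Rightarrow> bool" where
  "irreducible_matrix n G \<longleftrightarrow> (\<forall>T TI G' J. inv_pair n T TI \<longrightarrow> gauges rat_deriv n G T G' \<longrightarrow>
     J \<subseteq> {..<n} \<longrightarrow> J \<noteq> {} \<longrightarrow> J \<noteq> {..<n} \<longrightarrow> (\<exists>i<n. i \<notin> J \<and> (\<exists>j\<in>J. G' $$ (i, j) \<noteq> 0)))"

text \<open>Above the diagonal the spacing of l outweighs the poles, and below it the entries are
  zero. On the diagonal only the integers l i are added, which is compatible with r <= 0.\<close>

lemma dg_gauge_spread:
  assumes B: "B \<in> carrier_mat n n" "upper_triangular B" "mvge (- N0) n B" "\<And>i. i < n \<Longrightarrow> vge r (B $$ (i, i))"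
    and r: "r \<le> 0" and l: "\<And>i j. i < j \<Longrightarrow> j < n \<Longrightarrow> l j - l i \<ge> N0"
  obtains C where "gauges theta n B (dg n l) C" "mvge r n C"
proof -
  define C where "C = mat n n (\<lambda>(i, j). tp (l j - l i) * B $$ (i, j) + (if i = j then of_int (l i) else 0))"
  have "vge r (C $$ (i, j))" if "i < n" "j < n" for i j
  proof (cases i j rule: linorder_cases)
    case less
    have "vge (- N0) (B $$ (i, j))" using B(3) that by (simp add: mvge_def)
    then have "vge (r - (l j - l i)) (B $$ (i, j))" by (rule vge_mono) (use r l[OF less] that in auto)
    then show ?thesis using that less by (simp add: C_def vge_tp_mult)
  next
    case equal
    then show ?thesis using that B(4)[of i] r by (auto simp: C_def intro!: vge_add vge_mono[OF vge_of_int])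
  next
    case greater
    then show ?thesis using that B(1,2) by (auto simp: C_def upper_triangular_def)
  qed
  then have "mvge r n C" by (simp add: mvge_def)
  moreover have "gauges theta n B (dg n l) C" unfolding C_def by (rule gauges_dg[OF B(1)])
  ultimately show ?thesis using that by blast
qed

lemma free_frame:
  assumes G: "G \<in> carrier_mat n n" and irr: "irreducible_matrix n G" and n: "n > 0"
    and d: "\<And>p. d p \<ge> 0" "finite {p. d p \<noteq> 0}" and d0: "d p0 \<ge> 1"
    and loc: "\<And>p. p \<noteq> p0 \<Longrightarrow> locgood n (d p - 1) (locm p G)"
    and T0: "gauges theta n (locm p0 G) T0 B0" "inv_pair n T0 S0" "upper_triangular B0"
    and B0: "\<And>i. i < n \<Longrightarrow> vge (1 - d p0) (B0 $$ (i, i))"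
  obtains T TI G' where "inv_pair n T TI" "gauges rat_deriv n G T G'" "\<And>p. goodm n d p G'"
proof -
  define S where "S = {p. \<not> goodm n d p G} - {p0}"
  have "finite S" "p0 \<notin> S" using finite_bad_points[OF G d(1)] by (auto simp: S_def)
  then obtain T1 TI1 G1 where 1: "inv_pair n T1 TI1" "gauges rat_deriv n G T1 G1" "\<forall>p\<in>S. goodm n d p G1"
     "\<forall>q. q \<notin> S \<longrightarrow> q \<noteq> p0 \<longrightarrow> int_pair n (map_mat (expand q) T1) (map_mat (expand q) TI1)"
    using good_away[of S p0 d G n] d(1) G loc by (auto simp: S_def)
  have G1: "G1 \<in> carrier_mat n n" using 1(2) by (simp add: gauges_def)
  have good1: "goodm n d q G1" if "q \<noteq> p0" for q
  proof (cases "q \<in> S")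
    case False
    then have "goodm n d q G" using that by (simp add: S_def)
    then show ?thesis using goodm_gauge[OF _ 1(2)] 1(4) False that d(1) by blast
  qed (use 1 in blast)
  \<comment> \<open>The triangular frame at p0, expressed in the global frame that is good at all
    other points.\<close>
  define X0 where "X0 = map_mat (expand p0) TI1 * T0"
  have X0i: "inv_pair n X0 (S0 * map_mat (expand p0) T1)"
    unfolding X0_def by (rule inv_pair_mult[OF inv_pair_expand[OF inv_pair_sym[OF 1(1)]] T0(2)])
  have X0c: "X0 \<in> carrier_mat n n" using X0i by (simp add: inv_pair_def)
  have X0g: "gauges theta n (locm p0 G1) X0 B0"
    unfolding X0_def
    by (rule gauges_trans[OF derivation_theta gauges_inverse[OF derivation_theta inv_pair_expand[OF 1(1)] locm_gauge[OF 1(2)]] T0(1)])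
  have B0c: "B0 \<in> carrier_mat n n" using T0(1) by (simp add: gauges_def)
  obtain N0 where N0: "N0 \<ge> 0" "mvge (- N0) n B0" by (rule mvge_ex)
  define N where "N = (\<Sum>p\<in>{p. d p \<noteq> 0}. d p)"
  have N: "N \<ge> 0" unfolding N_def using d(1) by (intro sum_nonneg)
  \<comment> \<open>N0 is the spacing demanded by the off-diagonal poles. The second summand bounds
    the sum of the differences of the degrees, hence the spacing lost in \<open>equalize\<close>; it
    is known before the exponents k are chosen.\<close>
  define M where "M = N0 + int n * (int n * N)"
  have M: "M \<ge> N0" "M \<ge> 0" using N N0 by (auto simp: M_def)
  define k where "k a = int a * M" for a :: nat
  have k: "k j - k i \<ge> M" if "i < j" for i j
  proof -
    have "1 * M \<le> (int j - int i) * M" using that M by (intro mult_right_mono) auto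
    then show ?thesis by (simp add: k_def left_diff_distrib)
  qed
  have r: "1 - d p0 \<le> 0" using d0 by simp
  have spread: "\<exists>C. gauges theta n B0 (dg n l) C \<and> mvge (1 - d p0) n C"
    if l: "\<And>i j. i < j \<Longrightarrow> j < n \<Longrightarrow> l j - l i \<ge> N0" for l
  proof -
    obtain C where "gauges theta n B0 (dg n l) C" "mvge (1 - d p0) n C"
    proof (rule dg_gauge_spread[where l = l, OF B0c T0(3) N0(2) _ r])
      show "vge (1 - d p0) (B0 $$ (i, i))" if "i < n" for i by (rule B0[OF that])
    qed (use l in auto)
    then show ?thesis by blast
  qed
  obtain V VI P Q o' where V: "unit_off n p0 V VI" "int_pair n P Q" "map_mat (expand p0) V = X0 * dg n k * P * dg n o'"
    by (rule birkhoff[OF inv_pair_mult[OF X0i inv_pair_dg]])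
  \<comment> \<open>For sufficiently spaced l, the matrix at p0 in the frame V is one of admissible
    pole order, conjugated by the powers o' of t. This is applied to the first factorization and
    again after the degrees have been made equal.\<close>
  have cond: "\<exists>G2 C. gauges rat_deriv n G1 V G2 \<and> inv_pair n V VI \<and> (\<forall>q. q \<noteq> p0 \<longrightarrow> goodm n d q G2) \<and>
      C \<in> carrier_mat n n \<and> mvge (1 - d p0) n C \<and>
      locm p0 G2 = mat n n (\<lambda>(i, j). tp (o' j - o' i) * C $$ (i, j) + (if i = j then of_int (o' i) else 0))"
    if V: "unit_off n p0 V VI" "int_pair n P Q" "map_mat (expand p0) V = X0 * dg n l * P * dg n o'"
      and l: "\<And>i j. i < j \<Longrightarrow> j < n \<Longrightarrow> l j - l i \<ge> N0" for V VI P Q l o'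
  proof -
    have Vi: "inv_pair n V VI" using V(1) by (simp add: unit_off_def)
    define G2 where "G2 = VI * (G1 * V + map_mat rat_deriv V)"
    have G2: "gauges rat_deriv n G1 V G2" unfolding G2_def by (rule gauges_exists[OF Vi G1])
    have g2: "goodm n d q G2" if "q \<noteq> p0" for q
      by (rule goodm_gauge[OF good1[OF that] G2]) (use V(1) that d(1) in \<open>auto simp: unit_off_def\<close>)
    obtain B1 where B1: "gauges theta n B0 (dg n l) B1" "mvge (1 - d p0) n B1"
      using spread[of l] l by blast
    have B1c: "B1 \<in> carrier_mat n n" using B1(1) by (simp add: gauges_def)
    have Pi: "inv_pair n P Q" using V(2) by (simp add: int_pair_def)
    define C where "C = Q * (B1 * P + map_mat theta P)"
    have C: "gauges theta n B1 P C" unfolding C_def by (rule gauges_exists[OF Pi B1c])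
    have Cc: "C \<in> carrier_mat n n" using C by (simp add: gauges_def)
    have "mvge (1 - d p0) n C" by (rule gauge_int_pair[OF V(2) C B1(2)]) (use r in simp)
    moreover have "gauges theta n (locm p0 G1) (X0 * dg n l * P * dg n o')
        (mat n n (\<lambda>(i, j). tp (o' j - o' i) * C $$ (i, j) + (if i = j then of_int (o' i) else 0)))"
      by (rule gauges_trans[OF derivation_theta gauges_trans[OF derivation_theta gauges_trans[OF derivation_theta X0g B1(1)] C]
            gauges_dg[OF Cc]])
    then have "gauges theta n (locm p0 G1) (map_mat (expand p0) V)
        (mat n n (\<lambda>(i, j). tp (o' j - o' i) * C $$ (i, j) + (if i = j then of_int (o' i) else 0)))"
      by (simp only: V(3))
    then have "locm p0 G2 = mat n n (\<lambda>(i, j). tp (o' j - o' i) * C $$ (i, j) + (if i = j then of_int (o' i) else 0))"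
      by (rule gauges_unique[OF inv_pair_expand[OF Vi] locm_gauge[OF G2]])
    ultimately show ?thesis using G2 Vi g2 Cc by blast
  qed
  have kN: "\<And>i j. i < j \<Longrightarrow> j < n \<Longrightarrow> k j - k i \<ge> N0" using k M(1) by (meson order_trans)
  obtain G2 C where G2: "gauges rat_deriv n G1 V G2" "inv_pair n V VI" "\<forall>q. q \<noteq> p0 \<longrightarrow> goodm n d q G2"
      "C \<in> carrier_mat n n" "mvge (1 - d p0) n C"
      "locm p0 G2 = mat n n (\<lambda>(i, j). tp (o' j - o' i) * C $$ (i, j) + (if i = j then of_int (o' i) else 0))"
    using cond[OF V kN] by blast
  have G2c: "G2 \<in> carrier_mat n n" using G2(1) by (simp add: gauges_def)
  \<comment> \<open>The entry (i, j) gains the order o' j - o' i at p0; beyond the degree N of the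
    divisor it has to vanish.\<close>
  have bound: "o' j - o' i \<le> N" if "i < n" "j < n" "i \<noteq> j" "G2 $$ (i, j) \<noteq> 0" for i j
  proof (rule ccontr)
    assume "\<not> o' j - o' i \<le> N"
    then have s: "o' j - o' i > (\<Sum>p\<in>{p. d p \<noteq> 0}. d p)" by (simp add: N_def)
    have "G2 $$ (i, j) = 0"
    proof (rule few_poles_imp_zero[OF d s])
      fix p assume "p \<noteq> p0"
      then show "vge (1 - d p) (tdz p * expand p (G2 $$ (i, j)))"
        using G2(3) that G2c by (auto simp: goodm_def mvge_def locm_def)
    next
      have "tdz p0 * expand p0 (G2 $$ (i, j)) = tp (o' j - o' i) * C $$ (i, j)"
        using arg_cong[OF G2(6), of "\<lambda>M. M $$ (i, j)"] that G2c by (simp add: locm_def)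
      then show "vge (1 - d p0 + (o' j - o' i)) (tdz p0 * expand p0 (G2 $$ (i, j)))"
        using G2(5) that by (simp add: vge_tp_mult mvge_def)
    qed
    then show False using that by simp
  qed
  have comp: "gauges rat_deriv n G (T1 * V) G2" "inv_pair n (T1 * V) (VI * TI1)"
    by (rule gauges_trans[OF derivation_rat_deriv 1(2) G2(1)], rule inv_pair_mult[OF 1(1) G2(2)])
  have "\<exists>i<n. i \<notin> J \<and> (\<exists>j\<in>J. o' j - o' i \<le> N)" if J: "J \<subseteq> {..<n}" "J \<noteq> {}" "J \<noteq> {..<n}" for J
  proof -
    obtain i j where ij: "i < n" "i \<notin> J" "j \<in> J" "G2 $$ (i, j) \<noteq> 0"
      using irr comp J unfolding irreducible_matrix_def by blast
    then show ?thesis using bound[of i j] J(1) by blast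
  qed
  then have sp: "o' j - o' i \<le> int n * N" if "i < n" "j < n" for i j
    using spread_bound[OF N _ that] by blast
  define c where "c = Min (o' ` {..<n})"
  have "c \<in> o' ` {..<n}" unfolding c_def using n by (intro Min_in) auto
  then obtain i0 where i0: "i0 < n" "c = o' i0" by auto
  have co: "c \<le> o' a" if "a < n" for a unfolding c_def using that by (intro Min_le) auto
  have "(\<Sum>a<n. o' a - c) \<le> (\<Sum>a<n. int n * N)" using sp i0 by (intro sum_mono) auto
  then have sum: "(\<Sum>a<n. o' a - c) \<le> int n * (int n * N)" by simp
  obtain V' VI' P' Q' l' where V': "unit_off n p0 V' VI'" "int_pair n P' Q'"
    "map_mat (expand p0) V' = X0 * dg n l' * P' * dg n (\<lambda>_. c)"
    "\<forall>a<n. k a \<le> l' a \<and> l' a \<le> k a + (\<Sum>a<n. o' a - c)"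
    using equalize[OF V(1,2) X0c V(3) co] by blast
  have "l' j - l' i \<ge> N0" if "i < j" "j < n" for i j
  proof -
    have "k j \<le> l' j" "l' i \<le> k i + (\<Sum>a<n. o' a - c)" using V'(4) that by auto
    then show ?thesis using k[OF that(1)] sum by (simp add: M_def)
  qed
  then obtain G3 C' where G3: "gauges rat_deriv n G1 V' G3" "inv_pair n V' VI'" "\<forall>q. q \<noteq> p0 \<longrightarrow> goodm n d q G3"
      "C' \<in> carrier_mat n n" "mvge (1 - d p0) n C'"
      "locm p0 G3 = mat n n (\<lambda>(i, j). tp (c - c) * C' $$ (i, j) + (if i = j then of_int c else 0))"
    using cond[OF V'(1-3)] by blast
  \<comment> \<open>With equal exponents the conjugation is by a scalar power of t, which only adds
    the constant c on the diagonal.\<close>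
  have "goodm n d p0 G3"
    unfolding goodm_def mvge_def G3(6)
    using G3(5) r by (auto simp: mvge_def intro!: vge_add vge_mono[OF vge_of_int])
  then have "goodm n d p G3" for p using G3(3) by (cases "p = p0") auto
  then show ?thesis
    using that[OF inv_pair_mult[OF 1(1) G3(2)] gauges_trans[OF derivation_rat_deriv 1(2) G3(1)]] by blast
qed

section \<open>Formal solutions\<close>

lemma nth_mult_finite:
  assumes "finite S" "\<And>s. fls_nth F s \<noteq> 0 \<Longrightarrow> fls_nth G (j - s) \<noteq> 0 \<Longrightarrow> s \<in> S"
  shows "fls_nth (F * G :: complex fls) j = (\<Sum>s\<in>S. fls_nth F s * fls_nth G (j - s))"
proof -
  let ?I = "{fls_subdegree F..j - fls_subdegree G}"
  have "fls_nth (F * G) j = (\<Sum>s\<in>?I. fls_nth F s * fls_nth G (j - s))"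
    by (rule fls_times_nth(2))
  also have "\<dots> = (\<Sum>s\<in>?I \<union> S. fls_nth F s * fls_nth G (j - s))"
    by (rule sum.mono_neutral_left) (use assms(1) in auto)
  also have "\<dots> = (\<Sum>s\<in>S. fls_nth F s * fls_nth G (j - s))"
    by (rule sum.mono_neutral_right) (use assms in auto)
  finally show ?thesis .
qed

text \<open>The part of y with exponents in the class of a modulo 1/m and with the k-th power of log
  t, as a Laurent series in t^(1/m).\<close>

definition sec :: "nat \<Rightarrow> complex \<Rightarrow> nat \<Rightarrow> log_ser \<Rightarrow> complex fls" where
  "sec m a k y = Abs_fls (\<lambda>j. y (a + of_int j / of_nat m) k)"

lemma log_series_lower_bound:
  assumes "log_series y"
  obtains M where "\<And>a k. y a k \<noteq> 0 \<Longrightarrow> M \<le> Re a"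
proof -
  obtain A N where A: "finite A" "\<And>a k. y a k \<noteq> 0 \<Longrightarrow> k \<le> N \<and> (\<exists>a0\<in>A. \<exists>j::nat. a = a0 + of_nat j)"
    using assms unfolding log_series_def by blast
  show ?thesis
  proof (rule that[of "Min (insert 0 (Re ` A))"])
    fix a k assume "y a k \<noteq> 0"
    then obtain a0 and j :: nat where "a0 \<in> A" "a = a0 + of_nat j" using A(2) by blast
    then have "Min (insert 0 (Re ` A)) \<le> Re a0" "Re a0 \<le> Re a" using A(1) by (auto intro: Min_le)
    then show "Min (insert 0 (Re ` A)) \<le> Re a" by simp
  qed
qed

lemma nth_sec:
  assumes "log_series y" "m > 0"
  shows "fls_nth (sec m a k y) j = y (a + of_int j / of_nat m) k"
proof -
  obtain M where M: "\<And>a k. y a k \<noteq> 0 \<Longrightarrow> M \<le> Re a" by (rule log_series_lower_bound[OF assms(1)]) blast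
  have "y (a + of_int j / of_nat m) k = 0" if "j < \<lfloor>(M - Re a) * of_nat m\<rfloor>" for j
  proof (rule ccontr)
    assume "y (a + of_int j / of_nat m) k \<noteq> 0"
    then have "M \<le> Re a + real_of_int j / of_nat m" using M[of "a + of_int j / of_nat m" k] by simp
    then have "M - Re a \<le> of_int j / of_nat m" by simp
    then have "(M - Re a) * of_nat m \<le> of_int j" using assms(2) by (simp only: pos_le_divide_eq of_nat_0_less_iff)
    then show False using that by linarith
  qed
  then show ?thesis unfolding sec_def by (intro nth_Abs_fls_ex_lower_bound) blast
qed

lemma fls_times_sec:
  assumes y: "log_series y" and m: "m > 0"
  shows "fls_times_log_ser f y (a + of_int j / of_nat m) k = fls_nth (ram m f * sec m a k y) j"
proof -
  let ?a = "a + of_int j / of_nat m :: complex"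
  define L where "L = {l. fls_nth f l \<noteq> 0 \<and> y (?a - of_int l) k \<noteq> 0}"
  have sh: "?a - of_int l = a + of_int (j - int m * l) / of_nat m" for l
    using m by (simp add: diff_divide_distrib)
  have s: "fls_nth (sec m a k y) (j - int m * l) = y (?a - of_int l) k" for l
    by (simp only: nth_sec[OF y m] sh)
  have fin: "finite L"
  proof -
    obtain Mf where Mf: "vge Mf f" using vge_ex by blast
    obtain Ms where Ms: "vge Ms (sec m a k y)" using vge_ex by blast
    have "L \<subseteq> {Mf..\<bar>j\<bar> + \<bar>Ms\<bar>}"
    proof
      fix l assume l: "l \<in> L"
      have "Mf \<le> l" using l Mf by (auto simp: L_def vge_def not_less[symmetric])
      have "fls_nth (sec m a k y) (j - int m * l) \<noteq> 0" using l s by (simp add: L_def)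
      then have "Ms \<le> j - int m * l" using Ms by (auto simp: vge_def not_less[symmetric])
      moreover have "l \<le> int m * l \<or> l \<le> 0" using m mult_right_mono[of 1 "int m" l] by (cases "l \<ge> 0") auto
      ultimately show "l \<in> {Mf..\<bar>j\<bar> + \<bar>Ms\<bar>}" using \<open>Mf \<le> l\<close> by auto
    qed
    then show ?thesis by (rule finite_subset) simp
  qed
  have "fls_nth (ram m f * sec m a k y) j = (\<Sum>s\<in>(\<lambda>l. int m * l) ` L. fls_nth (ram m f) s * fls_nth (sec m a k y) (j - s))"
  proof (rule nth_mult_finite)
    fix t assume t: "fls_nth (ram m f) t \<noteq> 0" "fls_nth (sec m a k y) (j - t) \<noteq> 0"
    then obtain l where l: "t = int m * l" using m by (auto simp: nth_ram split: if_splits elim: dvdE)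
    then have "l \<in> L" using t s[of l] m by (simp add: L_def nth_ram)
    then show "t \<in> (\<lambda>l. int m * l) ` L" using l by blast
  qed (use fin in simp)
  also have "\<dots> = (\<Sum>l\<in>L. fls_nth (ram m f) (int m * l) * fls_nth (sec m a k y) (j - int m * l))"
    using m by (subst sum.reindex) (auto simp: inj_on_def)
  also have "\<dots> = (\<Sum>l\<in>L. fls_nth f l * y (?a - of_int l) k)" using m s by (simp add: nth_ram)
  finally show ?thesis by (simp add: fls_times_log_ser_def L_def)
qed

abbreviation plookup :: "(rat \<Rightarrow>\<^sub>0 complex) \<Rightarrow> rat \<Rightarrow> complex" where "plookup \<equiv> Poly_Mapping.lookup"

abbreviation pkeys :: "(rat \<Rightarrow>\<^sub>0 complex) \<Rightarrow> rat set" where "pkeys \<equiv> Poly_Mapping.keys"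

text \<open>The exponential part as an element of C((t^(1/m))), for m that clears the denominators
  of its exponents: t^(-r) gets the order - m r.\<close>

definition qf :: "nat \<Rightarrow> (rat \<Rightarrow>\<^sub>0 complex) \<Rightarrow> complex fls" where
  "qf m q = Abs_fls (\<lambda>k. if k < 0 then plookup q (of_int (- k) / of_nat m) else 0)"

lemma nth_qf:
  assumes "m > 0"
  shows "fls_nth (qf m q) k = (if k < 0 then plookup q (of_int (- k) / of_nat m) else 0)"
proof -
  have nn: "0 \<le> \<lceil>\<bar>x\<bar> * of_nat m\<rceil>" for x :: rat
    by (rule order_trans[OF _ ceiling_mono[of 0]]) auto
  define M where "M = - (\<Sum>r\<in>pkeys q. \<lceil>\<bar>r\<bar> * of_nat m\<rceil>)"
  have "(if k < 0 then plookup q (of_int (- k) / of_nat m) else 0) = 0" if "k < M" for k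
  proof (rule ccontr)
    assume "\<not> ?thesis"
    then have r: "of_int (- k) / of_nat m \<in> pkeys q" "k < 0" by (auto simp: in_keys_iff split: if_splits)
    have "\<lceil>\<bar>of_int (- k) / of_nat m :: rat\<bar> * of_nat m\<rceil> \<le> (\<Sum>r\<in>pkeys q. \<lceil>\<bar>r\<bar> * of_nat m\<rceil>)"
      by (intro member_le_sum nn r(1)) simp
    moreover have "\<bar>of_int (- k) / of_nat m :: rat\<bar> * of_nat m = of_int (- k)" using assms r(2) by simp
    ultimately have "- k \<le> (\<Sum>r\<in>pkeys q. \<lceil>\<bar>r\<bar> * of_nat m\<rceil>)" by (metis ceiling_of_int)
    then show False using that by (simp add: M_def)
  qed
  then show ?thesis unfolding qf_def by (intro nth_Abs_fls_ex_lower_bound) blast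
qed

lemma exp_part_sec:
  assumes y: "log_series y" and m: "m > 0" and q: "pkeys q \<subseteq> {0<..}" "\<And>r. r \<in> pkeys q \<Longrightarrow> of_nat m * r \<in> \<int>"
  shows "exp_part_times_log_ser q y (a + of_int j / of_nat m) k = fls_nth (qf m q * sec m a k y) j"
proof -
  define g where "g r = - \<lfloor>of_nat m * r\<rfloor>" for r :: rat
  have g: "(of_int (- g r) :: rat) = of_nat m * r" if "r \<in> pkeys q" for r
    using q(2)[OF that] by (auto simp: g_def elim!: Ints_cases)
  have gr: "of_int (- g r) / of_nat m = r" if "r \<in> pkeys q" for r using g[OF that] m by simp
  have gc: "(of_int (- g r) :: complex) = of_nat m * of_rat r" if "r \<in> pkeys q" for r
    by (metis g[OF that] of_rat_mult of_rat_of_int_eq of_rat_of_nat_eq)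
  have inj: "inj_on g (pkeys q)" by (rule inj_onI) (metis gr)
  have neg: "g r < 0" if "r \<in> pkeys q" for r
  proof -
    have "of_nat m * r > 0" using q(1) that m by auto
    then have "(0::rat) < of_int (- g r)" using g[OF that] by simp
    then show ?thesis by simp
  qed
  have "fls_nth (qf m q * sec m a k y) j = (\<Sum>s\<in>g ` pkeys q. fls_nth (qf m q) s * fls_nth (sec m a k y) (j - s))"
  proof (rule nth_mult_finite)
    fix s assume "fls_nth (qf m q) s \<noteq> 0"
    then have s: "s < 0" "of_int (- s) / of_nat m \<in> pkeys q" using m by (auto simp: nth_qf in_keys_iff split: if_splits)
    have "g (of_int (- s) / of_nat m) = s" using m by (simp add: g_def)
    then show "s \<in> g ` pkeys q" using s(2) by (metis image_eqI)
  qed simp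
  also have "\<dots> = (\<Sum>r\<in>pkeys q. fls_nth (qf m q) (g r) * fls_nth (sec m a k y) (j - g r))"
    using inj by (simp add: sum.reindex)
  also have "\<dots> = (\<Sum>r\<in>pkeys q. plookup q r * y (a + of_int j / of_nat m + of_rat r) k)"
  proof (rule sum.cong[OF refl])
    fix r assume r: "r \<in> pkeys q"
    have "a + of_int (j - g r) / of_nat m = a + of_int j / of_nat m + (of_int (- g r) / of_nat m :: complex)"
      by (simp add: diff_divide_distrib)
    also have "of_int (- g r) / of_nat m = (of_rat r :: complex)" using gc[OF r] m by simp
    finally have "fls_nth (sec m a k y) (j - g r) = y (a + of_int j / of_nat m + of_rat r) k"
      by (simp only: nth_sec[OF y m])
    then show "fls_nth (qf m q) (g r) * fls_nth (sec m a k y) (j - g r) = plookup q r * y (a + of_int j / of_nat m + of_rat r) k"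
      using neg[OF r] gr[OF r] m by (simp add: nth_qf)
  qed
  finally show ?thesis by (simp add: exp_part_times_log_ser_def)
qed

definition fsol :: "nat \<Rightarrow> complex fls mat \<Rightarrow> (rat \<Rightarrow>\<^sub>0 complex) \<Rightarrow> (nat \<Rightarrow> log_ser) \<Rightarrow> bool" where
  "fsol n A q Y \<longleftrightarrow> (\<forall>i<n. log_series (Y i)) \<and> (\<forall>i<n. \<forall>a k. log_ser_delta (Y i) a k +
     (\<Sum>j<n. fls_times_log_ser (A $$ (i, j)) (Y j) a k) + exp_part_times_log_ser q (Y i) a k = 0)"

text \<open>The vector \<open>w\<close> over \<open>\<complex>((t\<^bsup>1/m\<^esup>))\<close> stands for the solution \<open>exp(\<integral> q dt/t) t\<^sup>a w\<close>.\<close>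

definition eig :: "nat \<Rightarrow> complex fls mat \<Rightarrow> (rat \<Rightarrow>\<^sub>0 complex) \<Rightarrow> nat \<Rightarrow> complex \<Rightarrow> fvec \<Rightarrow> bool" where
  "eig n A q m a w \<longleftrightarrow> m > 0 \<and> (\<forall>r\<in>pkeys q. of_nat m * r \<in> \<int>) \<and>
     eigv n (ramm m A) (- of_nat m * (fls_const a + qf m q)) w"

lemma common_denominator:
  assumes "finite (R :: rat set)"
  obtains m :: nat where "m > 0" "\<And>r. r \<in> R \<Longrightarrow> of_nat m * r \<in> \<int>"
  using assms
proof (induction R arbitrary: thesis rule: finite_induct)
  case empty
  show ?case by (rule empty[of 1]) auto
next
  case (insert r R)
  obtain m where m: "m > 0" "\<And>r. r \<in> R \<Longrightarrow> of_nat m * r \<in> \<int>" using insert.IH by blast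
  obtain x y where xy: "quotient_of r = (x, y)" by (cases "quotient_of r")
  have y: "y > 0" "r = of_int x / of_int y" using quotient_of_denom_pos[OF xy] quotient_of_div[OF xy] by auto
  have "of_nat (m * nat y) * r' \<in> \<int>" if "r' \<in> insert r R" for r'
  proof (cases "r' = r")
    case True
    have "of_nat (m * nat y) * r = of_int (int m * x)" using y by simp
    then show ?thesis by (simp only: True Ints_of_int)
  next
    case False
    then have "of_nat m * r' \<in> \<int>" using m(2) that by blast
    then have "of_nat (nat y) * (of_nat m * r') \<in> \<int>" by (rule Ints_mult[OF Ints_of_nat])
    then show ?thesis by (simp add: mult_ac)
  qed
  then show ?case using insert.prems[of "m * nat y"] m(1) y(1) by simp
qed

lemma eigenvalue_split:
  fixes x y w :: "complex fls"
  shows "- of_nat m * (x + y) * w = - (of_nat m * (x * w) + of_nat m * (y * w))"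
  by (simp add: algebra_simps)

lemma move_terms:
  fixes A B S Q :: complex
  shows "A + B + S + Q = 0 \<longleftrightarrow> B + S = - (A + Q)"
proof -
  have "A + B + S + Q = (B + S) + (A + Q)" by (simp add: add_ac)
  then show ?thesis by (simp only: eq_neg_iff_add_eq_0)
qed

text \<open>The coefficient of the highest power of the logarithm of a formal solution is again a
  solution.\<close>

lemma eig_of_fsol:
  assumes A: "A \<in> carrier_mat n n" and Y: "fsol n A q Y" and nz: "i0 < n" "Y i0 \<noteq> (\<lambda>_ _. 0)"
    and q: "pkeys q \<subseteq> {0<..}"
  shows "\<exists>m a w. eig n A q m a w"
proof -
  have ls: "log_series (Y i)" if "i < n" for i using Y that by (simp add: fsol_def)
  obtain m where m: "m > 0" "\<And>r. r \<in> pkeys q \<Longrightarrow> of_nat m * r \<in> \<int>"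
    using common_denominator[of "pkeys q"] by auto
  obtain a k0 where ak: "Y i0 a k0 \<noteq> 0" using nz(2) by (metis ext)
  have "\<forall>i. \<exists>N. i < n \<longrightarrow> (\<forall>a k. Y i a k \<noteq> 0 \<longrightarrow> k \<le> N)"
    using ls unfolding log_series_def by blast
  then obtain Nf where Nf: "\<And>i a k. i < n \<Longrightarrow> Y i a k \<noteq> 0 \<Longrightarrow> k \<le> Nf i" by metis
  \<comment> \<open>Only exponents in the class of a modulo 1/m are considered, where a occurs in
    the solution. The equation respects this class, as q and the matrix shift exponents by multiples
    of 1/m.\<close>
  define K where "K = {k. \<exists>i<n. sec m a k (Y i) \<noteq> 0}"
  have "K \<subseteq> {..\<Sum>i<n. Nf i}"
  proof
    fix k assume "k \<in> K"
    then obtain i where i: "i < n" "sec m a k (Y i) \<noteq> 0" by (auto simp: K_def)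
    then obtain j where "fls_nth (sec m a k (Y i)) j \<noteq> 0" using fls_nonzero_nth by blast
    then have "k \<le> Nf i" using Nf[OF i(1)] by (simp add: nth_sec[OF ls[OF i(1)] m(1)])
    also have "Nf i \<le> (\<Sum>i<n. Nf i)" using i(1) by (intro member_le_sum) auto
    finally show "k \<in> {..\<Sum>i<n. Nf i}" by simp
  qed
  then have fK: "finite K" by (rule finite_subset) simp
  have "fls_nth (sec m a k0 (Y i0)) 0 \<noteq> 0" using ak by (simp add: nth_sec[OF ls[OF nz(1)] m(1)])
  then have "k0 \<in> K" using nz(1) by (auto simp: K_def)
  define k where "k = Max K"
  have kK: "k \<in> K" unfolding k_def using fK \<open>k0 \<in> K\<close> by (intro Max_in) auto
  have "Suc k \<notin> K" using Max_ge[OF fK, of "Suc k"] by (auto simp: k_def)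
  then have top: "sec m a (Suc k) (Y i) = 0" if "i < n" for i using that by (auto simp: K_def)
  define w where "w i = sec m a k (Y i)" for i
  have "theta (w i) + (\<Sum>j<n. ramm m A $$ (i, j) * w j) = - of_nat m * (fls_const a + qf m q) * w i" if i: "i < n" for i
  proof (rule fls_eqI)
    fix j
    let ?a = "a + of_int j / of_nat m :: complex"
    have "log_ser_delta (Y i) ?a k + (\<Sum>l<n. fls_times_log_ser (A $$ (i, l)) (Y l) ?a k) + exp_part_times_log_ser q (Y i) ?a k = 0"
      using Y i by (simp add: fsol_def)
    moreover have "log_ser_delta (Y i) ?a k = ?a * fls_nth (w i) j"
    proof -
      have "Y i ?a (Suc k) = fls_nth (sec m a (Suc k) (Y i)) j" by (simp only: nth_sec[OF ls[OF i] m(1)])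
      then show ?thesis by (simp add: log_ser_delta_def top[OF i] w_def nth_sec[OF ls[OF i] m(1)])
    qed
    moreover have "fls_times_log_ser (A $$ (i, l)) (Y l) ?a k = fls_nth (ram m (A $$ (i, l)) * w l) j" if "l < n" for l
      unfolding w_def by (rule fls_times_sec[OF ls[OF that] m(1)])
    moreover have "exp_part_times_log_ser q (Y i) ?a k = fls_nth (qf m q * w i) j"
      unfolding w_def by (rule exp_part_sec[OF ls[OF i] m(1) q m(2)])
    ultimately have "?a * fls_nth (w i) j + (\<Sum>l<n. fls_nth (ram m (A $$ (i, l)) * w l) j) + fls_nth (qf m q * w i) j = 0"
      by simp
    \<comment> \<open>The factor m passes from t d/dt to the derivation of the ramified
      parameter.\<close>
    then have "of_nat m * (?a * fls_nth (w i) j + (\<Sum>l<n. fls_nth (ram m (A $$ (i, l)) * w l) j) + fls_nth (qf m q * w i) j) = 0"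
      by simp
    moreover have "of_nat m * ?a = of_nat m * a + of_int j" using m(1) by (simp add: distrib_left)
    ultimately have "(of_nat m * a + of_int j) * fls_nth (w i) j + (\<Sum>l<n. of_nat m * fls_nth (ram m (A $$ (i, l)) * w l) j)
        + of_nat m * fls_nth (qf m q * w i) j = 0"
      by (simp only: distrib_left mult.assoc[symmetric] sum_distrib_left)
    moreover have "fls_nth (\<Sum>l<n. ramm m A $$ (i, l) * w l) j = (\<Sum>l<n. of_nat m * fls_nth (ram m (A $$ (i, l)) * w l) j)"
      using A i by (simp add: fls_nth_sum rams_def mult.assoc)
    moreover have "fls_nth (- of_nat m * (fls_const a + qf m q) * w i) j
        = - (of_nat m * a * fls_nth (w i) j + of_nat m * fls_nth (qf m q * w i) j)"
      unfolding eigenvalue_split by (simp add: mult.assoc)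
    ultimately show "fls_nth (theta (w i) + (\<Sum>j<n. ramm m A $$ (i, j) * w j)) j
        = fls_nth (- of_nat m * (fls_const a + qf m q) * w i) j"
      by (simp only: distrib_right move_terms fls_plus_nth nth_theta)
  qed
  moreover have "\<exists>i<n. w i \<noteq> 0" using kK by (simp add: K_def w_def)
  ultimately have "eigv n (ramm m A) (- of_nat m * (fls_const a + qf m q)) w" by (simp add: eigv_def)
  then show ?thesis using m unfolding eig_def by blast
qed

lemma fsol_of_eig:
  assumes A: "A \<in> carrier_mat n n" and e: "eig n A q m a w" and q: "pkeys q \<subseteq> {0<..}"
  obtains Y i0 where "fsol n A q Y" "i0 < n" "Y i0 \<noteq> (\<lambda>_ _. 0)"
proof -
  have m: "m > 0" "\<And>r. r \<in> pkeys q \<Longrightarrow> of_nat m * r \<in> \<int>"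
    and w: "eigv n (ramm m A) (- of_nat m * (fls_const a + qf m q)) w" using e by (auto simp: eig_def)
  define Y :: "nat \<Rightarrow> log_ser" where "Y i = (\<lambda>a' k. if k = 0 \<and> (\<exists>j :: int. a' = a + of_int j / of_nat m)
      then fls_nth (w i) (THE j :: int. a' = a + of_int j / of_nat m) else 0)" for i
  have the: "(THE j :: int. a + of_int j0 / of_nat m = a + of_int j / of_nat m) = j0" for j0 :: int
    using m(1) by (intro the_equality) auto
  have Y0: "Y i (a + of_int j / of_nat m) 0 = fls_nth (w i) j" for i j
    unfolding Y_def the by auto
  have Yk: "k > 0 \<Longrightarrow> Y i a' k = 0" for i a' k by (simp add: Y_def)
  have Yoff: "(\<And>j :: int. a' \<noteq> a + of_int j / of_nat m) \<Longrightarrow> Y i a' k = 0" for i a' k by (auto simp: Y_def)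
  have ls: "log_series (Y i)" for i
  proof -
    obtain M where M: "vge M (w i)" using vge_ex by blast
    \<comment> \<open>\<open>log_series\<close> asks for finitely many progressions with step 1:
      these are the m smallest exponents that can occur, one for each residue class.\<close>
    define B where "B = (\<lambda>s. a + of_int (M + int s) / of_nat m) ` {..<m}"
    have "\<exists>a0\<in>B. \<exists>t::nat. a' = a0 + of_nat t" if nz: "Y i a' k \<noteq> 0" for a' k
    proof -
      obtain j where j: "a' = a + of_int j / of_nat m" using Yoff[of a' i k] nz by blast
      have "k = 0" using Yk[of k i a'] nz by auto
      then have "fls_nth (w i) j \<noteq> 0" using nz j Y0 by simp
      then have jM: "j \<ge> M" using M by (auto simp: vge_def not_less[symmetric])
      define s t where "s = nat ((j - M) mod int m)" and "t = nat ((j - M) div int m)"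
      have st: "int s = (j - M) mod int m" "int t = (j - M) div int m" "s < m"
        using m(1) jM by (auto simp: s_def t_def pos_imp_zdiv_nonneg_iff nat_less_iff)
      have "j = M + int s + int m * int t" using st by simp
      then have "a' = a + of_int (M + int s) / of_nat m + of_nat t"
        using m(1) by (simp add: j add_divide_distrib)
      then show ?thesis using st(3) by (auto simp: B_def)
    qed
    moreover have "k \<le> 0" if "Y i a' k \<noteq> 0" for a' k using Yk[of k i a'] that by auto
    moreover have "finite B" by (simp add: B_def)
    ultimately show ?thesis unfolding log_series_def by (intro exI[of _ B] exI[of _ 0]) blast
  qed
  have sec: "sec m a 0 (Y i) = w i" for i
    by (rule fls_eqI) (simp add: nth_sec[OF ls m(1)] Y0)
  have "log_ser_delta (Y i) a' k + (\<Sum>j<n. fls_times_log_ser (A $$ (i, j)) (Y j) a' k) + exp_part_times_log_ser q (Y i) a' k = 0"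
    if i: "i < n" for i a' k
  proof (cases "k = 0 \<and> (\<exists>j :: int. a' = a + of_int j / of_nat m)")
    case True
    then obtain j where j: "a' = a + of_int j / of_nat m" and k: "k = 0" by auto
    have 1: "log_ser_delta (Y i) a' k = (a + of_int j / of_nat m) * fls_nth (w i) j"
      by (simp add: log_ser_delta_def j k Y0 Yk)
    have 2: "fls_times_log_ser (A $$ (i, l)) (Y l) a' k = fls_nth (ram m (A $$ (i, l)) * w l) j" for l
      unfolding j k by (subst fls_times_sec[OF ls m(1)]) (simp add: sec)
    have 3: "exp_part_times_log_ser q (Y i) a' k = fls_nth (qf m q * w i) j"
      unfolding j k by (subst exp_part_sec[OF ls m(1) q m(2)]) (simp_all add: sec)
    have "fls_nth (theta (w i) + (\<Sum>l<n. ramm m A $$ (i, l) * w l)) j = fls_nth (- of_nat m * (fls_const a + qf m q) * w i) j"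
      using w i by (simp add: eigv_def)
    moreover have "fls_nth (\<Sum>l<n. ramm m A $$ (i, l) * w l) j = of_nat m * (\<Sum>l<n. fls_nth (ram m (A $$ (i, l)) * w l) j)"
      using A i by (simp add: fls_nth_sum rams_def mult.assoc sum_distrib_left)
    moreover have "fls_nth (- of_nat m * (fls_const a + qf m q) * w i) j
        = - (of_nat m * a * fls_nth (w i) j + of_nat m * fls_nth (qf m q * w i) j)"
      unfolding eigenvalue_split by (simp add: mult.assoc)
    ultimately have "of_nat m * a * fls_nth (w i) j + of_int j * fls_nth (w i) j
        + of_nat m * (\<Sum>l<n. fls_nth (ram m (A $$ (i, l)) * w l) j) + of_nat m * fls_nth (qf m q * w i) j = 0"
      by (simp only: move_terms fls_plus_nth nth_theta)
    moreover have "of_nat m * ((a + of_int j / of_nat m) * fls_nth (w i) j) = of_nat m * a * fls_nth (w i) j + of_int j * fls_nth (w i) j"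
      using m(1) by (simp add: distrib_left distrib_right)
    ultimately have "of_nat m * ((a + of_int j / of_nat m) * fls_nth (w i) j + (\<Sum>l<n. fls_nth (ram m (A $$ (i, l)) * w l) j)
        + fls_nth (qf m q * w i) j) = 0"
      by (simp only: distrib_left)
    then show ?thesis using m(1) by (simp add: 1 2 3)
  next
    \<comment> \<open>Every term vanishes here, since the class of a modulo 1/m is stable under
      shifts by integers and by the exponents of q, and no logarithm occurs in Y.\<close>
    case False
    have off: "Y l (a' - of_int t) k = 0" for l t
    proof (cases "k = 0")
      case True
      have "a' - of_int t \<noteq> a + of_int j / of_nat m" for j :: int
      proof
        assume "a' - of_int t = a + of_int j / of_nat m"
        then have "a' = a + of_int j / of_nat m + of_int t" by (simp add: diff_eq_eq)
        then have "a' = a + of_int (j + int m * t) / of_nat m" using m(1) by (simp add: add_divide_distrib)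
        then show False using False True by blast
      qed
      then show ?thesis by (rule Yoff)
    qed (simp add: Yk)
    have offq: "Y i (a' + of_rat r) k = 0" if r: "r \<in> pkeys q" for r
    proof (cases "k = 0")
      case True
      obtain z where z: "of_nat m * r = of_int z" using m(2)[OF r] by (auto elim: Ints_cases)
      have zc: "of_nat m * of_rat r = (of_int z :: complex)"
        by (metis z of_rat_mult of_rat_of_int_eq of_rat_of_nat_eq)
      have "a' + of_rat r \<noteq> a + of_int j / of_nat m" for j :: int
      proof
        assume e: "a' + of_rat r = a + of_int j / of_nat m"
        have "a' = a + of_int j / of_nat m - of_int z / of_nat m"
          using e zc[symmetric] m(1) by (simp add: eq_diff_eq)
        also have "\<dots> = a + of_int (j - z) / of_nat m" by (simp add: diff_divide_distrib)
        finally show False using False True by blast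
      qed
      then show ?thesis by (rule Yoff)
    qed (simp add: Yk)
    have "Y i a' k = 0" using off[of i 0] by simp
    moreover have "Y i a' (Suc k) = 0" by (simp add: Yk)
    ultimately show ?thesis
      by (simp add: log_ser_delta_def fls_times_log_ser_def off exp_part_times_log_ser_def offq)
  qed
  then have "fsol n A q Y" using ls by (simp add: fsol_def)
  moreover obtain i0 where i0: "i0 < n" "w i0 \<noteq> 0" using w by (auto simp: eigv_def)
  moreover have "Y i0 \<noteq> (\<lambda>_ _. 0)"
  proof
    assume z: "Y i0 = (\<lambda>_ _. 0)"
    have "w i0 = 0" by (rule fls_eqI) (simp add: Y0[symmetric] z)
    then show False using i0 by simp
  qed
  ultimately show ?thesis using that by blast
qed


section \<open>Exponential parts and polar parts of eigenvalues\<close>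

lemma ramm_ramm: "m > 0 \<Longrightarrow> m' > 0 \<Longrightarrow> ramm m' (ramm m A) = ramm (m * m') A"
  by (rule eq_matI) (simp_all add: rams_rams)

lemma ramm_1 [simp]: "ramm 1 A = A"
  by (rule eq_matI) (simp_all add: rams_def ram_by_1[unfolded One_nat_def])

lemma polar_mapping_exists:
  assumes m: "m > 0"
  obtains q where "pkeys q \<subseteq> {0<..}" "\<And>r. r \<in> pkeys q \<Longrightarrow> of_nat m * r \<in> \<int>"
    "\<And>k. k < 0 \<Longrightarrow> fls_nth lam k = - of_nat m * plookup q (of_int (- k) / of_nat m)"
proof -
  obtain M where M: "vge M lam" using vge_ex by blast
  define f :: "int \<Rightarrow> rat" where "f k = of_int (- k) / of_nat m" for k
  have inj: "inj f" using m by (auto simp: inj_def f_def)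
  define q where "q = (\<Sum>k\<in>{M..-1}. Poly_Mapping.single (f k) (- fls_nth lam k / of_nat m))"
  have lk: "plookup q (f k) = (if k < 0 then - fls_nth lam k / of_nat m else 0)" for k
  proof -
    have "plookup q (f k) = (\<Sum>l\<in>{M..-1}. if l = k then - fls_nth lam k / of_nat m else 0)"
      unfolding q_def lookup_sum by (intro sum.cong refl) (auto simp: lookup_single when_def inj_eq[OF inj])
    also have "\<dots> = (if k \<in> {M..-1} then - fls_nth lam k / of_nat m else 0)" by (simp add: sum.delta)
    finally show ?thesis using M by (auto simp: vge_def)
  qed
  have keys: "pkeys q \<subseteq> f ` {M..-1}"
  proof
    fix r assume "r \<in> pkeys q"
    then have "(\<Sum>l\<in>{M..-1}. plookup (Poly_Mapping.single (f l) (- fls_nth lam l / of_nat m)) r) \<noteq> 0"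
      by (simp add: in_keys_iff q_def lookup_sum)
    then obtain l where "l \<in> {M..-1}" "plookup (Poly_Mapping.single (f l) (- fls_nth lam l / of_nat m)) r \<noteq> 0"
      by (meson sum.not_neutral_contains_not_neutral)
    then show "r \<in> f ` {M..-1}" by (auto simp: lookup_single when_def split: if_splits)
  qed
  show ?thesis
  proof (rule that[of q])
    show "pkeys q \<subseteq> {0<..}" using keys m by (auto simp: f_def divide_less_0_iff)
    show "of_nat m * r \<in> \<int>" if "r \<in> pkeys q" for r
      using keys that m by (auto simp: f_def)
    show "fls_nth lam k = - of_nat m * plookup q (of_int (- k) / of_nat m)" if "k < 0" for k
      using lk[of k] that m by (simp add: f_def)
  qed
qed

text \<open>Once the positive powers are removed from lam, its constant term gives the exponent a
  and its polar part gives q.\<close>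

lemma eig_of_eigv:
  assumes m: "m > 0" and w: "eigv n (ramm m A) lam w"
  obtains q a w' where "pkeys q \<subseteq> {0<..}" "eig n A q m a w'"
    "\<And>k. k < 0 \<Longrightarrow> fls_nth lam k = - of_nat m * plookup q (of_int (- k) / of_nat m)"
proof -
  obtain w' where w': "eigv n (ramm m A) (cut lam) w'" using eigv_cut[OF w] by blast
  obtain q where q: "pkeys q \<subseteq> {0<..}" "\<And>r. r \<in> pkeys q \<Longrightarrow> of_nat m * r \<in> \<int>"
    "\<And>k. k < 0 \<Longrightarrow> fls_nth lam k = - of_nat m * plookup q (of_int (- k) / of_nat m)"
    by (rule polar_mapping_exists[OF m]) (rule that; blast)
  define a where "a = - fls_nth lam 0 / of_nat m"
  have "cut lam = - of_nat m * (fls_const a + qf m q)"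
  proof (rule fls_eqI)
    fix k
    have "fls_nth (- of_nat m * (fls_const a + qf m q)) k = - of_nat m * (fls_nth (fls_const a) k + fls_nth (qf m q) k)"
      by (metis fls_mult_of_nat_nth(1) fls_plus_nth fls_uminus_nth mult_minus_left)
    then show "fls_nth (cut lam) k = fls_nth (- of_nat m * (fls_const a + qf m q)) k"
      using q(3)[of k] m by (cases k "0 :: int" rule: linorder_cases) (auto simp: nth_cut nth_qf a_def)
  qed
  then have "eig n A q m a w'" using w' q(2) m by (simp add: eig_def)
  then show ?thesis using that q by blast
qed

lemma nth_eigenvalue: "m > 0 \<Longrightarrow> k < 0 \<Longrightarrow>
    fls_nth (- of_nat m * (fls_const a + qf m q)) k = - of_nat m * plookup q (of_int (- k) / of_nat m)"
  by (metis (no_types, lifting) add_0 fls_const_nth fls_mult_of_nat_nth(1) fls_plus_nth fls_uminus_nth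
      mult_minus_left nth_qf order_less_irrefl)

text \<open>One triangular form over C((t^(1/m))) suffices: over a common extension every eigenvalue
  agrees with a diagonal entry up to integral terms. Finiteness gives the maximum in the Katz
  invariant its meaning.\<close>

lemma finite_eig:
  assumes A: "A \<in> carrier_mat n n"
  shows "finite {q. pkeys q \<subseteq> {0<..} \<and> (\<exists>m a w. eig n A q m a w)}"
proof -
  obtain m T S B where T: "m > 0" "inv_pair n T S" "gauges theta n (ramm m A) T B" "upper_triangular B"
    by (rule ramified_triangularization[OF A])
  \<comment> \<open>The coefficients of the only exponential part that can match the polar part of
    the diagonal entry i.\<close>
  define Q where "Q i = (\<lambda>r :: rat. if r > 0 \<and> of_nat m * r \<in> \<int>
      then - fls_nth (B $$ (i, i)) (- \<lfloor>of_nat m * r\<rfloor>) / of_nat m else 0)" for i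
  have "plookup q \<in> Q ` {..<n}" if q: "pkeys q \<subseteq> {0<..}" "eig n A q m1 a w" for q m1 a w
  proof -
    let ?lam = "- of_nat m1 * (fls_const a + qf m1 q)"
    have m1: "m1 > 0" "\<And>r. r \<in> pkeys q \<Longrightarrow> of_nat m1 * r \<in> \<int>" and w: "eigv n (ramm m1 A) ?lam w"
      using q(2) by (auto simp: eig_def)
    have "eigv n (ramm (m1 * m) A) (rams m ?lam) (\<lambda>i. ram m (w i))"
      using eigv_ram[OF T(1) _ w] A by (simp add: ramm_ramm[OF m1(1) T(1)])
    then have e1: "eigv n (ramm m1 (ramm m A)) (rams m ?lam) (\<lambda>i. ram m (w i))"
      by (simp add: ramm_ramm[OF T(1) m1(1)] mult.commute)
    have gi: "gauges theta n (ramm m1 B) (map_mat (ram m1) S) (ramm m1 (ramm m A))"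
      by (rule gauges_ram[OF m1(1) gauges_inverse[OF derivation_theta T(2,3)]])
    have Bc: "B \<in> carrier_mat n n" using T(3) by (simp add: gauges_def)
    have up: "upper_triangular (ramm m1 B)" using T(4) Bc by (auto simp: upper_triangular_def rams_def)
    obtain i where i: "i < n" "vge 0 (rams m ?lam - ramm m1 B $$ (i, i))"
      using triangular_eigenvalue[OF _ up eigv_gauge[OF gi inv_pair_ram[OF m1(1) inv_pair_sym[OF T(2)]] e1]] Bc by auto
    have co: "fls_nth (rams m ?lam) k = fls_nth (rams m1 (B $$ (i, i))) k" if "k < 0" for k
      using i(2) that i(1) Bc by (simp add: vge_def)
    have "plookup q r = Q i r" for r
    proof (cases "r > 0")
      case False
      then have "r \<notin> pkeys q" using q(1) by auto
      then show ?thesis using False by (auto simp: in_keys_iff Q_def)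
    next
      case r: True
      show ?thesis
      proof (cases "of_nat m * r \<in> \<int>")
        case True
        then obtain z where z: "of_nat m * r = of_int z" by (auto elim: Ints_cases)
        have "(0 :: rat) < of_int z" using r T(1) by (simp flip: z)
        then have z0: "z > 0" by simp
        define k where "k = int m1 * (- z)"
        have k0: "k < 0" using z0 m1 by (simp add: k_def mult_pos_neg)
        have R: "fls_nth (rams m1 (B $$ (i, i))) k = of_nat m1 * fls_nth (B $$ (i, i)) (- z)"
        proof -
          have "int m1 dvd k" "k div int m1 = - z"
            unfolding k_def using m1(1) by (simp_all del: mult_minus_right)
          then show ?thesis using m1(1) by (simp add: rams_def nth_ram)
        qed
        have L: "fls_nth (rams m ?lam) k = - of_nat m * of_nat m1 * plookup q r"
        proof (cases "int m dvd k")
          case True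
          then obtain l where l: "k = int m * l" by (elim dvdE)
          have l0: "l < 0" using k0 l T(1) by (simp add: mult_less_0_iff)
          have "(of_nat m :: rat) * of_int (- l) = of_int (- k)" by (simp add: l)
          also have "\<dots> = of_nat m1 * (of_nat m * r)" by (simp add: k_def z)
          finally have "(of_nat m :: rat) * of_int (- l) = of_nat m * (of_nat m1 * r)" by (simp only: mult.left_commute)
          then have "(of_int (- l) :: rat) = of_nat m1 * r" using T(1) by (simp only: mult_cancel_left of_nat_eq_0_iff) auto
          then have lr: "of_int (- l) / of_nat m1 = r" using m1(1) by simp
          have "fls_nth (rams m ?lam) k = of_nat m * fls_nth ?lam l"
            using T(1) by (simp add: rams_def nth_ram l)
          then show ?thesis unfolding nth_eigenvalue[OF m1(1) l0] lr by simp
        next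
          case False
          \<comment> \<open>Over the common extension r corresponds to the order k. If m does not
            divide k, then m1 r is not an integer, whereas m1 clears the denominators of q.\<close>
          have "r \<notin> pkeys q"
          proof
            assume "r \<in> pkeys q"
            then obtain z' where z': "of_nat m1 * r = of_int z'" using m1(2) by (auto elim: Ints_cases)
            have "(of_int (int m1 * z) :: rat) = of_int (int m * z')"
              using z z' by (metis mult.left_commute of_int_mult of_int_of_nat_eq)
            then have "int m1 * z = int m * z'" by (simp only: of_int_eq_iff)
            then show False using False by (simp add: k_def)
          qed
          then show ?thesis using False T(1) by (simp add: in_keys_iff rams_def nth_ram)
        qed
        have "of_nat m1 * fls_nth (B $$ (i, i)) (- z) = of_nat m1 * (- of_nat m * plookup q r)"
          using co[OF k0] L R by simp
        then have "fls_nth (B $$ (i, i)) (- z) = - of_nat m * plookup q r"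
          using m1(1) by (simp only: mult_cancel_left of_nat_eq_0_iff) auto
        then show ?thesis using r True T(1) by (simp add: Q_def z)
      next
        case False
        \<comment> \<open>Otherwise the diagonal entry, which lies in C((t^(1/m))), would have a
          term t^(-r) although m r is not an integer.\<close>
        have "r \<notin> pkeys q"
        proof
          assume rk: "r \<in> pkeys q"
          then obtain z where z: "of_nat m1 * r = of_int z" using m1(2) by (auto elim: Ints_cases)
          have "(0 :: rat) < of_int z" using r m1 by (simp flip: z)
          then have z0: "- z < 0" by simp
          define k where "k = int m * (- z)"
          have k0: "k < 0" using z0 T(1) by (simp add: k_def mult_pos_neg)
          have kz: "fls_nth (rams m lam) k = of_nat m * fls_nth lam (- z)" for lam
          proof -
            have "int m dvd k" "k div int m = - z"
              unfolding k_def using T(1) by (simp_all del: mult_minus_right)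
            then show ?thesis using T(1) by (simp add: rams_def nth_ram)
          qed
          have "fls_nth (rams m ?lam) k = of_nat m * fls_nth ?lam (- z)" by (rule kz)
          also have "fls_nth ?lam (- z) = - of_nat m1 * plookup q r"
            unfolding nth_eigenvalue[OF m1(1) z0] using z[symmetric] m1(1) by simp
          finally have "fls_nth (rams m1 (B $$ (i, i))) k = of_nat m * (- of_nat m1 * plookup q r)"
            unfolding co[OF k0] .
          then have "fls_nth (rams m1 (B $$ (i, i))) k \<noteq> 0"
            using rk m1(1) T(1) by (simp add: in_keys_iff)
          then have "int m1 dvd k" using m1(1) by (auto simp: rams_def nth_ram split: if_splits)
          then obtain t where "k = int m1 * t" by (elim dvdE)
          then have "(of_nat m1 :: rat) * (of_nat m * r) = of_nat m1 * of_int (- t)"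
            using z by (metis (no_types, opaque_lifting) k_def minus_minus mult.left_commute mult_minus_right of_int_mult of_int_of_nat_eq)
          then have "of_nat m * r = of_int (- t)" using m1(1) by (simp only: mult_cancel_left of_nat_eq_0_iff) auto
          then show False using False by (metis Ints_of_int)
        qed
        then show ?thesis using False by (simp add: in_keys_iff Q_def)
      qed
    qed
    then show ?thesis using i(1) by (intro image_eqI[of _ _ i]) auto
  qed
  then have "plookup ` {q. pkeys q \<subseteq> {0<..} \<and> (\<exists>m a w. eig n A q m a w)} \<subseteq> Q ` {..<n}" by blast
  then have "finite (plookup ` {q. pkeys q \<subseteq> {0<..} \<and> (\<exists>m a w. eig n A q m a w)})"
    by (rule finite_subset) simp
  then show ?thesis by (rule finite_imageD) (simp add: inj_on_def lookup_inject)
qed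

section \<open>Matrices of a differential module\<close>

lemma sum_fun_apply: "(\<Sum>i\<in>S. f i) x = (\<Sum>i\<in>S. f i x)"
  by (induction S rule: infinite_finite_induct) auto

lemma infinite_P1: "infinite (UNIV :: P1 set)"
proof
  assume "finite (UNIV :: P1 set)"
  then have "finite (range Finite)" by (rule finite_subset[rotated]) simp
  then have "finite (UNIV :: complex set)" by (rule finite_imageD) (simp add: inj_def)
  then show False using infinite_UNIV_char_0 by blast
qed

lemma zariski_open_cofinite: "finite (- U) \<Longrightarrow> zariski_open U"
  unfolding zariski_open_def using infinite_P1 by auto

lemma struct_sheaf_iff: "f \<in> struct_sheaf U \<longleftrightarrow> (\<forall>p\<in>U. vge 0 (expand p f))"
  by (simp add: struct_sheaf_def vge_0_iff)

lemma fls_subdegree_ge_of_vge: "vge N x \<Longrightarrow> N \<le> 0 \<Longrightarrow> N \<le> fls_subdegree x"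
  by (auto simp: vge_iff)

context differential_module
begin

definition dimn :: nat where "dimn = card Basis"

definition bas :: "nat \<Rightarrow> 'm" where "bas = (SOME b. bij_betw b {..<dimn} Basis)"

lemma bij_bas: "bij_betw bas {..<dimn} Basis"
proof -
  obtain b where "bij_betw b {0..<card Basis} Basis" using ex_bij_betw_nat_finite[OF finite_Basis] by blast
  then have "\<exists>b. bij_betw b {..<dimn} Basis" by (auto simp: dimn_def atLeast0LessThan)
  then show ?thesis unfolding bas_def by (rule someI_ex)
qed

lemma bas_in: "i < dimn \<Longrightarrow> bas i \<in> Basis" using bij_bas by (auto simp: bij_betw_def)

lemma Basis_cases: "b \<in> Basis \<Longrightarrow> (\<And>i. i < dimn \<Longrightarrow> b = bas i \<Longrightarrow> thesis) \<Longrightarrow> thesis"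
  using bij_bas by (auto simp: bij_betw_def)

lemma sum_Basis: "(\<Sum>b\<in>Basis. f b) = (\<Sum>i<dimn. f (bas i))"
  using sum.reindex_bij_betw[OF bij_bas, of f] by simp

definition Gm :: "ratfun mat" where
  "Gm = mat dimn dimn (\<lambda>(i, j). representation Basis (nabla (bas j)) (bas i))"

lemma Gm_carrier [simp]: "Gm \<in> carrier_mat dimn dimn" by (simp add: Gm_def)

lemma dim_Gm [simp]: "dim_row Gm = dimn" "dim_col Gm = dimn" by (simp_all add: Gm_def)

lemma delta_matrix_bas:
  assumes "i < dimn" "j < dimn"
  shows "delta_matrix p (bas i) (bas j) = locm p Gm $$ (i, j)"
proof -
  have "representation Basis (delta p (bas j)) = (\<lambda>b. (local_param p / rat_deriv (local_param p)) * representation Basis (nabla (bas j)) b)"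
    unfolding delta_def by (rule representation_scale) (use independent_Basis span_Basis in auto)
  then have "delta_matrix p (bas i) (bas j) = tdz p * expand p (representation Basis (nabla (bas j)) (bas i))"
    by (simp only: delta_matrix_def expand_mult expand_delta_factor)
  then show ?thesis using assms by (simp add: Gm_def locm_def)
qed

lemma comb_representation: "x = (\<Sum>i<dimn. representation Basis x (bas i) *s bas i)"
  using sum_representation_eq[OF independent_Basis _ finite_Basis order_refl, of x] span_Basis
  by (simp add: sum_Basis)

lemma bas_independent:
  assumes "(\<Sum>i<dimn. f i *s bas i) = 0" "i < dimn"
  shows "f i = 0"
proof -
  define g where "g b = f (the_inv_into {..<dimn} bas b)" for b
  have g: "g (bas j) = f j" if "j < dimn" for j
    using bij_bas that by (simp add: g_def the_inv_into_f_f bij_betw_def)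
  have "(\<Sum>b\<in>Basis. g b *s b) = 0" using assms(1) by (simp add: sum_Basis g)
  then have "\<forall>b\<in>Basis. g b = 0" using independent_Basis finite_Basis by (simp add: dependent_finite) blast
  then show ?thesis using g[OF assms(2)] bas_in[OF assms(2)] by auto
qed

lemma nabla_0: "nabla 0 = 0" using nabla_add[of 0 0] by simp

lemma nabla_sum: "nabla (\<Sum>i\<in>S. f i) = (\<Sum>i\<in>S. nabla (f i))"
  by (induction S rule: infinite_finite_induct) (auto simp: nabla_0 nabla_add)

section \<open>Frames of the module over the rational functions\<close>

definition frame :: "ratfun mat \<Rightarrow> nat \<Rightarrow> 'm" where
  "frame T j = (\<Sum>i<dimn. T $$ (i, j) *s bas i)"

definition comb :: "ratfun mat \<Rightarrow> (nat \<Rightarrow> ratfun) \<Rightarrow> 'm" where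
  "comb T f = (\<Sum>j<dimn. f j *s frame T j)"

lemma comb_bas: "comb T f = (\<Sum>i<dimn. mapp dimn T f i *s bas i)"
  unfolding comb_def frame_def mapp_def scale_sum_right scale_sum_left
  by (subst sum.swap) (simp add: mult.commute)

lemma comb_surj:
  assumes "inv_pair dimn T S"
  obtains f where "x = comb T f"
proof -
  define f where "f = mapp dimn S (\<lambda>i. representation Basis x (bas i))"
  have "comb T f = (\<Sum>i<dimn. representation Basis x (bas i) *s bas i)"
    unfolding comb_bas f_def by (intro sum.cong refl) (simp add: inv_pair_apply[OF assms])
  then show ?thesis using that comb_representation[of x] by metis
qed

lemma comb_inj:
  assumes "inv_pair dimn T S" "comb T f = comb T g" "j < dimn"
  shows "f j = g j"
proof -
  have "(\<Sum>i<dimn. (mapp dimn T f i - mapp dimn T g i) *s bas i) = 0"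
    using assms(2) by (simp add: comb_bas scale_left_diff_distrib sum_subtractf)
  then have e: "mapp dimn T f i = mapp dimn T g i" if "i < dimn" for i
    using bas_independent[of "\<lambda>i. mapp dimn T f i - mapp dimn T g i", OF _ that] by simp
  have "mapp dimn S (mapp dimn T f) j = mapp dimn S (mapp dimn T g) j" by (rule mapp_cong) (rule e)
  then show ?thesis using inv_pair_apply[OF inv_pair_sym[OF assms(1)] assms(3)] by simp
qed

lemma comb_cong: "(\<And>j. j < dimn \<Longrightarrow> f j = g j) \<Longrightarrow> comb T f = comb T g"
  by (simp add: comb_def)

lemma comb_add: "comb T f + comb T g = comb T (\<lambda>j. f j + g j)"
  by (simp add: comb_def scale_left_distrib sum.distrib)

lemma comb_scale: "c *s comb T f = comb T (\<lambda>j. c * f j)"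
  by (simp add: comb_def scale_sum_right)

lemma comb_delta: "j < dimn \<Longrightarrow> comb T (\<lambda>i. if i = j then 1 else 0) = frame T j"
  by (simp add: comb_def if_distrib[of "\<lambda>c. c *s _"] sum.delta cong: if_cong)

lemma comb_zero: "comb T (\<lambda>_. 0) = 0" by (simp add: comb_def)

lemma nabla_bas:
  assumes "j < dimn"
  shows "nabla (bas j) = (\<Sum>i<dimn. Gm $$ (i, j) *s bas i)"
  using comb_representation[of "nabla (bas j)"] assms by (simp add: Gm_def)

lemma nabla_frame:
  assumes g: "gauges rat_deriv dimn Gm T G'" and j: "j < dimn"
  shows "nabla (frame T j) = (\<Sum>i<dimn. G' $$ (i, j) *s frame T i)"
proof -
  have c: "T \<in> carrier_mat dimn dimn" "G' \<in> carrier_mat dimn dimn" using g by (auto simp: gauges_def)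
  have "nabla (frame T j) = (\<Sum>i<dimn. rat_deriv (T $$ (i, j)) *s bas i) + (\<Sum>l<dimn. \<Sum>i<dimn. (Gm $$ (i, l) * T $$ (l, j)) *s bas i)"
    by (simp add: frame_def nabla_sum nabla_Leibniz sum.distrib nabla_bas scale_sum_right mult.commute)
  also have "\<dots> = (\<Sum>i<dimn. (Gm * T + map_mat rat_deriv T) $$ (i, j) *s bas i)"
    using c j by (subst sum.swap) (simp add: sum.distrib[symmetric] scale_left_distrib scale_sum_left[symmetric]
        scalar_prod_def atLeast0LessThan add.commute)
  also have "Gm * T + map_mat rat_deriv T = T * G'" using g by (simp add: gauges_def)
  also have "(\<Sum>i<dimn. (T * G') $$ (i, j) *s bas i) = comb T (\<lambda>i. G' $$ (i, j))"
    using c j by (simp add: comb_bas mapp_def scalar_prod_def atLeast0LessThan)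
  finally show ?thesis by (simp add: comb_def)
qed

lemma nabla_comb:
  assumes g: "gauges rat_deriv dimn Gm T G'"
  shows "nabla (comb T f) = comb T (\<lambda>i. rat_deriv (f i) + mapp dimn G' f i)"
proof -
  have "nabla (comb T f) = (\<Sum>j<dimn. rat_deriv (f j) *s frame T j) + (\<Sum>j<dimn. \<Sum>i<dimn. (G' $$ (i, j) * f j) *s frame T i)"
    by (simp add: comb_def nabla_sum nabla_Leibniz sum.distrib nabla_frame[OF g] scale_sum_right mult.commute)
  also have "(\<Sum>j<dimn. \<Sum>i<dimn. (G' $$ (i, j) * f j) *s frame T i) = (\<Sum>i<dimn. mapp dimn G' f i *s frame T i)"
    by (subst sum.swap) (simp add: mapp_def scale_sum_left)
  finally show ?thesis by (simp add: comb_def scale_left_distrib sum.distrib)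
qed

text \<open>If all entries leading out of J vanished, the frame vectors in J would span a submodule,
  neither zero nor everything because a frame is a basis.\<close>

lemma irreducible_matrix_Gm:
  assumes irr: irreducible_module
  shows "irreducible_matrix dimn Gm"
  unfolding irreducible_matrix_def
proof (intro allI impI)
  fix T TI G' J
  assume T: "inv_pair dimn T TI" and g: "gauges rat_deriv dimn Gm T G'"
    and J: "J \<subseteq> {..<dimn}" "J \<noteq> {}" "J \<noteq> {..<dimn}"
  show "\<exists>i<dimn. i \<notin> J \<and> (\<exists>j\<in>J. G' $$ (i, j) \<noteq> 0)"
  proof (rule ccontr)
    assume contra: "\<not> ?thesis"
    define S where "S = {comb T f | f. \<forall>j<dimn. j \<notin> J \<longrightarrow> f j = 0}"
    have "subspace S"
    proof (rule subspaceI)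
      show "0 \<in> S" unfolding S_def using comb_zero[of T] by (auto intro!: exI[of _ "\<lambda>_. 0"])
      show "x + y \<in> S" if "x \<in> S" "y \<in> S" for x y
        using that unfolding S_def by (force simp: comb_add)
      show "c *s x \<in> S" if "x \<in> S" for c x
        using that unfolding S_def by (force simp: comb_scale)
    qed
    moreover have "nabla ` S \<subseteq> S"
    proof
      fix y assume "y \<in> nabla ` S"
      then obtain f where f: "y = nabla (comb T f)" "\<forall>j<dimn. j \<notin> J \<longrightarrow> f j = 0" by (auto simp: S_def)
      have "rat_deriv (f i) + mapp dimn G' f i = 0" if "i < dimn" "i \<notin> J" for i
      proof -
        have "G' $$ (i, j) * f j = 0" if "j < dimn" for j
          using contra f(2) that \<open>i < dimn\<close> \<open>i \<notin> J\<close> by (cases "j \<in> J") auto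
        then have "mapp dimn G' f i = 0" unfolding mapp_def by (intro sum.neutral) auto
        then show ?thesis using f(2) that by (simp add: derivation_0[OF derivation_rat_deriv])
      qed
      then show "y \<in> S" unfolding S_def f(1) nabla_comb[OF g] by blast
    qed
    ultimately have alt: "S = {0} \<or> S = UNIV" using irr unfolding irreducible_module_def by blast
    obtain j where j: "j \<in> J" "j < dimn" using J by blast
    have "frame T j \<in> S" unfolding S_def using comb_delta[OF j(2), of T, symmetric] j by (auto intro!: exI[of _ "\<lambda>i. if i = j then 1 else 0"])
    moreover have "frame T j \<noteq> 0"
    proof
      assume "frame T j = 0"
      then have "comb T (\<lambda>i. if i = j then 1 else 0) = comb T (\<lambda>_. 0)" using comb_delta[OF j(2)] comb_zero by simp
      from comb_inj[OF T this j(2)] show False by simp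
    qed
    ultimately have "S = UNIV" using alt by auto
    obtain i where i: "i < dimn" "i \<notin> J" using J by blast
    have "frame T i \<in> S" using \<open>S = UNIV\<close> by simp
    then obtain f where f: "frame T i = comb T f" "\<forall>j<dimn. j \<notin> J \<longrightarrow> f j = 0" by (auto simp: S_def)
    have "comb T (\<lambda>l. if l = i then 1 else 0) = comb T f" using comb_delta[OF i(1)] f(1) by simp
    from comb_inj[OF T this i(1)] show False using f(2) i by simp
  qed
qed

section \<open>Completions and horizontal bases in coordinates\<close>

definition cvec :: "(nat \<Rightarrow> 'v::zero) \<Rightarrow> 'm \<Rightarrow> 'v" where
  "cvec x b = (if b \<in> Basis then x (the_inv_into {..<dimn} bas b) else 0)"

lemma cvec_bas: "i < dimn \<Longrightarrow> cvec x (bas i) = x i"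
  using bij_bas bas_in by (simp add: cvec_def the_inv_into_f_f bij_betw_def)

lemma cvec_off: "b \<notin> Basis \<Longrightarrow> cvec x b = 0" by (simp add: cvec_def)

lemma cvec_completion: "cvec x \<in> completion" by (simp add: completion_def cvec_off)

lemma cvec_eqI:
  assumes "\<And>i. i < dimn \<Longrightarrow> Y (bas i) = x i" "\<And>b. b \<notin> Basis \<Longrightarrow> Y b = 0"
  shows "Y = cvec x"
proof
  show "Y b = cvec x b" for b
  proof (cases "b \<in> Basis")
    case True
    then obtain i where "i < dimn" "b = bas i" by (rule Basis_cases)
    then show ?thesis using assms(1) by (simp add: cvec_bas)
  qed (simp add: assms(2) cvec_off)
qed

lemma completion_cvec: "Y \<in> completion \<Longrightarrow> Y = cvec (\<lambda>i. Y (bas i))"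
  by (rule cvec_eqI) (auto simp: completion_def)

lemma cvec_cong: "(\<And>i. i < dimn \<Longrightarrow> x i = y i) \<Longrightarrow> cvec x = cvec y"
  by (rule cvec_eqI) (auto simp: cvec_bas cvec_off)

lemma completion_delta_cvec:
  "completion_delta p (cvec x) = cvec (\<lambda>i. theta (x i) + mapp dimn (locm p Gm) x i)"
proof
  fix c
  show "completion_delta p (cvec x) c = cvec (\<lambda>i. theta (x i) + mapp dimn (locm p Gm) x i) c"
  proof (cases "c \<in> Basis")
    case True
    then obtain i where i: "i < dimn" "c = bas i" by (rule Basis_cases)
    have "(\<Sum>b\<in>Basis. delta_matrix p c b * cvec x b) = mapp dimn (locm p Gm) x i"
      unfolding sum_Basis mapp_def by (intro sum.cong refl) (simp add: i delta_matrix_bas cvec_bas)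
    then show ?thesis using True i by (simp add: completion_delta_def cvec_bas theta_def)
  qed (simp add: completion_delta_def cvec_off)
qed

lemma cvec_0: "cvec x = 0 \<longleftrightarrow> (\<forall>i<dimn. x i = 0)"
proof
  assume "cvec x = 0"
  then show "\<forall>i<dimn. x i = 0" using cvec_bas[of _ x] by auto
next
  assume "\<forall>i<dimn. x i = 0"
  then have "0 = cvec x" by (intro cvec_eqI) auto
  then show "cvec x = 0" ..
qed

definition cols :: "complex fls mat \<Rightarrow> nat \<Rightarrow> 'm \<Rightarrow> complex fls" where
  "cols T j = cvec (\<lambda>i. T $$ (i, j))"

lemma sum_cols: "(\<Sum>j<dimn. (\<lambda>b. u j * cols T j b)) = cvec (mapp dimn T u)"
proof
  fix b show "(\<Sum>j<dimn. (\<lambda>b. u j * cols T j b)) b = cvec (mapp dimn T u) b"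
  proof (cases "b \<in> Basis")
    case True
    then obtain i where "i < dimn" "b = bas i" by (rule Basis_cases)
    then show ?thesis by (simp add: sum_fun_apply cols_def cvec_bas mapp_def mult.commute)
  qed (simp add: sum_fun_apply cols_def cvec_off)
qed

lemma cols_basis:
  assumes T: "inv_pair dimn T S"
  shows "inj_on (cols T) {..<dimn}" "coords.independent (cols T ` {..<dimn})" "coords.span (cols T ` {..<dimn}) = completion"
proof -
  have inj0: "u j = 0" if "(\<Sum>j<dimn. (\<lambda>b. u j * cols T j b)) = 0" "j < dimn" for u j
  proof -
    have "mapp dimn T u i = 0" if "i < dimn" for i
      using \<open>(\<Sum>j<dimn. (\<lambda>b. u j * cols T j b)) = 0\<close> that by (simp add: sum_cols cvec_0)
    then have "mapp dimn S (mapp dimn T u) j = mapp dimn S (\<lambda>_. 0) j" by (intro mapp_cong)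
    then show ?thesis using inv_pair_apply[OF inv_pair_sym[OF T] that(2)] by (simp add: mapp_def)
  qed
  show inj: "inj_on (cols T) {..<dimn}"
  proof (rule inj_onI, rule ccontr)
    fix j l assume jl: "j \<in> {..<dimn}" "l \<in> {..<dimn}" "cols T j = cols T l" "j \<noteq> l"
    define u :: "nat \<Rightarrow> complex fls" where "u k = (if k = j then 1 else if k = l then - 1 else 0)" for k
    have "(\<Sum>k<dimn. (\<lambda>b. u k * cols T k b)) = (\<Sum>k\<in>{j, l}. (\<lambda>b. u k * cols T k b))"
      using jl by (intro sum.mono_neutral_right) (auto simp: u_def zero_fun_def)
    also have "\<dots> = 0" using jl(3,4) by (auto simp: u_def fun_eq_iff)
    finally have "u j = 0" using inj0 jl(1) by blast
    then show False by (simp add: u_def)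
  qed
  show "coords.independent (cols T ` {..<dimn})"
  proof (rule coords.independent_if_scalars_zero)
    fix f x assume "(\<Sum>x\<in>cols T ` {..<dimn}. (\<lambda>b. f x * x b)) = 0" "x \<in> cols T ` {..<dimn}"
    then show "f x = 0" using inj0[of "\<lambda>j. f (cols T j)"] by (auto simp: sum.reindex[OF inj])
  qed simp
  have sub: "coords.subspace completion"
    by (rule coords.subspaceI) (auto simp: completion_def)
  show "coords.span (cols T ` {..<dimn}) = completion"
  proof
    show "coords.span (cols T ` {..<dimn}) \<subseteq> completion"
      by (rule coords.span_minimal[OF _ sub]) (auto simp: cols_def cvec_completion)
    show "completion \<subseteq> coords.span (cols T ` {..<dimn})"
    proof
      fix Y assume Y: "Y \<in> completion"
      define u where "u = mapp dimn S (\<lambda>i. Y (bas i))"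
      have "Y = cvec (mapp dimn T u)"
        by (subst completion_cvec[OF Y], rule cvec_cong) (simp add: u_def inv_pair_apply[OF T])
      also have "\<dots> = (\<Sum>j<dimn. (\<lambda>b. u j * cols T j b))" by (rule sum_cols[symmetric])
      also have "\<dots> \<in> coords.span (cols T ` {..<dimn})"
        by (intro coords.span_sum coords.span_scale coords.span_base) auto
      finally show "Y \<in> coords.span (cols T ` {..<dimn})" .
    qed
  qed
qed

lemma nonsingular_pointI:
  assumes T: "inv_pair dimn T S" and g: "gauges theta dimn (locm p Gm) T (0\<^sub>m dimn dimn)"
  shows "nonsingular_point p"
proof -
  have Tc: "T \<in> carrier_mat dimn dimn" using T by (simp add: inv_pair_def)
  have "completion_delta p (cols T j) = 0" if "j < dimn" for j
    unfolding cols_def completion_delta_cvec cvec_0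
  proof (intro allI impI)
    fix i assume i: "i < dimn"
    have "(locm p Gm * T + map_mat theta T) $$ (i, j) = 0" using g Tc i that by (simp add: gauges_def)
    then show "theta (T $$ (i, j)) + mapp dimn (locm p Gm) (\<lambda>i. T $$ (i, j)) i = 0"
      using Tc i that by (simp add: mapp_def scalar_prod_def atLeast0LessThan locm_def Gm_def add.commute)
  qed
  then show ?thesis unfolding nonsingular_point_def
    by (intro exI[of _ "cols T ` {..<dimn}"]) (use cols_basis[OF T] in auto)
qed

text \<open>A horizontal basis has as many elements as the standard one; expressing the standard
  basis through it inverts the matrix of its coordinates.\<close>

lemma nonsingular_pointD:
  assumes "nonsingular_point p"
  obtains T S where "inv_pair dimn T S" "gauges theta dimn (locm p Gm) T (0\<^sub>m dimn dimn)"
proof -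
  obtain B where B: "coords.independent B" "coords.span B = completion" "\<And>Y. Y \<in> B \<Longrightarrow> completion_delta p Y = 0"
    using assms unfolding nonsingular_point_def by blast
  let ?E = "cols (1\<^sub>m dimn) ` {..<dimn}"
  note E = cols_basis[OF inv_pair_one]
  have cE: "card ?E = dimn" using card_image[OF E(1)] by simp
  have BC: "B \<subseteq> coords.span ?E" unfolding E(3) B(2)[symmetric] by (rule coords.span_superset)
  have b1: "finite B" "card B \<le> dimn"
    using coords.independent_span_bound[OF _ B(1) BC] cE by auto
  have EB: "?E \<subseteq> coords.span B" unfolding B(2) E(3)[symmetric] by (rule coords.span_superset)
  have "dimn \<le> card B" using coords.independent_span_bound[OF b1(1) E(2) EB] cE by auto
  then have "card B = dimn" using b1 by simp
  then obtain y where y: "bij_betw y {..<dimn} B"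
    using ex_bij_betw_nat_finite[OF b1(1)] by (auto simp: atLeast0LessThan)
  have yB: "y j \<in> B" if "j < dimn" for j using y that by (auto simp: bij_betw_def)
  have yc: "y j = cvec (\<lambda>i. y j (bas i))" if "j < dimn" for j
    by (rule completion_cvec) (use yB[OF that] B(2) coords.span_superset in blast)
  define T where "T = mat dimn dimn (\<lambda>(i, j). y j (bas i))"
  have Tc: "T \<in> carrier_mat dimn dimn" by (simp add: T_def)
  have "\<exists>u. \<forall>i<dimn. mapp dimn T u i = (if i = l then 1 else 0)" if l: "l < dimn" for l
  proof -
    have "cols (1\<^sub>m dimn) l \<in> coords.span B" using EB l by blast
    then obtain u where u: "cols (1\<^sub>m dimn) l = (\<Sum>v\<in>B. (\<lambda>b. u v * v b))"
      unfolding coords.span_finite[OF b1(1)] by auto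
    have "mapp dimn T (\<lambda>j. u (y j)) i = (if i = l then 1 else 0)" if i: "i < dimn" for i
    proof -
      have "(\<Sum>v\<in>B. (\<lambda>b. u v * v b)) = (\<Sum>j<dimn. (\<lambda>b. u (y j) * y j b))"
        using sum.reindex_bij_betw[OF y, of "\<lambda>v b. u v * v b"] by simp
      then have "cols (1\<^sub>m dimn) l (bas i) = (\<Sum>j<dimn. u (y j) * y j (bas i))"
        using u by (simp add: sum_fun_apply)
      then show ?thesis using i l by (simp add: cols_def cvec_bas mapp_def T_def mult.commute)
    qed
    then show ?thesis by blast
  qed
  then obtain u where u: "\<And>l i. l < dimn \<Longrightarrow> i < dimn \<Longrightarrow> mapp dimn T (u l) i = (if i = l then 1 else 0)" by metis
  define S where "S = mat dimn dimn (\<lambda>(i, l). u l i)"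
  have Sc: "S \<in> carrier_mat dimn dimn" by (simp add: S_def)
  have TS: "T * S = 1\<^sub>m dimn"
  proof (rule eq_matI)
    fix i l assume il: "i < dim_row (1\<^sub>m dimn :: complex fls mat)" "l < dim_col (1\<^sub>m dimn :: complex fls mat)"
    then have "(T * S) $$ (i, l) = mapp dimn T (u l) i"
      using Tc by (simp add: scalar_prod_def atLeast0LessThan mapp_def S_def)
    then show "(T * S) $$ (i, l) = 1\<^sub>m dimn $$ (i, l)" using u il by simp
  qed (use Tc Sc in auto)
  then have i: "inv_pair dimn T S" using mat_mult_left_right_inverse[OF Tc Sc] Tc Sc by (simp add: inv_pair_def)
  have "locm p Gm * T + map_mat theta T = T * 0\<^sub>m dimn dimn"
  proof (rule eq_matI)
    fix i j assume "i < dim_row (T * 0\<^sub>m dimn dimn)" "j < dim_col (T * 0\<^sub>m dimn dimn)"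
    then have ij: "i < dimn" "j < dimn" using Tc by auto
    have "cvec (\<lambda>i. theta (y j (bas i)) + mapp dimn (locm p Gm) (\<lambda>i. y j (bas i)) i) = 0"
      using B(3)[OF yB[OF ij(2)]] completion_delta_cvec[of p "\<lambda>i. y j (bas i)"] yc[OF ij(2)] by simp
    then have "theta (y j (bas i)) + mapp dimn (locm p Gm) (\<lambda>i. y j (bas i)) i = 0" using ij(1) by (simp add: cvec_0)
    then show "(locm p Gm * T + map_mat theta T) $$ (i, j) = (T * 0\<^sub>m dimn dimn) $$ (i, j)"
      using ij Tc by (simp add: mapp_def scalar_prod_def atLeast0LessThan locm_def Gm_def T_def add.commute)
  qed (use Tc in auto)
  then have "gauges theta dimn (locm p Gm) T (0\<^sub>m dimn dimn)" using Tc by (simp add: gauges_def)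
  then show ?thesis using that i by blast
qed

text \<open>Without a pole there is a fundamental matrix with value 1 at t = 0, whose determinant is
  then non-zero. This leaves only finitely many candidates for singular points.\<close>

lemma nonsingular_of_regular:
  assumes "mvge 1 dimn (locm p Gm)"
  shows "nonsingular_point p"
proof -
  define A where "A i j = (if i < dimn \<and> j < dimn then locm p Gm $$ (i, j) else 0)" for i j
  have "vge 1 (A i j)" for i j using assms by (simp add: A_def mvge_def)
  then have "\<exists>x. (\<forall>i. vge 0 (x i)) \<and> (\<forall>i. theta (x i) + (\<Sum>k<dimn. A i k * x k) = 0) \<and> (\<forall>i. fls_nth (x i) 0 = (if i = j then 1 else 0))" for j
    using formal_system_solution[of A dimn "\<lambda>i. if i = j then 1 else 0"] by metis
  then obtain x where x: "\<And>j i. vge 0 (x j i)" "\<And>j i. theta (x j i) + (\<Sum>k<dimn. A i k * x j k) = 0"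
    "\<And>j i. fls_nth (x j i) 0 = (if i = j then 1 else 0)" by metis
  define T where "T = mat dimn dimn (\<lambda>(i, j). x j i)"
  have Tc: "T \<in> carrier_mat dimn dimn" by (simp add: T_def)
  have "fls_nth (det T) 0 = det (map_mat (\<lambda>x. fls_nth x 0) T)"
    by (rule nth_det[OF Tc]) (simp add: mvge_def T_def x(1))
  also have "map_mat (\<lambda>x. fls_nth x 0) T = 1\<^sub>m dimn" by (rule eq_matI) (auto simp: T_def x(3))
  finally have "det T \<noteq> 0" by auto
  then obtain S where S: "inv_pair dimn T S" using inv_pair_of_det[OF Tc] by blast
  have "locm p Gm * T + map_mat theta T = T * 0\<^sub>m dimn dimn"
  proof (rule eq_matI)
    fix i j assume "i < dim_row (T * 0\<^sub>m dimn dimn)" "j < dim_col (T * 0\<^sub>m dimn dimn)"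
    then have ij: "i < dimn" "j < dimn" using Tc by auto
    have "(\<Sum>k<dimn. A i k * x j k) = (\<Sum>k<dimn. locm p Gm $$ (i, k) * x j k)"
      using ij by (intro sum.cong) (auto simp: A_def)
    then show "(locm p Gm * T + map_mat theta T) $$ (i, j) = (T * 0\<^sub>m dimn dimn) $$ (i, j)"
      using x(2)[of j i] ij Tc by (simp add: scalar_prod_def atLeast0LessThan locm_def Gm_def T_def add.commute)
  qed (use Tc in auto)
  then have "gauges theta dimn (locm p Gm) T (0\<^sub>m dimn dimn)" using Tc by (simp add: gauges_def)
  then show ?thesis by (rule nonsingular_pointI[OF S])
qed

end

section \<open>Solution of the Riemann-Hilbert problem\<close>

context differential_module
begin

lemma fsol_of_formal_solution:
  assumes "Y \<in> formal_solutions p q"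
  shows "fsol dimn (locm p Gm) q (\<lambda>i. Y (bas i))"
  unfolding fsol_def
proof (intro conjI allI impI)
  fix i assume i: "i < dimn"
  show "log_series (Y (bas i))" using assms bas_in[OF i] by (auto simp: formal_solutions_def)
  fix a k
  have "log_ser_delta (Y (bas i)) + (\<Sum>b\<in>Basis. fls_times_log_ser (delta_matrix p (bas i) b) (Y b))
      + exp_part_times_log_ser q (Y (bas i)) = 0"
    using assms bas_in[OF i] by (auto simp: formal_solutions_def)
  from fun_cong[OF fun_cong[OF this, of a], of k]
  show "log_ser_delta (Y (bas i)) a k + (\<Sum>j<dimn. fls_times_log_ser (locm p Gm $$ (i, j)) (Y (bas j)) a k)
      + exp_part_times_log_ser q (Y (bas i)) a k = 0"
    using i by (simp add: sum_Basis sum_fun_apply delta_matrix_bas)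
qed

lemma formal_solution_of_fsol:
  assumes "fsol dimn (locm p Gm) q Y"
  shows "cvec Y \<in> formal_solutions p q"
proof -
  have "log_ser_delta (cvec Y c) + (\<Sum>b\<in>Basis. fls_times_log_ser (delta_matrix p c b) (cvec Y b))
      + exp_part_times_log_ser q (cvec Y c) = 0" if c: "c \<in> Basis" for c
  proof -
    obtain i where i: "i < dimn" "c = bas i" using c by (rule Basis_cases)
    show ?thesis
    proof (intro ext)
      fix a k
      show "(log_ser_delta (cvec Y c) + (\<Sum>b\<in>Basis. fls_times_log_ser (delta_matrix p c b) (cvec Y b))
          + exp_part_times_log_ser q (cvec Y c)) a k = 0 a k"
        using assms i by (simp add: fsol_def sum_Basis sum_fun_apply delta_matrix_bas cvec_bas)
    qed
  qed
  moreover have "log_series (cvec Y c)" if c: "c \<in> Basis" for c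
  proof -
    obtain i where "i < dimn" "c = bas i" using c by (rule Basis_cases)
    then show ?thesis using assms by (simp add: fsol_def cvec_bas)
  qed
  ultimately show ?thesis by (simp add: formal_solutions_def cvec_off)
qed

text \<open>Replaces formal solutions by eigenvectors over ramified extensions, which are what the
  local theory handles.\<close>

lemma eigenvalues_iff:
  "q \<in> eigenvalues p \<longleftrightarrow> pkeys q \<subseteq> {0<..} \<and> (\<exists>m a w. eig dimn (locm p Gm) q m a w)"
proof (intro iffI conjI)
  assume q: "q \<in> eigenvalues p"
  then show k: "pkeys q \<subseteq> {0<..}" by (simp add: eigenvalues_def exponential_parts_def)
  have "cvec (\<lambda>_. 0) \<in> formal_solutions p q"
    by (rule formal_solution_of_fsol)
       (auto simp: fsol_def log_series_def log_ser_delta_def fls_times_log_ser_def exp_part_times_log_ser_def)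
  moreover have "cvec (\<lambda>_. 0) = (0 :: 'm \<Rightarrow> log_ser)" by (simp add: cvec_0)
  ultimately obtain Y where Y: "Y \<in> formal_solutions p q" "Y \<noteq> 0"
    using q unfolding eigenvalues_def by auto
  then obtain b where b: "Y b \<noteq> 0" by (auto simp: fun_eq_iff)
  then have "b \<in> Basis" using Y(1) by (auto simp: formal_solutions_def)
  then obtain i where i: "i < dimn" "b = bas i" by (rule Basis_cases)
  show "\<exists>m a w. eig dimn (locm p Gm) q m a w"
    by (rule eig_of_fsol[OF _ fsol_of_formal_solution[OF Y(1)] i(1) _ k]) (use b i in \<open>auto simp: zero_fun_def\<close>)
next
  assume q: "pkeys q \<subseteq> {0<..} \<and> (\<exists>m a w. eig dimn (locm p Gm) q m a w)"
  then obtain m a w where e: "eig dimn (locm p Gm) q m a w" by blast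
  obtain Y i where Y: "fsol dimn (locm p Gm) q Y" "i < dimn" "Y i \<noteq> (\<lambda>_ _. 0)"
    by (rule fsol_of_eig[OF _ e]) (use q in auto)
  have "cvec Y \<noteq> 0" unfolding cvec_0 using Y(2,3) by (auto simp: zero_fun_def)
  then show "q \<in> eigenvalues p" using formal_solution_of_fsol[OF Y(1)] q
    by (auto simp: eigenvalues_def exponential_parts_def)
qed

lemma finite_eigenvalues: "finite (eigenvalues p)"
proof -
  have "eigenvalues p = {q. pkeys q \<subseteq> {0<..} \<and> (\<exists>m a w. eig dimn (locm p Gm) q m a w)}"
    using eigenvalues_iff by blast
  then show ?thesis using finite_eig[of "locm p Gm" dimn] by simp
qed

lemma eigenvalue_of_eigv:
  assumes "m > 0" "eigv dimn (ramm m (locm p Gm)) lam w"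
  obtains q where "q \<in> eigenvalues p"
    "\<And>k. k < 0 \<Longrightarrow> fls_nth lam k = - of_nat m * plookup q (of_int (- k) / of_nat m)"
  using eig_of_eigv[OF assms] eigenvalues_iff by metis

lemma eigenvalues_nonempty:
  assumes "dimn > 0"
  shows "eigenvalues p \<noteq> {}"
proof -
  obtain m lam w where "m > 0" "eigv dimn (ramm m (locm p Gm)) lam w"
    using eigenvector_exists[OF _ assms, of "locm p Gm"] by auto
  then show ?thesis using eigenvalue_of_eigv by blast
qed

lemma exp_part_degree_le_Katz:
  "q \<in> eigenvalues p \<Longrightarrow> exp_part_degree q \<le> Katz_invariant p"
  unfolding Katz_invariant_def using finite_eigenvalues by simp

lemma Katz_nonneg:
  assumes "dimn > 0"
  shows "Katz_invariant p \<ge> 0"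
proof -
  obtain q where q: "q \<in> eigenvalues p" using eigenvalues_nonempty[OF assms] by blast
  have "exp_part_degree q \<ge> 0"
  proof (cases "q = 0")
    case False
    then have "Max (pkeys q) \<in> pkeys q" by simp
    then have "0 < Max (pkeys q)" using q unfolding eigenvalues_iff by blast
    then show ?thesis using False by (simp add: exp_part_degree_def)
  qed (simp add: exp_part_degree_def)
  then show ?thesis using exp_part_degree_le_Katz[OF q] by simp
qed

text \<open>Up to integral terms a diagonal entry is an eigenvalue over the ramified extension, with
  polar part - m q for some q of degree at most the Katz invariant. The bound is rounded up, as e in
  \<open>locgood\<close> is an integer.\<close>

lemma diagonal_bound:
  assumes m: "m > 0" and T: "inv_pair dimn T S" and g: "gauges theta dimn (ramm m (locm p Gm)) T B"
    and B: "upper_triangular B" and i: "i < dimn"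
  shows "vge (- (int m * \<lceil>Katz_invariant p\<rceil>)) (B $$ (i, i))"
proof -
  have Bc: "B \<in> carrier_mat dimn dimn" using g by (simp add: gauges_def)
  obtain lam w where w: "eigv dimn B lam w" "vge 0 (lam - B $$ (i, i))"
    using triangular_eigenvector[OF Bc B i] by blast
  obtain q where q: "q \<in> eigenvalues p"
    "\<And>k. k < 0 \<Longrightarrow> fls_nth lam k = - of_nat m * plookup q (of_int (- k) / of_nat m)"
    using eigenvalue_of_eigv[OF m eigv_gauge[OF g T w(1)]] by blast
  have K: "0 \<le> \<lceil>Katz_invariant p\<rceil>" using Katz_nonneg i ceiling_mono[of 0 "Katz_invariant p"] by simp
  show ?thesis unfolding vge_def
  proof (intro allI impI)
    fix k assume k: "k < - (int m * \<lceil>Katz_invariant p\<rceil>)"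
    have "0 \<le> int m * \<lceil>Katz_invariant p\<rceil>" using K by simp
    then have k0: "k < 0" using k by linarith
    have "of_int (- k) / of_nat m \<notin> pkeys q"
    proof
      assume r: "of_int (- k) / of_nat m \<in> pkeys q"
      then have "of_int (- k) / of_nat m \<le> Max (pkeys q)" "q \<noteq> 0" by auto
      then have "of_int (- k) / of_nat m \<le> exp_part_degree q" by (simp add: exp_part_degree_def)
      also have "\<dots> \<le> Katz_invariant p" by (rule exp_part_degree_le_Katz[OF q(1)])
      also have "\<dots> \<le> of_int \<lceil>Katz_invariant p\<rceil>" by (rule le_of_int_ceiling)
      finally have "(of_int (- k) :: rat) \<le> of_int \<lceil>Katz_invariant p\<rceil> * of_nat m"
        using m by (simp only: pos_divide_le_eq of_nat_0_less_iff)
      also have "\<dots> = of_int (int m * \<lceil>Katz_invariant p\<rceil>)" by (simp add: mult.commute)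
      finally have "- k \<le> int m * \<lceil>Katz_invariant p\<rceil>" by (simp only: of_int_le_iff)
      then show False using k by linarith
    qed
    then have "fls_nth lam k = 0" using q(2)[OF k0] by (simp add: in_keys_iff)
    moreover have "fls_nth (lam - B $$ (i, i)) k = 0" using w(2) k0 by (simp add: vge_def)
    ultimately show "fls_nth (B $$ (i, i)) k = 0" by simp
  qed
qed

text \<open>Spacing the triangular frame by a bound N for its poles leaves the pole order to the
  diagonal.\<close>

lemma locgood_Katz:
  assumes n: "dimn > 0"
  shows "locgood dimn \<lceil>Katz_invariant p\<rceil> (locm p Gm)"
proof -
  define K where "K = \<lceil>Katz_invariant p\<rceil>"
  have K: "K \<ge> 0" using Katz_nonneg[OF n] ceiling_mono[of 0 "Katz_invariant p"] by (simp add: K_def)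
  obtain m T S B where T: "m > 0" "inv_pair dimn T S" "gauges theta dimn (ramm m (locm p Gm)) T B" "upper_triangular B"
    by (rule ramified_triangularization[of "locm p Gm" dimn]) auto
  have Bc: "B \<in> carrier_mat dimn dimn" using T(3) by (simp add: gauges_def)
  obtain N where N: "N \<ge> 0" "mvge (- N) dimn B" by (rule mvge_ex)
  have sp: "int j * N - int i * N \<ge> N" if "i < j" for i j :: nat
    using mult_right_mono[of 1 "int j - int i" N] that N(1) by (simp add: left_diff_distrib)
  obtain C where C: "gauges theta dimn B (dg dimn (\<lambda>i. int i * N)) C" "mvge (- (int m * K)) dimn C"
    by (rule dg_gauge_spread[OF Bc T(4) N(2), where r = "- (int m * K)" and l = "\<lambda>i. int i * N"])
       (use diagonal_bound[OF T(1-4)] K sp in \<open>auto simp: K_def\<close>)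
  have "vge (- (int m * K)) (theta (z i) + mapp dimn C z i)" if z: "\<And>j. j < dimn \<Longrightarrow> vge 0 (z j)" and i: "i < dimn" for z i
  proof (rule vge_add)
    show "vge (- (int m * K)) (theta (z i))"
      by (rule vge_mono[OF vge_theta[OF z[OF i]]]) (use K in simp)
    have "vge (- (int m * K)) (z j * C $$ (i, j))" if "j < dimn" for j
      using C(2) i that z by (intro vge_mult0) (auto simp: mvge_def)
    then show "vge (- (int m * K)) (mapp dimn C z i)"
      unfolding mapp_def by (intro vge_sum) (simp add: mult.commute)
  qed
  then show ?thesis
    using T(1) gauges_trans[OF derivation_theta T(3) C(1)] inv_pair_mult[OF T(2) inv_pair_dg]
    unfolding locgood_def K_def by blast
qed

text \<open>In a horizontal basis the operator is theta, which maps integral vectors to vectors of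
  order at least 1.\<close>

lemma locgood_nonsingular:
  assumes "nonsingular_point p"
  shows "locgood dimn (- 1) (locm p Gm)"
proof -
  obtain T S where T: "inv_pair dimn T S" "gauges theta dimn (locm p Gm) T (0\<^sub>m dimn dimn)"
    by (rule nonsingular_pointD[OF assms])
  have "vge 1 (theta (z i) + mapp dimn (0\<^sub>m dimn dimn) z i)" if "\<And>j. j < dimn \<Longrightarrow> vge 0 (z j)" "i < dimn" for z i
    using vge_theta_1 that by (simp add: mapp_def)
  then show ?thesis using T unfolding locgood_def
    by (intro exI[of _ 1] exI[of _ T] exI[of _ S] exI[of _ "0\<^sub>m dimn dimn"]) (simp del: One_nat_def)
qed

lemma Katz_divisor_locgood:
  "dimn > 0 \<Longrightarrow> locgood dimn (Katz_divisor p - 1) (locm p Gm)"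
  using locgood_Katz locgood_nonsingular by (auto simp: Katz_divisor_def singular_point_def)

text \<open>A coefficient of an eigenvalue at k < 0 yields an exponential part with the exponent - k
  / m, which is an integer only if m divides k.\<close>

lemma unram_of_unramified:
  assumes "unramified_point p"
  shows "unram dimn (locm p Gm)"
  unfolding unram_def
proof (intro allI impI)
  fix m lam w and k :: int
  assume m: "m > 0" and w: "eigv dimn (ramm m (locm p Gm)) lam w" and k: "k < 0" "fls_nth lam k \<noteq> 0"
  obtain q where q: "q \<in> eigenvalues p"
    "\<And>k. k < 0 \<Longrightarrow> fls_nth lam k = - of_nat m * plookup q (of_int (- k) / of_nat m)"
    using eigenvalue_of_eigv[OF m w] by blast
  have "of_int (- k) / of_nat m \<in> pkeys q" using q(2)[OF k(1)] k(2) m by (simp add: in_keys_iff)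
  then have "(of_int (- k) / of_nat m :: rat) \<in> \<int>" using q(1) assms unfolding unramified_point_def by blast
  then obtain z where "(of_int (- k) / of_nat m :: rat) = of_int z" by (elim Ints_cases)
  then have "(of_int (- k) :: rat) = of_int (z * int m)"
    using m by (simp only: divide_eq_eq of_nat_eq_0_iff of_int_mult of_int_of_nat_eq)
  then have "- k = z * int m" by (simp only: of_int_eq_iff)
  then show "int m dvd k" by (metis dvd_minus_iff dvd_triv_right)
qed

lemma Katz_divisor_bounds:
  assumes "dimn > 0"
  shows "Katz_divisor p \<ge> 0" "singular_point p \<Longrightarrow> Katz_divisor p \<ge> 1"
  using Katz_nonneg[OF assms, of p] ceiling_mono[of 0 "Katz_invariant p"] by (auto simp: Katz_divisor_def)

lemma finite_singular_points: "finite {p. singular_point p}"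
proof (rule finite_subset)
  show "{p. singular_point p} \<subseteq> {p. \<not> goodm dimn (\<lambda>_. 0) p Gm}"
    using nonsingular_of_regular by (auto simp: goodm_def singular_point_def)
  show "finite {p. \<not> goodm dimn (\<lambda>_. 0) p Gm}" by (rule finite_bad_points) auto
qed

lemma effective_Katz_divisor:
  assumes "dimn > 0"
  shows "effective_divisor Katz_divisor"
  unfolding effective_divisor_def
proof (intro conjI allI)
  show "finite {p. Katz_divisor p \<noteq> 0}"
    by (rule finite_subset[OF _ finite_singular_points]) (auto simp: Katz_divisor_def)
qed (rule Katz_divisor_bounds[OF assms])

text \<open>In rank 0 every point is non-singular.\<close>

lemma dimension_pos:
  assumes "singular_point p"
  shows "dimn > 0"
  using nonsingular_of_regular[of p] assms by (cases "dimn = 0") (auto simp: mvge_def singular_point_def)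

lemma Katz_free_frame:
  assumes irr: irreducible_module and p: "singular_point p" "unramified_point p"
  obtains T TI G' where "inv_pair dimn T TI" "gauges rat_deriv dimn Gm T G'" "\<And>q. goodm dimn Katz_divisor q G'"
proof -
  note n = dimension_pos[OF p(1)]
  obtain T S B where T: "inv_pair dimn T S" "gauges theta dimn (locm p Gm) T B" "upper_triangular B"
    by (rule unramified_triangularization[OF _ unram_of_unramified[OF p(2)]]) auto
  \<comment> \<open>Here m = 1, since the triangular frame lies over C((t)) itself.\<close>
  have d: "vge (1 - Katz_divisor p) (B $$ (i, i))" if "i < dimn" for i
    using diagonal_bound[of 1 T S p B, OF _ T(1) _ T(3) that] T(2) p(1)
    by (simp del: One_nat_def add: Katz_divisor_def)
  show ?thesis
    by (rule free_frame[OF Gm_carrier irreducible_matrix_Gm[OF irr] n Katz_divisor_bounds(1)[OF n] _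
        Katz_divisor_bounds(2)[OF n p(1)] Katz_divisor_locgood[OF n] T(2,1,3) d])
       (use effective_Katz_divisor[OF n] that in \<open>auto simp: effective_divisor_def\<close>)
qed

section \<open>The free bundle spanned by a frame\<close>

definition frame_sheaf :: "ratfun mat \<Rightarrow> P1 set \<Rightarrow> 'm set" where
  "frame_sheaf T U = {comb T f | f. \<forall>j<dimn. f j \<in> struct_sheaf U}"

lemma struct_sheaf_closed:
  "0 \<in> struct_sheaf U" "1 \<in> struct_sheaf U"
  "f \<in> struct_sheaf U \<Longrightarrow> g \<in> struct_sheaf U \<Longrightarrow> f + g \<in> struct_sheaf U"
  "f \<in> struct_sheaf U \<Longrightarrow> g \<in> struct_sheaf U \<Longrightarrow> f * g \<in> struct_sheaf U"
  by (auto simp: struct_sheaf_iff expand_add expand_mult intro: vge_add vge_mult0)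

lemma inj_frame:
  assumes T: "inv_pair dimn T S"
  shows "inj_on (frame T) {..<dimn}"
proof (rule inj_onI, rule ccontr)
  fix i j assume ij: "i \<in> {..<dimn}" "j \<in> {..<dimn}" "frame T i = frame T j" "i \<noteq> j"
  have "comb T (\<lambda>l. if l = i then 1 else 0) = comb T (\<lambda>l. if l = j then 1 else 0)"
    using ij comb_delta[of i T] comb_delta[of j T] by simp
  from comb_inj[OF T this, of i] show False using ij by simp
qed

lemma frame_sheaf_free:
  assumes T: "inv_pair dimn T S"
  shows "free_on (frame_sheaf T) W (frame T ` {..<dimn})"
  unfolding free_on_def
proof (intro conjI allI impI)
  let ?B = "frame T ` {..<dimn}"
  note inj = inj_frame[OF T]
  have c: "(\<Sum>b\<in>?B. f b *s b) = comb T (\<lambda>j. f (frame T j))" for f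
    by (simp add: sum.reindex[OF inj] comb_def)
  show "independent ?B"
  proof (rule independent_if_scalars_zero)
    fix f x assume "(\<Sum>b\<in>?B. f b *s b) = 0" and x: "x \<in> ?B"
    then have "comb T (\<lambda>j. f (frame T j)) = comb T (\<lambda>_. 0)" by (simp add: c comb_zero)
    then show "f x = 0" using comb_inj[OF T] x by fastforce
  qed simp
  fix U
  show "frame_sheaf T U = {\<Sum>b\<in>?B. f b *s b | f. \<forall>b\<in>?B. f b \<in> struct_sheaf U}"
  proof (intro equalityI subsetI)
    fix x assume "x \<in> frame_sheaf T U"
    then obtain f where f: "x = comb T f" "\<forall>j<dimn. f j \<in> struct_sheaf U" by (auto simp: frame_sheaf_def)
    define g where "g b = f (the_inv_into {..<dimn} (frame T) b)" for b
    have g: "g (frame T j) = f j" if "j < dimn" for j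
      using that by (simp add: g_def the_inv_into_f_f[OF inj])
    have "x = (\<Sum>b\<in>?B. g b *s b)" unfolding c f(1) by (rule comb_cong) (simp add: g)
    then show "x \<in> {\<Sum>b\<in>?B. f b *s b | f. \<forall>b\<in>?B. f b \<in> struct_sheaf U}" using f(2) g by auto
  next
    fix x assume "x \<in> {\<Sum>b\<in>?B. f b *s b | f. \<forall>b\<in>?B. f b \<in> struct_sheaf U}"
    then obtain f where "x = (\<Sum>b\<in>?B. f b *s b)" "\<forall>b\<in>?B. f b \<in> struct_sheaf U" by blast
    then show "x \<in> frame_sheaf T U" unfolding c frame_sheaf_def by auto
  qed
qed simp

lemma frame_sheaf_coeff:
  assumes "inv_pair dimn T S" "comb T f \<in> frame_sheaf T U" "j < dimn"
  shows "f j \<in> struct_sheaf U"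
  using assms(2,3) comb_inj[OF assms(1)] by (auto simp: frame_sheaf_def) metis

lemma frame_sheaf_vector_bundle:
  assumes T: "inv_pair dimn T S"
  shows "vector_bundle (frame_sheaf T)"
  unfolding vector_bundle_def
proof (intro conjI allI impI ballI)
  fix U
  show "0 \<in> frame_sheaf T U"
    unfolding frame_sheaf_def using comb_zero[of T, symmetric] struct_sheaf_closed(1) by blast
  show "x + y \<in> frame_sheaf T U" if "x \<in> frame_sheaf T U" "y \<in> frame_sheaf T U" for x y
    using that struct_sheaf_closed(3) unfolding frame_sheaf_def by (force simp: comb_add)
  show "f *s x \<in> frame_sheaf T U" if "f \<in> struct_sheaf U" "x \<in> frame_sheaf T U" for f x
    using that struct_sheaf_closed(4) unfolding frame_sheaf_def by (force simp: comb_scale)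
next
  fix U U' assume "zariski_open U \<and> zariski_open U' \<and> U' \<subseteq> U"
  then show "frame_sheaf T U \<subseteq> frame_sheaf T U'" unfolding frame_sheaf_def struct_sheaf_def by blast
next
  fix \<U> :: "P1 set set" assume U: "\<U> \<noteq> {} \<and> (\<forall>U\<in>\<U>. zariski_open U)"
  show "(\<Inter>U\<in>\<U>. frame_sheaf T U) \<subseteq> frame_sheaf T (\<Union>\<U>)"
  proof
    fix x assume x: "x \<in> (\<Inter>U\<in>\<U>. frame_sheaf T U)"
    obtain f where f: "x = comb T f" by (rule comb_surj[OF T])
    have "f j \<in> struct_sheaf U" if "j < dimn" "U \<in> \<U>" for j U
      using frame_sheaf_coeff[OF T _ that(1)] x that(2) f by blast
    then have "f j \<in> struct_sheaf (\<Union>\<U>)" if "j < dimn" for j using that unfolding struct_sheaf_def by blast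
    then show "x \<in> frame_sheaf T (\<Union>\<U>)" unfolding frame_sheaf_def f by blast
  qed
next
  fix p
  show "\<exists>W B. zariski_open W \<and> p \<in> W \<and> free_on (frame_sheaf T) W B"
    using frame_sheaf_free[OF T, of UNIV] zariski_open_cofinite[of UNIV]
    by (intro exI[of _ UNIV] exI[of _ "frame T ` {..<dimn}"]) simp
qed

text \<open>The coordinates of an element have finitely many poles; away from them it is a
  section.\<close>

lemma frame_sheaf_generic_fibre:
  assumes T: "inv_pair dimn T S"
  shows "generic_fibre (frame_sheaf T) = UNIV"
proof -
  have "\<exists>U. zariski_open U \<and> x \<in> frame_sheaf T U" for x
  proof -
    obtain f where f: "x = comb T f" by (rule comb_surj[OF T])
    define U where "U = {p. \<forall>j<dimn. vge 0 (expand p (f j))}"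
    have "- U = (\<Union>j<dimn. {p. \<not> vge 0 (expand p (f j))})" by (auto simp: U_def)
    then have "zariski_open U" using finite_poles by (intro zariski_open_cofinite) simp
    moreover have "f j \<in> struct_sheaf U" if "j < dimn" for j using that by (simp add: struct_sheaf_iff U_def)
    ultimately show ?thesis unfolding frame_sheaf_def f by blast
  qed
  then show ?thesis unfolding generic_fibre_def by blast
qed

lemma frame_sheaf_connection:
  assumes T: "inv_pair dimn T S" and g: "gauges rat_deriv dimn Gm T G'"
    and G': "\<And>p. goodm dimn d p G'" and d: "effective_divisor d"
  shows "connection_with_singularities (frame_sheaf T) d"
  unfolding connection_with_singularities_def
proof (intro conjI allI impI subsetI)
  show "vector_bundle (frame_sheaf T)" by (rule frame_sheaf_vector_bundle[OF T])
  show "effective_divisor d" by (rule d)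
  fix U y assume U: "zariski_open U" and "y \<in> nabla ` frame_sheaf T U"
  then obtain f where f: "y = nabla (comb T f)" "\<And>j. j < dimn \<Longrightarrow> f j \<in> struct_sheaf U"
    by (auto simp: frame_sheaf_def)
  define h where "h i = rat_deriv (f i) + mapp dimn G' f i" for i
  have dim: "dim_row G' = dimn" "dim_col G' = dimn" using g by (auto simp: gauges_def)
  have "h i \<in> Omega d U" if i: "i < dimn" for i
  proof -
    have "- d p \<le> fls_subdegree (expand p (h i) * fls_deriv (coord_at p))" if p: "p \<in> U" for p
    proof -
      have reg: "vge 0 (expand p (f j))" if "j < dimn" for j
        using f(2)[OF that] p by (simp add: struct_sheaf_iff)
      have d0: "d p \<ge> 0" using d by (simp add: effective_divisor_def)
      \<comment> \<open>The order is estimated along t d/dt, where \<open>goodm\<close> applies;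
        removing the factor t afterwards gives the coefficient of dt.\<close>
      have "tdz p * expand p (h i) = theta (expand p (f i)) + (\<Sum>j<dimn. expand p (f j) * locm p G' $$ (i, j))"
        using i by (simp add: h_def expand_add distrib_left theta_expand mapp_def expand_sum expand_mult
            sum_distrib_left locm_def dim mult_ac)
      moreover have "vge (1 - d p) (theta (expand p (f i)) + (\<Sum>j<dimn. expand p (f j) * locm p G' $$ (i, j)))"
        using G'[of p] i reg d0
        by (intro vge_add vge_sum vge_mult0 vge_mono[OF vge_theta_1]) (auto simp: goodm_def mvge_def)
      ultimately have "vge (1 - d p) (tp 1 * (expand p (h i) * fls_deriv (coord_at p)))"
        by (simp add: tdz_def tp_1 mult_ac)
      then have "vge (- d p) (expand p (h i) * fls_deriv (coord_at p))" unfolding vge_tp_mult by simp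
      then show ?thesis by (rule fls_subdegree_ge_of_vge) (use d0 in simp)
    qed
    then show ?thesis by (simp add: Omega_def)
  qed
  moreover have "frame T i \<in> frame_sheaf T U" if "i < dimn" for i
  proof -
    have "comb T (\<lambda>l. if l = i then 1 else 0) \<in> frame_sheaf T U"
      unfolding frame_sheaf_def using struct_sheaf_closed(1,2) by force
    then show ?thesis using comb_delta[OF that] by simp
  qed
  moreover have "y = (\<Sum>i<dimn. h i *s frame T i)"
    unfolding f(1) nabla_comb[OF g] by (simp add: comb_def h_def)
  ultimately show "y \<in> Omega_tensor d (frame_sheaf T) U" using U unfolding Omega_tensor_def by blast
qed

theorem strong_Riemann_Hilbert:
  assumes irr: irreducible_module and p: "singular_point p" "unramified_point p"
  shows "\<exists>\<V>. connection_with_singularities \<V> Katz_divisor \<and> generic_fibre \<V> = UNIV \<and> free_bundle \<V>"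
proof -
  obtain T S G' where T: "inv_pair dimn T S" "gauges rat_deriv dimn Gm T G'" "\<And>q. goodm dimn Katz_divisor q G'"
    using Katz_free_frame[OF irr p] by blast
  show ?thesis
    using frame_sheaf_connection[OF T effective_Katz_divisor[OF dimension_pos[OF p(1)]]]
      frame_sheaf_generic_fibre[OF T(1)] frame_sheaf_free[OF T(1)]
    unfolding free_bundle_def by blast
qed

end

theorem theorem1p11:
  fixes scale :: "ratfun \<Rightarrow> 'm::ab_group_add \<Rightarrow> 'm"
    and Basis :: "'m set"
    and nabla :: "'m \<Rightarrow> 'm"
  assumes "differential_module scale Basis nabla"
    and "differential_module.irreducible_module scale nabla"
    and "\<exists>p. differential_module.singular_point scale Basis nabla p \<and>
             differential_module.unramified_point scale Basis nabla p"
  shows "\<exists>\<V>. differential_module.connection_with_singularities scale nabla \<V>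
               (differential_module.Katz_divisor scale Basis nabla) \<and>
             generic_fibre \<V> = (UNIV :: 'm set) \<and>
             differential_module.free_bundle scale \<V>"
  using differential_module.strong_Riemann_Hilbert[OF assms(1,2)] assms(3) by blast

end
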